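(* Let $(M^{d+1},H)$ be a compact Heisenberg manifold equipped with a smooth positive density, $\mathcal E$ a Hermitian vector bundle over $M$, and let $P:C^\infty(M,\mathcal E)\to C^\infty(M,\mathcal E)$ be a selfadjoint differential operator of even Heisenberg order $v$ which is bounded from below and such that the principal symbol of $P+\partial_t$ is invertible in the Volterra–Heisenberg calculus. Let $A_0(P)=\lim_{t\to0^+}t^{\frac{d+2}v}\operatorname{Tr}e^{-tP}$ be the leading coefficient of the heat trace asymptotics of $P$ and set $\nu_0(P)=\Gamma\!\left(1+\frac{d+2}v\right)^{-1}A_0(P)$. Then: 1) $\nu_0(P)>0$. 2) As $\lambda\to\infty$ we have $N(P;\lambda)\sim\nu_0(P)\lambda^{\frac{d+2}v}$. 3) As $k\to\infty$ we have $\lambda_k(P)\sim\left(\frac k{\nu_0(P)}\right)^{\frac v{d+2}}$.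
   Context: Spectrum. $\lambda_0(P)\le\lambda_1(P)\le\dots$ are the eigenvalues of $P$ counted with multiplicity and $N(P;\lambda)=\#\{k\in\mathbb N:\lambda_k(P)\le\lambda\}$. Under the assumptions, $\operatorname{Tr}e^{-tP}\sim t^{-\frac{d+2}v}\sum_{j\ge0}t^{\frac{2j}v}A_j(P)$ as $t\to0^+$ (known result), so the limit defining $A_0(P)$ exists. Heisenberg manifolds. A Heisenberg manifold $(M^{d+1},H)$ is a smooth $(d+1)$-dimensional manifold with a hyperplane subbundle $H\subset TM$. An $H$-frame is a local frame $X_0,\dots,X_d$ of $TM$ such that $X_1,\dots,X_d$ span $H$. The Levi form is $\mathcal L_a(X(a),Y(a))=[X,Y](a)\bmod H_a$, for sections $X,Y$ of $H$. The tangent group is $G_aM=(T_aM/H_a)\oplus H_a$ with $(X_0+X').(Y_0+Y')=X_0+Y_0+\frac12\mathcal L_a(X',Y')+X'+Y'$. $\mathfrak gM=(TM/H)\oplus H$ is the bundle of their Lie algebras, $\mathfrak g^*M$ its dual with projection $\pi$ and dilations $\lambda.(\xi_0+\xi')=\lambda^2\xi_0+\lambda\xi'$. $\mathcal S_0(V)$: Schwartz functions on $V$ whose Fourier transform ($\hat f(\xi)=\int e^{-i\langle\xi,x\rangle}f(x)dx$) vanishes to infinite order at $0$. A homogeneous $\operatorname{End}\mathcal E_a$-valued symbol $p$ on $\mathfrak g_a^*M\setminus0$ with inverse Fourier transform $\check p\in\mathcal S_0(G_aM)'$ defines $\operatorname{Op}_a(p)f(x)=\langle\check p(y),f(x.y^{-1})\rangle$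 on $\mathcal S_0(G_aM,\mathcal E_a)$. Differential operators. For multi-indices $\langle\alpha\rangle=2\alpha_0+\alpha_1+\dots+\alpha_d$. $P$ has Heisenberg order $v$ if locally $P=\sum_{\langle\alpha\rangle\le v}a_\alpha(x)X^\alpha$, $X^\alpha=X_0^{\alpha_0}\cdots X_d^{\alpha_d}$. Its model operator at $a$ is $P^a=\sum_{\langle\alpha\rangle=v}a_\alpha(a)(X_0^a)^{\alpha_0}\cdots(X_d^a)^{\alpha_d}$, where $X_0^a$, $X_j^a$ ($j\ge1$) are the left-invariant vector fields on $G_aM$ defined by $X_0(a)\bmod H_a$ and $X_j(a)$; its principal symbol $\sigma_v(P)$, a smooth section of $\operatorname{End}\pi^*\mathcal E$ over $\mathfrak g^*M\setminus0$ homogeneous of degree $v$, is characterized by $\operatorname{Op}_a(\sigma_v(P)(a,\cdot))=P^a$ for all $a$. Volterra–Heisenberg symbols. Let $\mathbb C_-=\{\Im\tau<0\}$. $S_{\mathrm v,m}(\mathfrak g^*M\times\mathbb R_{(v)},\mathcal E)$, $m\in\mathbb Z$, is the space of smooth sections $q(x,\xi,\tau)$ of $\operatorname{End}\pi^*\mathcal E$ over $(\mathfrak g^*M\times\mathbb R)\setminus0$ with $q(x,\lambda.\xi,\lambda^v\tau)=\lambda^mq(x,\xi,\tau)$ for $\lambda\in\mathbb R\setminus0$ which extend to sections over $(\mathfrak g^*M\times\overline{\mathbb C_-})\setminus0$ that are smooth in the base variable and continuous in the others, and that on $\mathfrak g^*M\times\mathbb C_-$ are smooth and holomorphic in $\tau$.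 For such $q$ and $a\in M$, let $\check q(a,\cdot,\cdot)\in\mathcal S_0(G_aM\times\mathbb R)'$ ($\operatorname{End}\mathcal E_a$-valued) be the inverse Fourier transform of $q(a,\cdot,\cdot)$ with respect to $(\xi,\tau)$; then $q(a,\cdot,\cdot)$ defines the left-invariant convolution operator $\operatorname{Op}_a(q(a,\cdot,\cdot))f(x,t)=\langle\check q(a,y,s),f(x.y^{-1},t-s)\rangle$ on $\mathcal S_0(G_aM\times\mathbb R,\mathcal E_a)$, and the product $q_1*q_2$ is determined by $\operatorname{Op}_a((q_1*q_2)(a,\cdot,\cdot))=\operatorname{Op}_a(q_1(a,\cdot,\cdot))\operatorname{Op}_a(q_2(a,\cdot,\cdot))$. The principal symbol of $P+\partial_t$ is $\sigma_v(P)(x,\xi)+i\tau$; it is invertible in the Volterra–Heisenberg calculus if it has a two-sided inverse in $S_{\mathrm v,-v}(\mathfrak g^*M\times\mathbb R_{(v)},\mathcal E)$ for $*$. *)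

theory Defs
  imports "HOL-Analysis.Analysis" "HOL-Library.Landau_Symbols" "HOL-Library.Function_Algebras"
begin

section \<open>Calculus in Euclidean spaces\<close>

primrec iter_deriv ::
  "'a::euclidean_space list \<Rightarrow> ('a \<Rightarrow> 'c::real_normed_vector) \<Rightarrow> 'a \<Rightarrow> 'c" where
  "iter_deriv [] f = f"
| "iter_deriv (w # ws) f = (\<lambda>x. frechet_derivative (iter_deriv ws f) (at x) w)"

text \<open>\<open>C\<^sup>\<infinity>\<close> on an open set. The derivatives are taken at interior points, so the values of \<open>f\<close> outside
  of the open set \<open>U\<close> do not matter.\<close>

definition smooth_on :: "'a::euclidean_space set \<Rightarrow> ('a \<Rightarrow> 'c::real_normed_vector) \<Rightarrow> bool" where
  "smooth_on U f \<longleftrightarrow> (\<forall>ws. \<forall>x\<in>U. iter_deriv ws f differentiable (at x))"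

definition schwartz :: "('a::euclidean_space \<Rightarrow> 'c::real_normed_vector) \<Rightarrow> bool" where
  "schwartz f \<longleftrightarrow> smooth_on UNIV f \<and>
     (\<forall>ws (k::nat). \<exists>C. \<forall>x. (1 + norm x) ^ k * norm (iter_deriv ws f x) \<le> C)"

definition fourier :: "('a::euclidean_space \<Rightarrow> complex ^ 'r) \<Rightarrow> 'a \<Rightarrow> complex ^ 'r" where
  "fourier f \<xi> = (LINT x|lborel. cis (- (\<xi> \<bullet> x)) *s f x)"

definition schwartz0 :: "('a::euclidean_space \<Rightarrow> complex ^ 'r) set" where
  "schwartz0 = {f. schwartz f \<and> (\<forall>ws. iter_deriv ws (fourier f) 0 = 0)}"

text \<open>The pairing of the inverse Fourier transform of \<open>p\<close> (a functional on \<open>schwartz0\<close>) with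
  \<open>\<phi>\<close>, obtained by moving the transform onto \<open>\<phi>\<close>. Since the transform of \<open>\<phi>\<close> vanishes to
  infinite order at \<open>0\<close>, this makes sense for \<open>p\<close> homogeneous of any degree.\<close>

definition ift_pairing ::
  "('a::euclidean_space \<Rightarrow> complex ^ 'r ^ 'r) \<Rightarrow> ('a \<Rightarrow> complex ^ 'r) \<Rightarrow> complex ^ 'r" where
  "ift_pairing p \<phi> =
     (1 / (2 * pi) ^ DIM('a)) *\<^sub>R (LINT \<xi>|lborel. p \<xi> *v (LINT y|lborel. cis (\<xi> \<bullet> y) *s \<phi> y))"

text \<open>Left-invariant convolution for a group law \<open>m\<close> with neutral element \<open>0\<close> and inverses \<open>- y\<close>.\<close>

definition conv_op ::
  "('a::euclidean_space \<Rightarrow> 'a \<Rightarrow> 'a) \<Rightarrow> ('a \<Rightarrow> complex ^ 'r ^ 'r)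
     \<Rightarrow> ('a \<Rightarrow> complex ^ 'r) \<Rightarrow> 'a \<Rightarrow> complex ^ 'r" where
  "conv_op m p f x = ift_pairing p (\<lambda>y. f (m x (- y)))"

text \<open>An enumeration \<open>b\<^sub>0, \<dots>, b\<^sub>d\<close> of the standard basis, identifying the space with
  \<open>\<real>\<^sup>d\<^sup>+\<^sup>1\<close> (for \<open>d + 1 = DIM('b)\<close>); the coordinate along \<open>b\<^sub>0\<close> is the one of weight 2.\<close>

definition bvec :: "nat \<Rightarrow> 'b::euclidean_space" where
  "bvec = (SOME f. bij_betw f {..<DIM('b)} Basis)"


section \<open>Heisenberg manifolds\<close>

text \<open>A chart is a pair of its domain and its coordinate map. A tangent vector at a point is
  the family of its coordinate vectors in all charts around the point (and \<open>0\<close> for all others).\<close>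

type_synonym ('m, 'b) chart = "'m set \<times> ('m \<Rightarrow> 'b)"
type_synonym ('m, 'b) tvec = "('m, 'b) chart \<Rightarrow> 'b"

record ('m, 'b) heis_manifold =
  atlas :: "('m, 'b) chart set"
  hyper :: "'m \<Rightarrow> ('m, 'b) tvec set"

definition cinv :: "('m, 'b) chart \<Rightarrow> 'b \<Rightarrow> 'm" where
  "cinv c = inv_into (fst c) (snd c)"

definition smooth_atlas ::
  "('m::topological_space, 'b::euclidean_space) chart set \<Rightarrow> bool" where
  "smooth_atlas A \<longleftrightarrow>
     (\<forall>c\<in>A. open (fst c) \<and> open (snd c ` fst c) \<and>
        homeomorphism (fst c) (snd c ` fst c) (snd c) (cinv c)) \<and>
     (\<Union>c\<in>A. fst c) = UNIV \<and>
     (\<forall>c\<in>A. \<forall>c'\<in>A. smooth_on (snd c ` (fst c \<inter> fst c')) (snd c' \<circ> cinv c))"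

definition tangent_space ::
  "('m, 'b::euclidean_space, 'z) heis_manifold_scheme \<Rightarrow> 'm \<Rightarrow> ('m, 'b) tvec set" where
  "tangent_space S a = {w.
     (\<forall>c. \<not> (c \<in> atlas S \<and> a \<in> fst c) \<longrightarrow> w c = 0) \<and>
     (\<forall>c\<in>atlas S. \<forall>c'\<in>atlas S. a \<in> fst c \<longrightarrow> a \<in> fst c' \<longrightarrow>
        w c' = frechet_derivative (snd c' \<circ> cinv c) (at (snd c a)) (w c))}"

definition h_frame ::
  "('m::topological_space, 'b::euclidean_space, 'z) heis_manifold_scheme \<Rightarrow>
     'm set \<Rightarrow> (nat \<Rightarrow> 'm \<Rightarrow> ('m, 'b) tvec) \<Rightarrow> bool" where
  "h_frame S W X \<longleftrightarrow> open W \<and>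
     (\<forall>a\<in>W. \<forall>j<DIM('b). X j a \<in> tangent_space S a) \<and>
     (\<forall>c\<in>atlas S. \<forall>a\<in>W \<inter> fst c. inj_on (\<lambda>j. X j a c) {..<DIM('b)} \<and>
        independent ((\<lambda>j. X j a c) ` {..<DIM('b)})) \<and>
     (\<forall>a\<in>W. hyper S a = {w. \<exists>t. w = (\<lambda>c. \<Sum>j=1..<DIM('b). t j *\<^sub>R X j a c)}) \<and>
     (\<forall>c\<in>atlas S. \<forall>j<DIM('b). smooth_on (snd c ` (W \<inter> fst c)) (\<lambda>y. X j (cinv c y) c))"

definition heisenberg_manifold ::
  "('m::topological_space, 'b::euclidean_space, 'z) heis_manifold_scheme \<Rightarrow> bool" where
  "heisenberg_manifold S \<longleftrightarrow> smooth_atlas (atlas S) \<and> (\<forall>a. \<exists>W X. a \<in> W \<and> h_frame S W X)"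

definition lie_bracket ::
  "('m, 'b::euclidean_space, 'z) heis_manifold_scheme \<Rightarrow>
     ('m \<Rightarrow> ('m, 'b) tvec) \<Rightarrow> ('m \<Rightarrow> ('m, 'b) tvec) \<Rightarrow> 'm \<Rightarrow> ('m, 'b) tvec" where
  "lie_bracket S Y Z a = (\<lambda>c. if c \<in> atlas S \<and> a \<in> fst c then
       frechet_derivative (\<lambda>y. Z (cinv c y) c) (at (snd c a)) (Y a c) -
       frechet_derivative (\<lambda>y. Y (cinv c y) c) (at (snd c a)) (Z a c)
     else 0)"

text \<open>The Levi form on \<open>X\<^sub>i(a), X\<^sub>j(a)\<close>, as a multiple of the class of \<open>X\<^sub>0(a)\<close> modulo \<open>H\<^sub>a\<close>.\<close>

definition levi ::
  "('m, 'b::euclidean_space, 'z) heis_manifold_scheme \<Rightarrow>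
     (nat \<Rightarrow> 'm \<Rightarrow> ('m, 'b) tvec) \<Rightarrow> 'm \<Rightarrow> nat \<Rightarrow> nat \<Rightarrow> real" where
  "levi S X a i j =
     (THE t. (\<lambda>c. lie_bracket S (X i) (X j) a c - t *\<^sub>R X 0 a c) \<in> hyper S a)"

text \<open>The tangent group at \<open>a\<close>, in the linear coordinates given by the basis
  \<open>X\<^sub>0(a) mod H\<^sub>a, X\<^sub>1(a), \<dots>, X\<^sub>d(a)\<close> of \<open>(T\<^sub>aM/H\<^sub>a) \<oplus> H\<^sub>a\<close>. The Levi form is
  alternating, hence the inverse of \<open>x\<close> is \<open>- x\<close>.\<close>

definition grp_mult ::
  "('m, 'b::euclidean_space, 'z) heis_manifold_scheme \<Rightarrow>
     (nat \<Rightarrow> 'm \<Rightarrow> ('m, 'b) tvec) \<Rightarrow> 'm \<Rightarrow> 'b \<Rightarrow> 'b \<Rightarrow> 'b" where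
  "grp_mult S X a x y = x + y +
     ((1 / 2) * (\<Sum>i=1..<DIM('b). \<Sum>j=1..<DIM('b).
        levi S X a i j * (x \<bullet> bvec i) * (y \<bullet> bvec j))) *\<^sub>R bvec 0"

text \<open>The dual of \<open>(T\<^sub>aM/H\<^sub>a) \<oplus> H\<^sub>a\<close>: pairs of a linear form on \<open>T\<^sub>aM\<close> vanishing on \<open>H\<^sub>a\<close> and a
  linear form on \<open>H\<^sub>a\<close>, both extended by \<open>0\<close>.\<close>

type_synonym ('m, 'b) gcov = "(('m, 'b) tvec \<Rightarrow> real) \<times> (('m, 'b) tvec \<Rightarrow> real)"

definition linear_form_on ::
  "('m, 'b::euclidean_space) tvec set \<Rightarrow> (('m, 'b) tvec \<Rightarrow> real) \<Rightarrow> bool" where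
  "linear_form_on V l \<longleftrightarrow> (\<forall>w. w \<notin> V \<longrightarrow> l w = 0) \<and>
     (\<forall>w\<in>V. \<forall>w'\<in>V. \<forall>s t. l (\<lambda>c. s *\<^sub>R w c + t *\<^sub>R w' c) = s * l w + t * l w')"

definition gdual ::
  "('m, 'b::euclidean_space, 'z) heis_manifold_scheme \<Rightarrow> 'm \<Rightarrow> ('m, 'b) gcov set" where
  "gdual S a = {(\<xi>0, \<xi>'). linear_form_on (tangent_space S a) \<xi>0 \<and> (\<forall>w\<in>hyper S a. \<xi>0 w = 0) \<and>
     linear_form_on (hyper S a) \<xi>'}"

definition gzero :: "('m, 'b) gcov" where
  "gzero = ((\<lambda>_. 0), (\<lambda>_. 0))"

definition gdilate :: "real \<Rightarrow> ('m, 'b) gcov \<Rightarrow> ('m, 'b) gcov" where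
  "gdilate l \<xi> = ((\<lambda>w. l\<^sup>2 * fst \<xi> w), (\<lambda>w. l * snd \<xi> w))"

text \<open>The covector with coordinates \<open>\<eta>\<close> in the basis dual to the one given by the \<open>H\<close>-frame \<open>X\<close>.\<close>

definition gcov_of ::
  "('m, 'b::euclidean_space, 'z) heis_manifold_scheme \<Rightarrow>
     (nat \<Rightarrow> 'm \<Rightarrow> ('m, 'b) tvec) \<Rightarrow> 'm \<Rightarrow> 'b \<Rightarrow> ('m, 'b) gcov" where
  "gcov_of S X a \<eta> = (THE \<xi>. \<xi> \<in> gdual S a \<and> fst \<xi> (X 0 a) = \<eta> \<bullet> bvec 0 \<and>
     (\<forall>j\<in>{1..<DIM('b)}. snd \<xi> (X j a) = \<eta> \<bullet> bvec j))"


section \<open>Hermitian bundles, densities, sections\<close>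

text \<open>The fibres are subspaces of a complex vector space \<open>'v\<close> that carries no further structure
  (for instance the direct sum of all fibres); the smooth structure of the bundle is given by the
  local trivializations \<open>(W, \<psi>)\<close>, where \<open>\<psi> a\<close> maps the fibre at \<open>a \<in> W\<close> to \<open>\<complex>\<^sup>r\<close>.\<close>

record ('m, 'b, 'v, 'r) herm_heis = "('m, 'b) heis_manifold" +
  smul :: "complex \<Rightarrow> 'v \<Rightarrow> 'v"
  fib :: "'m \<Rightarrow> 'v set"
  trivs :: "('m set \<times> ('m \<Rightarrow> 'v \<Rightarrow> complex ^ 'r)) set"
  herm :: "'m \<Rightarrow> 'v \<Rightarrow> 'v \<Rightarrow> complex"
  dens :: "'m measure"

definition vector_bundle ::
  "('m::topological_space, 'b::euclidean_space, 'v::ab_group_add, 'r::finite) herm_heis \<Rightarrow> bool" where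
  "vector_bundle S \<longleftrightarrow>
     vector_space (smul S) \<and> (\<forall>a. module.subspace (smul S) (fib S a)) \<and>
     (\<Union>(W, \<psi>)\<in>trivs S. W) = UNIV \<and>
     (\<forall>(W, \<psi>)\<in>trivs S. open W \<and> (\<forall>a\<in>W. bij_betw (\<psi> a) (fib S a) UNIV \<and>
        (\<forall>u\<in>fib S a. \<forall>w\<in>fib S a. \<psi> a (u + w) = \<psi> a u + \<psi> a w) \<and>
        (\<forall>z. \<forall>u\<in>fib S a. \<psi> a (smul S z u) = z *s \<psi> a u))) \<and>
     (\<forall>(W, \<psi>)\<in>trivs S. \<forall>(W', \<psi>')\<in>trivs S. \<forall>c\<in>atlas S. \<forall>z.
        smooth_on (snd c ` (W \<inter> W' \<inter> fst c))
          (\<lambda>y. \<psi>' (cinv c y) (inv_into (fib S (cinv c y)) (\<psi> (cinv c y)) z)))"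

definition hermitian_metric ::
  "('m::topological_space, 'b::euclidean_space, 'v::ab_group_add, 'r::finite) herm_heis \<Rightarrow> bool" where
  "hermitian_metric S \<longleftrightarrow>
     (\<forall>a. \<forall>u\<in>fib S a. \<forall>w\<in>fib S a. herm S a w u = cnj (herm S a u w) \<and>
        (\<forall>u'\<in>fib S a. \<forall>z. herm S a (smul S z u + u') w = z * herm S a u w + herm S a u' w)) \<and>
     (\<forall>a. \<forall>u\<in>fib S a. u \<noteq> 0 \<longrightarrow> 0 < Re (herm S a u u)) \<and>
     (\<forall>(W, \<psi>)\<in>trivs S. \<forall>c\<in>atlas S. \<forall>z z'.
        smooth_on (snd c ` (W \<inter> fst c)) (\<lambda>y. herm S (cinv c y)
          (inv_into (fib S (cinv c y)) (\<psi> (cinv c y)) z)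
          (inv_into (fib S (cinv c y)) (\<psi> (cinv c y)) z')))"

definition smooth_positive_density ::
  "('m::topological_space, 'b::euclidean_space, 'v, 'r::finite) herm_heis \<Rightarrow> bool" where
  "smooth_positive_density S \<longleftrightarrow> sets (dens S) = sets borel \<and>
     (\<forall>c\<in>atlas S. \<exists>\<rho>::'b \<Rightarrow> real. smooth_on (snd c ` fst c) \<rho> \<and> (\<forall>y\<in>snd c ` fst c. 0 < \<rho> y) \<and>
        (\<forall>B\<in>sets borel. B \<subseteq> fst c \<longrightarrow>
           emeasure (dens S) B = (\<integral>\<^sup>+y\<in>snd c ` B. ennreal (\<rho> y) \<partial>lborel)))"

definition smooth_sections ::
  "('m::topological_space, 'b::euclidean_space, 'v, 'r::finite) herm_heis \<Rightarrow> ('m \<Rightarrow> 'v) set" where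
  "smooth_sections S = {u. (\<forall>a. u a \<in> fib S a) \<and>
     (\<forall>(W, \<psi>)\<in>trivs S. \<forall>c\<in>atlas S.
        smooth_on (snd c ` (W \<inter> fst c)) (\<lambda>y. \<psi> (cinv c y) (u (cinv c y))))}"

definition ip ::
  "('m, 'b, 'v, 'r::finite) herm_heis \<Rightarrow> ('m \<Rightarrow> 'v) \<Rightarrow> ('m \<Rightarrow> 'v) \<Rightarrow> complex" where
  "ip S u w = (LINT a|dens S. herm S a (u a) (w a))"

text \<open>Square integrable sections. They are not identified when they agree almost everywhere.\<close>

definition l2_sections ::
  "('m::topological_space, 'b, 'v, 'r::finite) herm_heis \<Rightarrow> ('m \<Rightarrow> 'v) set" where
  "l2_sections S = {u. (\<forall>a. u a \<in> fib S a) \<and>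
     (\<forall>(W, \<psi>)\<in>trivs S. (\<lambda>a. \<psi> a (u a)) \<in> borel_measurable (restrict_space borel W)) \<and>
     integrable (dens S) (\<lambda>a. Re (herm S a (u a) (u a)))}"

definition l2_orthonormal_basis ::
  "('m::topological_space, 'b, 'v::zero, 'r::finite) herm_heis \<Rightarrow> (nat \<Rightarrow> 'm \<Rightarrow> 'v) \<Rightarrow> bool" where
  "l2_orthonormal_basis S e \<longleftrightarrow> (\<forall>k. e k \<in> l2_sections S) \<and>
     (\<forall>j k. ip S (e j) (e k) = (if j = k then 1 else 0)) \<and>
     (\<forall>u\<in>l2_sections S. (\<forall>k. ip S u (e k) = 0) \<longrightarrow> (AE a in dens S. u a = 0))"

text \<open>The trace on the \<open>L\<^sup>2\<close> sections, required to be the same for all orthonormal bases.\<close>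

definition has_trace ::
  "('m::topological_space, 'b, 'v::zero, 'r::finite) herm_heis \<Rightarrow>
     (('m \<Rightarrow> 'v) \<Rightarrow> ('m \<Rightarrow> 'v)) \<Rightarrow> complex \<Rightarrow> bool" where
  "has_trace S T \<theta> \<longleftrightarrow> (\<exists>e. l2_orthonormal_basis S e) \<and>
     (\<forall>e. l2_orthonormal_basis S e \<longrightarrow> (\<lambda>k. ip S (T (e k)) (e k)) sums \<theta>)"


section \<open>Differential operators and their model operators\<close>

definition hweight :: "nat \<Rightarrow> (nat \<Rightarrow> nat) \<Rightarrow> nat" where
  "hweight n \<alpha> = \<alpha> 0 + (\<Sum>j<n. \<alpha> j)"

definition multi_index :: "nat \<Rightarrow> (nat \<Rightarrow> nat) set" where
  "multi_index n = {\<alpha>. \<forall>j\<ge>n. \<alpha> j = 0}"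

text \<open>\<open>D\<^sub>0\<^sup>\<alpha>\<^sup>0 \<dots> D\<^sub>n\<^sub>-\<^sub>1\<^sup>\<alpha>\<^sup>n\<^sup>-\<^sup>1\<close>, with the factor of index \<open>0\<close> applied last.\<close>

definition op_monomial :: "nat \<Rightarrow> (nat \<Rightarrow> 'f \<Rightarrow> 'f) \<Rightarrow> (nat \<Rightarrow> nat) \<Rightarrow> 'f \<Rightarrow> 'f" where
  "op_monomial n D \<alpha> = foldr (\<lambda>j g. (D j ^^ \<alpha> j) \<circ> g) [0..<n] id"

definition vf_apply ::
  "('m, 'b::euclidean_space) chart \<Rightarrow> ('m \<Rightarrow> ('m, 'b) tvec) \<Rightarrow>
     ('m \<Rightarrow> complex ^ 'r) \<Rightarrow> 'm \<Rightarrow> complex ^ 'r::finite" where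
  "vf_apply c Y f a = frechet_derivative (f \<circ> cinv c) (at (snd c a)) (Y a c)"

text \<open>\<open>P = \<Sum>\<^bsub>\<langle>\<alpha>\<rangle> \<le> v\<^esub> a\<^sub>\<alpha> X\<^sup>\<alpha>\<close> over \<open>W\<close>, for a chart \<open>c\<close>, a local trivialization \<open>\<psi>\<close> and an
  \<open>H\<close>-frame \<open>X\<close> over \<open>W\<close>.\<close>

definition local_expression ::
  "('m::topological_space, 'b::euclidean_space, 'v, 'r::finite) herm_heis \<Rightarrow>
     (('m \<Rightarrow> 'v) \<Rightarrow> ('m \<Rightarrow> 'v)) \<Rightarrow> nat \<Rightarrow> 'm set \<Rightarrow> ('m, 'b) chart \<Rightarrow>
     ('m \<Rightarrow> 'v \<Rightarrow> complex ^ 'r) \<Rightarrow> (nat \<Rightarrow> 'm \<Rightarrow> ('m, 'b) tvec) \<Rightarrow>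
     ((nat \<Rightarrow> nat) \<Rightarrow> 'm \<Rightarrow> complex ^ 'r ^ 'r) \<Rightarrow> bool" where
  "local_expression S P v W c \<psi> X coef \<longleftrightarrow>
     c \<in> atlas S \<and> W \<subseteq> fst c \<and> (\<exists>W'. (W', \<psi>) \<in> trivs S \<and> W \<subseteq> W') \<and> h_frame S W X \<and>
     (\<forall>\<alpha>. smooth_on (snd c ` W) (coef \<alpha> \<circ> cinv c)) \<and>
     (\<forall>u\<in>smooth_sections S. \<forall>a\<in>W. \<psi> a (P u a) =
        (\<Sum>\<alpha> | \<alpha> \<in> multi_index DIM('b) \<and> hweight DIM('b) \<alpha> \<le> v.
           coef \<alpha> a *v op_monomial DIM('b) (\<lambda>j. vf_apply c (X j)) \<alpha> (\<lambda>x. \<psi> x (u x)) a))"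

definition heis_diff_op ::
  "('m::topological_space, 'b::euclidean_space, 'v, 'r::finite) herm_heis \<Rightarrow>
     (('m \<Rightarrow> 'v) \<Rightarrow> ('m \<Rightarrow> 'v)) \<Rightarrow> nat \<Rightarrow> bool" where
  "heis_diff_op S P v \<longleftrightarrow> (\<forall>u\<in>smooth_sections S. P u \<in> smooth_sections S) \<and>
     (\<forall>a. \<exists>W c \<psi> X coef. a \<in> W \<and> local_expression S P v W c \<psi> X coef)"

text \<open>The left-invariant vector field on the tangent group at \<open>a\<close> defined by \<open>X\<^sub>j(a)\<close>
  (by \<open>X\<^sub>0(a) mod H\<^sub>a\<close> for \<open>j = 0\<close>).\<close>

definition left_inv ::
  "('m, 'b::euclidean_space, 'z) heis_manifold_scheme \<Rightarrow> (nat \<Rightarrow> 'm \<Rightarrow> ('m, 'b) tvec) \<Rightarrow> 'm \<Rightarrow>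
     nat \<Rightarrow> ('b \<Rightarrow> complex ^ 'r::finite) \<Rightarrow> 'b \<Rightarrow> complex ^ 'r" where
  "left_inv S X a j f x = vector_derivative (\<lambda>t. f (grp_mult S X a x (t *\<^sub>R bvec j))) (at 0)"

definition model_operator ::
  "('m, 'b::euclidean_space, 'z) heis_manifold_scheme \<Rightarrow> nat \<Rightarrow> (nat \<Rightarrow> 'm \<Rightarrow> ('m, 'b) tvec) \<Rightarrow>
     ((nat \<Rightarrow> nat) \<Rightarrow> 'm \<Rightarrow> complex ^ 'r ^ 'r) \<Rightarrow> 'm \<Rightarrow>
     ('b \<Rightarrow> complex ^ 'r::finite) \<Rightarrow> 'b \<Rightarrow> complex ^ 'r" where
  "model_operator S v X coef a f x =
     (\<Sum>\<alpha> | \<alpha> \<in> multi_index DIM('b) \<and> hweight DIM('b) \<alpha> = v.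
        coef \<alpha> a *v op_monomial DIM('b) (left_inv S X a) \<alpha> f x)"

definition formally_selfadjoint ::
  "('m::topological_space, 'b::euclidean_space, 'v, 'r::finite) herm_heis \<Rightarrow>
     (('m \<Rightarrow> 'v) \<Rightarrow> ('m \<Rightarrow> 'v)) \<Rightarrow> bool" where
  "formally_selfadjoint S P \<longleftrightarrow>
     (\<forall>u\<in>smooth_sections S. \<forall>w\<in>smooth_sections S. ip S (P u) w = ip S u (P w))"

definition bounded_from_below ::
  "('m::topological_space, 'b::euclidean_space, 'v, 'r::finite) herm_heis \<Rightarrow>
     (('m \<Rightarrow> 'v) \<Rightarrow> ('m \<Rightarrow> 'v)) \<Rightarrow> bool" where
  "bounded_from_below S P \<longleftrightarrow>
     (\<exists>C::real. \<forall>u\<in>smooth_sections S. C * Re (ip S u u) \<le> Re (ip S (P u) u))"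


section \<open>Principal symbols and the Volterra--Heisenberg calculus\<close>

definition fib_end ::
  "('m, 'b, 'v::ab_group_add, 'r::finite) herm_heis \<Rightarrow> 'm \<Rightarrow> ('v \<Rightarrow> 'v) set" where
  "fib_end S a = {L. \<forall>u\<in>fib S a. L u \<in> fib S a \<and>
     (\<forall>w\<in>fib S a. \<forall>z. L (smul S z u + w) = smul S z (L u) + L w)}"

definition fib_mat ::
  "('m, 'b, 'v, 'r::finite) herm_heis \<Rightarrow> ('m \<Rightarrow> 'v \<Rightarrow> complex ^ 'r) \<Rightarrow> 'm \<Rightarrow>
     ('v \<Rightarrow> 'v) \<Rightarrow> complex ^ 'r ^ 'r" where
  "fib_mat S \<psi> a L = matrix (\<lambda>z. \<psi> a (L (inv_into (fib S a) (\<psi> a) z)))"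

definition principal_symbol ::
  "('m::topological_space, 'b::euclidean_space, 'v::ab_group_add, 'r::finite) herm_heis \<Rightarrow>
     (('m \<Rightarrow> 'v) \<Rightarrow> ('m \<Rightarrow> 'v)) \<Rightarrow> nat \<Rightarrow> ('m \<Rightarrow> ('m, 'b) gcov \<Rightarrow> 'v \<Rightarrow> 'v) \<Rightarrow> bool" where
  "principal_symbol S P v \<sigma> \<longleftrightarrow>
     (\<forall>a. \<forall>\<xi>\<in>gdual S a - {gzero}. \<sigma> a \<xi> \<in> fib_end S a \<and>
        (\<forall>l>0. \<forall>u\<in>fib S a. \<sigma> a (gdilate l \<xi>) u = smul S (of_real (l ^ v)) (\<sigma> a \<xi> u))) \<and>
     (\<forall>c\<in>atlas S. \<forall>(W, \<psi>)\<in>trivs S. \<forall>V X. h_frame S V X \<longrightarrow>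
        smooth_on {(y, \<eta>). y \<in> snd c ` (fst c \<inter> W \<inter> V) \<and> \<eta> \<noteq> 0}
          (\<lambda>(y, \<eta>). fib_mat S \<psi> (cinv c y) (\<sigma> (cinv c y) (gcov_of S X (cinv c y) \<eta>)))) \<and>
     (\<forall>W c \<psi> X coef. local_expression S P v W c \<psi> X coef \<longrightarrow>
        (\<forall>a\<in>W. \<forall>f\<in>schwartz0.
           conv_op (grp_mult S X a) (\<lambda>\<eta>. fib_mat S \<psi> a (\<sigma> a (gcov_of S X a \<eta>))) f =
           model_operator S v X coef a f))"

text \<open>Symbols on \<open>\<gg>\<^sup>*M \<times> \<real>\<close> of degree \<open>m\<close>, where \<open>\<real>\<close> has weight \<open>v\<close>. The extension \<open>Q\<close> to
  \<open>Im z \<le> 0\<close> is smooth in the base variable with values in the continuous functions of the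
  other variables: all derivatives along the base are jointly continuous.\<close>

definition volterra_symbols ::
  "('m::topological_space, 'b::euclidean_space, 'v::ab_group_add, 'r::finite) herm_heis \<Rightarrow>
     nat \<Rightarrow> int \<Rightarrow> ('m \<Rightarrow> ('m, 'b) gcov \<Rightarrow> real \<Rightarrow> 'v \<Rightarrow> 'v) set" where
  "volterra_symbols S v m = {q.
     (\<forall>a. \<forall>\<xi>\<in>gdual S a. \<forall>\<tau>. (\<xi>, \<tau>) \<noteq> (gzero, 0) \<longrightarrow> q a \<xi> \<tau> \<in> fib_end S a \<and>
        (\<forall>l. l \<noteq> 0 \<longrightarrow> (\<forall>u\<in>fib S a.
           q a (gdilate l \<xi>) (l ^ v * \<tau>) u = smul S (of_real (l powi m)) (q a \<xi> \<tau> u)))) \<and>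
     (\<forall>c\<in>atlas S. \<forall>(W, \<psi>)\<in>trivs S. \<forall>V X. h_frame S V X \<longrightarrow>
        smooth_on {(y, \<eta>, \<tau>). y \<in> snd c ` (fst c \<inter> W \<inter> V) \<and> (\<eta>, \<tau>) \<noteq> (0, 0)}
          (\<lambda>(y, \<eta>, \<tau>). fib_mat S \<psi> (cinv c y) (q (cinv c y) (gcov_of S X (cinv c y) \<eta>) \<tau>))) \<and>
     (\<exists>Q :: 'm \<Rightarrow> ('m, 'b) gcov \<Rightarrow> complex \<Rightarrow> 'v \<Rightarrow> 'v.
        (\<forall>a. \<forall>\<xi>\<in>gdual S a. \<forall>\<tau>. (\<xi>, \<tau>) \<noteq> (gzero, 0) \<longrightarrow>
           (\<forall>u\<in>fib S a. Q a \<xi> (of_real \<tau>) u = q a \<xi> \<tau> u)) \<and>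
        (\<forall>a. \<forall>\<xi>\<in>gdual S a. \<forall>z. Im z \<le> 0 \<longrightarrow> (\<xi>, z) \<noteq> (gzero, 0) \<longrightarrow> Q a \<xi> z \<in> fib_end S a) \<and>
        (\<forall>c\<in>atlas S. \<forall>(W, \<psi>)\<in>trivs S. \<forall>V X. h_frame S V X \<longrightarrow>
           (let Y = snd c ` (fst c \<inter> W \<inter> V);
                g = (\<lambda>\<eta> z y. fib_mat S \<psi> (cinv c y) (Q (cinv c y) (gcov_of S X (cinv c y) \<eta>) z))
            in (\<forall>\<eta> z. Im z \<le> 0 \<longrightarrow> (\<eta>, z) \<noteq> (0, 0) \<longrightarrow> smooth_on Y (g \<eta> z)) \<and>
               (\<forall>ws. continuous_on {(y, \<eta>, z). y \<in> Y \<and> Im z \<le> 0 \<and> (\<eta>, z) \<noteq> (0, 0)}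
                  (\<lambda>(y, \<eta>, z). iter_deriv ws (g \<eta> z) y)) \<and>
               smooth_on {(y, \<eta>, z). y \<in> Y \<and> Im z < 0} (\<lambda>(y, \<eta>, z). g \<eta> z y) \<and>
               (\<forall>y\<in>Y. \<forall>\<eta> i j. (\<lambda>z. g \<eta> z y $ i $ j) holomorphic_on {z. Im z < 0}))))}"

text \<open>The convolution operator on \<open>G\<^sub>aM \<times> \<real>\<close>, in the coordinates given by \<open>X\<close> and \<open>\<psi>\<close>.\<close>

definition volterra_op ::
  "('m, 'b::euclidean_space, 'v, 'r::finite) herm_heis \<Rightarrow> (nat \<Rightarrow> 'm \<Rightarrow> ('m, 'b) tvec) \<Rightarrow>
     ('m \<Rightarrow> 'v \<Rightarrow> complex ^ 'r) \<Rightarrow> 'm \<Rightarrow> ('m \<Rightarrow> ('m, 'b) gcov \<Rightarrow> real \<Rightarrow> 'v \<Rightarrow> 'v) \<Rightarrow>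
     ('b \<times> real \<Rightarrow> complex ^ 'r) \<Rightarrow> 'b \<times> real \<Rightarrow> complex ^ 'r" where
  "volterra_op S X \<psi> a q =
     conv_op (\<lambda>(x, t) (y, s). (grp_mult S X a x y, t + s))
       (\<lambda>(\<eta>, \<tau>). fib_mat S \<psi> a (q a (gcov_of S X a \<eta>) \<tau>))"

text \<open>\<open>q = q\<^sub>1 * q\<^sub>2\<close>\<close>

definition volterra_product ::
  "('m::topological_space, 'b::euclidean_space, 'v, 'r::finite) herm_heis \<Rightarrow>
     ('m \<Rightarrow> ('m, 'b) gcov \<Rightarrow> real \<Rightarrow> 'v \<Rightarrow> 'v) \<Rightarrow> ('m \<Rightarrow> ('m, 'b) gcov \<Rightarrow> real \<Rightarrow> 'v \<Rightarrow> 'v) \<Rightarrow>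
     ('m \<Rightarrow> ('m, 'b) gcov \<Rightarrow> real \<Rightarrow> 'v \<Rightarrow> 'v) \<Rightarrow> bool" where
  "volterra_product S q\<^sub>1 q\<^sub>2 q \<longleftrightarrow>
     (\<forall>(W, \<psi>)\<in>trivs S. \<forall>V X. h_frame S V X \<longrightarrow> (\<forall>a\<in>W \<inter> V. \<forall>f\<in>schwartz0.
        volterra_op S X \<psi> a q f = volterra_op S X \<psi> a q\<^sub>1 (volterra_op S X \<psi> a q\<^sub>2 f)))"

text \<open>\<open>\<sigma> + i\<tau>\<close>. A principal symbol \<open>\<sigma>\<close> is only specified away from the zero section; that of a
  differential operator of positive order extends smoothly by \<open>0\<close>.\<close>

definition heat_symbol ::
  "('m, 'b, 'v::ab_group_add, 'r::finite) herm_heis \<Rightarrow> ('m \<Rightarrow> ('m, 'b) gcov \<Rightarrow> 'v \<Rightarrow> 'v) \<Rightarrow>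
     'm \<Rightarrow> ('m, 'b) gcov \<Rightarrow> real \<Rightarrow> 'v \<Rightarrow> 'v" where
  "heat_symbol S \<sigma> a \<xi> \<tau> u = (if \<xi> = gzero then 0 else \<sigma> a \<xi> u) + smul S (\<i> * of_real \<tau>) u"

definition heat_symbol_invertible ::
  "('m::topological_space, 'b::euclidean_space, 'v::ab_group_add, 'r::finite) herm_heis \<Rightarrow>
     (('m \<Rightarrow> 'v) \<Rightarrow> ('m \<Rightarrow> 'v)) \<Rightarrow> nat \<Rightarrow> bool" where
  "heat_symbol_invertible S P v \<longleftrightarrow>
     (\<exists>\<sigma>. principal_symbol S P v \<sigma> \<and>
        (\<exists>q\<in>volterra_symbols S v (- int v).
           volterra_product S q (heat_symbol S \<sigma>) (\<lambda>_ _ _ u. u) \<and>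
           volterra_product S (heat_symbol S \<sigma>) q (\<lambda>_ _ _ u. u)))"


section \<open>Eigenvalues and heat semigroup\<close>

definition eigenspace ::
  "('m::topological_space, 'b::euclidean_space, 'v, 'r::finite) herm_heis \<Rightarrow>
     (('m \<Rightarrow> 'v) \<Rightarrow> ('m \<Rightarrow> 'v)) \<Rightarrow> real \<Rightarrow> ('m \<Rightarrow> 'v) set" where
  "eigenspace S P \<mu> = {u \<in> smooth_sections S. P u = (\<lambda>a. smul S (of_real \<mu>) (u a))}"

definition section_smul ::
  "('m, 'b, 'v, 'r::finite) herm_heis \<Rightarrow> complex \<Rightarrow> ('m \<Rightarrow> 'v) \<Rightarrow> 'm \<Rightarrow> 'v" where
  "section_smul S z u = (\<lambda>a. smul S z (u a))"

text \<open>\<open>\<lambda>\<^sub>0 \<le> \<lambda>\<^sub>1 \<le> \<dots>\<close> are the eigenvalues with multiplicity: for every \<open>\<mu>\<close>, the indices \<open>k\<close> with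
  \<open>\<lambda>\<^sub>k = \<mu>\<close> label a basis of the eigenspace of \<open>\<mu>\<close> (the empty basis if \<open>\<mu>\<close> is not an eigenvalue).\<close>

definition eigenvalue_sequence ::
  "('m::topological_space, 'b::euclidean_space, 'v::ab_group_add, 'r::finite) herm_heis \<Rightarrow>
     (('m \<Rightarrow> 'v) \<Rightarrow> ('m \<Rightarrow> 'v)) \<Rightarrow> (nat \<Rightarrow> real) \<Rightarrow> bool" where
  "eigenvalue_sequence S P lam \<longleftrightarrow> mono lam \<and>
     (\<exists>e. \<forall>\<mu>. inj_on e {k. lam k = \<mu>} \<and>
        \<not> module.dependent (section_smul S) (e ` {k. lam k = \<mu>}) \<and>
        module.span (section_smul S) (e ` {k. lam k = \<mu>}) = eigenspace S P \<mu>)"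

definition eigenvalue_count :: "(nat \<Rightarrow> real) \<Rightarrow> real \<Rightarrow> nat" where
  "eigenvalue_count lam x = card {k. lam k \<le> x}"

text \<open>\<open>T t = e\<^sup>-\<^sup>t\<^sup>P\<close>: for every \<open>L\<^sup>2\<close> section \<open>u\<close>, the curve \<open>t \<mapsto> T t u\<close> solves the heat equation
  \<open>\<partial>\<^sub>t w + P w = 0\<close> for \<open>t > 0\<close> (with derivative in \<open>L\<^sup>2\<close> and smooth \<open>T t u\<close>, in the domain of \<open>P\<close>)
  and tends to \<open>u\<close> in \<open>L\<^sup>2\<close> as \<open>t \<rightarrow> 0\<close>. For \<open>P\<close> formally selfadjoint and bounded from below this
  determines \<open>T t u\<close>.\<close>

definition heat_semigroup ::
  "('m::topological_space, 'b::euclidean_space, 'v::ab_group_add, 'r::finite) herm_heis \<Rightarrow>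
     (('m \<Rightarrow> 'v) \<Rightarrow> ('m \<Rightarrow> 'v)) \<Rightarrow> (real \<Rightarrow> ('m \<Rightarrow> 'v) \<Rightarrow> ('m \<Rightarrow> 'v)) \<Rightarrow> bool" where
  "heat_semigroup S P T \<longleftrightarrow> (\<forall>u\<in>l2_sections S.
     (\<forall>t>0. T t u \<in> smooth_sections S) \<and>
     (let sqnorm = (\<lambda>w. Re (ip S w w)) in
       ((\<lambda>t. sqnorm (T t u - u)) \<longlongrightarrow> 0) (at_right 0) \<and>
       (\<forall>t>0. ((\<lambda>s. sqnorm (section_smul S (of_real (1 / s)) (T (t + s) u - T t u) + P (T t u)))
                  \<longlongrightarrow> 0) (at 0))))"

text \<open>The constant \<open>\<nu>\<^sub>0(P)\<close> in terms of \<open>A\<^sub>0(P)\<close> and the exponent \<open>(d+2)/v\<close>.\<close>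

definition nu0 :: "nat \<Rightarrow> nat \<Rightarrow> real \<Rightarrow> real" where
  "nu0 d v A0 = inverse (Gamma (1 + (real d + 2) / real v)) * A0"

end

theory Submission
  imports Defs "HOL-Library.Diagonal_Subsequence" "HOL-Real_Asymp.Real_Asymp" "HOL-Computational_Algebra.Polynomial"
begin

text \<open>The eigenfunctions of \<open>P\<close> can be chosen to form an orthonormal basis: the trace condition makes \<open>e\<^sup>-\<^sup>P\<close> compact,
  and an eigenvector of it orthogonal to all eigenfunctions of \<open>P\<close> would again be one, since it is an eigenvector of
  all \<open>e\<^sup>-\<^sup>t\<^sup>P\<close> with \<open>t = 2\<^sup>-\<^sup>n\<close>. Hence the heat trace is the sum of the \<open>exp (- t \<lambda>\<^sub>k)\<close>, and 2) and 3) follow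
  from Karamata's Tauberian theorem once \<open>A\<^sub>0(P) > 0\<close>.

  For the positivity, put \<open>N\<^sup>d\<^sup>+\<^sup>2\<close> disjoint boxes into a coordinate ball, of size \<open>\<epsilon>\<^sup>2\<close> transversally to \<open>H\<close> and of size
  \<open>\<epsilon>\<close> along \<open>H\<close>, where \<open>\<epsilon>\<close> is proportional to \<open>1/N\<close>. Bump sections \<open>u\<close> supported in the boxes satisfy
  \<open>\<parallel>P u\<parallel> \<le> C N\<^sup>v \<parallel>u\<parallel>\<close>, so that \<open>\<langle>e\<^sup>-\<^sup>t\<^sup>P u, u\<rangle> \<ge> \<parallel>u\<parallel>\<^sup>2/2\<close> for \<open>t\<close> a small multiple of \<open>N\<^sup>-\<^sup>v\<close>. As they are orthogonal,
  the trace of \<open>e\<^sup>-\<^sup>t\<^sup>P\<close> is at least \<open>N\<^sup>d\<^sup>+\<^sup>2/2\<close> for these \<open>t\<close>.\<close>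

section \<open>Hilbert spaces up to null vectors\<close>

text \<open>Sections are not identified when they agree almost everywhere, so limits and adjoint
  relations only hold up to null vectors. Heat operators map into smooth sections, where the form is
  definite, and this is what turns such relations into equalities. The operators \<open>T t\<close>
  are known only as solution maps of the heat equation, so their algebra comes from an energy
  estimate and uniqueness. Compactness of \<open>T 1\<close> is read off from the trace at time 2,
  because the squared norm of \<open>T 1 e\<close> is the pairing of \<open>T 2 e\<close> with
  \<open>e\<close>. Dyadic times occur because positivity determines square roots: an eigenvector of
  \<open>T t\<close> is one of \<open>T (t / 2)\<close>. For the boxes the obstacle is that the
  plane \<open>H\<close> turns from point to point. Over a box of size \<epsilon> a field along
  \<open>H\<close> acquires a transversal component of order \<epsilon> relative to the center.
  Divided by the thickness \<open>\<epsilon>\<^sup>2\<close> this costs one power of 1/\<epsilon>,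
  just what weight 1 allows, but only if the thin direction of every box is conormal to
  \<open>H\<close> at its own center. Boxes at different centers are thus tilted against each other,
  and their disjointness needs an argument.\<close>

locale semi_hilbert = vector_space sc
  for sc :: "complex \<Rightarrow> 'a::ab_group_add \<Rightarrow> 'a" +
  fixes H :: "'a set" and ip :: "'a \<Rightarrow> 'a \<Rightarrow> complex"
  assumes zero_H [simp]: "0 \<in> H"
    and add_H [simp]: "\<And>u w. u \<in> H \<Longrightarrow> w \<in> H \<Longrightarrow> u + w \<in> H"
    and scale_H [simp]: "\<And>z u. u \<in> H \<Longrightarrow> sc z u \<in> H"
    and ip_add: "\<And>u u' w. u \<in> H \<Longrightarrow> u' \<in> H \<Longrightarrow> w \<in> H \<Longrightarrow> ip (u + u') w = ip u w + ip u' w"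
    and ip_scale: "\<And>z u w. u \<in> H \<Longrightarrow> w \<in> H \<Longrightarrow> ip (sc z u) w = z * ip u w"
    and ip_cnj: "\<And>u w. u \<in> H \<Longrightarrow> w \<in> H \<Longrightarrow> ip w u = cnj (ip u w)"
    and ip_nonneg: "\<And>u. u \<in> H \<Longrightarrow> 0 \<le> Re (ip u u)"
    and complete_H: "\<And>x. (\<And>n::nat. x n \<in> H) \<Longrightarrow>
      (\<And>e. 0 < e \<Longrightarrow> \<exists>N. \<forall>m\<ge>N. \<forall>n\<ge>N. Re (ip (x m - x n) (x m - x n)) < e) \<Longrightarrow>
      \<exists>l\<in>H. (\<lambda>n. Re (ip (x n - l) (x n - l))) \<longlonglongrightarrow> 0"
begin

section \<open>The seminorm and the Cauchy-Schwarz inequality\<close>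

definition nrm :: "'a \<Rightarrow> real" where
  "nrm u = sqrt (Re (ip u u))"

lemma uminus_H [simp]: "u \<in> H \<Longrightarrow> - u \<in> H"
  using scale_H[of u "-1"] by simp

lemma diff_H [simp]: "u \<in> H \<Longrightarrow> w \<in> H \<Longrightarrow> u - w \<in> H"
  using add_H[of u "- w"] by simp

lemma sum_H [simp]: "(\<And>i. i \<in> F \<Longrightarrow> f i \<in> H) \<Longrightarrow> sum f F \<in> H"
  by (induction F rule: infinite_finite_induct) auto

lemma ip_add_right: "u \<in> H \<Longrightarrow> u' \<in> H \<Longrightarrow> w \<in> H \<Longrightarrow> ip w (u + u') = ip w u + ip w u'"
  by (metis ip_add ip_cnj add_H complex_cnj_add)

lemma ip_scale_right: "u \<in> H \<Longrightarrow> w \<in> H \<Longrightarrow> ip w (sc z u) = cnj z * ip w u"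
  by (metis ip_scale ip_cnj scale_H complex_cnj_mult)

lemma ip_uminus: "u \<in> H \<Longrightarrow> w \<in> H \<Longrightarrow> ip (- u) w = - ip u w"
  using ip_scale[of u w "-1"] by simp

lemma ip_uminus_right: "u \<in> H \<Longrightarrow> w \<in> H \<Longrightarrow> ip w (- u) = - ip w u"
  using ip_scale_right[of u w "-1"] by simp

lemma ip_diff: "u \<in> H \<Longrightarrow> u' \<in> H \<Longrightarrow> w \<in> H \<Longrightarrow> ip (u - u') w = ip u w - ip u' w"
  using ip_add[of u "- u'" w] by (simp add: ip_uminus)

lemma ip_diff_right: "u \<in> H \<Longrightarrow> u' \<in> H \<Longrightarrow> w \<in> H \<Longrightarrow> ip w (u - u') = ip w u - ip w u'"
  using ip_add_right[of u "- u'" w] by (simp add: ip_uminus_right)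

lemma ip_zero [simp]: "w \<in> H \<Longrightarrow> ip 0 w = 0" "w \<in> H \<Longrightarrow> ip w 0 = 0"
  using ip_scale[of 0 w 0] ip_scale_right[of 0 w 0] by simp_all

lemma ip_sum: "(\<And>i. i \<in> F \<Longrightarrow> f i \<in> H) \<Longrightarrow> w \<in> H \<Longrightarrow> ip (sum f F) w = (\<Sum>i\<in>F. ip (f i) w)"
  by (induction F rule: infinite_finite_induct) (auto simp: ip_add)

lemma ip_sum_right: "(\<And>i. i \<in> F \<Longrightarrow> f i \<in> H) \<Longrightarrow> w \<in> H \<Longrightarrow> ip w (sum f F) = (\<Sum>i\<in>F. ip w (f i))"
  by (induction F rule: infinite_finite_induct) (auto simp: ip_add_right)

lemma ip_self: "u \<in> H \<Longrightarrow> ip u u = of_real ((nrm u)\<^sup>2)"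
proof -
  assume u: "u \<in> H"
  have "Im (ip u u) = 0" using ip_cnj[OF u u] by (metis add.inverse_neutral complex_cnj equal_neg_zero complex.sel(2) complex_surj)
  then show ?thesis using ip_nonneg[OF u] by (simp add: nrm_def complex_eq_iff)
qed

lemma nrm_nonneg [simp]: "u \<in> H \<Longrightarrow> 0 \<le> nrm u"
  by (simp add: nrm_def ip_nonneg)

lemma nrm_sq: "u \<in> H \<Longrightarrow> (nrm u)\<^sup>2 = Re (ip u u)"
  by (simp add: nrm_def ip_nonneg)

lemma nrm_zero [simp]: "nrm 0 = 0"
  by (simp add: nrm_def)

lemma nrm_scale: "u \<in> H \<Longrightarrow> nrm (sc z u) = cmod z * nrm u"
proof -
  assume u: "u \<in> H"
  have "ip (sc z u) (sc z u) = (z * cnj z) * ip u u"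
    using u by (simp add: ip_scale ip_scale_right)
  also have "\<dots> = of_real ((cmod z)\<^sup>2 * (nrm u)\<^sup>2)"
    unfolding complex_norm_square[symmetric] ip_self[OF u] by simp
  finally have "ip (sc z u) (sc z u) = of_real ((cmod z)\<^sup>2 * (nrm u)\<^sup>2)" .
  then have "nrm (sc z u) = sqrt ((cmod z * nrm u)\<^sup>2)"
    unfolding nrm_def[of "sc z u"] by (simp only: Re_complex_of_real power_mult_distrib)
  then show ?thesis using u by simp
qed

lemma nrm_uminus: "u \<in> H \<Longrightarrow> nrm (- u) = nrm u"
  using nrm_scale[of u "-1"] by simp

lemma nrm_minus_commute: "u \<in> H \<Longrightarrow> w \<in> H \<Longrightarrow> nrm (u - w) = nrm (w - u)"
  using nrm_uminus[of "u - w"] by simp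

lemma nrm_diff_sq:
  assumes "u \<in> H" "w \<in> H"
  shows "(nrm (u - w))\<^sup>2 = (nrm u)\<^sup>2 - 2 * Re (ip u w) + (nrm w)\<^sup>2"
proof -
  have "Re (ip w u) = Re (ip u w)" using ip_cnj[OF assms] by simp
  then show ?thesis using assms by (simp add: nrm_sq ip_diff ip_diff_right)
qed

lemma nrm_add_sq:
  assumes "u \<in> H" "w \<in> H"
  shows "(nrm (u + w))\<^sup>2 = (nrm u)\<^sup>2 + 2 * Re (ip u w) + (nrm w)\<^sup>2"
  using nrm_diff_sq[of u "- w"] assms by (simp add: ip_uminus_right nrm_uminus)

text \<open>The norm of \<open>w\<close> may vanish without \<open>w\<close> being 0. So the norm of
  \<open>u\<close> minus a multiple of \<open>w\<close> is expanded for all multiples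
  \<open>s * ip u w\<close> with real \<open>s\<close>; this phase makes the mixed term real, and
  the result is a real quadratic inequality in \<open>s\<close>.\<close>

lemma cauchy_schwarz:
  assumes "u \<in> H" "w \<in> H"
  shows "cmod (ip u w) \<le> nrm u * nrm w"
proof -
  define a b c where "a = (nrm u)\<^sup>2" and "b = (nrm w)\<^sup>2" and "c = (cmod (ip u w))\<^sup>2"
  have *: "0 \<le> a - 2 * s * c + s\<^sup>2 * c * b" for s :: real
  proof -
    define z where "z = of_real s * ip u w"
    have "(nrm (u - sc z w))\<^sup>2 = a - 2 * Re (cnj z * ip u w) + (cmod z)\<^sup>2 * b"
      using assms by (simp add: nrm_diff_sq ip_scale_right nrm_scale power_mult_distrib a_def b_def)
    moreover have "cnj z * ip u w = of_real (s * c)"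
      using complex_norm_square[of "ip u w"] by (simp add: z_def c_def mult.assoc mult.commute)
    moreover have "(cmod z)\<^sup>2 = s\<^sup>2 * c"
      by (simp add: z_def c_def norm_mult power_mult_distrib)
    ultimately have "(nrm (u - sc z w))\<^sup>2 = a - 2 * s * c + s\<^sup>2 * c * b" by simp
    then show ?thesis by (metis zero_le_power2)
  qed
  have "c \<le> a * b"
  proof (cases "b = 0")
    case True
    have "c = 0"
    proof (rule ccontr)
      assume c0: "c \<noteq> 0"
      \<comment> \<open>With \<open>b = 0\<close> the inequality is linear in \<open>s\<close>, and
        at this value of \<open>s\<close> it would say \<open>0 \<le> a - (a + 1)\<close>.\<close>
      have "2 * ((a + 1) / (2 * c)) * c = a + 1" using c0 by simp
      then show False using *[of "(a + 1) / (2 * c)"] True by simp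
    qed
    then show ?thesis using True by simp
  next
    case False
    then have "b > 0" by (simp add: b_def)
    moreover have "2 * (1 / b) * c = 2 * (c / b)" and "(1 / b)\<^sup>2 * c * b = c / b"
      using \<open>b > 0\<close> by (simp_all add: power2_eq_square)
    ultimately have "c / b \<le> a" using *[of "1 / b"] by linarith
    then show ?thesis using \<open>b > 0\<close> by (simp add: pos_divide_le_eq)
  qed
  then have "(cmod (ip u w))\<^sup>2 \<le> (nrm u * nrm w)\<^sup>2"
    by (simp add: a_def b_def c_def power_mult_distrib)
  then show ?thesis by (rule power2_le_imp_le) (simp add: assms)
qed

lemma nrm_triangle:
  assumes "u \<in> H" "w \<in> H"
  shows "nrm (u + w) \<le> nrm u + nrm w"
proof -
  have "Re (ip u w) \<le> nrm u * nrm w"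
    using cauchy_schwarz[OF assms] complex_Re_le_cmod order_trans by blast
  then have "(nrm (u + w))\<^sup>2 \<le> (nrm u + nrm w)\<^sup>2"
    using assms by (simp add: nrm_add_sq power2_sum)
  then show ?thesis by (rule power2_le_imp_le) (simp add: assms)
qed

lemma nrm_triangle_via:
  assumes "u \<in> H" "w \<in> H" "x \<in> H"
  shows "nrm (u - w) \<le> nrm (u - x) + nrm (x - w)"
  using nrm_triangle[of "u - x" "x - w"] assms by simp

lemma nrm_null_add:
  assumes "u \<in> H" "w \<in> H" "nrm (u - w) = 0"
  shows "nrm u = nrm w"
proof -
  have "nrm (w - u) = 0" using assms nrm_minus_commute[of u w] by metis
  then show ?thesis using nrm_triangle[of "u - w" w] nrm_triangle[of "w - u" u] assms by simp
qed

text \<open>Membership in \<open>H\<close> is asked for only eventually, because heat curves are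
  controlled only at positive times.\<close>

lemma tendsto_ip:
  assumes f: "((\<lambda>i. nrm (f i - u)) \<longlongrightarrow> 0) F" and g: "((\<lambda>i. nrm (g i - w)) \<longlongrightarrow> 0) F"
    and H: "\<forall>\<^sub>F i in F. f i \<in> H" "\<forall>\<^sub>F i in F. g i \<in> H" "u \<in> H" "w \<in> H"
  shows "((\<lambda>i. ip (f i) (g i)) \<longlongrightarrow> ip u w) F"
proof -
  have "((\<lambda>i. nrm (f i - u) * (nrm (g i - w) + nrm w) + nrm u * nrm (g i - w)) \<longlongrightarrow> 0 * (0 + nrm w) + nrm u * 0) F"
    by (intro tendsto_intros f g)
  then have lim: "((\<lambda>i. nrm (f i - u) * (nrm (g i - w) + nrm w) + nrm u * nrm (g i - w)) \<longlongrightarrow> 0) F" by simp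
  have "\<forall>\<^sub>F i in F. norm (ip (f i) (g i) - ip u w) \<le> nrm (f i - u) * (nrm (g i - w) + nrm w) + nrm u * nrm (g i - w)"
    using H(1,2)
  proof eventually_elim
    case (elim i)
    have eq: "ip (f i) (g i) - ip u w = ip (f i - u) (g i) + ip u (g i - w)"
      using elim H(3,4) by (simp add: ip_diff ip_diff_right)
    have "cmod (ip (f i - u) (g i)) \<le> nrm (f i - u) * nrm (g i)"
      using elim H(3) by (intro cauchy_schwarz) auto
    also have "\<dots> \<le> nrm (f i - u) * (nrm (g i - w) + nrm w)"
      using nrm_triangle[of "g i - w" w] elim H(3,4) by (intro mult_left_mono) auto
    finally have 1: "cmod (ip (f i - u) (g i)) \<le> nrm (f i - u) * (nrm (g i - w) + nrm w)" .
    have 2: "cmod (ip u (g i - w)) \<le> nrm u * nrm (g i - w)"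
      using elim H(3,4) by (intro cauchy_schwarz) auto
    show ?case unfolding eq using 1 2 norm_triangle_ineq[of "ip (f i - u) (g i)" "ip u (g i - w)"] by linarith
  qed
  then have "((\<lambda>i. ip (f i) (g i) - ip u w) \<longlongrightarrow> 0) F"
    using lim by (rule Lim_null_comparison)
  then show ?thesis by (rule LIM_zero_cancel)
qed

lemma tendsto_nrm:
  assumes f: "((\<lambda>i. nrm (f i - u)) \<longlongrightarrow> 0) F" and H: "\<forall>\<^sub>F i in F. f i \<in> H" "u \<in> H"
  shows "((\<lambda>i. nrm (f i)) \<longlongrightarrow> nrm u) F"
proof -
  have "((\<lambda>i. ip (f i) (f i)) \<longlongrightarrow> ip u u) F" by (rule tendsto_ip[OF f f H(1) H(1) H(2) H(2)])
  then show ?thesis unfolding nrm_def by (intro tendsto_real_sqrt tendsto_Re)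
qed

lemma nrm_limit_unique:
  assumes f: "((\<lambda>i. nrm (f i - u)) \<longlongrightarrow> 0) F" and g: "((\<lambda>i. nrm (f i - w)) \<longlongrightarrow> 0) F"
    and H: "\<forall>\<^sub>F i in F. f i \<in> H" "u \<in> H" "w \<in> H" and F: "F \<noteq> bot"
  shows "nrm (u - w) = 0"
proof -
  have "((\<lambda>i. nrm (f i - u) + nrm (f i - w)) \<longlongrightarrow> 0 + 0) F" by (rule tendsto_add[OF f g])
  moreover have "\<forall>\<^sub>F i in F. nrm (u - w) \<le> nrm (f i - u) + nrm (f i - w)"
    using H(1)
  proof eventually_elim
    case (elim i)
    then show ?case using nrm_triangle_via[of u w "f i"] H(2,3) nrm_minus_commute[of u "f i"] by auto
  qed
  ultimately have "nrm (u - w) \<le> 0 + 0"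
    using F by (rule tendsto_lowerbound)
  moreover have "0 \<le> nrm (u - w)" using H by (intro nrm_nonneg) auto
  ultimately show ?thesis by simp
qed

section \<open>Orthonormal systems and Parseval's identity\<close>

definition orthonormal :: "('i \<Rightarrow> 'a) \<Rightarrow> 'i set \<Rightarrow> bool" where
  "orthonormal e F \<longleftrightarrow> (\<forall>i\<in>F. e i \<in> H) \<and> (\<forall>i\<in>F. \<forall>j\<in>F. ip (e i) (e j) = (if i = j then 1 else 0))"

lemma nrm_expansion:
  assumes e: "orthonormal e F" and F: "finite F"
  shows "(nrm (\<Sum>i\<in>F. sc (c i) (e i)))\<^sup>2 = (\<Sum>i\<in>F. (cmod (c i))\<^sup>2)"
proof -
  have eH: "\<And>i. i \<in> F \<Longrightarrow> e i \<in> H" using e by (simp add: orthonormal_def)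
  define S where "S = (\<Sum>i\<in>F. sc (c i) (e i))"
  have SH: "S \<in> H" using eH by (simp add: S_def)
  have "ip S S = ip (\<Sum>i\<in>F. sc (c i) (e i)) S" by (simp only: S_def)
  also have "\<dots> = (\<Sum>i\<in>F. c i * ip (e i) S)" using eH SH by (simp add: ip_sum ip_scale)
  also have "\<dots> = (\<Sum>i\<in>F. \<Sum>j\<in>F. c i * cnj (c j) * ip (e i) (e j))"
    using eH by (simp add: S_def ip_sum_right ip_scale_right sum_distrib_left mult.assoc)
  finally have "ip (\<Sum>i\<in>F. sc (c i) (e i)) (\<Sum>i\<in>F. sc (c i) (e i)) = (\<Sum>i\<in>F. \<Sum>j\<in>F. c i * cnj (c j) * ip (e i) (e j))"
    by (simp only: S_def)
  also have "\<dots> = (\<Sum>i\<in>F. \<Sum>j\<in>F. if i = j then of_real ((cmod (c i))\<^sup>2) else 0)"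
  proof (intro sum.cong refl)
    fix i j assume "i \<in> F" "j \<in> F"
    then show "c i * cnj (c j) * ip (e i) (e j) = (if i = j then of_real ((cmod (c i))\<^sup>2) else 0)"
      using e complex_norm_square[of "c i"] by (auto simp: orthonormal_def)
  qed
  also have "\<dots> = of_real (\<Sum>i\<in>F. (cmod (c i))\<^sup>2)" using F by simp
  finally show ?thesis using eH by (simp add: nrm_sq)
qed

lemma nrm_residual:
  assumes e: "orthonormal e F" and F: "finite F" and u: "u \<in> H"
  shows "(nrm (u - (\<Sum>i\<in>F. sc (ip u (e i)) (e i))))\<^sup>2 = (nrm u)\<^sup>2 - (\<Sum>i\<in>F. (cmod (ip u (e i)))\<^sup>2)"
proof -
  have eH: "\<And>i. i \<in> F \<Longrightarrow> e i \<in> H" using e by (simp add: orthonormal_def)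
  have "ip u (\<Sum>i\<in>F. sc (ip u (e i)) (e i)) = (\<Sum>i\<in>F. cnj (ip u (e i)) * ip u (e i))"
    using eH u by (simp add: ip_sum_right ip_scale_right)
  also have "\<dots> = of_real (\<Sum>i\<in>F. (cmod (ip u (e i)))\<^sup>2)"
    using complex_norm_square by (simp add: mult.commute)
  finally show ?thesis
    using eH u nrm_expansion[OF e F, of "\<lambda>i. ip u (e i)"] by (simp add: nrm_diff_sq)
qed

lemma bessel:
  assumes "orthonormal e F" "finite F" "u \<in> H"
  shows "(\<Sum>i\<in>F. (cmod (ip u (e i)))\<^sup>2) \<le> (nrm u)\<^sup>2"
  using nrm_residual[OF assms] by (smt (verit) zero_le_power2)

text \<open>Totality is stated through the orthogonal complement, which consists of null vectors
  rather than of 0 alone; this is the form in which \<open>l2_orthonormal_basis\<close> provides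
  it.\<close>

definition onb :: "(nat \<Rightarrow> 'a) \<Rightarrow> bool" where
  "onb e \<longleftrightarrow> orthonormal e UNIV \<and> (\<forall>u\<in>H. (\<forall>k. ip u (e k) = 0) \<longrightarrow> nrm u = 0)"

lemma orthonormal_mono: "orthonormal e F \<Longrightarrow> G \<subseteq> F \<Longrightarrow> orthonormal e G"
  unfolding orthonormal_def by blast

text \<open>The partial sums are Cauchy by Bessel's inequality and converge by
  \<open>complete_H\<close>. The limit \<open>l\<close> has the same coefficients as
  \<open>u\<close>, so \<open>u - l\<close> is null and \<open>u\<close> and \<open>l\<close> have
  the same norm.\<close>

lemma parseval:
  assumes e: "onb e" and u: "u \<in> H"
  shows "(\<lambda>k. (cmod (ip u (e k)))\<^sup>2) sums (nrm u)\<^sup>2"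
proof -
  have eU: "orthonormal e UNIV" and eH: "\<And>k. e k \<in> H" using e by (auto simp: onb_def orthonormal_def)
  note eF = orthonormal_mono[OF eU subset_UNIV]
  define s where "s n = (\<Sum>k<n. sc (ip u (e k)) (e k))" for n
  define q where "q k = (cmod (ip u (e k)))\<^sup>2" for k
  have sH: "s n \<in> H" for n using eH by (simp add: s_def)
  have "summable q"
    by (intro bounded_imp_summable[where B = "(nrm u)\<^sup>2"])
      (use bessel[OF eF, of "{..n}" u for n] u in \<open>auto simp: q_def\<close>)
  then have Cq: "Cauchy (\<lambda>n. sum q {..<n})" by (simp add: summable_iff_convergent Cauchy_convergent_iff)
  have sdiff: "(nrm (s m - s n))\<^sup>2 = \<bar>sum q {..<m} - sum q {..<n}\<bar>" for m n
  proof -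
    have *: "(nrm (s m - s n))\<^sup>2 = sum q {..<m} - sum q {..<n}" if "n \<le> m" for m n
    proof -
      have "s m - s n = (\<Sum>k\<in>{n..<m}. sc (ip u (e k)) (e k))"
        unfolding s_def using sum_diff_nat_ivl[of 0 n m "\<lambda>k. sc (ip u (e k)) (e k)"] that
        by (simp add: atLeast0LessThan)
      moreover have "sum q {..<m} - sum q {..<n} = sum q {n..<m}"
        using sum_diff_nat_ivl[of 0 n m q] that by (simp add: atLeast0LessThan)
      ultimately show ?thesis using nrm_expansion[OF eF] by (simp add: q_def)
    qed
    have q0: "n \<le> m \<Longrightarrow> sum q {..<n} \<le> sum q {..<m}" for n m by (intro sum_mono2) (auto simp: q_def)
    show ?thesis
    proof (cases "n \<le> m")
      case True then show ?thesis using *[of n m] q0[of n m] by simp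
    next
      case False then show ?thesis
        using *[of m n] q0[of m n] nrm_minus_commute[OF sH sH, of m n] by simp
    qed
  qed
  have "\<exists>l\<in>H. (\<lambda>n. Re (ip (s n - l) (s n - l))) \<longlonglongrightarrow> 0"
  proof (rule complete_H[OF sH])
    fix r :: real assume "0 < r"
    then obtain N where "\<forall>m\<ge>N. \<forall>n\<ge>N. dist (sum q {..<m}) (sum q {..<n}) < r"
      using Cq unfolding Cauchy_def by blast
    then show "\<exists>N. \<forall>m\<ge>N. \<forall>n\<ge>N. Re (ip (s m - s n) (s m - s n)) < r"
      using sdiff by (intro exI[of _ N]) (auto simp: dist_real_def nrm_sq sH)
  qed
  then obtain l where l: "l \<in> H" "(\<lambda>n. Re (ip (s n - l) (s n - l))) \<longlonglongrightarrow> 0" by blast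
  have sl: "(\<lambda>n. nrm (s n - l)) \<longlonglongrightarrow> 0"
    unfolding nrm_def using tendsto_real_sqrt[OF l(2)] by simp
  have "ip (u - l) (e k) = 0" for k
  proof -
    have "(\<lambda>n. ip (s n) (e k)) \<longlonglongrightarrow> ip l (e k)"
      by (rule tendsto_ip[OF sl]) (use eH sH l in auto)
    moreover have "\<forall>\<^sub>F n in sequentially. ip (s n) (e k) = ip u (e k)"
      using eventually_gt_at_top[of k]
    proof eventually_elim
      case (elim n)
      have "ip (s n) (e k) = (\<Sum>j<n. ip u (e j) * ip (e j) (e k))"
        using eH by (simp add: s_def ip_sum ip_scale)
      also have "\<dots> = (\<Sum>j<n. if j = k then ip u (e k) else 0)"
        using eU by (intro sum.cong) (auto simp: orthonormal_def)
      finally show ?case using elim by simp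
    qed
    ultimately have "(\<lambda>n. ip u (e k)) \<longlonglongrightarrow> ip l (e k)"
      using Lim_transform_eventually by fastforce
    then have "ip u (e k) = ip l (e k)" using LIMSEQ_const_iff by blast
    then show ?thesis using u l eH by (simp add: ip_diff)
  qed
  then have "nrm (u - l) = 0" using e u l by (simp add: onb_def)
  then have nu: "nrm l = nrm u" using nrm_null_add[OF u l(1)] by simp
  have "(\<lambda>n. (nrm (s n))\<^sup>2) \<longlonglongrightarrow> (nrm l)\<^sup>2"
    by (intro tendsto_intros tendsto_nrm[OF sl]) (use sH l in auto)
  moreover have "(nrm (s n))\<^sup>2 = sum q {..<n}" for n
    unfolding s_def q_def by (intro nrm_expansion eF) auto
  ultimately show ?thesis by (simp add: sums_def nu q_def)
qed

text \<open>The curve takes values in a type without topology and only near \<open>t\<close> need it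
  stay in \<open>H\<close>, so the difference quotient is spelled out. The derivative
  \<open>w'\<close> is determined only up to null vectors.\<close>

definition has_nrm_deriv :: "(real \<Rightarrow> 'a) \<Rightarrow> 'a \<Rightarrow> real \<Rightarrow> bool" where
  "has_nrm_deriv w w' t \<longleftrightarrow> w t \<in> H \<and> w' \<in> H \<and> (\<forall>\<^sub>F s in at 0. w (t + s) \<in> H) \<and>
     ((\<lambda>s. nrm (sc (of_real (1 / s)) (w (t + s) - w t) - w')) \<longlongrightarrow> 0) (at 0)"

lemma has_nrm_deriv_const: "u \<in> H \<Longrightarrow> has_nrm_deriv (\<lambda>_. u) 0 t"
  by (simp add: has_nrm_deriv_def)

lemma has_nrm_deriv_cont:
  assumes "has_nrm_deriv w w' t"
  shows "((\<lambda>s. nrm (w (t + s) - w t)) \<longlongrightarrow> 0) (at 0)"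
proof -
  have H: "w t \<in> H" "w' \<in> H" "\<forall>\<^sub>F s in at 0. w (t + s) \<in> H"
    and l: "((\<lambda>s. nrm (sc (of_real (1 / s)) (w (t + s) - w t) - w')) \<longlongrightarrow> 0) (at 0)"
    using assms by (auto simp: has_nrm_deriv_def)
  have "((\<lambda>s. \<bar>s\<bar> * (nrm (sc (of_real (1 / s)) (w (t + s) - w t) - w') + nrm w')) \<longlongrightarrow> \<bar>0\<bar> * (0 + nrm w')) (at (0::real))"
    by (intro tendsto_intros l)
  then have lim: "((\<lambda>s. \<bar>s\<bar> * (nrm (sc (of_real (1 / s)) (w (t + s) - w t) - w') + nrm w')) \<longlongrightarrow> 0) (at (0::real))"
    by simp
  have ne: "\<forall>\<^sub>F s in at (0::real). s \<noteq> 0" by (simp add: eventually_at_filter)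
  have "\<forall>\<^sub>F s in at 0. norm (nrm (w (t + s) - w t)) \<le> \<bar>s\<bar> * (nrm (sc (of_real (1 / s)) (w (t + s) - w t) - w') + nrm w')"
    using H(3) ne
  proof eventually_elim
    case (elim s)
    let ?d = "sc (of_real (1 / s)) (w (t + s) - w t)"
    have dH: "?d \<in> H" using elim H by auto
    have "w (t + s) - w t = sc (of_real s) ?d" using elim by simp
    then have "nrm (w (t + s) - w t) = \<bar>s\<bar> * nrm ?d" using nrm_scale[OF dH, of "of_real s"] by simp
    moreover have "nrm ?d \<le> nrm (?d - w') + nrm w'" using nrm_triangle[of "?d - w'" w'] dH H by simp
    ultimately show ?case using elim H by (simp add: mult_left_mono)
  qed
  then show ?thesis using lim by (rule Lim_null_comparison)
qed

text \<open>The pairing is complex valued, so ordinary calculus applies to it; the energy estimate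
  and the symmetry of the flow are obtained through such scalar functions.\<close>

lemma has_vector_derivative_ip:
  assumes 1: "has_nrm_deriv w w' t" and 2: "has_nrm_deriv x x' t"
  shows "((\<lambda>t. ip (w t) (x t)) has_vector_derivative ip w' (x t) + ip (w t) x') (at t)"
proof -
  note D = 1[unfolded has_nrm_deriv_def] 2[unfolded has_nrm_deriv_def]
  have ne: "\<forall>\<^sub>F s in at (0::real). s \<noteq> 0" by (simp add: eventually_at_filter)
  have evH: "\<forall>\<^sub>F s in at 0. w (t + s) \<in> H" "\<forall>\<^sub>F s in at 0. x (t + s) \<in> H" and H: "w t \<in> H" "x t \<in> H" "w' \<in> H" "x' \<in> H"
    using D by auto
  \<comment> \<open>In the first term \<open>x\<close> is taken at \<open>t + s\<close>, so
    continuity of \<open>x\<close> at \<open>t\<close> enters.\<close>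
  have a: "((\<lambda>s. ip (sc (of_real (1 / s)) (w (t + s) - w t)) (x (t + s))) \<longlongrightarrow> ip w' (x t)) (at 0)"
    by (rule tendsto_ip) (use D has_nrm_deriv_cont[OF 2] H evH(2) eventually_mono[OF evH(1)] in auto)
  have b: "((\<lambda>s. ip (w t) (sc (of_real (1 / s)) (x (t + s) - x t))) \<longlongrightarrow> ip (w t) x') (at 0)"
    by (rule tendsto_ip) (use D H eventually_mono[OF evH(2)] in auto)
  have "((\<lambda>s. ip (sc (of_real (1 / s)) (w (t + s) - w t)) (x (t + s)) + ip (w t) (sc (of_real (1 / s)) (x (t + s) - x t)))
    \<longlongrightarrow> ip w' (x t) + ip (w t) x') (at 0)" by (intro tendsto_add a b)
  moreover have "\<forall>\<^sub>F s in at 0. ip (sc (of_real (1 / s)) (w (t + s) - w t)) (x (t + s)) + ip (w t) (sc (of_real (1 / s)) (x (t + s) - x t))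
     = (ip (w (t + s)) (x (t + s)) - ip (w t) (x t)) /\<^sub>R s"
    using evH ne
  proof eventually_elim
    case (elim s)
    then show ?case using H
      by (simp add: ip_scale ip_scale_right ip_diff ip_diff_right scaleR_conv_of_real divide_inverse algebra_simps)
  qed
  ultimately have "((\<lambda>s. (ip (w (t + s)) (x (t + s)) - ip (w t) (x t)) /\<^sub>R s) \<longlongrightarrow> ip w' (x t) + ip (w t) x') (at 0)"
    by (rule Lim_transform_eventually)
  then have "((\<lambda>s. norm ((ip (w (t + s)) (x (t + s)) - ip (w t) (x t)) /\<^sub>R s - (ip w' (x t) + ip (w t) x'))) \<longlongrightarrow> 0) (at 0)"
    by (intro tendsto_norm_zero LIM_zero)
  moreover have "\<forall>\<^sub>F s in at 0. norm ((ip (w (t + s)) (x (t + s)) - ip (w t) (x t)) /\<^sub>R s - (ip w' (x t) + ip (w t) x')) =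
      norm (ip (w (t + s)) (x (t + s)) - ip (w t) (x t) - s *\<^sub>R (ip w' (x t) + ip (w t) x')) / norm s"
    using ne
  proof eventually_elim
    case (elim s)
    have "ip (w (t + s)) (x (t + s)) - ip (w t) (x t) - s *\<^sub>R (ip w' (x t) + ip (w t) x') =
        s *\<^sub>R ((ip (w (t + s)) (x (t + s)) - ip (w t) (x t)) /\<^sub>R s - (ip w' (x t) + ip (w t) x'))"
      using elim by (simp add: scaleR_diff_right)
    then show ?case using elim by simp
  qed
  ultimately have "((\<lambda>s. norm (ip (w (t + s)) (x (t + s)) - ip (w t) (x t) - s *\<^sub>R (ip w' (x t) + ip (w t) x')) / norm s) \<longlongrightarrow> 0) (at 0)"
    by (rule Lim_transform_eventually)
  then show ?thesis
    unfolding has_vector_derivative_def has_derivative_at by (simp add: bounded_linear_scaleR_left)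
qed

end


section \<open>Heat flow\<close>

context semi_hilbert
begin

lemma has_nrm_deriv_add:
  assumes "has_nrm_deriv w w' t" "has_nrm_deriv x x' t"
  shows "has_nrm_deriv (\<lambda>t. w t + x t) (w' + x') t"
proof -
  note D = assms[unfolded has_nrm_deriv_def]
  let ?a = "\<lambda>s. sc (of_real (1 / s)) (w (t + s) - w t)" and ?b = "\<lambda>s. sc (of_real (1 / s)) (x (t + s) - x t)"
  have H: "\<forall>\<^sub>F s in at 0. w (t + s) \<in> H \<and> x (t + s) \<in> H" using D by (simp add: eventually_conj)
  have "((\<lambda>s. nrm (?a s - w') + nrm (?b s - x')) \<longlongrightarrow> 0 + 0) (at 0)"
    using D by (intro tendsto_add) auto
  then have lim: "((\<lambda>s. nrm (?a s - w') + nrm (?b s - x')) \<longlongrightarrow> 0) (at 0)" by simp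
  have "\<forall>\<^sub>F s in at 0. norm (nrm (sc (of_real (1 / s)) (w (t + s) + x (t + s) - (w t + x t)) - (w' + x'))) \<le> nrm (?a s - w') + nrm (?b s - x')"
    using H
  proof eventually_elim
    case (elim s)
    have "sc (of_real (1 / s)) (w (t + s) + x (t + s) - (w t + x t)) - (w' + x') = (?a s - w') + (?b s - x')"
      by (simp add: scale_right_diff_distrib scale_right_distrib)
    moreover have "nrm ((?a s - w') + (?b s - x')) \<le> nrm (?a s - w') + nrm (?b s - x')"
      using elim D by (intro nrm_triangle) auto
    moreover have "sc (of_real (1 / s)) (w (t + s) + x (t + s) - (w t + x t)) - (w' + x') \<in> H"
      using elim D by auto
    ultimately show ?case by (metis abs_of_nonneg nrm_nonneg real_norm_def)
  qed
  then have "((\<lambda>s. nrm (sc (of_real (1 / s)) (w (t + s) + x (t + s) - (w t + x t)) - (w' + x'))) \<longlongrightarrow> 0) (at 0)"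
    using lim by (rule Lim_null_comparison)
  moreover have "\<forall>\<^sub>F s in at 0. w (t + s) + x (t + s) \<in> H" using H by eventually_elim simp
  ultimately show ?thesis using D by (simp add: has_nrm_deriv_def)
qed

lemma has_nrm_deriv_scale:
  assumes "has_nrm_deriv w w' t"
  shows "has_nrm_deriv (\<lambda>t. sc z (w t)) (sc z w') t"
proof -
  note D = assms[unfolded has_nrm_deriv_def]
  let ?a = "\<lambda>s. sc (of_real (1 / s)) (w (t + s) - w t)"
  have H: "\<forall>\<^sub>F s in at 0. w (t + s) \<in> H" using D by simp
  have "((\<lambda>s. cmod z * nrm (?a s - w')) \<longlongrightarrow> cmod z * 0) (at 0)"
    using D by (intro tendsto_mult tendsto_const) auto
  moreover have "\<forall>\<^sub>F s in at 0. cmod z * nrm (?a s - w') = nrm (sc (of_real (1 / s)) (sc z (w (t + s)) - sc z (w t)) - sc z w')"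
    using H
  proof eventually_elim
    case (elim s)
    have "sc (of_real (1 / s)) (sc z (w (t + s)) - sc z (w t)) - sc z w' = sc z (?a s - w')"
      by (simp add: scale_right_diff_distrib mult.commute)
    then show ?case using elim D nrm_scale[of "?a s - w'" z] by simp
  qed
  ultimately have "((\<lambda>s. nrm (sc (of_real (1 / s)) (sc z (w (t + s)) - sc z (w t)) - sc z w')) \<longlongrightarrow> cmod z * 0) (at 0)"
    by (rule Lim_transform_eventually)
  moreover have "\<forall>\<^sub>F s in at 0. sc z (w (t + s)) \<in> H" using H by eventually_elim simp
  ultimately show ?thesis using D by (simp add: has_nrm_deriv_def)
qed

lemma has_nrm_deriv_shift:
  "has_nrm_deriv w w' (t + r) \<Longrightarrow> has_nrm_deriv (\<lambda>t. w (t + r)) w' t"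
  by (simp add: has_nrm_deriv_def add_ac)

lemma filterlim_uminus_at_0: "filterlim uminus (at 0) (at (0::real))"
  by (auto simp: filterlim_at eventually_at_filter intro!: tendsto_eq_intros)

text \<open>Needed for the backward curve \<open>T (t - s) w\<close> in
  \<open>T_sym\<close>.\<close>

lemma has_nrm_deriv_reflect:
  assumes "has_nrm_deriv w w' (r - t)"
  shows "has_nrm_deriv (\<lambda>t. w (r - t)) (- w') t"
proof -
  note D = assms[unfolded has_nrm_deriv_def]
  have 1: "\<forall>\<^sub>F s in at 0. w (r - t + s) \<in> H"
    and 2: "((\<lambda>s. nrm (sc (of_real (1 / s)) (w (r - t + s) - w (r - t)) - w')) \<longlongrightarrow> 0) (at 0)"
    using D by auto
  have H: "\<forall>\<^sub>F s in at 0. w (r - (t + s)) \<in> H"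
    using filterlim_uminus_at_0[unfolded filterlim_iff, rule_format, OF 1] by (simp add: algebra_simps)
  have "((\<lambda>s. nrm (sc (of_real (1 / - s)) (w (r - t + - s) - w (r - t)) - w')) \<longlongrightarrow> 0) (at 0)"
    using filterlim_compose[OF 2 filterlim_uminus_at_0] by simp
  moreover have "\<forall>\<^sub>F s in at 0. nrm (sc (of_real (1 / - s)) (w (r - t + - s) - w (r - t)) - w') =
      nrm (sc (of_real (1 / s)) (w (r - (t + s)) - w (r - t)) - (- w'))"
    using H
  proof eventually_elim
    case (elim s)
    have "sc (of_real (1 / s)) (w (r - (t + s)) - w (r - t)) - (- w') =
        - (sc (of_real (1 / - s)) (w (r - t + - s) - w (r - t)) - w')"
      by (simp add: algebra_simps)
    moreover have "w (r - t + - s) = w (r - (t + s))" by (simp add: algebra_simps)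
    moreover have "sc (of_real (1 / - s)) (w (r - t + - s) - w (r - t)) - w' \<in> H"
      using elim D calculation(2) by (metis diff_H scale_H)
    ultimately show ?case by (metis nrm_uminus)
  qed
  ultimately have "((\<lambda>s. nrm (sc (of_real (1 / s)) (w (r - (t + s)) - w (r - t)) - (- w'))) \<longlongrightarrow> 0) (at 0)"
    by (rule Lim_transform_eventually)
  then show ?thesis using D H by (simp add: has_nrm_deriv_def)
qed

lemma has_nrm_deriv_scalar:
  assumes f: "(f has_real_derivative f') (at t)" and u: "u \<in> H"
  shows "has_nrm_deriv (\<lambda>t. sc (of_real (f t)) u) (sc (of_real f') u) t"
proof -
  have "((\<lambda>s. \<bar>(f (t + s) - f t) / s - f'\<bar> * nrm u) \<longlongrightarrow> \<bar>f' - f'\<bar> * nrm u) (at 0)"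
    using f[unfolded DERIV_def] by (intro tendsto_intros)
  moreover have "nrm (sc (of_real (1 / s)) (sc (of_real (f (t + s))) u - sc (of_real (f t)) u) - sc (of_real f') u)
      = \<bar>(f (t + s) - f t) / s - f'\<bar> * nrm u" for s
  proof -
    have "sc (of_real (1 / s)) (sc (of_real (f (t + s))) u - sc (of_real (f t)) u) - sc (of_real f') u
        = sc (of_real ((f (t + s) - f t) / s - f')) u"
      by (simp add: scale_left_diff_distrib[symmetric] diff_divide_distrib)
    then show ?thesis using nrm_scale[OF u] by (simp only: norm_of_real)
  qed
  ultimately show ?thesis using u by (simp add: has_nrm_deriv_def)
qed

end

text \<open>\<open>D\<close> stands for the smooth sections: \<open>P\<close> preserves them and the
  form is definite there. Linearity of \<open>P\<close> and \<open>T t\<close> is not part of the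
  locale; it is derived from symmetry and from uniqueness of heat solutions.\<close>

locale heat_flow = semi_hilbert sc H ip
  for sc :: "complex \<Rightarrow> 'a::ab_group_add \<Rightarrow> 'a" and H ip +
  fixes D :: "'a set" and P :: "'a \<Rightarrow> 'a" and T :: "real \<Rightarrow> 'a \<Rightarrow> 'a" and K :: real
  assumes D_H: "D \<subseteq> H"
    and add_D [simp]: "\<And>u w. u \<in> D \<Longrightarrow> w \<in> D \<Longrightarrow> u + w \<in> D"
    and scale_D [simp]: "\<And>z u. u \<in> D \<Longrightarrow> sc z u \<in> D"
    and P_D [simp]: "\<And>u. u \<in> D \<Longrightarrow> P u \<in> D"
    and P_sym: "\<And>u w. u \<in> D \<Longrightarrow> w \<in> D \<Longrightarrow> ip (P u) w = ip u (P w)"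
    and definite: "\<And>u. u \<in> D \<Longrightarrow> nrm u = 0 \<Longrightarrow> u = 0"
    and below: "\<And>u. u \<in> D \<Longrightarrow> - K * (nrm u)\<^sup>2 \<le> Re (ip (P u) u)"
    and T_D [simp]: "\<And>t u. u \<in> H \<Longrightarrow> 0 < t \<Longrightarrow> T t u \<in> D"
    and T_0: "\<And>u. u \<in> H \<Longrightarrow> ((\<lambda>t. nrm (T t u - u)) \<longlongrightarrow> 0) (at_right 0)"
    and T_heat: "\<And>t u. u \<in> H \<Longrightarrow> 0 < t \<Longrightarrow>
      ((\<lambda>s. nrm (sc (of_real (1 / s)) (T (t + s) u - T t u) + P (T t u))) \<longlongrightarrow> 0) (at 0)"
begin

lemma D_in_H [simp]: "u \<in> D \<Longrightarrow> u \<in> H"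
  using D_H by blast

lemma uminus_D [simp]: "u \<in> D \<Longrightarrow> - u \<in> D"
  using scale_D[of u "-1"] by simp

lemma diff_D [simp]: "u \<in> D \<Longrightarrow> w \<in> D \<Longrightarrow> u - w \<in> D"
  using add_D[of u "- w"] by simp

lemma eq_of_nrm: "u \<in> D \<Longrightarrow> w \<in> D \<Longrightarrow> nrm (u - w) = 0 \<Longrightarrow> u = w"
  using definite[of "u - w"] by simp

lemma D_zero_if_orthogonal: "u \<in> D \<Longrightarrow> (\<And>w. w \<in> D \<Longrightarrow> ip u w = 0) \<Longrightarrow> u = 0"
  using definite[of u] by (simp add: nrm_def)

text \<open>By symmetry both sides have the same pairing with every element of \<open>D\<close>, and
  definiteness makes the difference vanish.\<close>

lemma P_add: "u \<in> D \<Longrightarrow> w \<in> D \<Longrightarrow> P (u + w) = P u + P w"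
proof -
  assume u: "u \<in> D" "w \<in> D"
  have "P (u + w) - (P u + P w) = 0"
    by (rule D_zero_if_orthogonal) (use u in \<open>simp_all add: ip_diff ip_add P_sym\<close>)
  then show ?thesis by simp
qed

lemma P_scale: "u \<in> D \<Longrightarrow> P (sc z u) = sc z (P u)"
proof -
  assume u: "u \<in> D"
  have "P (sc z u) - sc z (P u) = 0"
    by (rule D_zero_if_orthogonal) (use u in \<open>simp_all add: ip_diff ip_scale P_sym\<close>)
  then show ?thesis by simp
qed

section \<open>Solutions of the heat equation\<close>

definition heat_sol :: "(real \<Rightarrow> 'a) \<Rightarrow> bool" where
  "heat_sol w \<longleftrightarrow> (\<forall>t>0. w t \<in> D \<and> has_nrm_deriv w (- P (w t)) t)"

lemma eventually_pos_shift: "0 < t \<Longrightarrow> \<forall>\<^sub>F s in at (0::real). 0 < t + s"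
  by (rule order_tendstoD(1)[of _ t]) (auto intro!: tendsto_eq_intros)

lemma heat_sol_T: "u \<in> H \<Longrightarrow> heat_sol (\<lambda>t. T t u)"
  unfolding heat_sol_def has_nrm_deriv_def
  using T_heat eventually_mono[OF eventually_pos_shift, of _ "\<lambda>s. T (t + s) u \<in> H" for t]
  by (auto simp: D_in_H)

lemma heat_sol_add: "heat_sol w \<Longrightarrow> heat_sol x \<Longrightarrow> heat_sol (\<lambda>t. w t + x t)"
  unfolding heat_sol_def
proof (intro allI impI conjI)
  fix t :: real
  assume *: "\<forall>t>0. w t \<in> D \<and> has_nrm_deriv w (- P (w t)) t" "\<forall>t>0. x t \<in> D \<and> has_nrm_deriv x (- P (x t)) t" and t: "0 < t"
  then show "w t + x t \<in> D" by simp
  show "has_nrm_deriv (\<lambda>t. w t + x t) (- P (w t + x t)) t"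
    using has_nrm_deriv_add[of w "- P (w t)" t x "- P (x t)"] * t by (simp add: P_add)
qed

lemma heat_sol_scale: "heat_sol w \<Longrightarrow> heat_sol (\<lambda>t. sc z (w t))"
  unfolding heat_sol_def
proof (intro allI impI conjI)
  fix t :: real
  assume *: "\<forall>t>0. w t \<in> D \<and> has_nrm_deriv w (- P (w t)) t" and t: "0 < t"
  then show "sc z (w t) \<in> D" by simp
  show "has_nrm_deriv (\<lambda>t. sc z (w t)) (- P (sc z (w t))) t"
    using has_nrm_deriv_scale[of w "- P (w t)" t z] * t by (simp add: P_scale)
qed

lemma heat_sol_diff: "heat_sol w \<Longrightarrow> heat_sol x \<Longrightarrow> heat_sol (\<lambda>t. w t - x t)"
  using heat_sol_add[of w "\<lambda>t. sc (-1) (x t)"] heat_sol_scale[of x "-1"] by simp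

text \<open>Energy estimate: the squared norm has derivative \<open>- 2 * r\<close>, where
  \<open>r\<close> is the quadratic form of \<open>P\<close>, and by \<open>below\<close> this
  exceeds the squared norm by a factor of at most \<open>2 * K\<close>. The exponential in
  \<open>g\<close> compensates that growth.\<close>

lemma heat_sol_decay:
  assumes w: "heat_sol w" and st: "0 < s" "s \<le> t"
  shows "nrm (w t) \<le> exp (K * (t - s)) * nrm (w s)"
proof -
  define F where "F t = Re (ip (w t) (w t))" for t
  define g where "g t = exp (- 2 * K * t) * F t" for t
  have "g t \<le> g s"
  proof (rule DERIV_nonpos_imp_nonincreasing[OF st(2)])
    fix x assume "s \<le> x" "x \<le> t"
    then have x: "0 < x" using st by simp
    then have wD: "w x \<in> D" and d: "has_nrm_deriv w (- P (w x)) x" using w by (auto simp: heat_sol_def)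
    define r where "r = Re (ip (P (w x)) (w x))"
    have "ip (w x) (P (w x)) = ip (P (w x)) (w x)" using wD by (simp add: P_sym)
    then have "(F has_real_derivative - 2 * r) (at x)"
      unfolding F_def
      using bounded_linear.has_vector_derivative[OF bounded_linear_Re has_vector_derivative_ip[OF d d]] wD
      by (simp add: has_real_derivative_iff_has_vector_derivative ip_uminus ip_uminus_right r_def)
    then have "(g has_real_derivative exp (- 2 * K * x) * (- 2 * K) * F x + exp (- 2 * K * x) * (- 2 * r)) (at x)"
      unfolding g_def by (auto intro!: derivative_eq_intros)
    moreover have "exp (- 2 * K * x) * (- 2 * K) * F x + exp (- 2 * K * x) * (- 2 * r) =
        2 * (exp (- 2 * K * x) * (- K * (nrm (w x))\<^sup>2 - r))"
      using wD by (simp add: nrm_sq algebra_simps F_def)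
    moreover have "exp (- 2 * K * x) * (- K * (nrm (w x))\<^sup>2 - r) \<le> 0"
      using below[OF wD] by (intro mult_nonneg_nonpos) (auto simp: r_def)
    ultimately show "\<exists>y. (g has_real_derivative y) (at x) \<and> y \<le> 0" by auto
  qed
  have "w t \<in> H" "w s \<in> H" using w st by (auto simp: heat_sol_def)
  then have "(nrm (w t))\<^sup>2 = exp (2 * K * t) * g t" "(nrm (w s))\<^sup>2 = exp (2 * K * s) * g s"
    by (simp_all add: g_def nrm_sq exp_minus F_def)
  moreover have "exp (2 * K * t) * g s = (exp (K * (t - s)))\<^sup>2 * (exp (2 * K * s) * g s)"
  proof -
    have "K * (t - s) + K * (t - s) + 2 * K * s = 2 * K * t" by (simp add: algebra_simps)
    then show ?thesis unfolding power2_eq_square mult.assoc[symmetric] exp_add[symmetric] by simp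
  qed
  moreover have "exp (2 * K * t) * g t \<le> exp (2 * K * t) * g s"
    using \<open>g t \<le> g s\<close> by simp
  ultimately have "(nrm (w t))\<^sup>2 \<le> (exp (K * (t - s)) * nrm (w s))\<^sup>2"
    by (simp only: power_mult_distrib)
  then show ?thesis by (rule power2_le_imp_le) (use \<open>w s \<in> H\<close> in auto)
qed

text \<open>The estimate \<open>heat_sol_decay\<close> starts at a positive time \<open>s\<close>,
  so the initial value enters by letting \<open>s\<close> tend to 0.\<close>

lemma heat_sol_bound:
  assumes w: "heat_sol w" and u: "u \<in> H" and l: "((\<lambda>t. nrm (w t - u)) \<longlongrightarrow> 0) (at_right 0)" and t: "0 < t"
  shows "nrm (w t) \<le> exp (K * t) * nrm u"
proof -
  have ev: "\<forall>\<^sub>F s in at_right 0. 0 < s \<and> s \<le> t"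
    using t by (auto simp: eventually_at_right_field intro!: exI[of _ t])
  then have "\<forall>\<^sub>F s in at_right 0. w s \<in> H" by eventually_elim (use w in \<open>auto simp: heat_sol_def\<close>)
  from tendsto_nrm[OF l this u]
  have "((\<lambda>s. exp (K * (t - s)) * nrm (w s)) \<longlongrightarrow> exp (K * (t - 0)) * nrm u) (at_right 0)"
    by (intro tendsto_intros)
  moreover have "\<forall>\<^sub>F s in at_right 0. nrm (w t) \<le> exp (K * (t - s)) * nrm (w s)"
    using ev by eventually_elim (use heat_sol_decay[OF w] in auto)
  ultimately have "nrm (w t) \<le> exp (K * (t - 0)) * nrm u"
    by (rule tendsto_lowerbound) simp
  then show ?thesis by simp
qed

text \<open>The difference is a solution with initial value 0, hence null at every positive time; as
  it lies in \<open>D\<close>, it is 0.\<close>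

lemma heat_sol_unique:
  assumes w: "heat_sol w" "heat_sol x" and u: "u \<in> H" and t: "0 < t"
    and l: "((\<lambda>t. nrm (w t - u)) \<longlongrightarrow> 0) (at_right 0)" "((\<lambda>t. nrm (x t - u)) \<longlongrightarrow> 0) (at_right 0)"
  shows "w t = x t"
proof -
  have wx: "\<And>t. 0 < t \<Longrightarrow> w t \<in> D" "\<And>t. 0 < t \<Longrightarrow> x t \<in> D" using w by (auto simp: heat_sol_def)
  have ev: "\<forall>\<^sub>F s in at_right (0::real). 0 < s" by (simp add: eventually_at_right_less)
  have "((\<lambda>t. nrm (w t - u) + nrm (x t - u)) \<longlongrightarrow> 0 + 0) (at_right 0)" by (intro tendsto_add l)
  then have lim: "((\<lambda>t. nrm (w t - u) + nrm (x t - u)) \<longlongrightarrow> 0) (at_right 0)" by simp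
  have "\<forall>\<^sub>F s in at_right 0. norm (nrm (w s - x s - 0)) \<le> nrm (w s - u) + nrm (x s - u)"
    using ev
  proof eventually_elim
    case (elim s)
    then show ?case using nrm_triangle_via[of "w s" "x s" u] nrm_minus_commute[of u "x s"] wx u by simp
  qed
  then have "((\<lambda>s. nrm (w s - x s - 0)) \<longlongrightarrow> 0) (at_right 0)" using lim by (rule Lim_null_comparison)
  from heat_sol_bound[OF heat_sol_diff[OF w] zero_H this t]
  have "nrm (w t - x t) \<le> 0" by simp
  moreover have "0 \<le> nrm (w t - x t)" using wx t by (intro nrm_nonneg) auto
  ultimately have "nrm (w t - x t) = 0" by simp
  then show ?thesis using wx t by (intro eq_of_nrm) auto
qed

section \<open>Linearity, semigroup law, symmetry and positivity of the heat operators\<close>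

lemma tendsto_nrm_add:
  assumes "((\<lambda>i. nrm (f i - u)) \<longlongrightarrow> 0) F" "((\<lambda>i. nrm (g i - w)) \<longlongrightarrow> 0) F"
    and H: "\<forall>\<^sub>F i in F. f i \<in> H" "\<forall>\<^sub>F i in F. g i \<in> H" "u \<in> H" "w \<in> H"
  shows "((\<lambda>i. nrm (f i + g i - (u + w))) \<longlongrightarrow> 0) F"
proof -
  have "((\<lambda>i. nrm (f i - u) + nrm (g i - w)) \<longlongrightarrow> 0 + 0) F" by (intro tendsto_add assms)
  then have lim: "((\<lambda>i. nrm (f i - u) + nrm (g i - w)) \<longlongrightarrow> 0) F" by simp
  have "\<forall>\<^sub>F i in F. norm (nrm (f i + g i - (u + w))) \<le> nrm (f i - u) + nrm (g i - w)"
    using H(1,2)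
  proof eventually_elim
    case (elim i)
    have "f i + g i - (u + w) = (f i - u) + (g i - w)" by simp
    moreover have "nrm ((f i - u) + (g i - w)) \<le> nrm (f i - u) + nrm (g i - w)"
      using elim H by (intro nrm_triangle) auto
    moreover have "f i + g i - (u + w) \<in> H" using elim H by auto
    ultimately show ?case by (metis abs_of_nonneg nrm_nonneg real_norm_def)
  qed
  then show ?thesis using lim by (rule Lim_null_comparison)
qed

lemma eventually_T_H: "u \<in> H \<Longrightarrow> \<forall>\<^sub>F t in at_right 0. T t u \<in> H"
  by (rule eventually_mono[OF eventually_at_right_less[of 0]]) simp

lemma T_add:
  assumes "u \<in> H" "w \<in> H" "0 < t"
  shows "T t (u + w) = T t u + T t w"
  by (rule heat_sol_unique[of "\<lambda>t. T t (u + w)" "\<lambda>t. T t u + T t w" "u + w"])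
    (use assms in \<open>auto intro!: heat_sol_T heat_sol_add T_0 tendsto_nrm_add eventually_T_H\<close>)

lemma T_scale:
  assumes u: "u \<in> H" "0 < t"
  shows "T t (sc z u) = sc z (T t u)"
proof (rule heat_sol_unique[of "\<lambda>t. T t (sc z u)" "\<lambda>t. sc z (T t u)" "sc z u"])
  have "((\<lambda>t. cmod z * nrm (T t u - u)) \<longlongrightarrow> cmod z * 0) (at_right 0)"
    by (intro tendsto_intros T_0 u)
  moreover have "\<forall>\<^sub>F t in at_right 0. cmod z * nrm (T t u - u) = nrm (sc z (T t u) - sc z u)"
    using eventually_T_H[OF u(1)]
  proof eventually_elim
    case (elim t)
    then show ?case using nrm_scale[of "T t u - u" z] u by (simp add: scale_right_diff_distrib)
  qed
  ultimately have "((\<lambda>t. nrm (sc z (T t u) - sc z u)) \<longlongrightarrow> cmod z * 0) (at_right 0)"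
    by (rule Lim_transform_eventually)
  then show "((\<lambda>t. nrm (sc z (T t u) - sc z u)) \<longlongrightarrow> 0) (at_right 0)" by simp
qed (use u in \<open>auto intro!: heat_sol_T heat_sol_scale T_0\<close>)

lemma T_diff: "u \<in> H \<Longrightarrow> w \<in> H \<Longrightarrow> 0 < t \<Longrightarrow> T t (u - w) = T t u - T t w"
  using T_add[of u "sc (-1) w" t] T_scale[of w t "-1"] by simp

lemma T_bound: "u \<in> H \<Longrightarrow> 0 < t \<Longrightarrow> nrm (T t u) \<le> exp (K * t) * nrm u"
  by (rule heat_sol_bound[of "\<lambda>t. T t u"]) (auto intro: heat_sol_T T_0)

text \<open>The values of \<open>T t\<close> lie in \<open>D\<close>, where a vector of norm 0
  vanishes, so the ambiguity by null vectors disappears after any positive time.\<close>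

lemma T_null:
  assumes "u \<in> H" "w \<in> H" "nrm (u - w) = 0" "0 < t"
  shows "T t u = T t w"
proof (rule eq_of_nrm)
  have "0 \<le> nrm (T t u - T t w)" using assms by (intro nrm_nonneg) auto
  moreover have "nrm (T t u - T t w) \<le> 0" using T_bound[of "u - w" t] assms by (simp add: T_diff)
  ultimately show "nrm (T t u - T t w) = 0" by simp
qed (use assms in auto)

lemma T_has_nrm_deriv: "u \<in> H \<Longrightarrow> 0 < t \<Longrightarrow> has_nrm_deriv (\<lambda>t. T t u) (- P (T t u)) t"
  using heat_sol_T by (simp add: heat_sol_def)

lemma filterlim_at_right_at: "filterlim (\<lambda>s. s) (at 0) (at_right (0::real))"
  by (simp add: filterlim_def at_le)

text \<open>Both sides, as functions of \<open>t\<close>, solve the heat equation with initial value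
  \<open>T s u\<close>; for the left side the initial condition is continuity of the flow at the
  positive time \<open>s\<close>.\<close>

lemma T_semigroup:
  assumes u: "u \<in> H" and st: "0 < s" "0 < t"
  shows "T (t + s) u = T t (T s u)"
proof (rule heat_sol_unique[of "\<lambda>t. T (t + s) u" "\<lambda>t. T t (T s u)" "T s u"])
  show "heat_sol (\<lambda>t. T (t + s) u)"
    unfolding heat_sol_def
  proof (intro allI impI conjI)
    fix r :: real assume r: "0 < r"
    then show "T (r + s) u \<in> D" using u st by simp
    show "has_nrm_deriv (\<lambda>t. T (t + s) u) (- P (T (r + s) u)) r"
      using T_has_nrm_deriv[OF u, of "r + s"] r st by (intro has_nrm_deriv_shift[where w = "\<lambda>t. T t u"]) auto
  qed
  have "((\<lambda>r. nrm (T (s + r) u - T s u)) \<longlongrightarrow> 0) (at_right 0)"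
    by (rule filterlim_compose[OF has_nrm_deriv_cont[OF T_has_nrm_deriv[OF u st(1)]] filterlim_at_right_at])
  then show "((\<lambda>t. nrm (T (t + s) u - T s u)) \<longlongrightarrow> 0) (at_right 0)" by (simp add: add.commute)
qed (use u st in \<open>auto intro!: heat_sol_T T_0\<close>)

text \<open>The pairing of \<open>T s u\<close> with \<open>T (t - s) w\<close> is constant for
  \<open>s\<close> between 0 and \<open>t\<close>, because \<open>P\<close> is symmetric on
  \<open>D\<close>. The two sides are its limits at the ends of the interval.\<close>

lemma T_sym:
  assumes u: "u \<in> H" and w: "w \<in> H" and t: "0 < t"
  shows "ip (T t u) w = ip u (T t w)"
proof -
  define g where "g s = ip (T s u) (T (t - s) w)" for s
  have dg: "(g has_vector_derivative 0) (at s within {0<..<t})" if s: "s \<in> {0<..<t}" for s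
  proof -
    have 1: "has_nrm_deriv (\<lambda>t. T t u) (- P (T s u)) s" using T_has_nrm_deriv[OF u] s by auto
    have 2: "has_nrm_deriv (\<lambda>s. T (t - s) w) (- (- P (T (t - s) w))) s"
      using T_has_nrm_deriv[OF w, of "t - s"] s by (intro has_nrm_deriv_reflect[where w = "\<lambda>t. T t w"]) auto
    have "T s u \<in> D" "T (t - s) w \<in> D" using u w s by auto
    then have "(g has_vector_derivative 0) (at s)"
      using has_vector_derivative_ip[OF 1 2] unfolding g_def by (simp add: ip_uminus P_sym)
    then show ?thesis by (rule has_vector_derivative_at_within)
  qed
  obtain c where c: "\<And>s. s \<in> {0<..<t} \<Longrightarrow> g s = c"
    by (rule has_vector_derivative_zero_constant[OF _ dg]) auto
  have cont: "((\<lambda>s. nrm (T (t - s) v - T t v)) \<longlongrightarrow> 0) (at_right 0)" if "v \<in> H" for v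
    using filterlim_compose[OF has_nrm_deriv_cont[OF T_has_nrm_deriv[OF that t]]
        filterlim_compose[OF filterlim_uminus_at_0 filterlim_at_right_at]] by simp
  have ev: "\<forall>\<^sub>F s in at_right 0. 0 < s \<and> s < t"
    using t by (auto simp: eventually_at_right_field intro!: exI[of _ t])
  have evH: "\<forall>\<^sub>F s in at_right 0. T (t - s) v \<in> H" if "v \<in> H" for v
    using ev by eventually_elim (use that in auto)
  have "((\<lambda>s. g s) \<longlongrightarrow> ip u (T t w)) (at_right 0)"
    unfolding g_def by (rule tendsto_ip) (use u w t in \<open>auto intro: T_0 cont eventually_T_H evH\<close>)
  moreover have "\<forall>\<^sub>F s in at_right 0. g s = c" using ev by eventually_elim (use c in auto)
  ultimately have "((\<lambda>_::real. c) \<longlongrightarrow> ip u (T t w)) (at_right 0)" by (rule Lim_transform_eventually)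
  then have c1: "c = ip u (T t w)" by (simp add: tendsto_const_iff)
  \<comment> \<open>The end \<open>s = t\<close> is moved to 0 by writing \<open>t - s\<close> for
    \<open>s\<close>.\<close>
  have "((\<lambda>s. ip (T (t - s) u) (T s w)) \<longlongrightarrow> ip (T t u) w) (at_right 0)"
    by (rule tendsto_ip) (use u w t in \<open>auto intro: T_0 cont eventually_T_H evH\<close>)
  moreover have "\<forall>\<^sub>F s in at_right 0. ip (T (t - s) u) (T s w) = c"
    using ev by eventually_elim (use c[of "t - s" for s] in \<open>auto simp: g_def\<close>)
  ultimately have "((\<lambda>_::real. c) \<longlongrightarrow> ip (T t u) w) (at_right 0)" by (rule Lim_transform_eventually)
  then show ?thesis using c1 by (simp add: tendsto_const_iff)
qed

lemma T_pos:
  assumes u: "u \<in> H" and t: "0 < t"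
  shows "ip (T t u) u = of_real ((nrm (T (t / 2) u))\<^sup>2)"
proof -
  have "T t u = T (t / 2) (T (t / 2) u)" using T_semigroup[OF u, of "t / 2" "t / 2"] t by simp
  then have "ip (T t u) u = ip (T (t / 2) u) (T (t / 2) u)" using T_sym[of "T (t / 2) u" u "t / 2"] u t by simp
  then show ?thesis using u t by (simp add: ip_self)
qed

text \<open>The right side is an explicit solution of the heat equation with initial value
  \<open>u\<close>.\<close>

lemma T_eigen:
  assumes u: "u \<in> D" and P: "P u = sc (of_real \<mu>) u" and t: "0 < t"
  shows "T t u = sc (of_real (exp (- (\<mu> * t)))) u"
proof (rule heat_sol_unique[of "\<lambda>t. T t u" "\<lambda>t. sc (of_real (exp (- (\<mu> * t)))) u" u])
  show "heat_sol (\<lambda>t. sc (of_real (exp (- (\<mu> * t)))) u)"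
    unfolding heat_sol_def
  proof (intro allI impI conjI)
    fix t :: real
    have "((\<lambda>t. exp (- (\<mu> * t))) has_real_derivative - (exp (- (\<mu> * t)) * \<mu>)) (at t)"
      by (auto intro!: derivative_eq_intros)
    from has_nrm_deriv_scalar[OF this, of u]
    show "has_nrm_deriv (\<lambda>t. sc (of_real (exp (- (\<mu> * t)))) u) (- P (sc (of_real (exp (- (\<mu> * t)))) u)) t"
      using u P by (simp add: P_scale)
  qed (use u in auto)
  have "((\<lambda>t. \<bar>exp (- (\<mu> * t)) - 1\<bar> * nrm u) \<longlongrightarrow> \<bar>exp (- (\<mu> * 0)) - 1\<bar> * nrm u) (at_right 0)"
    by (intro tendsto_intros)
  moreover have "nrm (sc (of_real (exp (- (\<mu> * t)))) u - u) = \<bar>exp (- (\<mu> * t)) - 1\<bar> * nrm u" for t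
  proof -
    have "sc (of_real (exp (- (\<mu> * t)))) u - u = sc (of_real (exp (- (\<mu> * t)) - 1)) u"
      by (simp add: scale_left_diff_distrib)
    then show ?thesis using nrm_scale[OF D_in_H[OF u], of "of_real (exp (- (\<mu> * t)) - 1)"] by (simp only: norm_of_real)
  qed
  ultimately show "((\<lambda>t. nrm (sc (of_real (exp (- (\<mu> * t)))) u - u)) \<longlongrightarrow> 0) (at_right 0)" by simp
qed (use u t in \<open>auto intro: heat_sol_T T_0\<close>)

text \<open>Each entry is the squared norm of \<open>T (t / 2) (f i)\<close>, which is expanded in
  the basis \<open>e\<close>. Symmetry moves the operator to \<open>e k\<close>; then for every
  \<open>k\<close> Bessel's inequality bounds the sum over \<open>F\<close> by the squared norm of
  \<open>T (t / 2) (e k)\<close>, and these add up to the trace.\<close>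

lemma trace_lower_bound:
  assumes e: "onb e" and t: "0 < t" and tr: "(\<lambda>k. ip (T t (e k)) (e k)) sums of_real \<theta>"
    and f: "orthonormal f F" and F: "finite F"
  shows "(\<Sum>i\<in>F. Re (ip (T t (f i)) (f i))) \<le> \<theta>"
proof -
  have eH: "\<And>k. e k \<in> H" and fH: "\<And>i. i \<in> F \<Longrightarrow> f i \<in> H" using e f by (auto simp: onb_def orthonormal_def)
  let ?S = "T (t / 2)"
  have "(\<lambda>k. Re (ip (T t (e k)) (e k))) sums \<theta>" using sums_Re[OF tr] by simp
  then have tr': "(\<lambda>k. (nrm (?S (e k)))\<^sup>2) sums \<theta>" using T_pos[OF eH t] by simp
  have "(\<lambda>k. (cmod (ip (f i) (?S (e k))))\<^sup>2) sums Re (ip (T t (f i)) (f i))" if i: "i \<in> F" for i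
    using parseval[OF e, of "?S (f i)"] T_pos[OF fH[OF i] t] T_sym[OF fH[OF i] eH, of "t / 2"] fH[OF i] t by simp
  then have *: "(\<lambda>k. \<Sum>i\<in>F. (cmod (ip (f i) (?S (e k))))\<^sup>2) sums (\<Sum>i\<in>F. Re (ip (T t (f i)) (f i)))"
    by (intro sums_sum)
  have "(\<Sum>i\<in>F. (cmod (ip (f i) (?S (e k))))\<^sup>2) \<le> (nrm (?S (e k)))\<^sup>2" for k
  proof -
    have SH: "?S (e k) \<in> H" using eH t by simp
    have "cmod (ip (f i) (?S (e k))) = cmod (ip (?S (e k)) (f i))" if "i \<in> F" for i
      using ip_cnj[OF SH fH[OF that]] by simp
    then show ?thesis using bessel[OF f F SH] by simp
  qed
  then show ?thesis by (rule sums_le[OF _ * tr'])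
qed

text \<open>The function \<open>g\<close> starts at the squared norm of \<open>u\<close>, and its
  derivative is minus the real part of the pairing of \<open>T s u\<close> with \<open>P u\<close>,
  which \<open>T_bound\<close> and \<open>M\<close> control up to time \<open>t\<close>.\<close>

lemma T_lower_bound:
  assumes u: "u \<in> D" and t: "0 < t" and M: "nrm (P u) \<le> M" and K: "0 \<le> K"
  shows "(nrm u)\<^sup>2 - t * (exp (K * t) * nrm u * M) \<le> Re (ip (T t u) u)"
proof -
  have uH: "u \<in> H" using u by simp
  define g where "g s = Re (ip (T s u) u)" for s
  have dg: "(g has_real_derivative - Re (ip (T s u) (P u))) (at s)" if s: "0 < s" for s
  proof -
    have "(g has_vector_derivative Re (ip (- P (T s u)) u + ip (T s u) 0)) (at s)"
      unfolding g_def
      by (intro bounded_linear.has_vector_derivative[OF bounded_linear_Re] has_vector_derivative_ip[OF T_has_nrm_deriv[OF uH s] has_nrm_deriv_const[OF uH]])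
    then show ?thesis using u s by (simp add: has_real_derivative_iff_has_vector_derivative ip_uminus P_sym)
  qed
  let ?M = "exp (K * t) * nrm u * M"
  have M0: "0 \<le> M" using M nrm_nonneg[OF D_in_H[OF P_D[OF u]]] by linarith
  \<comment> \<open>The comparison starts at a positive time, where \<open>g\<close> is
    differentiable; \<open>s\<close> tends to 0 afterwards.\<close>
  have le: "g s - (t - s) * ?M \<le> g t" if s: "0 < s" "s \<le> t" for s
  proof -
    have "(\<lambda>x. - g x - x * ?M) t \<le> (\<lambda>x. - g x - x * ?M) s"
    proof (rule DERIV_nonpos_imp_nonincreasing[OF s(2)])
      fix x assume "s \<le> x" "x \<le> t"
      then have x: "0 < x" "x \<le> t" using s by auto
      have "Re (ip (T x u) (P u)) \<le> nrm (T x u) * nrm (P u)"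
        using cauchy_schwarz[of "T x u" "P u"] complex_Re_le_cmod[of "ip (T x u) (P u)"] D_in_H[OF T_D[OF uH x(1)]] D_in_H[OF P_D[OF u]] by linarith
      also have "\<dots> \<le> (exp (K * x) * nrm u) * M"
        by (rule mult_mono[OF T_bound[OF uH x(1)] M]) (use u uH in simp_all)
      also have "\<dots> \<le> ?M" 
        by (intro mult_right_mono M0 nrm_nonneg uH) (simp add: mult_left_mono[OF x(2) K])
      finally have "Re (ip (T x u) (P u)) \<le> ?M" .
      moreover have "((\<lambda>x. - g x - x * ?M) has_real_derivative - (- Re (ip (T x u) (P u))) - ?M) (at x)"
        by (rule derivative_eq_intros dg[OF x(1)] refl)+ simp
      ultimately show "\<exists>y. ((\<lambda>x. - g x - x * ?M) has_real_derivative y) (at x) \<and> y \<le> 0" by auto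
    qed
    then show ?thesis by (simp add: algebra_simps)
  qed
  have "((\<lambda>s. ip (T s u) u) \<longlongrightarrow> ip u u) (at_right 0)"
    by (rule tendsto_ip) (use uH in \<open>auto intro: T_0 eventually_T_H\<close>)
  then have "((\<lambda>s. g s - (t - s) * ?M) \<longlongrightarrow> Re (ip u u) - (t - 0) * ?M) (at_right 0)"
    unfolding g_def by (intro tendsto_intros)
  moreover have "\<forall>\<^sub>F s in at_right 0. g s - (t - s) * ?M \<le> g t"
    using t le by (auto simp: eventually_at_right_field intro!: exI[of _ t])
  ultimately have "Re (ip u u) - (t - 0) * ?M \<le> g t"
    by (rule tendsto_upperbound) simp
  then show ?thesis using uH by (simp add: g_def nrm_sq)
qed

end


section \<open>Eigenbasis\<close>

lemma diagonal_convergent_subsequence: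
  fixes c :: "nat \<Rightarrow> nat \<Rightarrow> 'a::heine_borel"
  assumes "\<And>k. bounded (range (c k))"
  obtains r :: "nat \<Rightarrow> nat" where "strict_mono r" "\<And>k. convergent (\<lambda>n. c k (r n))"
proof -
  interpret subseqs "\<lambda>k s. convergent (\<lambda>n. c k (s n))"
  proof
    fix k and s :: "nat \<Rightarrow> nat"
    have "bounded (range (c k \<circ> s))" using assms[of k] by (rule bounded_subset) auto
    then obtain l r where "strict_mono (r :: nat \<Rightarrow> nat)" "((c k \<circ> s) \<circ> r) \<longlonglongrightarrow> l"
      using bounded_imp_convergent_subsequence by blast
    then show "\<exists>r. strict_mono r \<and> convergent (\<lambda>n. c k ((s \<circ> r) n))"
      by (intro exI[of _ r]) (auto simp: convergent_def o_def)
  qed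
  \<comment> \<open>The diagonal sequence is a subsequence of the one chosen for \<open>k\<close>
    only after its first \<open>k + 1\<close> terms.\<close>
  have "convergent (\<lambda>n. c k ((diagseq \<circ> (+) (Suc k)) n))" for k
  proof (rule diagseq_holds)
    fix r s and n :: nat
    assume "strict_mono (r :: nat \<Rightarrow> nat)" "convergent (\<lambda>na. c n (s na))"
    then show "convergent (\<lambda>na. c n ((s \<circ> r) na))"
      using convergent_subseq_convergent[of "\<lambda>na. c n (s na)" r] by (simp add: o_def)
  qed
  then have "convergent (\<lambda>n. c k (diagseq (n + Suc k)))" for k
    using \<open>convergent (\<lambda>n. c k ((diagseq \<circ> (+) (Suc k)) n))\<close> by (simp add: o_def add.commute[of k])
  then have "convergent (\<lambda>n. c k (diagseq n))" for k
    using convergent_ignore_initial_segment[of "\<lambda>n. c k (diagseq n)" "Suc k"] by blast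
  then show thesis using that subseq_diagseq by blast
qed

text \<open>This is the compactness of a Hilbert-Schmidt operator in coordinates: the tails are
  uniformly small by the square summable bound \<open>b\<close>, and the finitely many remaining
  coordinates converge.\<close>

lemma uniformly_summable_Cauchy:
  fixes c :: "nat \<Rightarrow> nat \<Rightarrow> complex"
  assumes conv: "\<And>k. convergent (c k)" and b: "\<And>k n. cmod (c k n) \<le> b k"
    and sb: "summable (\<lambda>k. (b k)\<^sup>2)" and e: "0 < e"
  shows "\<exists>N. \<forall>m\<ge>N. \<forall>n\<ge>N. (\<Sum>k. (cmod (c k m - c k n))\<^sup>2) < e"
proof -
  have b4: "(cmod (c k m - c k n))\<^sup>2 \<le> 4 * (b k)\<^sup>2" for k m n
  proof -
    have "cmod (c k m - c k n) \<le> 2 * b k" using norm_triangle_ineq4[of "c k m" "c k n"] b[of k m] b[of k n] by linarith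
    then have "(cmod (c k m - c k n))\<^sup>2 \<le> (2 * b k)\<^sup>2" by (rule power_mono) simp
    then show ?thesis by (simp add: power_mult_distrib)
  qed
  have s4: "summable (\<lambda>k. 4 * (b k)\<^sup>2)" using sb by (rule summable_mult)
  have sc: "summable (\<lambda>k. (cmod (c k m - c k n))\<^sup>2)" for m n
    by (rule summable_comparison_test'[OF s4, of 0]) (use b4 in auto)
  have "e / 2 > 0" using e by simp
  from suminf_exist_split[OF this s4] obtain K where K: "\<bar>\<Sum>i. 4 * (b (i + K))\<^sup>2\<bar> < e / 2" by auto
  \<comment> \<open>The \<open>K\<close> head terms share \<open>e / 2\<close>; the denominator
    contains \<open>K + 1\<close> to stay positive when there are none.\<close>
  have "\<forall>k. \<exists>N. \<forall>m\<ge>N. \<forall>n\<ge>N. (cmod (c k m - c k n))\<^sup>2 < e / (2 * (real K + 1))"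
  proof
    fix k
    have "Cauchy (c k)" using conv by (rule convergent_Cauchy)
    moreover have "sqrt (e / (2 * (real K + 1))) > 0" using e by simp
    ultimately obtain N where N: "\<forall>m\<ge>N. \<forall>n\<ge>N. cmod (c k m - c k n) < sqrt (e / (2 * (real K + 1)))"
      unfolding Cauchy_def dist_norm by meson
    have "(cmod (c k m - c k n))\<^sup>2 < e / (2 * (real K + 1))" if "m \<ge> N" "n \<ge> N" for m n
    proof -
      have "(cmod (c k m - c k n))\<^sup>2 < (sqrt (e / (2 * (real K + 1))))\<^sup>2"
        using N that by (intro power_strict_mono) auto
      also have "\<dots> = e / (2 * (real K + 1))" using e by (intro real_sqrt_pow2) simp
      finally show ?thesis .
    qed
    then show "\<exists>N. \<forall>m\<ge>N. \<forall>n\<ge>N. (cmod (c k m - c k n))\<^sup>2 < e / (2 * (real K + 1))" by blast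
  qed
  then obtain N where N: "\<And>k m n. m \<ge> N k \<Longrightarrow> n \<ge> N k \<Longrightarrow> (cmod (c k m - c k n))\<^sup>2 < e / (2 * (real K + 1))"
    by metis
  define M where "M = Max (insert 0 (N ` {..<K}))"
  have M: "N k \<le> M" if "k < K" for k using that unfolding M_def by (intro Max_ge) auto
  have "(\<Sum>k. (cmod (c k m - c k n))\<^sup>2) < e" if mn: "m \<ge> M" "n \<ge> M" for m n
  proof -
    have "(\<Sum>k. (cmod (c k m - c k n))\<^sup>2) = (\<Sum>k. (cmod (c (k + K) m - c (k + K) n))\<^sup>2) + (\<Sum>k<K. (cmod (c k m - c k n))\<^sup>2)"
      by (rule suminf_split_initial_segment[OF sc])
    moreover have "(\<Sum>k. (cmod (c (k + K) m - c (k + K) n))\<^sup>2) \<le> (\<Sum>k. 4 * (b (k + K))\<^sup>2)"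
      by (intro suminf_le b4 summable_ignore_initial_segment sc s4[THEN summable_ignore_initial_segment])
    moreover have "(\<Sum>k<K. (cmod (c k m - c k n))\<^sup>2) \<le> (\<Sum>k<K. e / (2 * (real K + 1)))"
    proof (rule sum_mono)
      fix k assume "k \<in> {..<K}"
      then have "N k \<le> m" "N k \<le> n" using M[of k] mn by auto
      then show "(cmod (c k m - c k n))\<^sup>2 \<le> e / (2 * (real K + 1))" using N[of k m n] by simp
    qed
    moreover have "(\<Sum>k<K. e / (2 * (real K + 1))) \<le> e / 2"
      using e by (simp add: divide_simps)
    ultimately show ?thesis using K by linarith
  qed
  then show ?thesis by blast
qed

context heat_flow
begin

text \<open>By \<open>T_pos\<close> a null value at time \<open>t\<close> forces a null value at
  \<open>t / 2\<close>. Repeated halving brings the time to 0, where the flow tends to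
  \<open>u\<close>.\<close>

lemma T_injective:
  assumes u: "u \<in> H" and t: "0 < t" and z: "nrm (T t u) = 0"
  shows "nrm u = 0"
proof -
  have T0: "nrm (T (t / 2 ^ n) u) = 0" for n
  proof (induction n)
    case (Suc n)
    have tn: "0 < t / 2 ^ n" "0 < t / 2 ^ Suc n" using t by auto
    have "cmod (ip (T (t / 2 ^ n) u) u) \<le> nrm (T (t / 2 ^ n) u) * nrm u"
      by (rule cauchy_schwarz) (use u tn in auto)
    then have "ip (T (t / 2 ^ n) u) u = 0" using Suc by simp
    moreover have "t / 2 ^ n / 2 = t / 2 ^ Suc n" by simp
    ultimately have "of_real ((nrm (T (t / 2 ^ Suc n) u))\<^sup>2) = (0::complex)"
      using T_pos[OF u tn(1)] by metis
    then show ?case by (simp only: of_real_eq_0_iff power_eq_0_iff)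
  qed (use z in simp)
  have "(\<lambda>n. t * (1 / 2) ^ n) \<longlonglongrightarrow> t * 0"
    by (intro tendsto_mult tendsto_const LIMSEQ_realpow_zero) auto
  then have "(\<lambda>n. t / 2 ^ n) \<longlonglongrightarrow> 0" by (simp add: power_divide)
  then have "filterlim (\<lambda>n. t / 2 ^ n) (at_right 0) sequentially"
    using t by (intro tendsto_imp_filterlim_at_right) auto
  from filterlim_compose[OF T_0[OF u] this] have "(\<lambda>n. nrm (T (t / 2 ^ n) u - u)) \<longlonglongrightarrow> 0" .
  moreover have "nrm (T (t / 2 ^ n) u - u) = nrm u" for n
  proof -
    have "T (t / 2 ^ n) u = 0" using u t T0 by (intro definite) auto
    then show ?thesis using nrm_uminus[OF u] by simp
  qed
  ultimately show ?thesis by (simp add: LIMSEQ_const_iff)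
qed

text \<open>The difference \<open>x\<close> of the two sides is mapped by \<open>T (t / 2)\<close>
  to \<open>- sqrt a\<close> times \<open>x\<close>, which positivity of that operator allows only
  for \<open>x = 0\<close>.\<close>

lemma T_half:
  assumes w: "w \<in> D" and t: "0 < t" and a: "0 < a" and T: "T t w = sc (of_real a) w"
  shows "T (t / 2) w = sc (of_real (sqrt a)) w"
proof -
  define x where "x = T (t / 2) w - sc (of_real (sqrt a)) w"
  have xD: "x \<in> D" using w t by (simp add: x_def)
  have tt: "T (t / 2) (T (t / 2) w) = sc (of_real a) w"
    using T_semigroup[of w "t / 2" "t / 2"] w t T by simp
  have "T (t / 2) x = sc (of_real a) w - sc (of_real (sqrt a)) (T (t / 2) w)"
    using w t by (simp add: x_def T_diff T_scale tt)
  also have "\<dots> = sc (- of_real (sqrt a)) x"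
    using a by (simp add: x_def scale_right_diff_distrib of_real_mult[symmetric] del: of_real_mult)
  finally have "ip (T (t / 2) x) x = of_real (- sqrt a * (nrm x)\<^sup>2)"
    using xD by (simp add: ip_uminus ip_scale ip_self)
  then have "(nrm (T (t / 2 / 2) x))\<^sup>2 = - sqrt a * (nrm x)\<^sup>2"
    using T_pos[of x "t / 2"] xD t by (metis of_real_eq_iff D_in_H half_gt_zero)
  moreover have "0 \<le> sqrt a * (nrm x)\<^sup>2" using a by simp
  ultimately have "sqrt a * (nrm x)\<^sup>2 = 0" using zero_le_power2[of "nrm (T (t / 2 / 2) x)"] by linarith
  then have "nrm x = 0" using a by simp
  then show ?thesis using definite[OF xD] by (simp add: x_def)
qed

text \<open>Halving gives the eigenvalue \<open>m powr (1 / 2 ^ n)\<close> at time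
  \<open>1 / 2 ^ n\<close>. By the semigroup law the difference quotients of the flow at time 1
  along these increments are explicit multiples of \<open>w\<close>; the heat equation says that
  they tend to \<open>- P (T 1 w)\<close>.\<close>

lemma eigenvector_of_T:
  assumes w: "w \<in> D" and m: "0 < m" and T: "T 1 w = sc (of_real m) w"
  shows "P w = sc (of_real (- ln m)) w"
proof -
  have Tn: "T (1 / 2 ^ n) w = sc (of_real (m powr (1 / 2 ^ n))) w" for n
  proof (induction n)
    case (Suc n)
    have "sqrt (m powr (1 / 2 ^ n)) = m powr (1 / 2 ^ Suc n)"
      using m by (simp add: powr_half_sqrt[symmetric] powr_powr mult.commute)
    then show ?case using T_half[OF w _ _ Suc] m by (simp add: mult.commute)
  qed (use T m in simp)
  \<comment> \<open>The difference quotient at 0 of \<open>m\<close> to the power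
    \<open>1 + s\<close>, with limit \<open>m * ln m\<close>.\<close>
  define c where "c s = (m powr s * m - m) / s" for s
  have "((\<lambda>s. m powr s) has_real_derivative ln m) (at 0)"
    using m by (auto intro!: derivative_eq_intros)
  then have "((\<lambda>s. (m powr s - 1) / s) \<longlongrightarrow> ln m) (at 0)" using m by (simp add: DERIV_def)
  then have "((\<lambda>s. m * ((m powr s - 1) / s)) \<longlongrightarrow> m * ln m) (at 0)" by (intro tendsto_intros)
  then have c: "(c \<longlongrightarrow> m * ln m) (at 0)" by (simp add: c_def[abs_def] algebra_simps)
  have "(\<lambda>n. (1 / 2) ^ n :: real) \<longlonglongrightarrow> 0" by (intro LIMSEQ_realpow_zero) auto
  then have lim: "filterlim (\<lambda>n. 1 / 2 ^ n :: real) (at 0) sequentially"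
    by (simp add: filterlim_at power_divide)
  have wH: "w \<in> H" using w by simp
  have "(\<lambda>n. nrm (sc (of_real (1 / (1 / 2 ^ n))) (T (1 + 1 / 2 ^ n) w - T 1 w) + P (T 1 w))) \<longlonglongrightarrow> 0"
    using filterlim_compose[OF T_heat[OF wH, of 1] lim] by simp
  moreover have "sc (of_real (1 / (1 / 2 ^ n))) (T (1 + 1 / 2 ^ n) w - T 1 w) + P (T 1 w) =
      sc (of_real (c (1 / 2 ^ n))) w - (- sc (of_real m) (P w))" for n
  proof -
    have "T (1 + 1 / 2 ^ n) w = T 1 (T (1 / 2 ^ n) w)" using wH by (intro T_semigroup) auto
    also have "\<dots> = sc (of_real (m powr (1 / 2 ^ n) * m)) w"
      using wH by (simp add: Tn T_scale T)
    finally have *: "T (1 + 1 / 2 ^ n) w = sc (of_real (m powr (1 / 2 ^ n) * m)) w" .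
    show ?thesis
      unfolding * T c_def using w
      by (simp only: P_scale scale_left_diff_distrib[symmetric] scale_scale of_real_diff[symmetric] of_real_mult[symmetric]
          diff_minus_eq_add times_divide_eq_left mult_1)
  qed
  ultimately have 1: "(\<lambda>n. nrm (sc (of_real (c (1 / 2 ^ n))) w - (- sc (of_real m) (P w)))) \<longlonglongrightarrow> 0" by simp
  have "(\<lambda>n. \<bar>c (1 / 2 ^ n) - m * ln m\<bar> * nrm w) \<longlonglongrightarrow> \<bar>m * ln m - m * ln m\<bar> * nrm w"
    by (intro tendsto_intros filterlim_compose[OF c lim])
  moreover have "nrm (sc (of_real a) w - sc (of_real b) w) = \<bar>a - b\<bar> * nrm w" for a b :: real
    using nrm_scale[OF wH, of "of_real (a - b)"]
    by (simp only: scale_left_diff_distrib[symmetric] of_real_diff[symmetric] norm_of_real)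
  ultimately have 2: "(\<lambda>n. nrm (sc (of_real (c (1 / 2 ^ n))) w - sc (of_real (m * ln m)) w)) \<longlonglongrightarrow> 0" by (simp del: of_real_mult)
  \<comment> \<open>The limits \<open>1\<close> and \<open>2\<close> of the same sequence agree up
    to a null vector, and both lie in \<open>D\<close>.\<close>
  have "nrm (- sc (of_real m) (P w) - sc (of_real (m * ln m)) w) = 0"
    by (rule nrm_limit_unique[OF 1 2]) (use w in auto)
  then have "- sc (of_real m) (P w) = sc (of_real (m * ln m)) w"
    using w by (intro eq_of_nrm) auto
  then have "sc (of_real (- 1 / m)) (- sc (of_real m) (P w)) = sc (of_real (- 1 / m)) (sc (of_real (m * ln m)) w)" by simp
  then show ?thesis using m by simp
qed


text \<open>If the complement of the eigenvectors were nonzero, the compact positive operator \<open>T 1\<close> would have an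
  eigenvector there, and this would be an eigenvector of \<open>P\<close>.\<close>

lemma eigenvectors_total:
  assumes e: "onb e" and HS: "summable (\<lambda>k. (nrm (T 1 (e k)))\<^sup>2)"
    and u: "u \<in> H" and orth: "\<And>w \<mu>. w \<in> D \<Longrightarrow> P w = sc (of_real \<mu>) w \<Longrightarrow> ip u w = 0"
  shows "nrm u = 0"
proof (rule ccontr)
  assume nu: "nrm u \<noteq> 0"
  have eH: "\<And>k. e k \<in> H" using e by (auto simp: onb_def orthonormal_def)
  \<comment> \<open>The complement of all eigenvectors. It is invariant under \<open>T t\<close>,
    which is symmetric and acts on eigenvectors by scalars.\<close>
  define V where "V = {v \<in> H. \<forall>w \<mu>. w \<in> D \<longrightarrow> P w = sc (of_real \<mu>) w \<longrightarrow> ip v w = 0}"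
  have VH: "\<And>v. v \<in> V \<Longrightarrow> v \<in> H" by (simp add: V_def)
  have Vsc: "sc z v \<in> V" if "v \<in> V" for z v using that by (auto simp: V_def ip_scale)
  have VT: "T t v \<in> V" if v: "v \<in> V" and t: "0 < t" for t v
  proof -
    have "ip (T t v) w = 0" if w: "w \<in> D" "P w = sc (of_real \<mu>) w" for w \<mu>
      using v w t T_sym[of v w t] by (simp add: V_def T_eigen[OF w t] ip_scale_right)
    then show ?thesis using v t by (auto simp: V_def)
  qed
  have uV: "u \<in> V" using u orth by (auto simp: V_def)
  \<comment> \<open>The quadratic form of \<open>T 1\<close>. Its supremum \<open>m\<close> over the
    unit vectors of \<open>V\<close> will be the eigenvalue.\<close>
  define R where "R v = Re (ip (T 1 v) v)" for v
  define A where "A = {R v | v. v \<in> V \<and> nrm v = 1}"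
  have R_sq: "R v = (nrm (T (1 / 2) v))\<^sup>2" if "v \<in> H" for v
    using T_pos[OF that, of 1] by (simp add: R_def)
  have R_scale: "R (sc z v) = (cmod z)\<^sup>2 * R v" if "v \<in> H" for z v
    using that by (simp add: R_sq T_scale nrm_scale power_mult_distrib)
  define u1 where "u1 = sc (of_real (1 / nrm u)) u"
  have u1: "u1 \<in> V" "nrm u1 = 1" using uV nu nrm_scale[OF u, of "of_real (1 / nrm u)"] nrm_nonneg[OF u]
    by (auto simp: u1_def Vsc simp del: of_real_divide)
  have bdd: "bdd_above A"
  proof (rule bdd_aboveI)
    fix x assume "x \<in> A"
    then obtain v where v: "v \<in> V" "nrm v = 1" "x = R v" by (auto simp: A_def)
    have "nrm (T (1 / 2) v) \<le> exp (K / 2)" using T_bound[of v "1 / 2"] v VH by simp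
    then have "(nrm (T (1 / 2) v))\<^sup>2 \<le> (exp (K / 2))\<^sup>2" using v VH by (intro power_mono) auto
    then show "x \<le> (exp (K / 2))\<^sup>2" using R_sq v VH by simp
  qed
  define m where "m = Sup A"
  have Rm: "R v \<le> m" if "v \<in> V" "nrm v = 1" for v
    unfolding m_def using that bdd by (intro cSup_upper) (auto simp: A_def)
  have "nrm (T (1 / 2) u1) \<noteq> 0" using T_injective[of u1 "1 / 2"] u1 VH by auto
  then have "0 < R u1" using R_sq[of u1] u1 VH by simp
  then have m0: "0 < m" using Rm[OF u1] by simp
  have Rm': "R v \<le> m * (nrm v)\<^sup>2" if v: "v \<in> V" for v
  proof (cases "nrm v = 0")
    case True
    have "cmod (ip (T 1 v) v) \<le> nrm (T 1 v) * nrm v" by (rule cauchy_schwarz) (use v VH in auto)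
    then show ?thesis using True by (simp add: R_def)
  next
    case False
    define x where "x = sc (of_real (1 / nrm v)) v"
    have vH: "v \<in> H" using v VH by simp
    have "nrm x = 1" using False nrm_scale[OF vH, of "of_real (1 / nrm v)"] nrm_nonneg[OF vH]
      by (simp add: x_def del: of_real_divide)
    then have "R x \<le> m" using v by (intro Rm) (auto simp: x_def Vsc)
    moreover have "R x = R v / (nrm v)\<^sup>2"
      using R_scale[OF vH, of "of_real (1 / nrm v)"] nrm_nonneg[OF vH]
      by (simp add: x_def power_divide del: of_real_divide)
    ultimately show ?thesis using False by (simp add: divide_le_eq)
  qed
  \<comment> \<open>Cauchy-Schwarz for the positive form of \<open>T 1\<close>, applied to
    \<open>v\<close> and \<open>T 1 v\<close>, bounds the fourth power of the norm of
    \<open>T 1 v\<close> by \<open>R v * R (T 1 v)\<close>. Then \<open>Rm'\<close> for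
    \<open>T 1 v\<close> allows one square to be cancelled.\<close>
  have TR: "(nrm (T 1 v))\<^sup>2 \<le> m * R v" if v: "v \<in> V" for v
  proof -
    have vH: "v \<in> H" and TH: "T 1 v \<in> H" using v VH by auto
    have "T 1 v = T (1 / 2) (T (1 / 2) v)" using T_semigroup[OF vH, of "1 / 2" "1 / 2"] by simp
    then have "ip (T 1 v) (T 1 v) = ip (T (1 / 2) v) (T (1 / 2) (T 1 v))"
      using T_sym[of "T (1 / 2) v" "T 1 v" "1 / 2"] vH by simp
    moreover have "cmod (ip (T 1 v) (T 1 v)) = (nrm (T 1 v))\<^sup>2" by (simp add: ip_self[OF TH] norm_power TH)
    ultimately have "(nrm (T 1 v))\<^sup>2 \<le> nrm (T (1 / 2) v) * nrm (T (1 / 2) (T 1 v))"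
      using cauchy_schwarz[of "T (1 / 2) v" "T (1 / 2) (T 1 v)"] vH TH by simp
    then have "((nrm (T 1 v))\<^sup>2)\<^sup>2 \<le> (nrm (T (1 / 2) v) * nrm (T (1 / 2) (T 1 v)))\<^sup>2"
      by (rule power_mono) simp
    also have "\<dots> = R v * R (T 1 v)" using R_sq[OF vH] R_sq[OF TH] by (simp add: power_mult_distrib)
    also have "\<dots> \<le> R v * (m * (nrm (T 1 v))\<^sup>2)"
      using Rm'[OF VT[OF v]] R_sq[OF vH] by (intro mult_left_mono) auto
    finally have *: "(nrm (T 1 v))\<^sup>2 * (nrm (T 1 v))\<^sup>2 \<le> (m * R v) * (nrm (T 1 v))\<^sup>2"
      by (simp add: power2_eq_square mult_ac)
    show ?thesis
    proof (cases "nrm (T 1 v) = 0")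
      case True
      then show ?thesis using m0 R_sq[OF vH] by simp
    next
      case False
      then show ?thesis using * by (intro mult_right_le_imp_le[OF *]) simp
    qed
  qed
  have "\<exists>v. v \<in> V \<and> nrm v = 1 \<and> m - 1 / (real n + 1) < R v" for n
  proof -
    have "m - 1 / (real n + 1) < Sup A" by (simp add: m_def)
    then obtain a where "a \<in> A" "m - 1 / (real n + 1) < a"
      using less_cSupE[of _ A] u1 by (auto simp: A_def)
    then show ?thesis by (auto simp: A_def)
  qed
  then obtain v where v: "\<And>n. v n \<in> V" "\<And>n. nrm (v n) = 1" "\<And>n. m - 1 / (real n + 1) < R (v n)" by metis
  have vH: "\<And>n. v n \<in> H" using v VH by auto
  \<comment> \<open>By symmetry these are the coefficients of \<open>T 1 (v n)\<close> in the basis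
    \<open>e\<close>. They are bounded, uniformly in \<open>n\<close>, by the norms of
    \<open>T 1 (e k)\<close>, which are square summable by \<open>HS\<close>.\<close>
  define c where "c k n = ip (v n) (T 1 (e k))" for k n
  have cb: "cmod (c k n) \<le> nrm (T 1 (e k))" for k n
    using cauchy_schwarz[of "v n" "T 1 (e k)"] vH eH v by (simp add: c_def)
  then have "bounded (range (c k))" for k by (auto simp: bounded_iff)
  then obtain r where r: "strict_mono r" "\<And>k. convergent (\<lambda>n. c k (r n))"
    using diagonal_convergent_subsequence by blast
  have TvH: "T 1 (v n) \<in> H" for n using vH by simp
  have dist: "(nrm (T 1 (v i) - T 1 (v j)))\<^sup>2 = (\<Sum>k. (cmod (c k i - c k j))\<^sup>2)" for i j
  proof -
    have "ip (T 1 (v i) - T 1 (v j)) (e k) = c k i - c k j" for k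
      using vH eH by (simp add: ip_diff T_sym c_def)
    then show ?thesis using parseval[OF e, of "T 1 (v i) - T 1 (v j)"] TvH by (simp add: sums_iff)
  qed
  have "\<exists>l\<in>H. (\<lambda>n. Re (ip (T 1 (v (r n)) - l) (T 1 (v (r n)) - l))) \<longlonglongrightarrow> 0"
  proof (rule complete_H[OF TvH])
    fix \<epsilon> :: real assume "0 < \<epsilon>"
    from uniformly_summable_Cauchy[of "\<lambda>k n. c k (r n)", OF r(2) cb HS this]
    show "\<exists>N. \<forall>m\<ge>N. \<forall>n\<ge>N. Re (ip (T 1 (v (r m)) - T 1 (v (r n))) (T 1 (v (r m)) - T 1 (v (r n)))) < \<epsilon>"
      using dist nrm_sq[OF diff_H[OF TvH TvH]] by simp
  qed
  then obtain l where l: "l \<in> H" "(\<lambda>n. Re (ip (T 1 (v (r n)) - l) (T 1 (v (r n)) - l))) \<longlonglongrightarrow> 0" by blast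
  have Tl: "(\<lambda>n. nrm (T 1 (v (r n)) - l)) \<longlonglongrightarrow> 0"
    unfolding nrm_def using tendsto_real_sqrt[OF l(2)] by simp
  define q where "q n = sc (of_real m) (v (r n))" for n
  have qV: "q n \<in> V" for n using v by (simp add: q_def Vsc)
  have qH: "q n \<in> H" for n using qV VH by simp
  \<comment> \<open>On a maximizing sequence \<open>T 1\<close> is asymptotically multiplication by
    \<open>m\<close>. Hence convergence of \<open>T 1 (v (r n))\<close> to \<open>l\<close> entails
    convergence of \<open>q n\<close> to \<open>l\<close>.\<close>
  have "(nrm (T 1 (v n) - sc (of_real m) (v n)))\<^sup>2 \<le> m * (1 / (real n + 1))" for n
  proof -
    have "(nrm (T 1 (v n) - sc (of_real m) (v n)))\<^sup>2 = (nrm (T 1 (v n)))\<^sup>2 - 2 * (m * R (v n)) + m\<^sup>2"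
      using nrm_diff_sq[of "T 1 (v n)" "sc (of_real m) (v n)"] vH v m0
      by (simp add: nrm_scale ip_scale_right R_def)
    also have "\<dots> \<le> m * (m - R (v n))" using TR[OF v(1), of n] by (simp add: power2_eq_square algebra_simps)
    also have "\<dots> \<le> m * (1 / (real n + 1))" using v(3)[of n] m0 by (intro mult_left_mono) auto
    finally show ?thesis .
  qed
  then have *: "(nrm (T 1 (v (r n)) - q n))\<^sup>2 \<le> m * (1 / (real (r n) + 1))" for n by (simp add: q_def)
  have "(\<lambda>n. m * (1 / (real (r n) + 1))) \<longlonglongrightarrow> m * 0"
  proof (intro tendsto_mult tendsto_const)
    have "(\<lambda>n. 1 / (real n + 1)) \<longlonglongrightarrow> 0" using LIMSEQ_inverse_real_of_nat by (simp add: inverse_eq_divide add.commute)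
    from LIMSEQ_subseq_LIMSEQ[OF this r(1)] show "(\<lambda>n. 1 / (real (r n) + 1)) \<longlonglongrightarrow> 0" by (simp add: o_def)
  qed
  then have lim: "(\<lambda>n. m * (1 / (real (r n) + 1))) \<longlonglongrightarrow> 0" by simp
  have "(\<lambda>n. (nrm (T 1 (v (r n)) - q n))\<^sup>2) \<longlonglongrightarrow> 0"
    by (rule Lim_null_comparison[OF always_eventually lim]) (use * in simp)
  from tendsto_real_sqrt[OF this] have Tq: "(\<lambda>n. nrm (T 1 (v (r n)) - q n)) \<longlonglongrightarrow> 0"
    using nrm_nonneg[OF diff_H[OF TvH qH]] by simp
  have "(\<lambda>n. nrm (T 1 (v (r n)) - q n) + nrm (T 1 (v (r n)) - l)) \<longlonglongrightarrow> 0 + 0" by (intro tendsto_add Tq Tl)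
  then have lim: "(\<lambda>n. nrm (T 1 (v (r n)) - q n) + nrm (T 1 (v (r n)) - l)) \<longlonglongrightarrow> 0" by simp
  have ql: "(\<lambda>n. nrm (q n - l)) \<longlonglongrightarrow> 0"
  proof (rule Lim_null_comparison[OF always_eventually lim], rule allI)
    fix n
    show "norm (nrm (q n - l)) \<le> nrm (T 1 (v (r n)) - q n) + nrm (T 1 (v (r n)) - l)"
      using nrm_triangle_via[OF qH l(1) TvH, of n "r n"] nrm_minus_commute[OF qH TvH, of n "r n"] nrm_nonneg[OF diff_H[OF qH l(1)]]
      by simp
  qed
  have evq: "\<forall>\<^sub>F n in sequentially. q n \<in> H" using qH by simp
  have lV: "l \<in> V"
  proof -
    have "ip l w = 0" if w: "w \<in> D" "P w = sc (of_real \<mu>) w" for w \<mu>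
    proof -
      have "(\<lambda>n. ip (q n) w) \<longlonglongrightarrow> ip l w"
        by (rule tendsto_ip[OF ql]) (use w l evq in auto)
      moreover have "ip (q n) w = 0" for n using qV[of n] w by (simp add: V_def)
      ultimately show ?thesis by (simp add: LIMSEQ_const_iff)
    qed
    then show ?thesis using l by (auto simp: V_def)
  qed
  have "(\<lambda>n. nrm (q n)) \<longlonglongrightarrow> nrm l" by (rule tendsto_nrm[OF ql evq l(1)])
  moreover have "nrm (q n) = m" for n using v m0 vH by (simp add: q_def nrm_scale)
  ultimately have nl: "nrm l = m" by (simp add: LIMSEQ_const_iff)
  have "(\<lambda>n. exp K * nrm (q n - l)) \<longlonglongrightarrow> exp K * 0" by (intro tendsto_intros ql)
  then have lim: "(\<lambda>n. exp K * nrm (q n - l)) \<longlonglongrightarrow> 0" by simp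
  have a: "(\<lambda>n. nrm (T 1 (q n) - T 1 l)) \<longlonglongrightarrow> 0"
  proof (rule Lim_null_comparison[OF always_eventually lim], rule allI)
    fix n
    show "norm (nrm (T 1 (q n) - T 1 l)) \<le> exp K * nrm (q n - l)"
      using T_bound[OF diff_H[OF qH l(1)], of 1 n] nrm_nonneg[OF diff_H, of "T 1 (q n)" "T 1 l"] qH[of n] l(1) by (simp add: T_diff)
  qed
  have "(\<lambda>n. m * nrm (T 1 (v (r n)) - l)) \<longlonglongrightarrow> m * 0" by (intro tendsto_intros Tl)
  moreover have "m * nrm (T 1 (v (r n)) - l) = nrm (T 1 (q n) - sc (of_real m) l)" for n
    using nrm_scale[OF diff_H[OF TvH l(1)], of "of_real m" "r n"] m0 vH
    by (simp add: q_def T_scale scale_right_diff_distrib)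
  ultimately have b: "(\<lambda>n. nrm (T 1 (q n) - sc (of_real m) l)) \<longlonglongrightarrow> 0" by simp
  have nT: "nrm (T 1 l - sc (of_real m) l) = 0"
    by (rule nrm_limit_unique[OF a b]) (use qH l in auto)
  \<comment> \<open>The eigenvalue equation for \<open>l\<close> holds up to a null vector. The
    vector \<open>T 1 l\<close> lies in \<open>D\<close>, so for it the equation is exact.\<close>
  define w where "w = T 1 l"
  have wD: "w \<in> D" using l by (simp add: w_def)
  have "T 1 w = T 1 (sc (of_real m) l)"
    using nT l by (intro T_null) (auto simp: w_def)
  then have Tw: "T 1 w = sc (of_real m) w" using l by (simp add: T_scale w_def)
  have "w \<in> V" using lV by (simp add: w_def VT)
  moreover have "P w = sc (of_real (- ln m)) w" by (rule eigenvector_of_T[OF wD m0 Tw])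
  \<comment> \<open>Being an eigenvector of \<open>P\<close> inside \<open>V\<close>,
    \<open>w\<close> is orthogonal to itself, although its norm is \<open>m\<close> times that of
    \<open>l\<close> and both are positive.\<close>
  ultimately have "ip w w = 0" using wD unfolding V_def by blast
  then have "nrm w = 0" by (simp add: nrm_def)
  moreover have "nrm w = nrm (sc (of_real m) l)"
    using nT l by (intro nrm_null_add) (auto simp: w_def)
  ultimately show False using nl m0 l by (simp add: nrm_scale)
qed

lemma eigenspaces_orthogonal:
  assumes "u \<in> D" "w \<in> D" "P u = sc (of_real a) u" "P w = sc (of_real b) w" "a \<noteq> b"
  shows "ip u w = 0"
proof -
  have "of_real a * ip u w = of_real b * ip u w"
    using P_sym[OF assms(1,2)] assms by (simp add: ip_scale ip_scale_right)
  then show ?thesis using assms(5) by simp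
qed

text \<open>Vectors are orthogonalized only against earlier ones with the same eigenvalue, so each
  stays in its eigenspace; different eigenspaces are orthogonal anyway, by symmetry of
  \<open>P\<close>.\<close>

fun gram_schmidt :: "(nat \<Rightarrow> real) \<Rightarrow> (nat \<Rightarrow> 'a) \<Rightarrow> nat \<Rightarrow> 'a" where
  "gram_schmidt lam e k =
     (let x = e k - (\<Sum>j | j < k \<and> lam j = lam k. sc (ip (e k) (gram_schmidt lam e j)) (gram_schmidt lam e j))
      in sc (of_real (1 / nrm x)) x)"

declare gram_schmidt.simps [simp del]

text \<open>For totality, each \<open>f k\<close> is a combination of vectors
  \<open>\<psi> j\<close>, so a vector orthogonal to all \<open>\<psi> k\<close> is orthogonal to
  the spans of the \<open>f k\<close>. These are the full eigenspaces, and
  \<open>eigenvectors_total\<close> applies.\<close>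

lemma eigenbasis_exists:
  assumes e: "onb e" and HS: "summable (\<lambda>k. (nrm (T 1 (e k)))\<^sup>2)"
    and inj: "\<And>\<mu>. inj_on f {k. lam k = \<mu>}"
    and ind: "\<And>\<mu>. \<not> dependent (f ` {k. lam k = \<mu>})"
    and spn: "\<And>\<mu>. span (f ` {k. lam k = \<mu>}) = {u \<in> D. P u = sc (of_real \<mu>) u}"
  obtains \<psi> where "onb \<psi>" "\<And>k. \<psi> k \<in> D" "\<And>k. P (\<psi> k) = sc (of_real (lam k)) (\<psi> k)"
proof -
  define E where "E k = {j. j < k \<and> lam j = lam k}" for k
  define \<psi> where "\<psi> = gram_schmidt lam f"
  define s where "s k = (\<Sum>j\<in>E k. sc (ip (f k) (\<psi> j)) (\<psi> j))" for k
  define x where "x k = f k - s k" for k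
  have psi: "\<psi> k = sc (of_real (1 / nrm (x k))) (x k)" for k
    unfolding \<psi>_def x_def s_def E_def by (subst gram_schmidt.simps) (simp add: Let_def)
  have finE: "finite (E k)" for k by (simp add: E_def)
  have eigsub: "u \<in> D \<and> P u = sc (of_real \<mu>) u \<longleftrightarrow> u \<in> span (f ` {k. lam k = \<mu>})" for u \<mu>
    using spn[of \<mu>] by blast
  have fD: "f k \<in> D" for k using eigsub[of "f k" "lam k"] by (auto intro: span_base)
  \<comment> \<open>The span of the earlier \<open>f j\<close> is carried along in the induction,
    because linear independence of the \<open>f k\<close> then shows that \<open>x k\<close> does
    not vanish.\<close>
  have main: "\<psi> k \<in> span (f ` insert k (E k)) \<and> nrm (x k) \<noteq> 0 \<and> nrm (\<psi> k) = 1 \<and> (\<forall>j\<in>E k. ip (\<psi> k) (\<psi> j) = 0)" for k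
  proof (induction k rule: less_induct)
    case (less k)
    have psi_span: "\<psi> j \<in> span (f ` E k)" if j: "j \<in> E k" for j
    proof -
      have "insert j (E j) \<subseteq> E k" using j by (auto simp: E_def)
      then have "span (f ` insert j (E j)) \<subseteq> span (f ` E k)" by (intro span_mono image_mono)
      then show ?thesis using less[of j] j by (auto simp: E_def)
    qed
    then have s_span: "s k \<in> span (f ` E k)" unfolding s_def by (intro span_sum span_scale)
    have Esub: "f ` insert k (E k) \<subseteq> f ` {j. lam j = lam k}" by (auto simp: E_def)
    have x_span: "x k \<in> span (f ` insert k (E k))"
      using s_span span_mono[of "f ` E k" "f ` insert k (E k)"] span_base[of "f k" "f ` insert k (E k)"]
      unfolding x_def by (intro span_diff) auto
    have psi_D: "\<psi> j \<in> D" if "j \<in> E k" for j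
      using psi_span[OF that] eigsub[of "\<psi> j" "lam k"] span_mono[of "f ` E k" "f ` {j. lam j = lam k}"] by (auto simp: E_def)
    have xD: "x k \<in> D" using x_span eigsub[of "x k" "lam k"] span_mono[OF Esub] by auto
    have "x k \<noteq> 0"
    proof
      assume "x k = 0"
      then have "f k \<in> span (f ` E k)" using s_span by (simp add: x_def)
      moreover have "f ` E k \<subseteq> f ` {j. lam j = lam k} - {f k}"
      proof
        fix y assume "y \<in> f ` E k"
        then obtain j where j: "j \<in> E k" "y = f j" by auto
        have "f j \<noteq> f k" using inj[of "lam k"] j unfolding inj_on_def E_def by auto
        then show "y \<in> f ` {j. lam j = lam k} - {f k}" using j by (auto simp: E_def)
      qed
      ultimately have "f k \<in> span (f ` {j. lam j = lam k} - {f k})" using span_mono by blast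
      then show False using ind[of "lam k"] unfolding dependent_def by auto
    qed
    then have nx: "nrm (x k) \<noteq> 0" using definite[OF xD] by auto
    have "nrm (\<psi> k) = 1" using nx nrm_scale[OF D_in_H[OF xD], of "of_real (1 / nrm (x k))"] nrm_nonneg[OF D_in_H[OF xD]]
      unfolding psi by (simp del: of_real_divide)
    moreover have "ip (\<psi> k) (\<psi> j) = 0" if j: "j \<in> E k" for j
    proof -
      have "ip (\<psi> i) (\<psi> j) = (if i = j then 1 else 0)" if i: "i \<in> E k" for i
      proof -
        consider "i = j" | "i \<in> E j" | "j \<in> E i"
          using i j unfolding E_def by (metis (mono_tags, lifting) mem_Collect_eq nat_neq_iff)
        then show ?thesis
        proof cases
          case 1
          have "nrm (\<psi> j) = 1" using less[of j] j by (auto simp: E_def)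
          then show ?thesis using 1 ip_self[OF D_in_H[OF psi_D[OF j]]] by simp
        next
          case 2
          then have "ip (\<psi> j) (\<psi> i) = 0" using less[of j] j by (auto simp: E_def)
          then show ?thesis using 2 ip_cnj[of "\<psi> j" "\<psi> i"] psi_D i j by (auto simp: E_def)
        next
          case 3
          then have "ip (\<psi> i) (\<psi> j) = 0" using less[of i] i by (auto simp: E_def)
          then show ?thesis using 3 by (auto simp: E_def)
        qed
      qed
      then have "ip (s k) (\<psi> j) = (\<Sum>i\<in>E k. if i = j then ip (f k) (\<psi> j) else 0)"
        unfolding s_def using psi_D j by (subst ip_sum) (auto simp: ip_scale intro!: sum.cong)
      also have "\<dots> = ip (f k) (\<psi> j)" using j finE by simp
      finally have "ip (x k) (\<psi> j) = 0"
        using psi_D j fD by (simp add: x_def ip_diff s_def)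
      then show ?thesis using psi_D j xD by (simp add: psi ip_scale)
    qed
    moreover have "\<psi> k \<in> span (f ` insert k (E k))" unfolding psi using x_span by (rule span_scale)
    ultimately show ?case using nx by blast
  qed
  have psi_eig: "\<psi> k \<in> D \<and> P (\<psi> k) = sc (of_real (lam k)) (\<psi> k)" for k
    unfolding eigsub using main[of k] span_mono[of "f ` insert k (E k)" "f ` {j. lam j = lam k}"] by (auto simp: E_def)
  have psi_H: "\<psi> k \<in> H" for k using psi_eig by simp
  have "ip (\<psi> i) (\<psi> j) = (if i = j then 1 else 0)" for i j
  proof -
    consider "i = j" | "i \<in> E j" | "j \<in> E i" | "lam i \<noteq> lam j" unfolding E_def by (metis (mono_tags, lifting) mem_Collect_eq nat_neq_iff)
    then show ?thesis
    proof cases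
      case 1 then show ?thesis using main[of j] ip_self[OF psi_H, of j] by simp
    next
      case 2
      then have "ip (\<psi> j) (\<psi> i) = 0" using main[of j] by auto
      then show ?thesis using 2 ip_cnj[OF psi_H psi_H, of j i] by (auto simp: E_def)
    next
      case 3 then show ?thesis using main[of i] by (auto simp: E_def)
    next
      case 4 then show ?thesis using eigenspaces_orthogonal[of "\<psi> i" "\<psi> j"] psi_eig by auto
    qed
  qed
  then have on: "orthonormal \<psi> UNIV" using psi_H by (auto simp: orthonormal_def)
  have "nrm u = 0" if u: "u \<in> H" and z: "\<forall>k. ip u (\<psi> k) = 0" for u
  proof (rule eigenvectors_total[OF e HS u])
    fix w \<mu> assume "w \<in> D" "P w = sc (of_real \<mu>) w"
    then have "w \<in> span (f ` {k. lam k = \<mu>})" using eigsub by blast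
    then have "w \<in> H \<and> ip u w = 0"
    proof (induction rule: span_induct_alt)
      case base
      show ?case using u by simp
    next
      case (step c y z)
      then obtain k where k: "y = f k" by auto
      have "f k = sc (of_real (nrm (x k))) (\<psi> k) + s k"
        using main[of k] by (simp add: psi x_def)
      moreover have "ip u (sc (of_real (nrm (x k))) (\<psi> k) + s k) = 0"
        using psi_H u z by (simp add: s_def ip_add_right ip_scale_right ip_sum_right)
      ultimately have "ip u y = 0" using k by simp
      then show ?case using step k fD u by (simp add: ip_add_right ip_scale_right)
    qed
    then show "ip u w = 0" by simp
  qed
  then have "onb \<psi>" using on by (auto simp: onb_def)
  then show thesis using that psi_eig by blast
qed

end


section \<open>Karamata's theorem\<close>

text \<open>For \<open>c = i + 1\<close> this is the integral of the power
  \<open>exp (- s) ^ (i + 1)\<close> needed in \<open>karamata\<close>; it is the Gamma integral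
  under a linear substitution.\<close>

lemma has_integral_powr_exp:
  fixes \<alpha> c :: real
  assumes \<alpha>: "0 < \<alpha>" and c: "0 < c"
  shows "((\<lambda>s. s powr (\<alpha> - 1) * exp (- (c * s))) has_integral Gamma \<alpha> / c powr \<alpha>) {0..}"
proof -
  let ?f = "\<lambda>t. t powr (\<alpha> - 1) / exp t"
  have hi: "(?f has_integral Gamma \<alpha>) {0..}" using \<alpha> by (rule Gamma_integral_real)
  then have abs: "?f absolutely_integrable_on {0..}"
    by (intro nonnegative_absolutely_integrable_1) (auto simp: integrable_on_def)
  have im: "(\<lambda>x. c * x) ` {0..} = {0..}"
  proof (intro equalityI subsetI)
    fix y :: real assume "y \<in> {0..}"
    then show "y \<in> (\<lambda>x. c * x) ` {0..}" using c by (intro image_eqI[of _ _ "y / c"]) auto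
  qed (use c in auto)
  have "(\<lambda>x. \<bar>c\<bar> *\<^sub>R ?f (c * x)) absolutely_integrable_on {0..} \<and>
      integral {0..} (\<lambda>x. \<bar>c\<bar> *\<^sub>R ?f (c * x)) = Gamma \<alpha> \<longleftrightarrow>
      ?f absolutely_integrable_on (\<lambda>x. c * x) ` {0..} \<and> integral ((\<lambda>x. c * x) ` {0..}) ?f = Gamma \<alpha>"
    by (rule has_absolute_integral_change_of_variables_real[where h = "\<lambda>_. c"])
      (use c in \<open>auto intro!: derivative_eq_intros inj_onI\<close>)
  then have "(\<lambda>x. \<bar>c\<bar> *\<^sub>R ?f (c * x)) absolutely_integrable_on {0..}" "integral {0..} (\<lambda>x. \<bar>c\<bar> *\<^sub>R ?f (c * x)) = Gamma \<alpha>"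
    using abs hi im by (auto simp: integral_unique)
  then have "((\<lambda>x. \<bar>c\<bar> *\<^sub>R ?f (c * x)) has_integral Gamma \<alpha>) {0..}"
    by (metis absolutely_integrable_on_def has_integral_integrable_integral)
  from has_integral_mult_right[OF this, of "1 / c powr \<alpha>"]
  have "((\<lambda>x. 1 / c powr \<alpha> * (\<bar>c\<bar> *\<^sub>R ?f (c * x))) has_integral 1 / c powr \<alpha> * Gamma \<alpha>) {0..}" .
  moreover have "1 / c powr \<alpha> * (\<bar>c\<bar> *\<^sub>R ?f (c * x)) = x powr (\<alpha> - 1) * exp (- (c * x))" if "x \<in> {0..}" for x
    using that c by (simp add: powr_mult powr_diff exp_minus field_simps)
  ultimately show ?thesis
    by (metis (no_types, lifting) has_integral_cong mult.commute times_divide_eq_right mult_1_right)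
qed

lemma has_integral_powr_step:
  fixes \<alpha> b :: real
  assumes \<alpha>: "0 < \<alpha>" and b: "0 \<le> b"
  shows "((\<lambda>s. s powr (\<alpha> - 1) * (if s \<le> b then 1 else 0)) has_integral b powr \<alpha> / \<alpha>) {0..}"
proof -
  have "((\<lambda>s. s powr (\<alpha> - 1)) has_integral b powr \<alpha> / \<alpha>) {0..b}"
    using has_integral_powr_from_0[of "\<alpha> - 1" b] \<alpha> b by simp
  then have "((\<lambda>s. if s \<in> {0..b} then s powr (\<alpha> - 1) else 0) has_integral b powr \<alpha> / \<alpha>) {0..}"
    by (subst has_integral_restrict) auto
  then show ?thesis by (rule has_integral_eq[rotated]) auto
qed

text \<open>The trapezoid \<open>h\<close> is 1 up to \<open>a\<close> and 0 from \<open>b\<close>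
  on. In the variable \<open>x = exp (- s)\<close> its quotient by \<open>x\<close> is still
  continuous on the closed unit interval, since it vanishes near 0. Weierstrass approximation of
  this quotient \<open>g\<close> leaves the factor \<open>exp (- s)\<close> in the error, which
  keeps the error summable over the eigenvalues and integrable.\<close>

lemma polynomial_step_approximation:
  fixes a b \<epsilon> :: real
  assumes ab: "0 \<le> a" "a < b" and \<epsilon>: "0 < \<epsilon>"
  obtains c n where
    "\<And>s. 0 \<le> s \<Longrightarrow> (if s \<le> a then 1 else 0) - \<epsilon> * exp (- s) \<le> exp (- s) * (\<Sum>i\<le>n. c i * exp (- s) ^ i)"
    "\<And>s. 0 \<le> s \<Longrightarrow> exp (- s) * (\<Sum>i\<le>n. c i * exp (- s) ^ i) \<le> (if s \<le> b then 1 else 0) + \<epsilon> * exp (- s)"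
proof -
  define h where "h s = max 0 (min 1 ((b - s) / (b - a)))" for s
  define g where "g x = (if x \<le> exp (- b) then 0 else h (- ln x) / x)" for x :: real
  have "continuous_on ({0..exp (- b)} \<union> {exp (- b)..1}) (\<lambda>x. if x \<le> exp (- b) then 0 else h (- ln x) / x)"
  proof (rule continuous_on_If)
    have "continuous_on {exp (- b)..1} (\<lambda>x. max 0 (min 1 ((b - - ln x) / (b - a))) / x)"
      using ab by (intro continuous_intros) (auto simp: not_le[symmetric] dest: order_trans[OF less_imp_le[OF exp_gt_zero]])
    then show "continuous_on {exp (- b)..1} (\<lambda>x. h (- ln x) / x)" by (simp only: h_def)
  qed (auto simp: h_def)
  moreover have "{0..exp (- b)} \<union> {exp (- b)..1} = {0..1}"
    using ab by (intro ivl_disj_un_two_touch) auto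
  ultimately have cg: "continuous_on {0..1} g" unfolding g_def[abs_def] by simp
  obtain p where p: "real_polynomial_function p" "\<And>x. x \<in> {0..1} \<Longrightarrow> \<bar>g x - p x\<bar> < \<epsilon>"
    using Stone_Weierstrass_real_polynomial_function[of "{0..1}" g \<epsilon>] cg \<epsilon> by auto
  then obtain c n where cn: "p = (\<lambda>x. \<Sum>i\<le>n. c i * x ^ i)" by (auto simp: real_polynomial_function_iff_sum)
  have eg: "exp (- s) * g (exp (- s)) = h s" for s
    using ab by (auto simp: g_def h_def divide_le_0_iff)
  have h: "(if s \<le> a then 1 else 0) \<le> h s" "h s \<le> (if s \<le> b then 1 else 0)" for s
    using ab by (auto simp: h_def divide_le_0_iff)
  have "\<bar>h s - exp (- s) * p (exp (- s))\<bar> \<le> \<epsilon> * exp (- s)" if "0 \<le> s" for s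
  proof -
    have "\<bar>h s - exp (- s) * p (exp (- s))\<bar> = exp (- s) * \<bar>g (exp (- s)) - p (exp (- s))\<bar>"
      unfolding eg[symmetric] by (simp add: right_diff_distrib[symmetric] abs_mult)
    also have "\<dots> \<le> exp (- s) * \<epsilon>" using p(2)[of "exp (- s)"] that by (intro mult_left_mono) auto
    finally show ?thesis by (simp add: mult.commute)
  qed
  then have *: "h s - exp (- s) * p (exp (- s)) \<le> \<epsilon> * exp (- s)" "exp (- s) * p (exp (- s)) - h s \<le> \<epsilon> * exp (- s)"
    if "0 \<le> s" for s using that by (auto simp: abs_le_iff)
  show thesis
  proof (rule that[of c n])
    fix s :: real assume s: "0 \<le> s"
    show "(if s \<le> a then 1 else 0) - \<epsilon> * exp (- s) \<le> exp (- s) * (\<Sum>i\<le>n. c i * exp (- s) ^ i)"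
      using *(1)[OF s] h(1)[of s] unfolding cn by linarith
    show "exp (- s) * (\<Sum>i\<le>n. c i * exp (- s) ^ i) \<le> (if s \<le> b then 1 else 0) + \<epsilon> * exp (- s)"
      using *(2)[OF s] h(2)[of s] unfolding cn by linarith
  qed
qed

lemma finite_sublevel_of_heat_sum:
  fixes lam :: "nat \<Rightarrow> real"
  assumes "summable (\<lambda>k. exp (- lam k))"
  shows "finite {k. lam k \<le> x}"
proof -
  have "(\<lambda>k. exp (- lam k)) \<longlonglongrightarrow> 0" using assms by (rule summable_LIMSEQ_zero)
  then have "\<forall>\<^sub>F k in sequentially. exp (- lam k) < exp (- x)" by (rule order_tendstoD) simp
  then have "finite {k. \<not> exp (- lam k) < exp (- x)}"
    unfolding eventually_cofinite[symmetric] cofinite_eq_sequentially .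
  then show ?thesis by (rule rev_finite_subset) auto
qed

text \<open>The count at \<open>1 / t\<close> is the sum over \<open>k\<close> of a step function of
  \<open>t * lam k\<close>. For \<open>exp (- s)\<close> times a polynomial in
  \<open>exp (- s)\<close> the corresponding sum is a combination of values of
  \<open>\<theta>\<close> at multiples of \<open>t\<close>, whose limit is known; such functions
  enclose the step up to small errors.\<close>

theorem karamata:
  fixes lam :: "nat \<Rightarrow> real"
  assumes nonneg: "\<And>k. 0 \<le> lam k"
    and sums: "\<And>t. 0 < t \<Longrightarrow> (\<lambda>k. exp (- (t * lam k))) sums \<theta> t"
    and lim: "((\<lambda>t. t powr \<alpha> * \<theta> t) \<longlongrightarrow> A) (at_right 0)" and \<alpha>: "0 < \<alpha>"
  shows "((\<lambda>t. t powr \<alpha> * real (eigenvalue_count lam (1 / t))) \<longlongrightarrow> A / Gamma (\<alpha> + 1)) (at_right 0)"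
proof -
  define N where "N t = real (eigenvalue_count lam (1 / t))" for t
  have fin: "finite {k. lam k \<le> x}" for x
    using finite_sublevel_of_heat_sum[of lam x] sums[of 1] by (auto simp: sums_iff)
  have th0: "0 \<le> \<theta> t" if "0 < t" for t by (rule sums_le[OF _ sums_zero sums[OF that]]) simp
  have ev0: "\<forall>\<^sub>F t in at_right (0::real). 0 < t" by (simp add: eventually_at_right_less)
  have A0: "0 \<le> A"
  proof (rule tendsto_lowerbound[OF lim])
    show "\<forall>\<^sub>F t in at_right 0. 0 \<le> t powr \<alpha> * \<theta> t" using ev0 by eventually_elim (simp add: th0)
  qed simp
  have G0: "0 < Gamma \<alpha>" using \<alpha> by simp
  have NS: "(\<lambda>k. if t * lam k \<le> 1 then 1 else 0) sums N t" if t: "0 < t" for t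
  proof -
    have "{k. lam k \<le> 1 / t} = {k. t * lam k \<le> 1}" using t by (simp add: field_simps)
    then show ?thesis using sums_If_finite_set[OF fin[of "1 / t"], of "\<lambda>_. 1::real"]
      by (simp add: N_def eigenvalue_count_def)
  qed
  define L where "L c n t = t powr \<alpha> * (\<Sum>i\<le>n. c i * \<theta> (real (Suc i) * t))" for c :: "nat \<Rightarrow> real" and n t
  define I where "I c n = A * (\<Sum>i\<le>n. c i / real (Suc i) powr \<alpha>)" for c :: "nat \<Rightarrow> real" and n
  have L_sums: "(\<lambda>k. exp (- (t * lam k)) * (\<Sum>i\<le>n. c i * exp (- (t * lam k)) ^ i)) sums (\<Sum>i\<le>n. c i * \<theta> (real (Suc i) * t))"
    if t: "0 < t" for c n t
  proof -
    have "(\<lambda>k. \<Sum>i\<le>n. c i * exp (- (real (Suc i) * t * lam k))) sums (\<Sum>i\<le>n. c i * \<theta> (real (Suc i) * t))"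
      using t by (intro sums_sum sums_mult sums) auto
    moreover have "(\<Sum>i\<le>n. c i * exp (- (real (Suc i) * t * lam k))) = exp (- (t * lam k)) * (\<Sum>i\<le>n. c i * exp (- (t * lam k)) ^ i)" for k
    proof -
      have "exp (- (real (Suc i) * t * lam k)) = exp (- (t * lam k)) * exp (- (t * lam k)) ^ i" for i
        using exp_of_nat_mult[of "Suc i" "- (t * lam k)"] by (simp add: mult.assoc)
      then show ?thesis by (simp only: sum_distrib_left mult_ac)
    qed
    ultimately show ?thesis by simp
  qed
  have L_lim: "(L c n \<longlongrightarrow> I c n) (at_right 0)" for c n
  proof -
    have "((\<lambda>t. t powr \<alpha> * \<theta> (real (Suc i) * t)) \<longlongrightarrow> A / real (Suc i) powr \<alpha>) (at_right 0)" for i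
    proof -
      have f: "filterlim (\<lambda>t. real (Suc i) * t) (at_right 0) (at_right 0)"
        unfolding filterlim_at using ev0
        by (auto intro!: tendsto_eq_intros elim!: eventually_mono)
      have "((\<lambda>t. ((real (Suc i) * t) powr \<alpha> * \<theta> (real (Suc i) * t)) / real (Suc i) powr \<alpha>) \<longlongrightarrow> A / real (Suc i) powr \<alpha>) (at_right 0)"
        by (intro tendsto_divide filterlim_compose[OF lim f] tendsto_const) simp
      moreover have "\<forall>\<^sub>F t in at_right 0. ((real (Suc i) * t) powr \<alpha> * \<theta> (real (Suc i) * t)) / real (Suc i) powr \<alpha> = t powr \<alpha> * \<theta> (real (Suc i) * t)"
        using ev0 by eventually_elim (simp add: powr_mult del: of_nat_Suc)
      ultimately show ?thesis by (rule Lim_transform_eventually)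
    qed
    then have "((\<lambda>t. \<Sum>i\<le>n. c i * (t powr \<alpha> * \<theta> (real (Suc i) * t))) \<longlongrightarrow> (\<Sum>i\<le>n. c i * (A / real (Suc i) powr \<alpha>))) (at_right 0)"
      by (intro tendsto_intros)
    then show ?thesis
      unfolding L_def[abs_def] I_def by (simp add: sum_distrib_left mult_ac del: of_nat_Suc)
  qed
  have I_integral: "((\<lambda>s. s powr (\<alpha> - 1) * (exp (- s) * (\<Sum>i\<le>n. c i * exp (- s) ^ i))) has_integral
      (\<Sum>i\<le>n. c i * (Gamma \<alpha> / real (Suc i) powr \<alpha>))) {0..}" for c n
  proof -
    have "((\<lambda>s. \<Sum>i\<le>n. c i * (s powr (\<alpha> - 1) * exp (- (real (Suc i) * s)))) has_integral
      (\<Sum>i\<le>n. c i * (Gamma \<alpha> / real (Suc i) powr \<alpha>))) {0..}"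
      by (intro has_integral_sum has_integral_mult_right has_integral_powr_exp \<alpha>) auto
    moreover have "(\<Sum>i\<le>n. c i * (s powr (\<alpha> - 1) * exp (- (real (Suc i) * s)))) = s powr (\<alpha> - 1) * (exp (- s) * (\<Sum>i\<le>n. c i * exp (- s) ^ i))" for s
    proof -
      have "exp (- (real (Suc i) * s)) = exp (- s) * exp (- s) ^ i" for i
        using exp_of_nat_mult[of "Suc i" "- s"] by simp
      then show ?thesis by (simp only: sum_distrib_left mult_ac)
    qed
    ultimately show ?thesis by simp
  qed
  \<comment> \<open>So the limit \<open>I c n\<close> is \<open>A / Gamma \<alpha>\<close> times an
    integral against \<open>s powr (\<alpha> - 1)\<close>, which is monotone in the integrand and
    can be compared with that of a step.\<close>
  have I_eq: "I c n = A / Gamma \<alpha> * (\<Sum>i\<le>n. c i * (Gamma \<alpha> / real (Suc i) powr \<alpha>))" for c n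
    using G0 by (simp add: I_def sum_distrib_left)
  have step_int: "((\<lambda>s. s powr (\<alpha> - 1) * ((if s \<le> b then 1 else 0) + \<epsilon> * exp (- s))) has_integral b powr \<alpha> / \<alpha> + \<epsilon> * Gamma \<alpha>) {0..}"
    if b: "0 \<le> b" for b \<epsilon> :: real
  proof -
    have "((\<lambda>s. s powr (\<alpha> - 1) * (if s \<le> b then 1 else 0) + \<epsilon> * (s powr (\<alpha> - 1) * exp (- (1 * s)))) has_integral
        b powr \<alpha> / \<alpha> + \<epsilon> * (Gamma \<alpha> / 1 powr \<alpha>)) {0..}"
      by (intro has_integral_add has_integral_mult_right has_integral_powr_step has_integral_powr_exp \<alpha> b) auto
    then show ?thesis by (simp add: algebra_simps)
  qed
  have GA: "A / Gamma \<alpha> * (x / \<alpha> + \<epsilon> * Gamma \<alpha>) = A / Gamma (\<alpha> + 1) * x + \<epsilon> * A" for x \<epsilon>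
  proof -
    have "\<alpha> \<notin> \<int>\<^sub>\<le>\<^sub>0" using \<alpha> by (auto elim!: nonpos_Ints_cases)
    then have "Gamma (\<alpha> + 1) = \<alpha> * Gamma \<alpha>" by (rule Gamma_plus1)
    moreover have "A / g * (x / \<alpha> + \<epsilon> * g) = A / (\<alpha> * g) * x + \<epsilon> * A" if "0 < g" for g
      using that \<alpha> by (simp add: field_simps)
    ultimately show ?thesis using G0 by metis
  qed
  \<comment> \<open>One \<open>\<epsilon> * A\<close> comes from integrating the approximation
    error, the other from the summand \<open>\<epsilon> * \<theta> t\<close>; the last
    \<open>\<epsilon>\<close> makes the inequality strict.\<close>
  have upper: "\<forall>\<^sub>F t in at_right 0. t powr \<alpha> * N t < A / Gamma (\<alpha> + 1) * b powr \<alpha> + 2 * \<epsilon> * A + \<epsilon>"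
    if b: "1 < b" and \<epsilon>: "0 < \<epsilon>" for b \<epsilon>
  proof -
    obtain c n where c: "\<And>s. 0 \<le> s \<Longrightarrow> (if s \<le> 1 then 1 else 0) - \<epsilon> * exp (- s) \<le> exp (- s) * (\<Sum>i\<le>n. c i * exp (- s) ^ i)"
      "\<And>s. 0 \<le> s \<Longrightarrow> exp (- s) * (\<Sum>i\<le>n. c i * exp (- s) ^ i) \<le> (if s \<le> b then 1 else 0) + \<epsilon> * exp (- s)"
      using polynomial_step_approximation[of 1 b \<epsilon>] b \<epsilon> by auto
    have "(\<Sum>i\<le>n. c i * (Gamma \<alpha> / real (Suc i) powr \<alpha>)) \<le> b powr \<alpha> / \<alpha> + \<epsilon> * Gamma \<alpha>"
    proof (rule has_integral_le[OF I_integral step_int])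
      fix s :: real assume "s \<in> {0..}"
      then show "s powr (\<alpha> - 1) * (exp (- s) * (\<Sum>i\<le>n. c i * exp (- s) ^ i)) \<le> s powr (\<alpha> - 1) * ((if s \<le> b then 1 else 0) + \<epsilon> * exp (- s))"
        by (intro mult_left_mono c(2)) auto
    qed (use b in simp)
    then have "I c n \<le> A / Gamma \<alpha> * (b powr \<alpha> / \<alpha> + \<epsilon> * Gamma \<alpha>)"
      unfolding I_eq using A0 G0 by (intro mult_left_mono) auto
    then have Ile: "I c n + \<epsilon> * A < A / Gamma (\<alpha> + 1) * b powr \<alpha> + 2 * \<epsilon> * A + \<epsilon>" using GA[of "b powr \<alpha>" \<epsilon>] \<epsilon> by linarith
    have "((\<lambda>t. L c n t + \<epsilon> * (t powr \<alpha> * \<theta> t)) \<longlongrightarrow> I c n + \<epsilon> * A) (at_right 0)"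
      by (intro tendsto_intros L_lim lim)
    then have "\<forall>\<^sub>F t in at_right 0. L c n t + \<epsilon> * (t powr \<alpha> * \<theta> t) < A / Gamma (\<alpha> + 1) * b powr \<alpha> + 2 * \<epsilon> * A + \<epsilon>"
      using Ile by (rule order_tendstoD)
    with ev0 show ?thesis
    proof eventually_elim
      case (elim t)
      have "N t \<le> (\<Sum>i\<le>n. c i * \<theta> (real (Suc i) * t)) + \<epsilon> * \<theta> t"
      proof (rule sums_le[OF _ NS[OF elim(1)] sums_add[OF L_sums[OF elim(1)] sums_mult[OF sums[OF elim(1)]]]])
        fix k
        show "(if t * lam k \<le> 1 then 1 else 0) \<le> exp (- (t * lam k)) * (\<Sum>i\<le>n. c i * exp (- (t * lam k)) ^ i) + \<epsilon> * exp (- (t * lam k))"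
          using c(1)[of "t * lam k"] nonneg[of k] elim(1) by simp
      qed
      then have "t powr \<alpha> * N t \<le> t powr \<alpha> * ((\<Sum>i\<le>n. c i * \<theta> (real (Suc i) * t)) + \<epsilon> * \<theta> t)"
        by (intro mult_left_mono) auto
      then have "t powr \<alpha> * N t \<le> L c n t + \<epsilon> * (t powr \<alpha> * \<theta> t)" unfolding L_def by (simp only: algebra_simps)
      then show ?case using elim(2) by linarith
    qed
  qed
  have lower: "\<forall>\<^sub>F t in at_right 0. A / Gamma (\<alpha> + 1) * a powr \<alpha> - 2 * \<epsilon> * A - \<epsilon> < t powr \<alpha> * N t"
    if a: "0 < a" "a < 1" and \<epsilon>: "0 < \<epsilon>" for a \<epsilon>
  proof -
    obtain c n where c: "\<And>s. 0 \<le> s \<Longrightarrow> (if s \<le> a then 1 else 0) - \<epsilon> * exp (- s) \<le> exp (- s) * (\<Sum>i\<le>n. c i * exp (- s) ^ i)"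
      "\<And>s. 0 \<le> s \<Longrightarrow> exp (- s) * (\<Sum>i\<le>n. c i * exp (- s) ^ i) \<le> (if s \<le> 1 then 1 else 0) + \<epsilon> * exp (- s)"
      using polynomial_step_approximation[of a 1 \<epsilon>] a \<epsilon> by auto
    \<comment> \<open>Written as a sum, so that \<open>step_int\<close> applies with
      \<open>- \<epsilon>\<close>.\<close>
    have c1: "(if s \<le> a then 1 else 0) + - \<epsilon> * exp (- s) \<le> exp (- s) * (\<Sum>i\<le>n. c i * exp (- s) ^ i)" if "0 \<le> s" for s
      using c(1)[OF that] by simp
    have "a powr \<alpha> / \<alpha> + (- \<epsilon>) * Gamma \<alpha> \<le> (\<Sum>i\<le>n. c i * (Gamma \<alpha> / real (Suc i) powr \<alpha>))"
    proof (rule has_integral_le[OF step_int I_integral])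
      fix s :: real assume "s \<in> {0..}"
      then show "s powr (\<alpha> - 1) * ((if s \<le> a then 1 else 0) + - \<epsilon> * exp (- s)) \<le> s powr (\<alpha> - 1) * (exp (- s) * (\<Sum>i\<le>n. c i * exp (- s) ^ i))"
        by (intro mult_left_mono c1) auto
    qed (use a in simp)
    then have "A / Gamma \<alpha> * (a powr \<alpha> / \<alpha> + (- \<epsilon>) * Gamma \<alpha>) \<le> I c n"
      unfolding I_eq using A0 G0 by (intro mult_left_mono) auto
    then have Ile: "A / Gamma (\<alpha> + 1) * a powr \<alpha> - 2 * \<epsilon> * A - \<epsilon> < I c n - \<epsilon> * A"
      using GA[of "a powr \<alpha>" "- \<epsilon>"] \<epsilon> by linarith
    have "((\<lambda>t. L c n t - \<epsilon> * (t powr \<alpha> * \<theta> t)) \<longlongrightarrow> I c n - \<epsilon> * A) (at_right 0)"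
      by (intro tendsto_intros L_lim lim)
    then have "\<forall>\<^sub>F t in at_right 0. A / Gamma (\<alpha> + 1) * a powr \<alpha> - 2 * \<epsilon> * A - \<epsilon> < L c n t - \<epsilon> * (t powr \<alpha> * \<theta> t)"
      using Ile by (rule order_tendstoD)
    with ev0 show ?thesis
    proof eventually_elim
      case (elim t)
      have "(\<Sum>i\<le>n. c i * \<theta> (real (Suc i) * t)) - \<epsilon> * \<theta> t \<le> N t"
      proof (rule sums_le[OF _ sums_diff[OF L_sums[OF elim(1)] sums_mult[OF sums[OF elim(1)]]] NS[OF elim(1)]])
        fix k
        show "exp (- (t * lam k)) * (\<Sum>i\<le>n. c i * exp (- (t * lam k)) ^ i) - \<epsilon> * exp (- (t * lam k)) \<le> (if t * lam k \<le> 1 then 1 else 0)"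
          using c(2)[of "t * lam k"] nonneg[of k] elim(1) by simp
      qed
      then have "t powr \<alpha> * ((\<Sum>i\<le>n. c i * \<theta> (real (Suc i) * t)) - \<epsilon> * \<theta> t) \<le> t powr \<alpha> * N t"
        by (intro mult_left_mono) auto
      then have "L c n t - \<epsilon> * (t powr \<alpha> * \<theta> t) \<le> t powr \<alpha> * N t" unfolding L_def by (simp only: algebra_simps)
      then show ?case using elim(2) by linarith
    qed
  qed
  define B where "B = A / Gamma (\<alpha> + 1)"
  show ?thesis
    unfolding N_def[symmetric] B_def[symmetric]
  proof (rule order_tendstoI)
    fix y assume y: "B < y"
    have "((\<lambda>\<epsilon>. B * (1 + \<epsilon>) powr \<alpha> + 2 * \<epsilon> * A + \<epsilon>) \<longlongrightarrow> B * (1 + 0) powr \<alpha> + 2 * 0 * A + 0) (at_right 0)"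
      by (intro tendsto_intros) auto
    then have "\<forall>\<^sub>F \<epsilon> in at_right 0. B * (1 + \<epsilon>) powr \<alpha> + 2 * \<epsilon> * A + \<epsilon> < y"
      using y by (intro order_tendstoD(2)) simp_all
    with ev0 have "\<forall>\<^sub>F \<epsilon> in at_right 0. 0 < \<epsilon> \<and> B * (1 + \<epsilon>) powr \<alpha> + 2 * \<epsilon> * A + \<epsilon> < y" by eventually_elim simp
    then obtain \<epsilon> where e: "0 < \<epsilon>" "B * (1 + \<epsilon>) powr \<alpha> + 2 * \<epsilon> * A + \<epsilon> < y"
      using eventually_happens'[OF trivial_limit_at_right_real] by blast
    show "\<forall>\<^sub>F t in at_right 0. t powr \<alpha> * N t < y"
      using upper[of "1 + \<epsilon>" \<epsilon>] e unfolding B_def by (auto elim!: eventually_mono)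
  next
    fix y assume y: "y < B"
    have "((\<lambda>\<epsilon>. B * (1 - \<epsilon>) powr \<alpha> - 2 * \<epsilon> * A - \<epsilon>) \<longlongrightarrow> B * (1 - 0) powr \<alpha> - 2 * 0 * A - 0) (at_right 0)"
      by (intro tendsto_intros) auto
    then have "\<forall>\<^sub>F \<epsilon> in at_right 0. y < B * (1 - \<epsilon>) powr \<alpha> - 2 * \<epsilon> * A - \<epsilon>"
      using y by (intro order_tendstoD(1)) simp_all
    moreover have "\<forall>\<^sub>F \<epsilon> in at_right (0::real). \<epsilon> < 1"
      by (auto simp: eventually_at_right_field intro!: exI[of _ 1])
    ultimately have "\<forall>\<^sub>F \<epsilon> in at_right 0. 0 < \<epsilon> \<and> \<epsilon> < 1 \<and> y < B * (1 - \<epsilon>) powr \<alpha> - 2 * \<epsilon> * A - \<epsilon>"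
      using ev0 by eventually_elim simp
    then obtain \<epsilon> where e: "0 < \<epsilon>" "\<epsilon> < 1" "y < B * (1 - \<epsilon>) powr \<alpha> - 2 * \<epsilon> * A - \<epsilon>"
      using eventually_happens'[OF trivial_limit_at_right_real] by blast
    show "\<forall>\<^sub>F t in at_right 0. y < t powr \<alpha> * N t"
      using lower[of "1 - \<epsilon>" \<epsilon>] e unfolding B_def by (auto elim!: eventually_mono)
  qed
qed

section \<open>From the heat trace to counting function and eigenvalues\<close>

lemma eigenvalue_count_asymptotics:
  fixes lam :: "nat \<Rightarrow> real"
  assumes mono: "mono lam"
    and sums: "\<And>t. 0 < t \<Longrightarrow> (\<lambda>k. exp (- (t * lam k))) sums \<theta> t"
    and lim: "((\<lambda>t. t powr \<alpha> * \<theta> t) \<longlongrightarrow> A) (at_right 0)" and \<alpha>: "0 < \<alpha>"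
  shows "((\<lambda>x. real (eigenvalue_count lam x) / x powr \<alpha>) \<longlongrightarrow> A / Gamma (\<alpha> + 1)) at_top"
proof -
  \<comment> \<open>Shifting by \<open>c\<close> makes all eigenvalues nonnegative. It multiplies
    the trace by \<open>exp (- (t * c))\<close>, which tends to 1, so \<open>A\<close> is
    unchanged.\<close>
  define c where "c = \<bar>lam 0\<bar>"
  define B where "B = A / Gamma (\<alpha> + 1)"
  have "((\<lambda>t. t powr \<alpha> * real (eigenvalue_count (\<lambda>k. lam k + c) (1 / t))) \<longlongrightarrow> B) (at_right 0)"
    unfolding B_def
  proof (rule karamata[where \<theta> = "\<lambda>t. exp (- (t * c)) * \<theta> t"])
    show "0 \<le> lam k + c" for k using monoD[OF mono, of 0 k] by (simp add: c_def)
    show "(\<lambda>k. exp (- (t * (lam k + c)))) sums (exp (- (t * c)) * \<theta> t)" if "0 < t" for t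
      using sums_mult[OF sums[OF that], of "exp (- (t * c))"] by (simp add: exp_add[symmetric] algebra_simps)
    have "((\<lambda>t. exp (- (t * c)) * (t powr \<alpha> * \<theta> t)) \<longlongrightarrow> exp (- (0 * c)) * A) (at_right 0)"
      by (intro tendsto_intros lim)
    then show "((\<lambda>t. t powr \<alpha> * (exp (- (t * c)) * \<theta> t)) \<longlongrightarrow> A) (at_right 0)" by (simp add: mult_ac)
  qed fact
  moreover have "filterlim (\<lambda>x. 1 / (x + c)) (at_right 0) at_top" by real_asymp
  ultimately have "((\<lambda>x. (1 / (x + c)) powr \<alpha> * real (eigenvalue_count (\<lambda>k. lam k + c) (1 / (1 / (x + c))))) \<longlongrightarrow> B) at_top"
    by (rule filterlim_compose)
  moreover have "((\<lambda>x. ((x + c) / x) powr \<alpha>) \<longlongrightarrow> 1) at_top" by real_asymp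
  ultimately have "((\<lambda>x. (1 / (x + c)) powr \<alpha> * real (eigenvalue_count (\<lambda>k. lam k + c) (1 / (1 / (x + c)))) * ((x + c) / x) powr \<alpha>) \<longlongrightarrow> B * 1) at_top"
    by (rule tendsto_mult)
  moreover have "\<forall>\<^sub>F x in at_top. (1 / (x + c)) powr \<alpha> * real (eigenvalue_count (\<lambda>k. lam k + c) (1 / (1 / (x + c)))) * ((x + c) / x) powr \<alpha> =
      real (eigenvalue_count lam x) / x powr \<alpha>"
    using eventually_gt_at_top[of 0]
  proof eventually_elim
    case (elim x)
    then have "0 < x + c" by (simp add: c_def add_pos_nonneg)
    then show ?case using elim by (simp add: eigenvalue_count_def powr_divide)
  qed
  ultimately have "((\<lambda>x. real (eigenvalue_count lam x) / x powr \<alpha>) \<longlongrightarrow> B * 1) at_top"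
    by (rule Lim_transform_eventually)
  then show ?thesis by (simp add: B_def)
qed

text \<open>The index \<open>k\<close> lies between the counts at \<open>lam k - 1\<close> and at
  \<open>lam k\<close>, and both are asymptotic to \<open>B * lam k powr \<alpha>\<close>.
  Subtracting 1 steps below all indices that share the eigenvalue of \<open>k\<close>, so
  multiplicities do no harm.\<close>

lemma eigenvalue_asymptotics:
  fixes lam :: "nat \<Rightarrow> real"
  assumes mono: "mono lam" and fin: "\<And>x. finite {k. lam k \<le> x}"
    and N: "((\<lambda>x. real (eigenvalue_count lam x) / x powr \<alpha>) \<longlongrightarrow> B) at_top"
    and \<alpha>: "0 < \<alpha>" and B: "0 < B"
  shows "lam \<sim>[at_top] (\<lambda>k. (real k / B) powr (1 / \<alpha>))"
proof -
  have top: "filterlim lam at_top sequentially"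
    unfolding filterlim_at_top_dense
  proof
    fix x
    have "eventually (\<lambda>k. \<not> lam k \<le> x) sequentially"
      unfolding cofinite_eq_sequentially[symmetric] eventually_cofinite using fin[of x] by simp
    then show "eventually (\<lambda>k. x < lam k) sequentially" by eventually_elim simp
  qed
  have upper: "(\<lambda>k. real (eigenvalue_count lam (lam k)) / lam k powr \<alpha>) \<longlonglongrightarrow> B"
    by (rule filterlim_compose[OF N top])
  have "filterlim (\<lambda>x::real. x - 1) at_top at_top" by real_asymp
  then have "((\<lambda>x. real (eigenvalue_count lam (x - 1)) / (x - 1) powr \<alpha>) \<longlongrightarrow> B) at_top"
    by (rule filterlim_compose[OF N])
  moreover have "((\<lambda>x. ((x - 1) / x) powr \<alpha>) \<longlongrightarrow> 1) at_top" by real_asymp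
  ultimately have "((\<lambda>x. real (eigenvalue_count lam (x - 1)) / (x - 1) powr \<alpha> * ((x - 1) / x) powr \<alpha>) \<longlongrightarrow> B * 1) at_top"
    by (rule tendsto_mult)
  moreover have "\<forall>\<^sub>F x in at_top. real (eigenvalue_count lam (x - 1)) / (x - 1) powr \<alpha> * ((x - 1) / x) powr \<alpha> = real (eigenvalue_count lam (x - 1)) / x powr \<alpha>"
    using eventually_gt_at_top[of 1] by eventually_elim (simp add: powr_divide)
  ultimately have "((\<lambda>x. real (eigenvalue_count lam (x - 1)) / x powr \<alpha>) \<longlongrightarrow> B * 1) at_top"
    by (rule Lim_transform_eventually)
  then have lower: "(\<lambda>k. real (eigenvalue_count lam (lam k - 1)) / lam k powr \<alpha>) \<longlonglongrightarrow> B"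
    using filterlim_compose[OF _ top] by simp
  have "(\<lambda>k. real k / lam k powr \<alpha>) \<longlonglongrightarrow> B"
  proof (rule tendsto_sandwich[OF always_eventually always_eventually lower upper]; rule allI)
    fix k
    have "{j. lam j \<le> lam k - 1} \<subseteq> {..<k}"
    proof
      fix j assume "j \<in> {j. lam j \<le> lam k - 1}"
      then show "j \<in> {..<k}" using monoD[OF mono, of k j] by (cases "j < k") auto
    qed
    from card_mono[OF _ this] have "eigenvalue_count lam (lam k - 1) \<le> k" by (simp add: eigenvalue_count_def)
    then show "real (eigenvalue_count lam (lam k - 1)) / lam k powr \<alpha> \<le> real k / lam k powr \<alpha>"
      by (intro divide_right_mono) auto
    have "{..<k} \<subseteq> {j. lam j \<le> lam k}" using monoD[OF mono] by auto
    from card_mono[OF fin this] have "k \<le> eigenvalue_count lam (lam k)" by (simp add: eigenvalue_count_def)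
    then show "real k / lam k powr \<alpha> \<le> real (eigenvalue_count lam (lam k)) / lam k powr \<alpha>"
      by (intro divide_right_mono) auto
  qed
  then have "(\<lambda>k. real k / lam k powr \<alpha> / B) \<longlonglongrightarrow> B / B" using B by (intro tendsto_divide tendsto_const) auto
  then have "(\<lambda>k. (real k / B) / lam k powr \<alpha>) \<longlonglongrightarrow> 1" using B by (simp add: mult.commute)
  then have "(\<lambda>k. real k / B) \<sim>[at_top] (\<lambda>k. lam k powr \<alpha>)" by (rule asymp_equivI')
  then have "(\<lambda>k. (real k / B) powr (1 / \<alpha>)) \<sim>[at_top] (\<lambda>k. (lam k powr \<alpha>) powr (1 / \<alpha>))"
    using B by (intro asymp_equiv_powr_real) auto
  moreover have "\<forall>\<^sub>F k in at_top. (lam k powr \<alpha>) powr (1 / \<alpha>) = lam k"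
    using top[unfolded filterlim_at_top_dense, rule_format, of 0] by eventually_elim (use \<alpha> in \<open>simp add: powr_powr\<close>)
  ultimately have "(\<lambda>k. (real k / B) powr (1 / \<alpha>)) \<sim>[at_top] lam"
    by (subst (asm) asymp_equiv_cong[OF always_eventually]) auto
  then show ?thesis by (rule asymp_equiv_symI)
qed


section \<open>Smooth functions\<close>

lemma frechet_derivative_cong_open:
  assumes "open U" "x \<in> U" "\<And>y. y \<in> U \<Longrightarrow> f y = g y"
  shows "frechet_derivative f (at x) = frechet_derivative g (at x)"
proof -
  have "(f has_derivative D) (at x) \<longleftrightarrow> (g has_derivative D) (at x)" for D
    using has_derivative_transform_within_open[of f D x UNIV U g] has_derivative_transform_within_open[of g D x UNIV U f] assms
    by auto
  then show ?thesis unfolding frechet_derivative_def by simp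
qed

lemma differentiable_cong_open:
  assumes "open U" "x \<in> U" "\<And>y. y \<in> U \<Longrightarrow> f y = g y"
  shows "f differentiable at x \<longleftrightarrow> g differentiable at x"
  using has_derivative_transform_within_open[of f _ x UNIV U g] has_derivative_transform_within_open[of g _ x UNIV U f] assms
  unfolding differentiable_def by fastforce

text \<open>The recursion splits off the innermost derivative, whereas \<open>iter_deriv\<close>
  splits off the outermost one. This lets product and chain rules be proved by induction on
  \<open>n\<close> for all functions at once.\<close>

primrec ck :: "nat \<Rightarrow> 'a::euclidean_space set \<Rightarrow> ('a \<Rightarrow> 'c::real_normed_vector) \<Rightarrow> bool" where
  "ck 0 U f \<longleftrightarrow> (\<forall>x\<in>U. f differentiable at x)"
| "ck (Suc n) U f \<longleftrightarrow> (\<forall>x\<in>U. f differentiable at x) \<and> (\<forall>w. ck n U (\<lambda>x. frechet_derivative f (at x) w))"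

lemma iter_deriv_snoc: "iter_deriv (ws @ [w]) f = iter_deriv ws (\<lambda>x. frechet_derivative f (at x) w)"
  by (induction ws) auto

lemma ck_iff: "ck n U f \<longleftrightarrow> (\<forall>ws. length ws \<le> n \<longrightarrow> (\<forall>x\<in>U. iter_deriv ws f differentiable at x))"
proof (induction n arbitrary: f)
  case (Suc n)
  have *: "(\<forall>ws. length ws \<le> Suc n \<longrightarrow> Q ws) \<longleftrightarrow> Q [] \<and> (\<forall>ws w. length ws \<le> n \<longrightarrow> Q (ws @ [w]))"
    for Q :: "'d list \<Rightarrow> bool"
  proof (intro iffI conjI allI impI)
    fix ws :: "'d list" assume *: "Q [] \<and> (\<forall>ws w. length ws \<le> n \<longrightarrow> Q (ws @ [w]))" and "length ws \<le> Suc n"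
    then show "Q ws" by (cases ws rule: rev_cases) auto
  qed auto
  show ?case
    unfolding * by (auto simp: Suc iter_deriv_snoc)
qed simp

lemma smooth_on_ck: "smooth_on U f \<longleftrightarrow> (\<forall>n. ck n U f)"
  by (auto simp: smooth_on_def ck_iff)

lemma ck_differentiable: "ck n U f \<Longrightarrow> x \<in> U \<Longrightarrow> f differentiable at x"
  by (cases n) auto

lemma ck_Suc_D: "ck (Suc n) U f \<Longrightarrow> ck n U f"
  by (auto simp: ck_iff)

lemma ck_cong:
  assumes "open U" "\<And>x. x \<in> U \<Longrightarrow> f x = g x" "ck n U f"
  shows "ck n U g"
  using assms(2,3)
proof (induction n arbitrary: f g)
  case 0
  then show ?case using differentiable_cong_open[OF assms(1), of _ f g] by auto
next
  case (Suc n)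
  have "ck n U (\<lambda>x. frechet_derivative g (at x) w)" for w
    by (rule Suc.IH[of "\<lambda>x. frechet_derivative f (at x) w"])
      (use Suc.prems frechet_derivative_cong_open[OF assms(1), of _ f g] in auto)
  then show ?case using Suc.prems differentiable_cong_open[OF assms(1), of _ f g] by auto
qed

lemma ck_Suc_I:
  assumes U: "open U" and d: "\<And>x. x \<in> U \<Longrightarrow> (f has_derivative f' x) (at x)" and ck: "\<And>w. ck n U (\<lambda>x. f' x w)"
  shows "ck (Suc n) U f"
proof -
  have "ck n U (\<lambda>x. frechet_derivative f (at x) w)" for w
    by (rule ck_cong[OF U _ ck[of w]]) (use frechet_derivative_at[OF d] in auto)
  moreover have "\<forall>x\<in>U. f differentiable at x" using d by (auto simp: differentiable_def)
  ultimately show ?thesis by simp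
qed

lemma ck_const [simp]: "ck n U (\<lambda>_. c)"
  by (induction n arbitrary: c) auto

lemma ck_linear:
  assumes U: "open U" and L: "bounded_linear L" and f: "ck n U f"
  shows "ck n U (\<lambda>x. L (f x))"
  using f
proof (induction n arbitrary: f)
  case 0
  show ?case
  proof (simp, intro ballI)
    fix x assume "x \<in> U"
    then obtain D where "(f has_derivative D) (at x)" using 0 by (auto simp: differentiable_def)
    from bounded_linear.has_derivative[OF L this] show "(\<lambda>x. L (f x)) differentiable at x"
      by (auto simp: differentiable_def)
  qed
next
  case (Suc n)
  show ?case
  proof (rule ck_Suc_I[OF U])
    fix x assume "x \<in> U"
    then have "(f has_derivative frechet_derivative f (at x)) (at x)"
      using Suc.prems by (simp add: frechet_derivative_works[symmetric])
    then show "((\<lambda>x. L (f x)) has_derivative (\<lambda>w. L (frechet_derivative f (at x) w))) (at x)"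
      by (rule bounded_linear.has_derivative[OF L])
  next
    fix w show "ck n U (\<lambda>x. L (frechet_derivative f (at x) w))" using Suc by simp
  qed
qed

lemma ck_add:
  assumes U: "open U" and "ck n U f" "ck n U g"
  shows "ck n U (\<lambda>x. f x + g x)"
  using assms(2,3)
proof (induction n arbitrary: f g)
  case (Suc n)
  show ?case
  proof (rule ck_Suc_I[OF U])
    fix x assume "x \<in> U"
    then show "((\<lambda>x. f x + g x) has_derivative (\<lambda>w. frechet_derivative f (at x) w + frechet_derivative g (at x) w)) (at x)"
      using Suc.prems by (intro has_derivative_add) (auto simp: frechet_derivative_works[symmetric])
  next
    fix w show "ck n U (\<lambda>x. frechet_derivative f (at x) w + frechet_derivative g (at x) w)" using Suc by simp
  qed
qed auto

lemma ck_sum: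
  assumes U: "open U" and "\<And>i. i \<in> I \<Longrightarrow> ck n U (f i)"
  shows "ck n U (\<lambda>x. \<Sum>i\<in>I. f i x)"
  using assms(2) by (induction I rule: infinite_finite_induct) (auto intro: ck_add[OF U])

lemma ck_bilinear:
  assumes U: "open U" and B: "bounded_bilinear B" and "ck n U f" "ck n U g"
  shows "ck n U (\<lambda>x. B (f x) (g x))"
  using assms(3,4)
proof (induction n arbitrary: f g)
  case 0
  show ?case
  proof (simp, intro ballI)
    fix x assume "x \<in> U"
    then have "(f has_derivative frechet_derivative f (at x)) (at x)" "(g has_derivative frechet_derivative g (at x)) (at x)"
      using 0 by (auto simp: frechet_derivative_works[symmetric])
    from bounded_bilinear.FDERIV[OF B this] show "(\<lambda>x. B (f x) (g x)) differentiable at x"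
      by (auto simp: differentiable_def)
  qed
next
  case (Suc n)
  show ?case
  proof (rule ck_Suc_I[OF U])
    fix x assume "x \<in> U"
    then show "((\<lambda>x. B (f x) (g x)) has_derivative
        (\<lambda>w. B (f x) (frechet_derivative g (at x) w) + B (frechet_derivative f (at x) w) (g x))) (at x)"
      using Suc.prems by (intro bounded_bilinear.FDERIV[OF B]) (auto simp: frechet_derivative_works[symmetric])
  next
    fix w
    have "ck n U f" "ck n U g" using Suc.prems ck_Suc_D by auto
    then show "ck n U (\<lambda>x. B (f x) (frechet_derivative g (at x) w) + B (frechet_derivative f (at x) w) (g x))"
      using Suc by (intro ck_add[OF U] Suc.IH) auto
  qed
qed

lemma ck_compose:
  fixes k :: "'a::euclidean_space \<Rightarrow> 'b::euclidean_space" and g :: "'b \<Rightarrow> 'c::real_normed_vector"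
  assumes U: "open U" and k: "ck n U k" and g: "ck n V g" and sub: "k ` U \<subseteq> V"
  shows "ck n U (\<lambda>x. g (k x))"
  using k g
proof (induction n arbitrary: g)
  case 0
  then show ?case using differentiable_chain_at[of k _ g] sub by (auto simp: o_def)
next
  case (Suc n)
  show ?case
  proof (rule ck_Suc_I[OF U])
    fix x assume x: "x \<in> U"
    have kx: "(k has_derivative frechet_derivative k (at x)) (at x)"
      and gx: "(g has_derivative frechet_derivative g (at (k x))) (at (k x))"
      using Suc.prems x sub by (auto simp: frechet_derivative_works[symmetric])
    have lin: "linear (frechet_derivative g (at (k x)))" using gx by (simp add: has_derivative_linear)
    \<comment> \<open>Expansion in the basis separates the two dependences on \<open>x\<close>: the
      coefficients are linear in the derivative of \<open>k\<close>, and the vectors are partial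
      derivatives of \<open>g\<close> composed with \<open>k\<close>, to which the induction
      hypothesis applies.\<close>
    have "frechet_derivative g (at (k x)) (frechet_derivative k (at x) w) =
        (\<Sum>b\<in>Basis. (frechet_derivative k (at x) w \<bullet> b) *\<^sub>R frechet_derivative g (at (k x)) b)" for w
      by (subst (2) euclidean_representation[symmetric]) (simp add: linear_sum[OF lin] linear_cmul[OF lin] o_def)
    then show "((\<lambda>x. g (k x)) has_derivative (\<lambda>w. \<Sum>b\<in>Basis. (frechet_derivative k (at x) w \<bullet> b) *\<^sub>R frechet_derivative g (at (k x)) b)) (at x)"
      using has_derivative_compose[OF kx gx] by simp
  next
    fix w
    have "ck n U (\<lambda>x. frechet_derivative k (at x) w \<bullet> b)" for b
      using Suc.prems by (intro ck_linear[OF U bounded_linear_inner_left]) auto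
    moreover have "ck n U (\<lambda>x. frechet_derivative g (at (k x)) b)" for b
      using Suc.prems ck_Suc_D by (intro Suc.IH) auto
    ultimately show "ck n U (\<lambda>x. \<Sum>b\<in>Basis. (frechet_derivative k (at x) w \<bullet> b) *\<^sub>R frechet_derivative g (at (k x)) b)"
      by (intro ck_sum[OF U] ck_bilinear[OF U bounded_bilinear_scaleR])
  qed
qed

lemma smooth_on_cong: "open U \<Longrightarrow> (\<And>x. x \<in> U \<Longrightarrow> f x = g x) \<Longrightarrow> smooth_on U f \<Longrightarrow> smooth_on U g"
  using ck_cong unfolding smooth_on_ck by blast

lemma smooth_on_subset: "smooth_on U f \<Longrightarrow> V \<subseteq> U \<Longrightarrow> smooth_on V f"
  by (auto simp: smooth_on_def)

lemma smooth_on_const [simp]: "smooth_on U (\<lambda>_. c)"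
  by (simp add: smooth_on_ck)

lemma smooth_on_add: "open U \<Longrightarrow> smooth_on U f \<Longrightarrow> smooth_on U g \<Longrightarrow> smooth_on U (\<lambda>x. f x + g x)"
  unfolding smooth_on_ck by (rule allI, rule ck_add) auto

lemma smooth_on_sum: "open U \<Longrightarrow> (\<And>i. i \<in> I \<Longrightarrow> smooth_on U (f i)) \<Longrightarrow> smooth_on U (\<lambda>x. \<Sum>i\<in>I. f i x)"
  unfolding smooth_on_ck by (rule allI, rule ck_sum) auto

lemma smooth_on_linear: "open U \<Longrightarrow> bounded_linear L \<Longrightarrow> smooth_on U f \<Longrightarrow> smooth_on U (\<lambda>x. L (f x))"
  unfolding smooth_on_ck by (rule allI, rule ck_linear) auto

lemma smooth_on_bilinear:
  "open U \<Longrightarrow> bounded_bilinear B \<Longrightarrow> smooth_on U f \<Longrightarrow> smooth_on U g \<Longrightarrow> smooth_on U (\<lambda>x. B (f x) (g x))"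
  unfolding smooth_on_ck by (rule allI, rule ck_bilinear) auto

lemma smooth_on_compose:
  "open U \<Longrightarrow> smooth_on U k \<Longrightarrow> smooth_on V g \<Longrightarrow> k ` U \<subseteq> V \<Longrightarrow> smooth_on U (\<lambda>x. g (k x))"
  unfolding smooth_on_ck by (rule allI, rule ck_compose) auto

lemma smooth_on_frechet: "smooth_on U f \<Longrightarrow> smooth_on U (\<lambda>x. frechet_derivative f (at x) w)"
  unfolding smooth_on_ck using ck.simps(2) by blast

lemma smooth_on_differentiable: "smooth_on U f \<Longrightarrow> x \<in> U \<Longrightarrow> f differentiable at x"
  unfolding smooth_on_ck using ck_differentiable by blast

lemma smooth_on_has_derivative: "smooth_on U f \<Longrightarrow> x \<in> U \<Longrightarrow> (f has_derivative frechet_derivative f (at x)) (at x)"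
  using smooth_on_differentiable by (auto simp: frechet_derivative_works[symmetric])

lemma smooth_on_continuous_on: "smooth_on U f \<Longrightarrow> continuous_on U f"
  unfolding continuous_on_eq_continuous_within
  using differentiable_imp_continuous_within[OF differentiable_at_withinI[OF smooth_on_differentiable]] by blast

lemma smooth_on_Un: "smooth_on U f \<Longrightarrow> smooth_on V f \<Longrightarrow> smooth_on (U \<union> V) f"
  by (auto simp: smooth_on_def)

lemma smooth_on_linear_UNIV: "bounded_linear L \<Longrightarrow> smooth_on UNIV L"
  unfolding smooth_on_ck
  by (rule allI, rule ck_Suc_D, rule ck_Suc_I[where f' = "\<lambda>_. L"]) (auto intro: bounded_linear_imp_has_derivative)

text \<open>The polynomial is a parameter because the whole class, unlike the single function with
  \<open>p = 1\<close>, is closed under differentiation; smoothness at 0 thus becomes an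
  induction.\<close>

definition flat :: "real poly \<Rightarrow> real \<Rightarrow> real" where
  "flat p x = (if 0 < x then poly p (1 / x) * exp (- (1 / x)) else 0)"

text \<open>In \<open>y = 1 / x\<close> the operator d/dx is \<open>- y\<^sup>2\<close> times d/dy,
  and d/dy turns the factor \<open>p\<close> in front of \<open>exp (- y)\<close> into
  \<open>pderiv p - p\<close>.\<close>

definition flat_deriv :: "real poly \<Rightarrow> real poly" where
  "flat_deriv p = monom 1 2 * (p - pderiv p)"

lemma poly_exp_tendsto_0: "((\<lambda>y. poly p y * exp (- y)) \<longlongrightarrow> 0) at_top" for p :: "real poly"
proof -
  have "((\<lambda>y. \<Sum>i\<le>degree p. coeff p i * (y ^ i / exp y)) \<longlongrightarrow> (\<Sum>i\<le>degree p. coeff p i * 0)) at_top"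
    by (intro tendsto_intros tendsto_power_div_exp_0)
  moreover have "(\<Sum>i\<le>degree p. coeff p i * (y ^ i / exp y)) = poly p y * exp (- y)" for y
    by (simp add: poly_altdef exp_minus divide_inverse sum_distrib_right mult.assoc)
  ultimately show ?thesis by simp
qed

lemma flat_has_real_derivative: "(flat p has_real_derivative flat (flat_deriv p) x) (at x)"
proof -
  consider "0 < x" | "x < 0" | "x = 0" by linarith
  then show ?thesis
  proof cases
    case 1
    have "((\<lambda>x. poly p (1 / x) * exp (- (1 / x))) has_real_derivative flat (flat_deriv p) x) (at x)"
      using 1 by (auto intro!: derivative_eq_intros DERIV_chain'[OF _ poly_DERIV]
        simp: flat_def flat_deriv_def poly_monom power2_eq_square field_simps)
    then show ?thesis
      by (rule has_field_derivative_transform_within_open[of _ _ _ "{0<..}"]) (use 1 in \<open>auto simp: flat_def\<close>)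
  next
    case 2
    have "((\<lambda>_. 0) has_real_derivative 0) (at x)" by simp
    then have "(flat p has_real_derivative 0) (at x)"
      by (rule has_field_derivative_transform_within_open[of _ _ _ "{..<0}"]) (use 2 in \<open>auto simp: flat_def\<close>)
    then show ?thesis using 2 by (simp add: flat_def)
  next
    case 3
    \<comment> \<open>The right difference quotient at 0 is \<open>y * poly p y * exp (- y)\<close>
      at \<open>y = 1 / h\<close>.\<close>
    have "((\<lambda>y. poly (monom 1 1 * p) y * exp (- y)) \<longlongrightarrow> 0) at_top" by (rule poly_exp_tendsto_0)
    moreover have "filterlim (\<lambda>h::real. 1 / h) at_top (at_right 0)"
      using filterlim_inverse_at_top_right by (simp add: inverse_eq_divide)
    ultimately have "((\<lambda>h. poly (monom 1 1 * p) (1 / h) * exp (- (1 / h))) \<longlongrightarrow> 0) (at_right 0)"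
      by (rule filterlim_compose)
    moreover have "\<forall>\<^sub>F h in at_right 0. poly (monom 1 1 * p) (1 / h) * exp (- (1 / h)) = (flat p (0 + h) - flat p 0) / h"
      using eventually_at_right_less[of 0] by eventually_elim (simp add: flat_def poly_monom)
    ultimately have r: "((\<lambda>h. (flat p (0 + h) - flat p 0) / h) \<longlongrightarrow> 0) (at_right 0)"
      by (rule Lim_transform_eventually)
    have "\<forall>\<^sub>F h in at_left (0::real). h < 0" by (auto simp: eventually_at_left_field intro!: exI[of _ "-1"])
    then have "\<forall>\<^sub>F h in at_left 0. 0 = (flat p (0 + h) - flat p 0) / h" by eventually_elim (simp add: flat_def)
    then have l: "((\<lambda>h. (flat p (0 + h) - flat p 0) / h) \<longlongrightarrow> 0) (at_left 0)"
      by (rule Lim_transform_eventually[OF tendsto_const])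
    have "(flat p has_real_derivative 0) (at 0)" unfolding DERIV_def by (rule filterlim_split_at[OF l r])
    then show ?thesis using 3 by (simp add: flat_def)
  qed
qed

lemma smooth_on_flat: "smooth_on UNIV (flat p)"
proof -
  have "ck n UNIV (flat p)" for n p
  proof (induction n arbitrary: p)
    case 0
    show ?case using flat_has_real_derivative real_differentiable_def
      by (auto intro: field_differentiable_imp_differentiable simp: field_differentiable_def)
  next
    case (Suc n)
    show ?case
    proof (rule ck_Suc_I)
      fix x show "(flat p has_derivative (\<lambda>w. flat (flat_deriv p) x * w)) (at x)"
        using flat_has_real_derivative[of p x] by (simp add: has_field_derivative_def)
      fix w show "ck n UNIV (\<lambda>x. flat (flat_deriv p) x * w)"
        by (rule ck_linear[OF open_UNIV bounded_linear_mult_left Suc])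
    qed simp
  qed
  then show ?thesis by (simp add: smooth_on_ck)
qed

lemma flat_bounded: "\<exists>C. \<forall>x\<in>{0..b}. \<bar>flat p x\<bar> \<le> C"
proof -
  have "continuous_on {0..b} (flat p)"
    using smooth_on_continuous_on[OF smooth_on_flat] continuous_on_subset by blast
  then have "bounded (flat p ` {0..b})" by (intro compact_imp_bounded compact_continuous_image) auto
  then show ?thesis by (auto simp: bounded_iff)
qed

lemma flat_one_pos: "0 < x \<Longrightarrow> 0 < flat 1 x" and flat_one_nonneg: "0 \<le> flat 1 x"
  and flat_eq_0: "x \<le> 0 \<Longrightarrow> flat p x = 0"
  by (auto simp: flat_def)


section \<open>Hermitian bundles\<close>

locale herm_bundle =
  fixes S :: "('m::{t2_space, second_countable_topology}, 'b::euclidean_space,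
                'v::ab_group_add, 'r::finite) herm_heis"
  assumes compact_M: "compact (UNIV :: 'm set)"
    and manifold: "heisenberg_manifold S"
    and density: "smooth_positive_density S"
    and vbundle: "vector_bundle S"
    and metric: "hermitian_metric S"
begin

section \<open>Charts\<close>

lemma chart_open: "c \<in> atlas S \<Longrightarrow> open (fst c)" "c \<in> atlas S \<Longrightarrow> open (snd c ` fst c)"
  and chart_homeomorphism: "c \<in> atlas S \<Longrightarrow> homeomorphism (fst c) (snd c ` fst c) (snd c) (cinv c)"
  using manifold by (auto simp: heisenberg_manifold_def smooth_atlas_def)

lemma chart_cover: obtains c where "c \<in> atlas S" "a \<in> fst c"
proof -
  have "a \<in> (\<Union>c\<in>atlas S. fst c)" using manifold by (simp add: heisenberg_manifold_def smooth_atlas_def)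
  then show thesis using that by blast
qed

lemma chart_transition: "c \<in> atlas S \<Longrightarrow> c' \<in> atlas S \<Longrightarrow> smooth_on (snd c ` (fst c \<inter> fst c')) (snd c' \<circ> cinv c)"
  using manifold by (auto simp: heisenberg_manifold_def smooth_atlas_def)

lemma cinv_chart [simp]: "c \<in> atlas S \<Longrightarrow> a \<in> fst c \<Longrightarrow> cinv c (snd c a) = a"
  using chart_homeomorphism by (auto simp: homeomorphism_def)

lemma chart_cinv [simp]: "c \<in> atlas S \<Longrightarrow> y \<in> snd c ` fst c \<Longrightarrow> snd c (cinv c y) = y"
  and cinv_in [simp]: "c \<in> atlas S \<Longrightarrow> y \<in> snd c ` fst c \<Longrightarrow> cinv c y \<in> fst c"
  by auto

lemma chart_continuous: "c \<in> atlas S \<Longrightarrow> continuous_on (fst c) (snd c)"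
  and cinv_continuous: "c \<in> atlas S \<Longrightarrow> continuous_on (snd c ` fst c) (cinv c)"
  using chart_homeomorphism by (auto simp: homeomorphism_def)

lemma open_chart_image:
  assumes c: "c \<in> atlas S" and W: "open W" "W \<subseteq> fst c"
  shows "open (snd c ` W)"
proof -
  have "openin (top_of_set (fst c)) W" using W by (auto simp: openin_open)
  then have "openin (top_of_set (snd c ` fst c)) (snd c ` W)"
    using homeomorphism_imp_open_map[OF chart_homeomorphism[OF c]] by blast
  then show ?thesis using chart_open(2)[OF c] openin_open_trans by blast
qed

lemma continuous_on_chart:
  assumes c: "c \<in> atlas S" and W: "W \<subseteq> fst c" and f: "continuous_on (snd c ` W) (\<lambda>y. f (cinv c y))"
  shows "continuous_on W f"
proof -
  have "continuous_on W (snd c)" using chart_continuous[OF c] W by (rule continuous_on_subset)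
  from continuous_on_compose[OF this f] have "continuous_on W (\<lambda>a. f (cinv c (snd c a)))" by (simp add: o_def)
  then show ?thesis by (rule continuous_on_eq) (use c W in auto)
qed

lemma continuous_on_charts:
  fixes f :: "'m \<Rightarrow> 'c::topological_space"
  assumes W: "open W" and f: "\<And>c. c \<in> atlas S \<Longrightarrow> continuous_on (snd c ` (W \<inter> fst c)) (\<lambda>y. f (cinv c y))"
  shows "continuous_on W f"
proof -
  have "continuous_on (\<Union>c\<in>atlas S. W \<inter> fst c) f"
  proof (rule continuous_on_open_UN)
    fix c assume c: "c \<in> atlas S"
    show "open (W \<inter> fst c)" using W chart_open(1)[OF c] by (rule open_Int)
    show "continuous_on (W \<inter> fst c) f" by (rule continuous_on_chart[OF c _ f[OF c]]) auto
  qed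
  moreover have "(\<Union>c\<in>atlas S. W \<inter> fst c) = W" using chart_cover by blast
  ultimately show ?thesis by simp
qed

section \<open>Fibres and trivializations\<close>

sublocale vs: vector_space "smul S"
  using vbundle by (simp add: vector_bundle_def)

lemma fib_subspace: "vs.subspace (fib S a)"
  using vbundle by (simp add: vector_bundle_def)

lemma fib_zero [simp]: "0 \<in> fib S a" and fib_add [simp]: "u \<in> fib S a \<Longrightarrow> w \<in> fib S a \<Longrightarrow> u + w \<in> fib S a"
  and fib_smul [simp]: "u \<in> fib S a \<Longrightarrow> smul S z u \<in> fib S a"
  using fib_subspace by (auto simp: vs.subspace_def)

lemma fib_diff [simp]: "u \<in> fib S a \<Longrightarrow> w \<in> fib S a \<Longrightarrow> u - w \<in> fib S a"
  using vs.subspace_diff[OF fib_subspace] .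

lemma fib_sum [simp]: "(\<And>i. i \<in> I \<Longrightarrow> f i \<in> fib S a) \<Longrightarrow> sum f I \<in> fib S a"
  using vs.subspace_sum[OF fib_subspace] .

lemma triv_cover: obtains W \<psi> where "(W, \<psi>) \<in> trivs S" "a \<in> W"
proof -
  have "a \<in> (\<Union>(W, \<psi>)\<in>trivs S. W)" using vbundle by (simp only: vector_bundle_def UNIV_I)
  then show thesis using that by auto
qed

lemma triv_props: "(W, \<psi>) \<in> trivs S \<Longrightarrow> open W \<and> (\<forall>a\<in>W. bij_betw (\<psi> a) (fib S a) UNIV \<and>
    (\<forall>u\<in>fib S a. \<forall>w\<in>fib S a. \<psi> a (u + w) = \<psi> a u + \<psi> a w) \<and>
    (\<forall>z. \<forall>u\<in>fib S a. \<psi> a (smul S z u) = z *s \<psi> a u))"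
proof -
  assume W: "(W, \<psi>) \<in> trivs S"
  have "\<forall>(W, \<psi>)\<in>trivs S. open W \<and> (\<forall>a\<in>W. bij_betw (\<psi> a) (fib S a) UNIV \<and>
    (\<forall>u\<in>fib S a. \<forall>w\<in>fib S a. \<psi> a (u + w) = \<psi> a u + \<psi> a w) \<and>
    (\<forall>z. \<forall>u\<in>fib S a. \<psi> a (smul S z u) = z *s \<psi> a u))"
    using vbundle unfolding vector_bundle_def by (elim conjE)
  from bspec[OF this W] show ?thesis by simp
qed

lemma triv_open: "(W, \<psi>) \<in> trivs S \<Longrightarrow> open W"
  using triv_props by blast

definition triv_inv :: "('m \<Rightarrow> 'v \<Rightarrow> complex ^ 'r) \<Rightarrow> 'm \<Rightarrow> complex ^ 'r \<Rightarrow> 'v" where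
  "triv_inv \<psi> a = inv_into (fib S a) (\<psi> a)"

context
  fixes W \<psi> a
  assumes W\<psi>: "(W, \<psi>) \<in> trivs S" and a: "a \<in> W"
begin

lemma triv_bij: "bij_betw (\<psi> a) (fib S a) UNIV"
  and triv_add: "u \<in> fib S a \<Longrightarrow> w \<in> fib S a \<Longrightarrow> \<psi> a (u + w) = \<psi> a u + \<psi> a w"
  and triv_smul: "u \<in> fib S a \<Longrightarrow> \<psi> a (smul S z u) = z *s \<psi> a u"
  using triv_props[OF W\<psi>] a by simp_all

lemma triv_zero: "\<psi> a 0 = 0"
  using triv_smul[of 0 0] by simp

lemma triv_diff: "u \<in> fib S a \<Longrightarrow> w \<in> fib S a \<Longrightarrow> \<psi> a (u - w) = \<psi> a u - \<psi> a w"
proof -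
  assume uw: "u \<in> fib S a" "w \<in> fib S a"
  have "u - w = u + smul S (-1) w" by simp
  then have "\<psi> a (u - w) = \<psi> a u + (-1) *s \<psi> a w" using uw by (simp only: triv_add triv_smul fib_smul)
  then show ?thesis by (simp add: vec_eq_iff)
qed

lemma triv_inv_fib [simp]: "triv_inv \<psi> a z \<in> fib S a"
  unfolding triv_inv_def using triv_bij by (metis UNIV_I bij_betw_def inv_into_into)

lemma triv_triv_inv [simp]: "\<psi> a (triv_inv \<psi> a z) = z"
  unfolding triv_inv_def using triv_bij by (metis UNIV_I bij_betw_def f_inv_into_f)

lemma triv_inv_triv [simp]: "u \<in> fib S a \<Longrightarrow> triv_inv \<psi> a (\<psi> a u) = u"
  unfolding triv_inv_def using triv_bij by (metis bij_betw_def inv_into_f_f)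

lemma triv_inv_eqI: "u \<in> fib S a \<Longrightarrow> \<psi> a u = z \<Longrightarrow> triv_inv \<psi> a z = u"
  by auto

lemma triv_inv_add: "triv_inv \<psi> a (z + z') = triv_inv \<psi> a z + triv_inv \<psi> a z'"
  by (rule triv_inv_eqI) (auto simp: triv_add)

lemma triv_inv_smul: "triv_inv \<psi> a (c *s z) = smul S c (triv_inv \<psi> a z)"
  by (rule triv_inv_eqI) (auto simp: triv_smul)

lemma triv_inv_zero: "triv_inv \<psi> a 0 = 0"
  by (rule triv_inv_eqI) (auto simp: triv_zero)

lemma triv_inv_sum: "triv_inv \<psi> a (sum f I) = (\<Sum>i\<in>I. triv_inv \<psi> a (f i))"
  by (induction I rule: infinite_finite_induct) (auto simp: triv_inv_add triv_inv_zero)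

lemma triv_inv_expansion: "triv_inv \<psi> a z = (\<Sum>i\<in>UNIV. smul S (z $ i) (triv_inv \<psi> a (axis i 1)))"
  by (subst basis_expansion[symmetric]) (simp add: triv_inv_sum triv_inv_smul del: basis_expansion)

end

section \<open>The Hermitian form on the fibres\<close>

lemma herm_add: "u \<in> fib S a \<Longrightarrow> u' \<in> fib S a \<Longrightarrow> w \<in> fib S a \<Longrightarrow> herm S a (u + u') w = herm S a u w + herm S a u' w"
proof -
  assume "u \<in> fib S a" "u' \<in> fib S a" "w \<in> fib S a"
  then have "herm S a (smul S 1 u + u') w = 1 * herm S a u w + herm S a u' w"
    using metric unfolding hermitian_metric_def by blast
  then show ?thesis by simp
qed

lemma herm_zero_left [simp]: "w \<in> fib S a \<Longrightarrow> herm S a 0 w = 0"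
  using herm_add[of 0 a 0 w] by simp

lemma herm_smul: "u \<in> fib S a \<Longrightarrow> w \<in> fib S a \<Longrightarrow> herm S a (smul S z u) w = z * herm S a u w"
proof -
  assume "u \<in> fib S a" "w \<in> fib S a"
  moreover from this have "herm S a (smul S z u + 0) w = z * herm S a u w + herm S a 0 w"
    using metric fib_zero unfolding hermitian_metric_def by blast
  ultimately show ?thesis by simp
qed

lemma herm_cnj: "u \<in> fib S a \<Longrightarrow> w \<in> fib S a \<Longrightarrow> herm S a w u = cnj (herm S a u w)"
  using metric unfolding hermitian_metric_def by blast

lemma herm_pos: "u \<in> fib S a \<Longrightarrow> u \<noteq> 0 \<Longrightarrow> 0 < Re (herm S a u u)"
  using metric unfolding hermitian_metric_def by blast

lemma herm_add_right: "u \<in> fib S a \<Longrightarrow> u' \<in> fib S a \<Longrightarrow> w \<in> fib S a \<Longrightarrow> herm S a w (u + u') = herm S a w u + herm S a w u'"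
  by (metis herm_add herm_cnj fib_add complex_cnj_add)

lemma herm_smul_right: "u \<in> fib S a \<Longrightarrow> w \<in> fib S a \<Longrightarrow> herm S a w (smul S z u) = cnj z * herm S a w u"
  by (metis herm_smul herm_cnj fib_smul complex_cnj_mult)

lemma herm_zero_right [simp]: "w \<in> fib S a \<Longrightarrow> herm S a w 0 = 0"
  using herm_add_right[of 0 a 0 w] by simp

lemma herm_nonneg: "u \<in> fib S a \<Longrightarrow> 0 \<le> Re (herm S a u u)"
  using herm_pos[of u a] by (cases "u = 0") auto

lemma herm_sum: "(\<And>i. i \<in> I \<Longrightarrow> f i \<in> fib S a) \<Longrightarrow> w \<in> fib S a \<Longrightarrow> herm S a (sum f I) w = (\<Sum>i\<in>I. herm S a (f i) w)"
  by (induction I rule: infinite_finite_induct) (auto simp: herm_add)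

lemma herm_sum_right: "(\<And>i. i \<in> I \<Longrightarrow> f i \<in> fib S a) \<Longrightarrow> w \<in> fib S a \<Longrightarrow> herm S a w (sum f I) = (\<Sum>i\<in>I. herm S a w (f i))"
  by (induction I rule: infinite_finite_induct) (auto simp: herm_add_right)

definition sq :: "'m \<Rightarrow> 'v \<Rightarrow> real" where
  "sq a u = Re (herm S a u u)"

text \<open>A weak Cauchy-Schwarz inequality, sufficient for integrability. The real part is
  controlled because \<open>sq\<close> is nonnegative on \<open>u + w\<close> and
  \<open>u - w\<close>, the imaginary part by replacing \<open>u\<close> with its multiple by the
  imaginary unit.\<close>

lemma herm_bound:
  assumes "u \<in> fib S a" "w \<in> fib S a"
  shows "cmod (herm S a u w) \<le> sq a u + sq a w"
proof -
  have *: "2 * \<bar>Re (herm S a u w)\<bar> \<le> sq a u + sq a w" if "u \<in> fib S a" "w \<in> fib S a" for u w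
  proof -
    have "Re (herm S a w u) = Re (herm S a u w)" using herm_cnj[OF that] by simp
    moreover have "0 \<le> sq a (u + w)" "0 \<le> sq a (u + smul S (-1) w)"
      unfolding sq_def using that by (intro herm_nonneg; simp del: vs.scale_minus_left)+
    ultimately show ?thesis
      using that by (simp add: sq_def herm_add herm_add_right herm_smul herm_smul_right del: vs.scale_minus_left)
  qed
  have "Re (herm S a (smul S \<i> u) w) = - Im (herm S a u w)" "sq a (smul S \<i> u) = sq a u"
    using assms by (simp_all add: sq_def herm_smul herm_smul_right)
  then have "2 * \<bar>Im (herm S a u w)\<bar> \<le> sq a u + sq a w" using *[of "smul S \<i> u" w] assms by simp
  then show ?thesis using *[OF assms] cmod_le[of "herm S a u w"] by linarith
qed

lemma sq_nonneg: "u \<in> fib S a \<Longrightarrow> 0 \<le> sq a u"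
  by (simp add: sq_def herm_nonneg)

lemma sq_add_le:
  assumes "u \<in> fib S a" "w \<in> fib S a"
  shows "sq a (u + w) \<le> 2 * sq a u + 2 * sq a w"
proof -
  have "0 \<le> sq a (u + smul S (-1) w)" using assms by (intro sq_nonneg) (simp del: vs.scale_minus_left)
  then show ?thesis
    using assms by (simp add: sq_def herm_add herm_add_right herm_smul herm_smul_right del: vs.scale_minus_left)
qed

lemma sq_smul: "u \<in> fib S a \<Longrightarrow> sq a (smul S z u) = (cmod z)\<^sup>2 * sq a u"
proof -
  assume u: "u \<in> fib S a"
  have "herm S a (smul S z u) (smul S z u) = (z * cnj z) * herm S a u u"
    using u by (simp add: herm_smul herm_smul_right)
  then show ?thesis unfolding sq_def complex_norm_square[symmetric] by simp
qed

definition gram :: "('m \<Rightarrow> 'v \<Rightarrow> complex ^ 'r) \<Rightarrow> 'm \<Rightarrow> 'r \<Rightarrow> 'r \<Rightarrow> complex" where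
  "gram \<psi> a i j = herm S a (triv_inv \<psi> a (axis i 1)) (triv_inv \<psi> a (axis j 1))"

definition tsq :: "('m \<Rightarrow> 'v \<Rightarrow> complex ^ 'r) \<Rightarrow> 'm \<Rightarrow> complex ^ 'r \<Rightarrow> real" where
  "tsq \<psi> a z = Re (\<Sum>i\<in>UNIV. \<Sum>j\<in>UNIV. z $ i * cnj (z $ j) * gram \<psi> a i j)"

lemma herm_triv:
  assumes W: "(W, \<psi>) \<in> trivs S" "a \<in> W" and u: "u \<in> fib S a" "w \<in> fib S a"
  shows "herm S a u w = (\<Sum>i\<in>UNIV. \<Sum>j\<in>UNIV. \<psi> a u $ i * cnj (\<psi> a w $ j) * gram \<psi> a i j)"
proof -
  have "herm S a u w = herm S a (\<Sum>i\<in>UNIV. smul S (\<psi> a u $ i) (triv_inv \<psi> a (axis i 1))) (\<Sum>i\<in>UNIV. smul S (\<psi> a w $ i) (triv_inv \<psi> a (axis i 1)))"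
    using triv_inv_expansion[OF W, of "\<psi> a u"] triv_inv_expansion[OF W, of "\<psi> a w"] triv_inv_triv[OF W] u by simp
  also have "\<dots> = (\<Sum>i\<in>UNIV. \<psi> a u $ i * herm S a (triv_inv \<psi> a (axis i 1)) (\<Sum>i\<in>UNIV. smul S (\<psi> a w $ i) (triv_inv \<psi> a (axis i 1))))"
    using triv_inv_fib[OF W] by (simp add: herm_sum herm_smul)
  also have "\<dots> = (\<Sum>i\<in>UNIV. \<psi> a u $ i * (\<Sum>j\<in>UNIV. cnj (\<psi> a w $ j) * gram \<psi> a i j))"
    using triv_inv_fib[OF W] by (simp add: herm_sum_right herm_smul_right gram_def)
  finally show ?thesis by (simp add: sum_distrib_left mult.assoc)
qed

lemma sq_triv:
  assumes W: "(W, \<psi>) \<in> trivs S" "a \<in> W" and u: "u \<in> fib S a"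
  shows "sq a u = tsq \<psi> a (\<psi> a u)"
  unfolding sq_def tsq_def herm_triv[OF W u u] ..

lemma gram_continuous:
  assumes W: "(W, \<psi>) \<in> trivs S"
  shows "continuous_on W (\<lambda>a. gram \<psi> a i j)"
proof (rule continuous_on_charts[OF triv_open[OF W]])
  fix c assume c: "c \<in> atlas S"
  have "smooth_on (snd c ` (W \<inter> fst c)) (\<lambda>y. gram \<psi> (cinv c y) i j)"
    using metric W c unfolding hermitian_metric_def gram_def triv_inv_def by blast
  then show "continuous_on (snd c ` (W \<inter> fst c)) (\<lambda>y. gram \<psi> (cinv c y) i j)"
    by (rule smooth_on_continuous_on)
qed

lemma tsq_pos: "(W, \<psi>) \<in> trivs S \<Longrightarrow> a \<in> W \<Longrightarrow> z \<noteq> 0 \<Longrightarrow> 0 < tsq \<psi> a z"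
  using sq_triv[of W \<psi> a "triv_inv \<psi> a z"] herm_pos[of "triv_inv \<psi> a z" a] triv_zero[of W \<psi> a]
    triv_triv_inv[of W \<psi> a z] by (fastforce simp: sq_def)

lemma tsq_zero [simp]: "tsq \<psi> a 0 = 0"
  by (simp add: tsq_def)

lemma tsq_continuous: "continuous_on UNIV (tsq \<psi> a)"
  unfolding tsq_def by (intro continuous_intros)

lemma tsq_scaleR: "tsq \<psi> a (x *\<^sub>R z) = x\<^sup>2 * tsq \<psi> a z"
proof -
  have "(\<Sum>i\<in>UNIV. \<Sum>j\<in>UNIV. (x *\<^sub>R z) $ i * cnj ((x *\<^sub>R z) $ j) * gram \<psi> a i j) =
      of_real (x\<^sup>2) * (\<Sum>i\<in>UNIV. \<Sum>j\<in>UNIV. z $ i * cnj (z $ j) * gram \<psi> a i j)"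
    unfolding sum_distrib_left
    by (intro sum.cong refl) (simp add: scaleR_conv_of_real[where 'a = complex] power2_eq_square)
  then show ?thesis unfolding tsq_def by (simp only: Re_complex_of_real Im_complex_of_real times_complex.sel mult_zero_left diff_zero)
qed

text \<open>Compactness of the unit sphere and homogeneity of degree 2. The constant depends on
  \<open>a\<close>, which is enough for pointwise convergence inside a fibre.\<close>

lemma tsq_lower:
  assumes W: "(W, \<psi>) \<in> trivs S" "a \<in> W"
  shows "\<exists>c>0. \<forall>z. c * (norm z)\<^sup>2 \<le> tsq \<psi> a z"
proof -
  have "compact (sphere (0 :: complex ^ 'r) 1)" "sphere (0 :: complex ^ 'r) 1 \<noteq> {}" by auto
  from continuous_attains_inf[OF this continuous_on_subset[OF tsq_continuous[of \<psi> a] subset_UNIV]]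
  obtain z0 where z0: "norm z0 = 1" "\<And>z. norm z = 1 \<Longrightarrow> tsq \<psi> a z0 \<le> tsq \<psi> a z" by auto
  have "tsq \<psi> a z0 * (norm z)\<^sup>2 \<le> tsq \<psi> a z" for z
  proof (cases "z = 0")
    case False
    have "tsq \<psi> a z = (norm z)\<^sup>2 * tsq \<psi> a ((1 / norm z) *\<^sub>R z)"
      using False tsq_scaleR[of \<psi> a "norm z" "(1 / norm z) *\<^sub>R z"] by simp
    moreover have "tsq \<psi> a z0 \<le> tsq \<psi> a ((1 / norm z) *\<^sub>R z)" using False by (intro z0) simp
    ultimately show ?thesis using mult_right_mono[of "tsq \<psi> a z0" "tsq \<psi> a ((1 / norm z) *\<^sub>R z)" "(norm z)\<^sup>2"]
      by (metis mult.commute zero_le_power2)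
  qed simp
  moreover have "0 < tsq \<psi> a z0" using z0 by (intro tsq_pos[OF W]) auto
  ultimately show ?thesis by blast
qed

lemma triv_transition_linear:
  assumes W: "(W, \<psi>) \<in> trivs S" "a \<in> W" and W': "(W', \<psi>') \<in> trivs S" "a \<in> W'"
  shows "bounded_linear (\<lambda>z. \<psi>' a (triv_inv \<psi> a z))"
proof -
  have r: "r *\<^sub>R z = of_real r *s z" for r and z :: "complex ^ 'r"
    by (simp add: vec_eq_iff scaleR_conv_of_real[where 'a = complex])
  have "linear (\<lambda>z. \<psi>' a (triv_inv \<psi> a z))"
    by (rule linearI) (simp_all add: r triv_inv_add[OF W] triv_inv_smul[OF W] triv_add[OF W'] triv_smul[OF W'] triv_inv_fib[OF W])
  then show ?thesis by (rule linear_conv_bounded_linear[THEN iffD1])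
qed

end


section \<open>Square integrable sections\<close>

context herm_bundle
begin

section \<open>Measurable sections and completeness\<close>

lemma sets_dens [measurable_cong, simp]: "sets (dens S) = sets borel"
  using density by (simp add: smooth_positive_density_def)

lemma space_dens [simp]: "space (dens S) = UNIV"
  using sets_eq_imp_space_eq[OF sets_dens] by simp

lemma l2_fib: "u \<in> l2_sections S \<Longrightarrow> u a \<in> fib S a"
  by (simp add: l2_sections_def)

lemma l2_measurable: "u \<in> l2_sections S \<Longrightarrow> (W, \<psi>) \<in> trivs S \<Longrightarrow> (\<lambda>a. \<psi> a (u a)) \<in> borel_measurable (restrict_space borel W)"
  by (auto simp: l2_sections_def)

text \<open>There may be uncountably many trivializations, but by compactness finitely many of their
  domains cover, and measurability can be checked on those.\<close>

lemma measurable_trivs: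
  assumes "\<And>W \<psi>. (W, \<psi>) \<in> trivs S \<Longrightarrow> f \<in> borel_measurable (restrict_space borel W)"
  shows "f \<in> borel_measurable borel"
proof -
  have UN: "UNIV \<subseteq> (\<Union>W\<in>fst ` trivs S. W)"
  proof
    fix a :: 'm
    obtain W \<psi> where "(W, \<psi>) \<in> trivs S" "a \<in> W" by (rule triv_cover)
    then show "a \<in> (\<Union>W\<in>fst ` trivs S. W)" by force
  qed
  have op: "open T" if "T \<in> fst ` trivs S" for T using that triv_open by auto
  obtain C where C: "C \<subseteq> fst ` trivs S" "finite C" "UNIV \<subseteq> (\<Union>W\<in>C. W)"
    using compactE_image[OF compact_M op UN] by auto
  show ?thesis
  proof (rule measurable_piecewise_restrict)
    show "countable C" using C by (simp add: countable_finite)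
    fix W assume "W \<in> C"
    then obtain \<psi> where "(W, \<psi>) \<in> trivs S" using C by auto
    then show "W \<inter> space borel \<in> sets borel" "f \<in> borel_measurable (restrict_space borel W)"
      using triv_open assms by auto
  qed (use C in auto)
qed

definition triv_measurable :: "('m \<Rightarrow> 'v) \<Rightarrow> bool" where
  "triv_measurable u \<longleftrightarrow> (\<forall>a. u a \<in> fib S a) \<and>
     (\<forall>(W, \<psi>)\<in>trivs S. (\<lambda>a. \<psi> a (u a)) \<in> borel_measurable (restrict_space borel W))"

lemma l2_iff: "u \<in> l2_sections S \<longleftrightarrow> triv_measurable u \<and> integrable (dens S) (\<lambda>a. sq a (u a))"
  by (auto simp: l2_sections_def triv_measurable_def sq_def)

lemma triv_measurable_fib: "triv_measurable u \<Longrightarrow> u a \<in> fib S a"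
  by (simp add: triv_measurable_def)

lemma triv_measurable_zero: "triv_measurable 0"
  unfolding triv_measurable_def
proof (intro conjI allI ballI, goal_cases)
  case (2 x)
  obtain W \<psi> where x: "x = (W, \<psi>)" by (cases x)
  have "(\<lambda>a. \<psi> a (0 a)) \<in> borel_measurable (restrict_space borel W) \<longleftrightarrow> (\<lambda>a. 0 :: complex ^ 'r) \<in> borel_measurable (restrict_space borel W)"
    by (rule measurable_cong) (use 2 x triv_zero in \<open>auto simp: space_restrict_space\<close>)
  then show ?case by (simp add: x)
qed simp

lemma triv_measurable_add:
  assumes "triv_measurable u" "triv_measurable w"
  shows "triv_measurable (u + w)"
  unfolding triv_measurable_def
proof (intro conjI allI ballI, goal_cases)
  case (2 x)
  obtain W \<psi> where x: "x = (W, \<psi>)" by (cases x)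
  have [measurable]: "(\<lambda>a. \<psi> a (u a)) \<in> borel_measurable (restrict_space borel W)" "(\<lambda>a. \<psi> a (w a)) \<in> borel_measurable (restrict_space borel W)"
    using assms 2 x unfolding triv_measurable_def by auto
  have "(\<lambda>a. \<psi> a ((u + w) a)) \<in> borel_measurable (restrict_space borel W) \<longleftrightarrow> (\<lambda>a. \<psi> a (u a) + \<psi> a (w a)) \<in> borel_measurable (restrict_space borel W)"
    by (rule measurable_cong) (use 2 x assms triv_add in \<open>auto simp: space_restrict_space triv_measurable_def\<close>)
  then show ?case by (simp add: x)
qed (use assms in \<open>simp add: triv_measurable_def\<close>)

lemma vec_smul_continuous: "continuous_on UNIV (\<lambda>x :: complex ^ 'r. z *s x)"
  unfolding vector_scalar_mult_def by (intro continuous_intros)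

lemma triv_measurable_scale:
  assumes "triv_measurable u"
  shows "triv_measurable (section_smul S z u)"
  unfolding triv_measurable_def
proof (intro conjI allI ballI, goal_cases)
  case (2 x)
  obtain W \<psi> where x: "x = (W, \<psi>)" by (cases x)
  have m: "(\<lambda>a. \<psi> a (u a)) \<in> borel_measurable (restrict_space borel W)"
    using assms 2 x unfolding triv_measurable_def by auto
  have "(\<lambda>a. \<psi> a (section_smul S z u a)) \<in> borel_measurable (restrict_space borel W) \<longleftrightarrow> (\<lambda>a. z *s \<psi> a (u a)) \<in> borel_measurable (restrict_space borel W)"
    by (rule measurable_cong) (use 2 x assms triv_smul in \<open>auto simp: space_restrict_space triv_measurable_def section_smul_def\<close>)
  then show ?case
    using measurable_compose[OF m borel_measurable_continuous_onI[OF vec_smul_continuous]] by (simp add: x)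
qed (use assms in \<open>simp add: triv_measurable_def section_smul_def\<close>)

lemma vec_nth_measurable: "f \<in> borel_measurable M \<Longrightarrow> (\<lambda>a. f a $ i) \<in> borel_measurable M" for f :: "'x \<Rightarrow> complex ^ 'r"
  by (rule measurable_compose[OF _ borel_measurable_continuous_onI]) (auto intro!: continuous_intros)

lemma herm_measurable:
  assumes u: "triv_measurable u" "triv_measurable w"
  shows "(\<lambda>a. herm S a (u a) (w a)) \<in> borel_measurable borel"
proof (rule measurable_trivs)
  fix W \<psi> assume W: "(W, \<psi>) \<in> trivs S"
  have [measurable]: "(\<lambda>a. \<psi> a (u a) $ i) \<in> borel_measurable (restrict_space borel W)" "(\<lambda>a. \<psi> a (w a) $ i) \<in> borel_measurable (restrict_space borel W)" for i
    using u W unfolding triv_measurable_def by (auto intro: vec_nth_measurable)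
  have [measurable]: "(\<lambda>a. gram \<psi> a i j) \<in> borel_measurable (restrict_space borel W)" for i j
    by (rule borel_measurable_continuous_on_restrict[OF gram_continuous[OF W]])
  have "(\<lambda>x. cnj (\<psi> x (w x) $ i)) \<in> borel_measurable (restrict_space borel W)" for i
    by (rule measurable_compose[OF _ borel_measurable_continuous_onI]) (auto intro!: continuous_intros)
  note [measurable] = this
  have "(\<lambda>a. herm S a (u a) (w a)) \<in> borel_measurable (restrict_space borel W) \<longleftrightarrow>
    (\<lambda>a. \<Sum>i\<in>UNIV. \<Sum>j\<in>UNIV. \<psi> a (u a) $ i * cnj (\<psi> a (w a) $ j) * gram \<psi> a i j) \<in> borel_measurable (restrict_space borel W)"
    by (rule measurable_cong) (use herm_triv[OF W] u in \<open>auto simp: space_restrict_space triv_measurable_def\<close>)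
  then show "(\<lambda>a. herm S a (u a) (w a)) \<in> borel_measurable (restrict_space borel W)" by simp
qed

lemma sq_measurable: "triv_measurable u \<Longrightarrow> (\<lambda>a. sq a (u a)) \<in> borel_measurable (dens S)"
  using measurable_compose[OF herm_measurable[of u u] borel_measurable_Re] by (simp add: sq_def cong: measurable_cong_sets)

lemma l2_add: "u \<in> l2_sections S \<Longrightarrow> w \<in> l2_sections S \<Longrightarrow> u + w \<in> l2_sections S"
proof -
  assume u: "u \<in> l2_sections S" and w: "w \<in> l2_sections S"
  have m: "triv_measurable (u + w)" using u w triv_measurable_add by (auto simp: l2_iff)
  have "integrable (dens S) (\<lambda>a. sq a ((u + w) a))"
  proof (rule Bochner_Integration.integrable_bound)
    show "integrable (dens S) (\<lambda>a. 2 * sq a (u a) + 2 * sq a (w a))" using u w by (simp add: l2_iff)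
    show "AE a in dens S. norm (sq a ((u + w) a)) \<le> norm (2 * sq a (u a) + 2 * sq a (w a))"
      using l2_fib[OF u] l2_fib[OF w] sq_add_le sq_nonneg by (intro AE_I2) (simp add: sq_nonneg)
  qed (rule sq_measurable[OF m])
  then show "u + w \<in> l2_sections S" using m by (simp add: l2_iff)
qed

lemma l2_scale: "u \<in> l2_sections S \<Longrightarrow> section_smul S z u \<in> l2_sections S"
  using triv_measurable_scale[of u z] by (auto simp: l2_iff section_smul_def sq_smul triv_measurable_fib)

lemma l2_zero: "0 \<in> l2_sections S"
proof -
  have "integrable (dens S) (\<lambda>a. sq a ((0 :: 'm \<Rightarrow> 'v) a))" by (simp add: sq_def)
  then show ?thesis using triv_measurable_zero by (simp add: l2_iff)
qed

lemma herm_integrable: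
  assumes u: "u \<in> l2_sections S" and w: "w \<in> l2_sections S"
  shows "integrable (dens S) (\<lambda>a. herm S a (u a) (w a))"
proof (rule Bochner_Integration.integrable_bound)
  show "integrable (dens S) (\<lambda>a. sq a (u a) + sq a (w a))" using u w by (simp add: l2_iff)
  show "(\<lambda>a. herm S a (u a) (w a)) \<in> borel_measurable (dens S)"
    using herm_measurable[of u w] u w by (simp add: l2_iff cong: measurable_cong_sets)
  show "AE a in dens S. norm (herm S a (u a) (w a)) \<le> norm (sq a (u a) + sq a (w a))"
    using l2_fib[OF u] l2_fib[OF w] herm_bound sq_nonneg by (intro AE_I2) (simp add: sq_nonneg)
qed

lemma Re_ip: "u \<in> l2_sections S \<Longrightarrow> Re (ip S u u) = (LINT a|dens S. sq a (u a))"
  using integral_Re[OF herm_integrable[of u u]] by (simp add: ip_def sq_def)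

lemma section_vector_space: "vector_space (section_smul S)"
  by unfold_locales (auto simp: section_smul_def fun_eq_iff vs.scale_right_distrib vs.scale_left_distrib)

lemma l2_uminus: "u \<in> l2_sections S \<Longrightarrow> - u \<in> l2_sections S"
proof -
  have "- u = section_smul S (-1) u" by (simp add: section_smul_def fun_eq_iff)
  then show "u \<in> l2_sections S \<Longrightarrow> - u \<in> l2_sections S" using l2_scale[of u "-1"] by metis
qed

lemma l2_diff: "u \<in> l2_sections S \<Longrightarrow> w \<in> l2_sections S \<Longrightarrow> u - w \<in> l2_sections S"
  using l2_add[of u "- w"] l2_uminus[of w] by simp

text \<open>Along a subsequence the squared distances are summable with weights \<open>2\<^sup>n\<close>, which forces convergence
  almost everywhere.\<close>

lemma l2_complete:
  assumes x: "\<And>n::nat. x n \<in> l2_sections S"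
    and cauchy: "\<And>e. 0 < e \<Longrightarrow> \<exists>N. \<forall>m\<ge>N. \<forall>n\<ge>N. Re (ip S (x m - x n) (x m - x n)) < e"
  shows "\<exists>l\<in>l2_sections S. (\<lambda>n. Re (ip S (x n - l) (x n - l))) \<longlonglongrightarrow> 0"
proof -
  define d where "d m n a = sq a (x m a - x n a)" for m n a
  have xf: "x n a \<in> fib S a" for n a using l2_fib[OF x] .
  have d0: "0 \<le> d m n a" for m n a using xf by (simp add: d_def sq_nonneg)
  have dmeas: "d m n \<in> borel_measurable (dens S)" for m n
    using sq_measurable[of "x m - x n"] l2_diff[OF x x, of m n] by (simp add: l2_iff d_def[abs_def])
  have dint: "integrable (dens S) (d m n)" for m n
    using l2_diff[OF x x, of m n] by (simp add: l2_iff d_def[abs_def])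
  have dI: "(\<integral>\<^sup>+a. ennreal (d m n a) \<partial>dens S) = ennreal (Re (ip S (x m - x n) (x m - x n)))" for m n
    using nn_integral_eq_integral[OF dint] d0 Re_ip[OF l2_diff[OF x x], of m n] by (simp add: d_def[abs_def])
  have "\<exists>N. \<forall>m\<ge>N. \<forall>k\<ge>N. Re (ip S (x m - x k) (x m - x k)) < (1 / 4) ^ n" for n by (rule cauchy) simp
  then obtain N where N: "\<And>n m k. m \<ge> N n \<Longrightarrow> k \<ge> N n \<Longrightarrow> Re (ip S (x m - x k) (x m - x k)) < (1 / 4) ^ n" by metis
  \<comment> \<open>The summand \<open>n\<close> makes \<open>r\<close> tend to infinity; the
    maximum makes it monotone and at least \<open>N n\<close>.\<close>
  define r where "r n = n + Max (N ` {..n})" for n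
  have rN: "N n \<le> r n" for n unfolding r_def by (intro trans_le_add2 Max_ge) auto
  have rmono: "r n \<le> r (Suc n)" for n unfolding r_def by (intro add_mono Max_mono) auto
  have rmono': "N n \<le> r k" if "n \<le> k" for n k
    using order_trans[OF rN lift_Suc_mono_le[of r, OF rmono that]] .
  \<comment> \<open>The squared distances have integrals below \<open>(1 / 4) ^ n\<close>, so their
    sum with weights \<open>2 ^ n\<close> still has a finite integral.\<close>
  define f where "f n a = 2 ^ n * d (r (Suc n)) (r n) a" for n a
  have fmeas: "f n \<in> borel_measurable (dens S)" for n using dmeas by (simp add: f_def[abs_def])
  have f0: "0 \<le> f n a" for n a using d0 by (simp add: f_def)
  have fint: "(\<integral>\<^sup>+a. ennreal (f n a) \<partial>dens S) \<le> ennreal ((1 / 2) ^ n)" for n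
  proof -
    have "(\<integral>\<^sup>+a. ennreal (f n a) \<partial>dens S) = ennreal (2 ^ n) * (\<integral>\<^sup>+a. ennreal (d (r (Suc n)) (r n) a) \<partial>dens S)"
      unfolding f_def using dmeas d0 by (simp add: ennreal_mult nn_integral_cmult)
    also have "\<dots> \<le> ennreal (2 ^ n) * ennreal ((1 / 4) ^ n)"
      unfolding dI using less_imp_le[OF N[OF rmono' rN, of n "Suc n" ]] by (intro mult_left_mono ennreal_leI) auto
    also have "\<dots> = ennreal (2 ^ n * (1 / 4) ^ n)" by (simp add: ennreal_mult)
    also have "2 ^ n * (1 / 4) ^ n = (1 / 2 :: real) ^ n" by (simp add: power_mult_distrib[symmetric])
    finally show ?thesis .
  qed
  have "(\<integral>\<^sup>+a. (\<Sum>n. ennreal (f n a)) \<partial>dens S) = (\<Sum>n. \<integral>\<^sup>+a. ennreal (f n a) \<partial>dens S)"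
    using fmeas by (intro nn_integral_suminf) auto
  also have "\<dots> \<le> (\<Sum>n. ennreal ((1 / 2) ^ n))" by (intro suminf_le fint) auto
  also have "\<dots> = ennreal (\<Sum>n. (1 / 2) ^ n)" by (intro suminf_ennreal2) (auto intro: summable_geometric)
  also have "\<dots> < \<infinity>" by simp
  finally have "(\<integral>\<^sup>+a. (\<Sum>n. ennreal (f n a)) \<partial>dens S) \<noteq> \<infinity>" by simp
  moreover have "(\<lambda>a. \<Sum>n. ennreal (f n a)) \<in> borel_measurable (dens S)" using fmeas by measurable
  ultimately have "AE a in dens S. (\<Sum>n. ennreal (f n a)) \<noteq> \<infinity>" by (intro nn_integral_noteq_infinite)
  then have AEs: "AE a in dens S. summable (\<lambda>n. f n a)"
    by eventually_elim (use summable_suminf_not_top f0 in auto)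
  \<comment> \<open>Where the weighted series converges its terms are bounded, so consecutive
    differences in the fibre are dominated by a geometric series of ratio
    \<open>sqrt (1 / 2)\<close>.\<close>
  have conv: "convergent (\<lambda>n. \<psi> a (x (r n) a))" if W: "(W, \<psi>) \<in> trivs S" "a \<in> W" and s: "summable (\<lambda>n. f n a)" for W \<psi> a
  proof -
    have "Bseq (\<lambda>n. f n a)" using summable_LIMSEQ_zero[OF s] by (intro convergent_imp_Bseq) (auto simp: convergent_def)
    then obtain C where C: "0 < C" "\<And>n. \<bar>f n a\<bar> \<le> C" unfolding Bseq_def by auto
    obtain c where c: "0 < c" "\<And>z. c * (norm z)\<^sup>2 \<le> tsq \<psi> a z" using tsq_lower[OF W] by blast
    have bd: "norm (\<psi> a (x (r (Suc n)) a) - \<psi> a (x (r n) a)) \<le> sqrt (C / c) * sqrt (1 / 2) ^ n" for n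
    proof -
      have "\<psi> a (x (r (Suc n)) a) - \<psi> a (x (r n) a) = \<psi> a (x (r (Suc n)) a - x (r n) a)"
        by (rule triv_diff[OF W xf xf, symmetric])
      then have "c * (norm (\<psi> a (x (r (Suc n)) a) - \<psi> a (x (r n) a)))\<^sup>2 \<le> d (r (Suc n)) (r n) a"
        using c(2) sq_triv[OF W, of "x (r (Suc n)) a - x (r n) a"] xf by (simp add: d_def)
      moreover have "2 ^ n * d (r (Suc n)) (r n) a \<le> C" using C(2)[of n] by (simp add: f_def)
      then have "d (r (Suc n)) (r n) a \<le> C / 2 ^ n" by (simp add: field_simps)
      ultimately have "c * (norm (\<psi> a (x (r (Suc n)) a) - \<psi> a (x (r n) a)))\<^sup>2 \<le> C / 2 ^ n" by linarith
      then have "(norm (\<psi> a (x (r (Suc n)) a) - \<psi> a (x (r n) a)))\<^sup>2 \<le> C / c * (1 / 2) ^ n"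
        using c(1) by (simp add: field_simps power_divide)
      then have "sqrt ((norm (\<psi> a (x (r (Suc n)) a) - \<psi> a (x (r n) a)))\<^sup>2) \<le> sqrt (C / c * (1 / 2) ^ n)"
        by (rule real_sqrt_le_mono)
      moreover have "sqrt (C / c * (1 / 2) ^ n) = sqrt (C / c) * sqrt (1 / 2) ^ n"
        by (simp only: real_sqrt_mult real_sqrt_power)
      ultimately show ?thesis by simp
    qed
    have "sqrt (1 / 2) < sqrt 1" by (intro real_sqrt_less_mono) simp
    then have "summable (\<lambda>n. sqrt (C / c) * sqrt (1 / 2) ^ n)"
      by (intro summable_mult summable_geometric) simp
    then have "summable (\<lambda>n. \<psi> a (x (r (Suc n)) a) - \<psi> a (x (r n) a))"
      using bd by (rule summable_comparison_test'[where N = 0])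
    then have "convergent (\<lambda>n. \<Sum>k<n. \<psi> a (x (r (Suc k)) a) - \<psi> a (x (r k) a))" by (simp add: summable_iff_convergent)
    then have "convergent (\<lambda>n. \<psi> a (x (r n) a) - \<psi> a (x (r 0) a))" by (simp only: sum_lessThan_telescope[of "\<lambda>k. \<psi> a (x (r k) a)"])
    then show ?thesis by (simp add: convergent_diff_const_right_iff)
  qed
  define \<kappa> where "\<kappa> a = (SOME p. p \<in> trivs S \<and> a \<in> fst p)" for a
  have \<kappa>: "(fst (\<kappa> a), snd (\<kappa> a)) \<in> trivs S" "a \<in> fst (\<kappa> a)" for a
  proof -
    obtain W \<psi> where "(W, \<psi>) \<in> trivs S" "a \<in> W" by (rule triv_cover)
    then have "\<exists>p. p \<in> trivs S \<and> a \<in> fst p" by auto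
    from someI_ex[OF this] show "(fst (\<kappa> a), snd (\<kappa> a)) \<in> trivs S" "a \<in> fst (\<kappa> a)" by (auto simp: \<kappa>_def)
  qed
  \<comment> \<open>The limit is formed in a trivialization chosen at \<open>a\<close>, with value 0
    where the sequence is not Cauchy, so that \<open>l\<close> is defined everywhere.\<close>
  define l where "l a = (let s = \<lambda>n. snd (\<kappa> a) a (x (r n) a) in
    triv_inv (snd (\<kappa> a)) a (if Cauchy s then lim s else 0))" for a
  have lf: "l a \<in> fib S a" for a using triv_inv_fib[OF \<kappa>] by (simp add: l_def Let_def)
  \<comment> \<open>The same formula holds in every trivialization, because transition maps are
    linear isomorphisms and preserve Cauchy sequences, limits and 0. Measurability of
    \<open>l\<close> depends on this, since the choice \<open>\<kappa>\<close> is arbitrary.\<close>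
  have l: "\<psi> a (l a) = (if Cauchy (\<lambda>n. \<psi> a (x (r n) a)) then lim (\<lambda>n. \<psi> a (x (r n) a)) else 0)"
    if W: "(W, \<psi>) \<in> trivs S" "a \<in> W" for W \<psi> a
  proof -
    let ?\<kappa> = "snd (\<kappa> a)"
    define L where "L z = \<psi> a (triv_inv ?\<kappa> a z)" for z
    define L' where "L' z = ?\<kappa> a (triv_inv \<psi> a z)" for z
    have L: "bounded_linear L" unfolding L_def[abs_def] by (rule triv_transition_linear[OF \<kappa> W])
    have L': "bounded_linear L'" unfolding L'_def[abs_def] by (rule triv_transition_linear[OF W \<kappa>])
    have Lx: "L (?\<kappa> a (x (r n) a)) = \<psi> a (x (r n) a)" for n using triv_inv_triv[OF \<kappa> xf] by (simp add: L_def)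
    have Lx': "L' (\<psi> a (x (r n) a)) = ?\<kappa> a (x (r n) a)" for n using triv_inv_triv[OF W xf] by (simp add: L'_def)
    have iff: "Cauchy (\<lambda>n. \<psi> a (x (r n) a)) \<longleftrightarrow> Cauchy (\<lambda>n. ?\<kappa> a (x (r n) a))"
      using bounded_linear.Cauchy[OF L, of "\<lambda>n. ?\<kappa> a (x (r n) a)"] bounded_linear.Cauchy[OF L', of "\<lambda>n. \<psi> a (x (r n) a)"]
      by (auto simp: Lx Lx')
    show ?thesis
    proof (cases "Cauchy (\<lambda>n. ?\<kappa> a (x (r n) a))")
      case True
      then have "(\<lambda>n. ?\<kappa> a (x (r n) a)) \<longlonglongrightarrow> lim (\<lambda>n. ?\<kappa> a (x (r n) a))"
        by (simp add: Cauchy_convergent_iff convergent_LIMSEQ_iff)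
      then have "(\<lambda>n. \<psi> a (x (r n) a)) \<longlonglongrightarrow> L (lim (\<lambda>n. ?\<kappa> a (x (r n) a)))"
        using bounded_linear.tendsto[OF L] by (fastforce simp: Lx[symmetric])
      then have "lim (\<lambda>n. \<psi> a (x (r n) a)) = L (lim (\<lambda>n. ?\<kappa> a (x (r n) a)))" by (rule limI)
      then show ?thesis using True iff by (simp add: l_def L_def)
    next
      case False
      then show ?thesis using iff triv_inv_zero[OF \<kappa>] triv_zero[OF W] by (simp add: l_def)
    qed
  qed
  have lmeas: "triv_measurable l"
    unfolding triv_measurable_def
  proof (intro conjI allI ballI, goal_cases)
    case (2 p)
    obtain W \<psi> where p: "p = (W, \<psi>)" by (cases p)
    have W: "(W, \<psi>) \<in> trivs S" using 2 p by simp
    have [measurable]: "(\<lambda>a. \<psi> a (x (r n) a)) \<in> borel_measurable (restrict_space borel W)" for n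
      using l2_measurable[OF x W] .
    have "(\<lambda>a. if Cauchy (\<lambda>n. \<psi> a (x (r n) a)) then lim (\<lambda>n. \<psi> a (x (r n) a)) else 0) \<in> borel_measurable (restrict_space borel W)"
      by measurable
    moreover have "(\<lambda>a. \<psi> a (l a)) \<in> borel_measurable (restrict_space borel W) \<longleftrightarrow>
      (\<lambda>a. if Cauchy (\<lambda>n. \<psi> a (x (r n) a)) then lim (\<lambda>n. \<psi> a (x (r n) a)) else 0) \<in> borel_measurable (restrict_space borel W)"
      by (rule measurable_cong) (use l[OF W] in \<open>auto simp: space_restrict_space\<close>)
    ultimately show ?case by (simp add: p)
  qed (rule lf)
  have dl: "(\<lambda>n. d m (r n) a) \<longlonglongrightarrow> sq a (x m a - l a)" if s: "summable (\<lambda>n. f n a)" for m a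
  proof -
    obtain W \<psi> where W: "(W, \<psi>) \<in> trivs S" "a \<in> W" by (rule triv_cover)
    have "convergent (\<lambda>n. \<psi> a (x (r n) a))" by (rule conv[OF W s])
    then have "(\<lambda>n. \<psi> a (x (r n) a)) \<longlonglongrightarrow> \<psi> a (l a)"
      using l[OF W] by (simp add: Cauchy_convergent_iff convergent_LIMSEQ_iff)
    then have "(\<lambda>n. \<psi> a (x m a) - \<psi> a (x (r n) a)) \<longlonglongrightarrow> \<psi> a (x m a) - \<psi> a (l a)" by (intro tendsto_intros)
    then have "(\<lambda>n. tsq \<psi> a (\<psi> a (x m a) - \<psi> a (x (r n) a))) \<longlonglongrightarrow> tsq \<psi> a (\<psi> a (x m a) - \<psi> a (l a))"
      by (rule continuous_on_tendsto_compose[OF tsq_continuous]) auto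
    then show ?thesis
      using sq_triv[OF W] triv_diff[OF W] xf lf by (simp add: d_def)
  qed
  have mdl: "triv_measurable (x m - l)" for m
  proof -
    have "x m - l = x m + section_smul S (-1) l" by (auto simp: section_smul_def)
    moreover have "triv_measurable (x m)" using x by (simp add: l2_iff)
    ultimately show ?thesis using triv_measurable_add[OF _ triv_measurable_scale[OF lmeas]] by metis
  qed
  \<comment> \<open>With \<open>m\<close> fixed and the other index running through the subsequence,
    Fatou's lemma turns the Cauchy condition into a bound for the distance from \<open>x m\<close>
    to \<open>l\<close>.\<close>
  have fatou: "(\<integral>\<^sup>+a. ennreal (sq a (x m a - l a)) \<partial>dens S) \<le> ennreal e"
    if M: "\<And>n. n \<ge> M \<Longrightarrow> Re (ip S (x m - x n) (x m - x n)) \<le> e" for m M e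
  proof -
    have "AE a in dens S. ennreal (sq a (x m a - l a)) = liminf (\<lambda>n. ennreal (d m (r n) a))"
      using AEs
    proof eventually_elim
      case (elim a)
      have "(\<lambda>n. ennreal (d m (r n) a)) \<longlonglongrightarrow> ennreal (sq a (x m a - l a))" by (intro tendsto_ennrealI dl elim)
      from lim_imp_Liminf[OF sequentially_bot this] show ?case by (rule sym)
    qed
    then have "(\<integral>\<^sup>+a. ennreal (sq a (x m a - l a)) \<partial>dens S) = (\<integral>\<^sup>+a. liminf (\<lambda>n. ennreal (d m (r n) a)) \<partial>dens S)"
      by (rule nn_integral_cong_AE)
    also have "\<dots> \<le> liminf (\<lambda>n. \<integral>\<^sup>+a. ennreal (d m (r n) a) \<partial>dens S)"
      using dmeas by (intro nn_integral_liminf) auto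
    also have "\<dots> \<le> ennreal e"
    proof (rule Liminf_le)
      show "\<forall>\<^sub>F n in sequentially. (\<integral>\<^sup>+a. ennreal (d m (r n) a) \<partial>dens S) \<le> ennreal e"
        using eventually_ge_at_top[of M]
      proof eventually_elim
        case (elim n)
        then have "M \<le> r n" by (simp add: r_def)
        then show ?case unfolding dI by (intro ennreal_leI M)
      qed
    qed simp
    finally show ?thesis .
  qed
  have lim_bound: "x m - l \<in> l2_sections S \<and> Re (ip S (x m - l) (x m - l)) \<le> e"
    if M: "\<And>n. n \<ge> M \<Longrightarrow> Re (ip S (x m - x n) (x m - x n)) \<le> e" and e: "0 \<le> e" for m M e
  proof -
    have le: "(\<integral>\<^sup>+a. ennreal (sq a ((x m - l) a)) \<partial>dens S) \<le> ennreal e" using fatou[OF M] by simp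
    have sq0: "0 \<le> sq a ((x m - l) a)" for a using xf lf by (simp add: sq_nonneg)
    have int: "integrable (dens S) (\<lambda>a. sq a ((x m - l) a))"
      by (rule integrableI_nonneg[OF sq_measurable[OF mdl]]) (use sq0 le in \<open>auto intro: le_less_trans\<close>)
    then have mem: "x m - l \<in> l2_sections S" using mdl by (simp add: l2_iff)
    moreover have "ennreal (Re (ip S (x m - l) (x m - l))) \<le> ennreal e"
      using le nn_integral_eq_integral[OF int] sq0 Re_ip[OF mem] by simp
    ultimately show ?thesis using e by (simp add: ennreal_le_iff)
  qed
  have ev: "\<exists>M. \<forall>m\<ge>M. x m - l \<in> l2_sections S \<and> Re (ip S (x m - l) (x m - l)) \<le> e" if "0 < e" for e
  proof -
    obtain M where M: "\<forall>m\<ge>M. \<forall>n\<ge>M. Re (ip S (x m - x n) (x m - x n)) < e" using cauchy[OF \<open>0 < e\<close>] by blast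
    have "x m - l \<in> l2_sections S \<and> Re (ip S (x m - l) (x m - l)) \<le> e" if "m \<ge> M" for m
      by (rule lim_bound[of M]) (use M that \<open>0 < e\<close> in \<open>auto intro: less_imp_le\<close>)
    then show ?thesis by blast
  qed
  obtain M where "x M - l \<in> l2_sections S" using ev[of 1] by auto
  from l2_diff[OF x[of M] this] have l2: "l \<in> l2_sections S" by simp
  have "(\<lambda>n. Re (ip S (x n - l) (x n - l))) \<longlonglongrightarrow> 0"
  proof (rule LIMSEQ_I)
    fix e :: real assume "0 < e"
    then obtain M where M: "\<And>m. m \<ge> M \<Longrightarrow> Re (ip S (x m - l) (x m - l)) \<le> e / 2" using ev[of "e / 2"] by auto
    have "norm (Re (ip S (x n - l) (x n - l)) - 0) < e" if "n \<ge> M" for n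
    proof -
      have "0 \<le> Re (ip S (x n - l) (x n - l))"
        unfolding Re_ip[OF l2_diff[OF x l2]] using xf lf by (intro integral_nonneg_AE AE_I2) (simp add: sq_nonneg)
      then show ?thesis using M[OF that] \<open>0 < e\<close> by simp
    qed
    then show "\<exists>no. \<forall>n\<ge>no. norm (Re (ip S (x n - l) (x n - l)) - 0) < e" by blast
  qed
  then show ?thesis using l2 by blast
qed

lemma semi_hilbert_l2: "semi_hilbert (section_smul S) (l2_sections S) (ip S)"
proof -
  interpret vector_space "section_smul S" by (rule section_vector_space)
  show ?thesis
  proof
    fix u u' w :: "'m \<Rightarrow> 'v" and z :: complex
    assume u: "u \<in> l2_sections S" and u': "u' \<in> l2_sections S" and w: "w \<in> l2_sections S"
    note f = l2_fib[OF u] l2_fib[OF u'] l2_fib[OF w]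
    show "ip S (u + u') w = ip S u w + ip S u' w"
      using Bochner_Integration.integral_add[OF herm_integrable[OF u w] herm_integrable[OF u' w]] f
      by (simp add: ip_def herm_add)
    show "ip S (section_smul S z u) w = z * ip S u w"
      using f by (simp add: ip_def herm_smul section_smul_def)
    have "herm S a (w a) (u a) = cnj (herm S a (u a) (w a))" for a by (rule herm_cnj) (use f in auto)
    then show "ip S w u = cnj (ip S u w)" by (simp add: ip_def)
    show "0 \<le> Re (ip S u u)"
      unfolding Re_ip[OF u] using f by (intro integral_nonneg_AE AE_I2) (simp add: sq_nonneg)
  qed (use l2_zero l2_add l2_scale l2_complete in blast)+
qed

section \<open>The density in charts\<close>

lemma open_cinv_image:
  assumes c: "c \<in> atlas S" and U: "open U" "U \<subseteq> snd c ` fst c"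
  shows "open (cinv c ` U)"
proof -
  have "cinv c ` U = fst c \<inter> snd c -` U"
    using U(2) c by (auto simp: image_iff) (metis cinv_chart)
  then show ?thesis
    using continuous_open_preimage[OF chart_continuous[OF c] chart_open(1)[OF c] U(1)] by simp
qed

lemma chart_image_cinv: "c \<in> atlas S \<Longrightarrow> B \<subseteq> snd c ` fst c \<Longrightarrow> snd c ` cinv c ` B = B"
  by (force simp: image_image)

lemma borel_cinv_image:
  assumes c: "c \<in> atlas S" and B: "B \<in> sets borel" "B \<subseteq> snd c ` fst c"
  shows "cinv c ` B \<in> sets borel"
proof -
  have "cinv c ` B = snd c -` B \<inter> space (restrict_space borel (fst c))"
    using B(2) c by (auto simp: image_iff space_restrict_space) (metis cinv_chart)
  moreover have "snd c -` B \<inter> space (restrict_space borel (fst c)) \<in> sets (restrict_space borel (fst c))"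
    using borel_measurable_continuous_on_restrict[OF chart_continuous[OF c]] B(1) by (rule measurable_sets)
  ultimately show ?thesis using chart_open(1)[OF c] by (simp add: sets_restrict_space_iff)
qed

text \<open>The density function is continuous and positive, so it attains positive bounds on
  \<open>K\<close>. Afterwards only comparison with Lebesgue measure up to constants is
  used.\<close>

lemma density_bounds:
  assumes c: "c \<in> atlas S" and K: "compact K" "K \<subseteq> snd c ` fst c"
  obtains m M :: real where "0 < m" "0 < M"
    "\<forall>B\<in>sets borel. B \<subseteq> K \<longrightarrow> ennreal m * emeasure lborel B \<le> emeasure (dens S) (cinv c ` B) \<and>
      emeasure (dens S) (cinv c ` B) \<le> ennreal M * emeasure lborel B"
proof (cases "K = {}")
  case True
  then show thesis using that[of 1 1] by auto
next
  case False
  obtain \<rho> :: "'b \<Rightarrow> real" where \<rho>: "smooth_on (snd c ` fst c) \<rho>" "\<And>y. y \<in> snd c ` fst c \<Longrightarrow> 0 < \<rho> y"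
    "\<And>B. B \<in> sets borel \<Longrightarrow> B \<subseteq> fst c \<Longrightarrow> emeasure (dens S) B = (\<integral>\<^sup>+y\<in>snd c ` B. ennreal (\<rho> y) \<partial>lborel)"
    using density c unfolding smooth_positive_density_def by metis
  have cont: "continuous_on K \<rho>" using smooth_on_continuous_on[OF \<rho>(1)] K(2) by (rule continuous_on_subset)
  obtain a where a: "a \<in> K" "\<And>y. y \<in> K \<Longrightarrow> \<rho> a \<le> \<rho> y" using continuous_attains_inf[OF K(1) False cont] by blast
  obtain b where b: "b \<in> K" "\<And>y. y \<in> K \<Longrightarrow> \<rho> y \<le> \<rho> b" using continuous_attains_sup[OF K(1) False cont] by blast
  have em: "emeasure (dens S) (cinv c ` B) = (\<integral>\<^sup>+y\<in>B. ennreal (\<rho> y) \<partial>lborel)" if "B \<in> sets borel" "B \<subseteq> K" for B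
  proof -
    have BU: "B \<subseteq> snd c ` fst c" using that K by auto
    have "cinv c ` B \<subseteq> fst c" using BU c by auto
    then show ?thesis
      using \<rho>(3)[OF borel_cinv_image[OF c that(1) BU]] chart_image_cinv[OF c BU] by simp
  qed
  show thesis
  proof (rule that[of "\<rho> a" "\<rho> b"])
    show "0 < \<rho> a" "0 < \<rho> b" using a b K \<rho>(2) by auto
    show "\<forall>B\<in>sets borel. B \<subseteq> K \<longrightarrow> ennreal (\<rho> a) * emeasure lborel B \<le> emeasure (dens S) (cinv c ` B) \<and>
      emeasure (dens S) (cinv c ` B) \<le> ennreal (\<rho> b) * emeasure lborel B"
    proof (intro ballI impI conjI)
    fix B :: "'b set" assume B: "B \<in> sets borel" "B \<subseteq> K"
    have "ennreal (\<rho> a) * emeasure lborel B = (\<integral>\<^sup>+y\<in>B. ennreal (\<rho> a) \<partial>lborel)"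
      using B by (simp add: nn_integral_cmult_indicator)
    also have "\<dots> \<le> (\<integral>\<^sup>+y\<in>B. ennreal (\<rho> y) \<partial>lborel)"
      using a(2) B by (intro nn_integral_mono) (auto simp: indicator_def intro: ennreal_leI)
    finally show "ennreal (\<rho> a) * emeasure lborel B \<le> emeasure (dens S) (cinv c ` B)" using em[OF B] by simp
    have "(\<integral>\<^sup>+y\<in>B. ennreal (\<rho> y) \<partial>lborel) \<le> (\<integral>\<^sup>+y\<in>B. ennreal (\<rho> b) \<partial>lborel)"
      using b(2) B by (intro nn_integral_mono) (auto simp: indicator_def intro: ennreal_leI)
    also have "\<dots> = ennreal (\<rho> b) * emeasure lborel B"
      using B by (simp add: nn_integral_cmult_indicator)
    finally show "emeasure (dens S) (cinv c ` B) \<le> ennreal (\<rho> b) * emeasure lborel B" using em[OF B] by simp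
    qed
  qed
qed

lemma chart_ball:
  assumes c: "c \<in> atlas S" and W: "open W" "W \<subseteq> fst c" and a: "a \<in> W"
  obtains r where "0 < r" "cball (snd c a) r \<subseteq> snd c ` W"
  using open_chart_image[OF c W] a open_contains_cball by blast

text \<open>Small chart balls have finite measure, and finitely many of them cover the
  manifold.\<close>

lemma finite_dens: "finite_measure (dens S)"
proof
  define \<V> where "\<V> = {V. open V \<and> emeasure (dens S) V < \<infinity>}"
  have "\<exists>V\<in>\<V>. a \<in> V" for a
  proof -
    obtain c where c: "c \<in> atlas S" "a \<in> fst c" by (rule chart_cover)
    obtain r where r: "0 < r" "cball (snd c a) r \<subseteq> snd c ` fst c"
      using chart_ball[OF c(1) chart_open(1)[OF c(1)] _ c(2)] by auto
    obtain m M :: real where "0 < m" "0 < M" and M: "\<forall>B\<in>sets borel. B \<subseteq> cball (snd c a) r \<longrightarrow> ennreal m * emeasure lborel B \<le> emeasure (dens S) (cinv c ` B) \<and>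
      emeasure (dens S) (cinv c ` B) \<le> ennreal M * emeasure lborel B"
      by (rule density_bounds[OF c(1) compact_cball r(2)])
    have "emeasure (dens S) (cinv c ` ball (snd c a) r) \<le> ennreal M * emeasure lborel (ball (snd c a) r)" using M by auto
    also have "\<dots> < \<infinity>"
      using emeasure_lborel_ball_finite[of "snd c a" r] by (simp add: ennreal_mult_less_top)
    finally have "cinv c ` ball (snd c a) r \<in> \<V>"
      using open_cinv_image[OF c(1) open_ball order_trans[OF ball_subset_cball r(2)]] by (simp add: \<V>_def)
    moreover have "a \<in> cinv c ` ball (snd c a) r" using c r by (intro image_eqI[of _ _ "snd c a"]) auto
    ultimately show ?thesis by (rule bexI[rotated])
  qed
  then have "UNIV \<subseteq> \<Union>\<V>" by auto
  then obtain C where C: "C \<subseteq> \<V>" "finite C" "UNIV \<subseteq> \<Union>C"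
    by (rule compactE[OF compact_M]) (simp add: \<V>_def)
  have "emeasure (dens S) (\<Union>V\<in>C. V) \<le> (\<Sum>V\<in>C. emeasure (dens S) V)"
    using C by (intro emeasure_subadditive_finite) (auto simp: \<V>_def)
  also have "\<dots> < \<infinity>" using C by (auto simp: \<V>_def)
  finally have "emeasure (dens S) UNIV < \<infinity>" using C(3) by (simp add: top.extremum_unique)
  then show "emeasure (dens S) (space (dens S)) \<noteq> \<infinity>" by simp
qed

section \<open>Smooth sections inside the square integrable ones\<close>

lemma smooth_sections_fib: "u \<in> smooth_sections S \<Longrightarrow> u a \<in> fib S a"
  by (simp add: smooth_sections_def)

lemma smooth_sections_smooth: "u \<in> smooth_sections S \<Longrightarrow> (W, \<psi>) \<in> trivs S \<Longrightarrow> c \<in> atlas S \<Longrightarrow>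
    smooth_on (snd c ` (W \<inter> fst c)) (\<lambda>y. \<psi> (cinv c y) (u (cinv c y)))"
  by (auto simp: smooth_sections_def)

lemma smooth_sections_I:
  assumes "\<And>a. u a \<in> fib S a"
    and "\<And>W \<psi> c. (W, \<psi>) \<in> trivs S \<Longrightarrow> c \<in> atlas S \<Longrightarrow> smooth_on (snd c ` (W \<inter> fst c)) (\<lambda>y. \<psi> (cinv c y) (u (cinv c y)))"
  shows "u \<in> smooth_sections S"
  using assms by (auto simp: smooth_sections_def)

lemma open_triv_chart: "(W, \<psi>) \<in> trivs S \<Longrightarrow> c \<in> atlas S \<Longrightarrow> open (snd c ` (W \<inter> fst c))"
  by (rule open_chart_image[OF _ open_Int[OF triv_open chart_open(1)]]) auto

lemma smooth_sections_add: "u \<in> smooth_sections S \<Longrightarrow> w \<in> smooth_sections S \<Longrightarrow> u + w \<in> smooth_sections S"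
proof (rule smooth_sections_I)
  assume u: "u \<in> smooth_sections S" and w: "w \<in> smooth_sections S"
  then show "(u + w) a \<in> fib S a" for a using smooth_sections_fib by simp
  fix W \<psi> c assume W: "(W, \<psi>) \<in> trivs S" and c: "c \<in> atlas S"
  show "smooth_on (snd c ` (W \<inter> fst c)) (\<lambda>y. \<psi> (cinv c y) ((u + w) (cinv c y)))"
  proof (rule smooth_on_cong[OF open_triv_chart[OF W c] _ smooth_on_add[OF open_triv_chart[OF W c]
        smooth_sections_smooth[OF u W c] smooth_sections_smooth[OF w W c]]])
    fix y assume "y \<in> snd c ` (W \<inter> fst c)"
    then have "cinv c y \<in> W" using c by auto
    then show "\<psi> (cinv c y) (u (cinv c y)) + \<psi> (cinv c y) (w (cinv c y)) = \<psi> (cinv c y) ((u + w) (cinv c y))"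
      using triv_add[OF W] smooth_sections_fib u w by simp
  qed
qed

lemma bounded_linear_vec_smul: "bounded_linear (\<lambda>x :: complex ^ 'r. z *s x)"
proof -
  have "linear (\<lambda>x :: complex ^ 'r. z *s x)"
    by (rule linearI) (simp_all add: vec_eq_iff scaleR_conv_of_real[where 'a = complex] algebra_simps)
  then show ?thesis by (rule linear_conv_bounded_linear[THEN iffD1])
qed

lemma smooth_sections_scale: "u \<in> smooth_sections S \<Longrightarrow> section_smul S z u \<in> smooth_sections S"
proof (rule smooth_sections_I)
  assume u: "u \<in> smooth_sections S"
  then show "section_smul S z u a \<in> fib S a" for a using smooth_sections_fib by (simp add: section_smul_def)
  fix W \<psi> c assume W: "(W, \<psi>) \<in> trivs S" and c: "c \<in> atlas S"
  show "smooth_on (snd c ` (W \<inter> fst c)) (\<lambda>y. \<psi> (cinv c y) (section_smul S z u (cinv c y)))"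
  proof (rule smooth_on_cong[OF open_triv_chart[OF W c] _ smooth_on_linear[OF open_triv_chart[OF W c]
        bounded_linear_vec_smul smooth_sections_smooth[OF u W c]]])
    fix y assume "y \<in> snd c ` (W \<inter> fst c)"
    then have "cinv c y \<in> W" using c by auto
    then show "z *s \<psi> (cinv c y) (u (cinv c y)) = \<psi> (cinv c y) (section_smul S z u (cinv c y))"
      using triv_smul[OF W] smooth_sections_fib u by (simp add: section_smul_def)
  qed
qed

lemma smooth_section_continuous:
  assumes u: "u \<in> smooth_sections S" and W: "(W, \<psi>) \<in> trivs S"
  shows "continuous_on W (\<lambda>a. \<psi> a (u a))"
  by (rule continuous_on_charts[OF triv_open[OF W]]) (rule smooth_on_continuous_on[OF smooth_sections_smooth[OF u W]])

lemma sq_continuous: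
  assumes u: "u \<in> smooth_sections S"
  shows "continuous_on UNIV (\<lambda>a. sq a (u a))"
proof -
  have "continuous_on (\<Union>p\<in>trivs S. fst p) (\<lambda>a. sq a (u a))"
  proof (rule continuous_on_open_UN)
    fix p assume p: "p \<in> trivs S"
    then have W: "(fst p, snd p) \<in> trivs S" by simp
    show "open (fst p)" by (rule triv_open[OF W])
    have "continuous_on (fst p) (\<lambda>a. Re (\<Sum>i\<in>UNIV. \<Sum>j\<in>UNIV. snd p a (u a) $ i * cnj (snd p a (u a) $ j) * gram (snd p) a i j))"
      by (intro continuous_intros gram_continuous[OF W] smooth_section_continuous[OF u W])
    then show "continuous_on (fst p) (\<lambda>a. sq a (u a))"
      by (rule continuous_on_eq) (simp add: sq_triv[OF W _ smooth_sections_fib[OF u]] tsq_def)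
  qed
  moreover have "(\<Union>p\<in>trivs S. fst p) = UNIV" using triv_cover by (metis UNIV_eq_I UN_I fst_conv)
  ultimately show ?thesis by simp
qed

lemma smooth_sections_l2: "smooth_sections S \<subseteq> l2_sections S"
proof
  fix u assume u: "u \<in> smooth_sections S"
  have "triv_measurable u"
    unfolding triv_measurable_def
    using smooth_sections_fib[OF u] borel_measurable_continuous_on_restrict[OF smooth_section_continuous[OF u]] by auto
  moreover have "integrable (dens S) (\<lambda>a. sq a (u a))"
  proof -
    interpret finite_measure "dens S" by (rule finite_dens)
    have "bounded ((\<lambda>a. sq a (u a)) ` UNIV)"
      by (intro compact_imp_bounded compact_continuous_image sq_continuous u compact_M)
    then obtain B where "\<And>a. norm (sq a (u a)) \<le> B" by (auto simp: bounded_iff)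
    then show ?thesis using sq_measurable[OF calculation] by (intro integrable_const_bound[of _ B]) auto
  qed
  ultimately show "u \<in> l2_sections S" by (simp add: l2_iff)
qed

text \<open>A nonzero value persists by continuity on a whole chart ball, and chart balls have
  positive measure by \<open>density_bounds\<close>.\<close>

lemma smooth_sections_definite:
  assumes u: "u \<in> smooth_sections S" and z: "Re (ip S u u) = 0"
  shows "u = 0"
proof (rule ccontr)
  assume "u \<noteq> 0"
  then obtain a where a: "u a \<noteq> 0" by (auto simp: fun_eq_iff)
  have u2: "u \<in> l2_sections S" using u smooth_sections_l2 by blast
  have pos: "0 < sq a (u a)" using herm_pos[OF smooth_sections_fib[OF u] a] by (simp add: sq_def)
  define V where "V = {b. sq a (u a) / 2 < sq b (u b)}"
  have oV: "open V" unfolding V_def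
    by (rule open_Collect_less[OF continuous_on_const sq_continuous[OF u]])
  obtain c where c: "c \<in> atlas S" "a \<in> fst c" by (rule chart_cover)
  have "open (V \<inter> fst c)" "a \<in> V \<inter> fst c" using oV chart_open(1)[OF c(1)] c pos by (auto simp: V_def)
  then obtain r where r: "0 < r" "cball (snd c a) r \<subseteq> snd c ` (V \<inter> fst c)"
    using chart_ball[OF c(1), of "V \<inter> fst c"] by blast
  then have sub: "cball (snd c a) r \<subseteq> snd c ` fst c" by blast
  obtain m M :: real where m: "0 < m" and "0 < M" and m': "\<forall>B\<in>sets borel. B \<subseteq> cball (snd c a) r \<longrightarrow> ennreal m * emeasure lborel B \<le> emeasure (dens S) (cinv c ` B) \<and>
      emeasure (dens S) (cinv c ` B) \<le> ennreal M * emeasure lborel B"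
    by (rule density_bounds[OF c(1) compact_cball sub])
  have "AE b in dens S. sq b (u b) = 0"
    using integral_nonneg_eq_0_iff_AE[of "dens S" "\<lambda>b. sq b (u b)"] z Re_ip[OF u2] u2 sq_nonneg[OF l2_fib[OF u2]]
    by (simp add: l2_iff)
  then have "AE b in dens S. b \<notin> cinv c ` ball (snd c a) r"
  proof eventually_elim
    case (elim b)
    have "b \<in> V" if b: "b \<in> cinv c ` ball (snd c a) r"
    proof -
      obtain y where "b = cinv c y" "y \<in> ball (snd c a) r" using b by (rule imageE)
      then have y: "b = cinv c y" "y \<in> cball (snd c a) r" using ball_subset_cball by auto
      then obtain b' where "b' \<in> V \<inter> fst c" "y = snd c b'" using r(2) by blast
      then show ?thesis using y c(1) by simp
    qed
    then show ?case using elim pos by (auto simp: V_def)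
  qed
  moreover have "cinv c ` ball (snd c a) r \<in> sets borel"
    using sub ball_subset_cball by (intro borel_cinv_image[OF c(1)]) auto
  ultimately have "emeasure (dens S) (cinv c ` ball (snd c a) r) = 0"
    by (subst (asm) AE_iff_measurable[OF _ refl]) auto
  moreover have "ennreal m * emeasure lborel (ball (snd c a) r) \<le> emeasure (dens S) (cinv c ` ball (snd c a) r)"
    using m' by auto
  ultimately have "emeasure lborel (ball (snd c a) r) = 0" using m by simp
  then have "ball (snd c a) r \<in> null_sets lborel" by (simp add: null_sets_def)
  then have "negligible (ball (snd c a) r)" by (simp add: negligible_iff_null_sets null_sets_completionI)
  then show False using open_not_negligible[of "ball (snd c a) r"] r(1) by simp
qed

end


section \<open>Disjoint Heisenberg boxes\<close>

lemma smooth_on_lipschitz: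
  fixes f :: "'b::euclidean_space \<Rightarrow> 'c::real_normed_vector"
  assumes f: "smooth_on U f" and K: "cball p R \<subseteq> U"
  shows "\<exists>B\<ge>0. \<forall>y\<in>cball p R. \<forall>z\<in>cball p R. norm (f y - f z) \<le> B * norm (y - z)"
proof -
  have "\<exists>B. \<forall>x\<in>cball p R. norm (frechet_derivative f (at x) b) \<le> B" for b
  proof -
    have "continuous_on (cball p R) (\<lambda>x. frechet_derivative f (at x) b)"
      using smooth_on_continuous_on[OF smooth_on_frechet[OF f]] K by (rule continuous_on_subset)
    then have "bounded ((\<lambda>x. frechet_derivative f (at x) b) ` cball p R)"
      by (intro compact_imp_bounded compact_continuous_image) auto
    then show ?thesis by (auto simp: bounded_iff)
  qed
  then obtain B where B: "\<And>b x. x \<in> cball p R \<Longrightarrow> norm (frechet_derivative f (at x) b) \<le> B b" by metis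
  define C where "C = (\<Sum>b\<in>Basis. \<bar>B b\<bar>)"
  have der: "(f has_derivative frechet_derivative f (at x)) (at x)" if "x \<in> cball p R" for x
    using smooth_on_has_derivative[OF f] that K by blast
  have "norm (frechet_derivative f (at x) h) \<le> C * norm h" if x: "x \<in> cball p R" for x h
  proof -
    have lin: "linear (frechet_derivative f (at x))" using der[OF x] by (rule has_derivative_linear)
    have "frechet_derivative f (at x) h = (\<Sum>b\<in>Basis. (h \<bullet> b) *\<^sub>R frechet_derivative f (at x) b)"
      by (subst (1) euclidean_representation[symmetric]) (simp add: linear_sum[OF lin] linear_cmul[OF lin])
    also have "norm \<dots> \<le> (\<Sum>b\<in>Basis. \<bar>B b\<bar> * norm h)"
    proof (rule sum_norm_le)
      fix b :: 'b assume b: "b \<in> Basis"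
      have "norm ((h \<bullet> b) *\<^sub>R frechet_derivative f (at x) b) = \<bar>h \<bullet> b\<bar> * norm (frechet_derivative f (at x) b)" by simp
      also have "\<dots> \<le> norm h * \<bar>B b\<bar>"
        using Basis_le_norm[OF b, of h] B[OF x, of b] by (intro mult_mono) auto
      finally show "norm ((h \<bullet> b) *\<^sub>R frechet_derivative f (at x) b) \<le> \<bar>B b\<bar> * norm h" by (simp add: mult.commute)
    qed
    finally show ?thesis by (simp add: C_def sum_distrib_right)
  qed
  then have on: "onorm (frechet_derivative f (at x)) \<le> C" if "x \<in> cball p R" for x
    using that by (intro onorm_le) auto
  have "norm (f y - f z) \<le> C * norm (y - z)" if "y \<in> cball p R" "z \<in> cball p R" for y z
    by (rule differentiable_bound[OF convex_cball has_derivative_at_withinI[OF der] on that])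
  moreover have "0 \<le> C" by (simp add: C_def sum_nonneg)
  ultimately show ?thesis by blast
qed

text \<open>The grid of \<open>N\<^sup>d\<^sup>+\<^sup>2\<close> boxes, each of size \<open>\<epsilon>\<^sup>2\<close> in the direction of weight 2 and \<open>\<epsilon>\<close> in the others,
  where \<open>\<epsilon> = r / N\<close>.\<close>

definition grid :: "nat \<Rightarrow> nat \<Rightarrow> (nat \<Rightarrow> nat) set" where
  "grid n N = PiE {..<n} (\<lambda>k. {..<if k = 0 then N\<^sup>2 else N})"

lemma card_grid: "card (grid (Suc d) N) = N ^ (d + 2)"
proof -
  have "card (grid (Suc d) N) = (\<Prod>k<Suc d. if k = 0 then N\<^sup>2 else N)"
    by (auto simp: grid_def card_PiE intro!: prod.cong)
  also have "\<dots> = N\<^sup>2 * (\<Prod>k<d. N)"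
    by (subst prod.lessThan_Suc_shift) simp
  finally show ?thesis by (simp add: power_add power2_eq_square)
qed

lemma finite_grid: "finite (grid n N)"
  by (auto simp: grid_def intro!: finite_PiE)

lemma nat_eq_if_close:
  fixes a b :: nat
  assumes "\<bar>real a - real b\<bar> < 1"
  shows "a = b"
proof -
  have "real a < real (b + 1)" "real b < real (a + 1)" using assms by auto
  then show ?thesis by (simp only: of_nat_less_iff)
qed

text \<open>An \<open>H\<close>-frame in the coordinates of a chart: the fields with positive index
  span \<open>H\<close>, and the boxes will be placed near \<open>p\<close>.\<close>

locale moving_frame =
  fixes U :: "'b::euclidean_space set" and X :: "nat \<Rightarrow> 'b \<Rightarrow> 'b" and p :: 'b
  assumes U: "open U" and p: "p \<in> U"
    and X_smooth: "\<And>j. j < DIM('b) \<Longrightarrow> smooth_on U (X j)"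
    and X_inj: "\<And>y. y \<in> U \<Longrightarrow> inj_on (\<lambda>j. X j y) {..<DIM('b)}"
    and X_indep: "\<And>y. y \<in> U \<Longrightarrow> independent ((\<lambda>j. X j y) ` {..<DIM('b)})"
begin

abbreviation "e \<equiv> \<lambda>j. X j p"

lemma dual_frame: "\<exists>l. \<forall>k<DIM('b). \<forall>j<DIM('b). l k \<bullet> e j = (if j = k then 1 else 0)"
proof -
  have "\<exists>l. \<forall>j<DIM('b). l \<bullet> e j = (if j = k then 1 else 0)" if k: "k < DIM('b)" for k
  proof -
    obtain g :: "'b \<Rightarrow> real" where g: "linear g" "\<And>x. x \<in> e ` {..<DIM('b)} \<Longrightarrow> g x = (if x = e k then 1 else 0)"
      using linear_independent_extend[OF X_indep[OF p], of "\<lambda>x. if x = e k then 1 else 0"] by blast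
    have "adjoint g 1 \<bullet> e j = (if j = k then 1 else 0)" if j: "j < DIM('b)" for j
    proof -
      have "adjoint g 1 \<bullet> e j = g (e j)" using adjoint_works[OF g(1), of "e j" 1] by (simp add: inner_commute)
      also have "\<dots> = (if j = k then 1 else 0)"
        using g(2)[of "e j"] inj_onD[OF X_inj[OF p], of j k] j k by auto
      finally show ?thesis .
    qed
    then show ?thesis by blast
  qed
  then show ?thesis by metis
qed

text \<open>The dual basis of the frame at \<open>p\<close>, represented through the inner product.
  It stays the same for all boxes.\<close>

definition l where "l = (SOME l. \<forall>k<DIM('b). \<forall>j<DIM('b). l k \<bullet> e j = (if j = k then 1 else 0))"

lemma l_e: "k < DIM('b) \<Longrightarrow> j < DIM('b) \<Longrightarrow> l k \<bullet> e j = (if j = k then 1 else 0)"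
  using someI_ex[OF dual_frame] unfolding l_def by blast

lemma expansion: "v = (\<Sum>k<DIM('b). (l k \<bullet> v) *\<^sub>R e k)"
proof -
  let ?B = "e ` {..<DIM('b)}"
  have "UNIV \<subseteq> span ?B"
    by (rule card_ge_dim_independent) (use X_indep[OF p] card_image[OF X_inj[OF p]] in auto)
  then obtain u where "v = (\<Sum>x\<in>?B. u x *\<^sub>R x)" using span_finite[of ?B] by auto
  then have v: "v = (\<Sum>k<DIM('b). u (e k) *\<^sub>R e k)" by (simp add: sum.reindex[OF X_inj[OF p]])
  have "l k \<bullet> v = u (e k)" if k: "k < DIM('b)" for k
  proof -
    have "l k \<bullet> v = (\<Sum>j<DIM('b). u (e j) * (l k \<bullet> e j))" by (subst v) (simp add: inner_sum_right)
    also have "\<dots> = (\<Sum>j<DIM('b). if j = k then u (e k) else 0)"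
      using k by (intro sum.cong) (auto simp: l_e)
    finally show ?thesis using k by simp
  qed
  then show ?thesis by (subst v) auto
qed

lemma inner_expansion: "o' \<bullet> v = (\<Sum>k<DIM('b). (l k \<bullet> v) * (o' \<bullet> e k))"
  by (subst expansion[of v]) (simp add: inner_sum_right)

definition E where "E = (\<Sum>k<DIM('b). norm (e k))"
definition C0 where "C0 = (\<Sum>k<DIM('b). norm (l k))"

lemma E_nonneg: "0 \<le> E" and C0_nonneg: "0 \<le> C0"
  by (auto simp: E_def C0_def sum_nonneg)

lemma norm_e_le: "k < DIM('b) \<Longrightarrow> norm (e k) \<le> E"
  unfolding E_def by (rule member_le_sum) auto

lemma norm_le_e: "norm v \<le> C0 * (\<Sum>k<DIM('b). \<bar>v \<bullet> e k\<bar>)"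
proof -
  have "v = (\<Sum>k<DIM('b). (v \<bullet> e k) *\<^sub>R l k)"
  proof (rule vector_eq_rdot[THEN iffD1], rule allI)
    fix w
    show "v \<bullet> w = (\<Sum>k<DIM('b). (v \<bullet> e k) *\<^sub>R l k) \<bullet> w"
      by (subst inner_expansion) (simp add: inner_sum_left mult.commute)
  qed
  then have "norm v \<le> (\<Sum>k<DIM('b). norm ((v \<bullet> e k) *\<^sub>R l k))" by (metis norm_sum)
  also have "\<dots> \<le> (\<Sum>k<DIM('b). C0 * \<bar>v \<bullet> e k\<bar>)"
  proof (rule sum_mono)
    fix k assume "k \<in> {..<DIM('b)}"
    then have "norm (l k) \<le> C0" unfolding C0_def by (intro member_le_sum) auto
    then show "norm ((v \<bullet> e k) *\<^sub>R l k) \<le> C0 * \<bar>v \<bullet> e k\<bar>" by (simp add: mult.commute mult_right_mono)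
  qed
  finally show ?thesis by (simp add: sum_distrib_left)
qed

lemma norm_le_l: "norm v \<le> (\<Sum>k<DIM('b). \<bar>l k \<bullet> v\<bar> * norm (e k))"
proof -
  have "norm v \<le> (\<Sum>k<DIM('b). norm ((l k \<bullet> v) *\<^sub>R e k))" using expansion[of v] by (metis norm_sum)
  then show ?thesis by simp
qed

lemma DIM_split: "(\<Sum>k<DIM('b). f k) = f 0 + (\<Sum>k\<in>{1..<DIM('b)}. f k)" for f :: "nat \<Rightarrow> 'z::comm_monoid_add"
proof -
  have "{..<DIM('b)} = insert 0 {1..<DIM('b)}" by auto
  then show ?thesis by simp
qed

text \<open>One vector fewer than the dimension cannot span the space.\<close>

lemma conormal_exists: "\<exists>w::'b. w \<noteq> 0 \<and> (\<forall>j\<in>{1..<DIM('b)}. w \<bullet> X j y = 0)"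
proof -
  have "dim ((\<lambda>j. X j y) ` {1..<DIM('b)}) \<le> card ((\<lambda>j. X j y) ` {1..<DIM('b)})" by (rule dim_le_card') auto
  also have "\<dots> \<le> card {1..<DIM('b)}" by (rule card_image_le) auto
  also have "\<dots> < DIM('b)" using DIM_positive[where 'a = 'b] by (simp del: DIM_positive)
  finally have lt: "dim ((\<lambda>j. X j y) ` {1..<DIM('b)}) < DIM('b)" .
  obtain w where w: "w \<noteq> 0" "\<And>x. x \<in> span ((\<lambda>j. X j y) ` {1..<DIM('b)}) \<Longrightarrow> orthogonal w x"
    by (rule orthogonal_to_subspace_exists[OF lt], rule that)
  have "w \<bullet> X j y = 0" if "j \<in> {1..<DIM('b)}" for j
    using w(2)[OF span_base[OF imageI[OF that]]] by (simp add: orthogonal_def)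
  then show ?thesis using w(1) by blast
qed

text \<open>The normalization by \<open>X\<^sub>0(p)\<close> makes the conormal bounded and Lipschitz in \<open>y\<close> near \<open>p\<close>, by perturbation of
  the frame at \<open>p\<close>.\<close>

definition conormal :: "'b \<Rightarrow> 'b" where
  "conormal y = (SOME w. w \<bullet> e 0 = 1 \<and> (\<forall>j\<in>{1..<DIM('b)}. w \<bullet> X j y = 0))"

text \<open>Only the thin direction is adapted to the center \<open>y\<close>. In the others the
  functionals at \<open>p\<close> suffice: differentiating along any frame field there costs at most
  one power of \<open>1 / \<epsilon>\<close>, which every weight allows.\<close>

definition box :: "'b \<Rightarrow> real \<Rightarrow> 'b set" where
  "box y \<epsilon> = {x. \<bar>conormal y \<bullet> (x - y)\<bar> \<le> \<epsilon>\<^sup>2 \<and> (\<forall>k\<in>{1..<DIM('b)}. \<bar>l k \<bullet> (x - y)\<bar> \<le> \<epsilon>)}"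

text \<open>The spacings \<open>3 * \<epsilon>\<close> and \<open>3 * \<epsilon>\<^sup>2\<close>
  exceed the box widths \<open>2 * \<epsilon>\<close> and \<open>2 * \<epsilon>\<^sup>2\<close>. In
  the thin direction the excess leaves room for the change of the conormal from center to
  center.\<close>

definition center :: "real \<Rightarrow> (nat \<Rightarrow> nat) \<Rightarrow> 'b" where
  "center \<epsilon> i = p + (3 * \<epsilon>\<^sup>2 * real (i 0)) *\<^sub>R e 0 + (\<Sum>k\<in>{1..<DIM('b)}. (3 * \<epsilon> * real (i k)) *\<^sub>R e k)"

lemma l_center:
  assumes k: "k \<in> {1..<DIM('b)}"
  shows "l k \<bullet> (center \<epsilon> i - center \<epsilon> j) = 3 * \<epsilon> * (real (i k) - real (j k))"
proof -
  have "l k \<bullet> (\<Sum>m\<in>{1..<DIM('b)}. (3 * \<epsilon> * real (i m)) *\<^sub>R e m) = 3 * \<epsilon> * real (i k)" for i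
  proof -
    have "l k \<bullet> (\<Sum>m\<in>{1..<DIM('b)}. (3 * \<epsilon> * real (i m)) *\<^sub>R e m) = (\<Sum>m\<in>{1..<DIM('b)}. if m = k then 3 * \<epsilon> * real (i k) else 0)"
      unfolding inner_sum_right using k by (intro sum.cong) (auto simp: l_e)
    then show ?thesis using k by simp
  qed
  then show ?thesis using k by (simp add: center_def inner_add_right inner_diff_right l_e right_diff_distrib)
qed

text \<open>If two boxes meet, the spacing forces all indices other than the one of weight 2 to
  agree, so the centers differ by a multiple of \<open>e 0\<close>. By its Lipschitz bound the
  conormal then changes by at most a constant times that distance. This acts on vectors of length of
  order \<epsilon>, so for small \<open>r\<close> it cannot compensate the spacing of the
  centers.\<close>

lemma packing:
  obtains r R C2 C3 :: real where "0 < r" "r \<le> 1" "0 < R" "cball p R \<subseteq> U" "0 \<le> C2" "0 \<le> C3"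
    and "\<forall>y\<in>cball p R. norm (conormal y) \<le> C3 \<and> (\<forall>j\<in>{1..<DIM('b)}. conormal y \<bullet> X j y = 0)"
    and "\<forall>N>0. \<forall>i\<in>grid DIM('b) N. center (r / real N) i \<in> cball p R \<and>
      (\<forall>x\<in>box (center (r / real N) i) (r / real N). x \<in> cball p R \<and> norm (x - center (r / real N) i) \<le> C2 * (r / real N))"
    and "\<forall>N>0. \<forall>i\<in>grid DIM('b) N. \<forall>j\<in>grid DIM('b) N. i \<noteq> j \<longrightarrow>
      box (center (r / real N) i) (r / real N) \<inter> box (center (r / real N) j) (r / real N) = {}"
proof -
  obtain R0 where R0: "0 < R0" "cball p R0 \<subseteq> U" using open_contains_cball U p by blast
  have "\<exists>B\<ge>0. \<forall>y\<in>cball p R0. \<forall>z\<in>cball p R0. norm (X k y - X k z) \<le> B * norm (y - z)" if "k < DIM('b)" for k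
    by (rule smooth_on_lipschitz[OF X_smooth[OF that] R0(2)])
  then obtain B where B: "\<And>k. k < DIM('b) \<Longrightarrow> 0 \<le> B k"
    "\<And>k y z. k < DIM('b) \<Longrightarrow> y \<in> cball p R0 \<Longrightarrow> z \<in> cball p R0 \<Longrightarrow> norm (X k y - X k z) \<le> B k * norm (y - z)" by metis
  define \<Lambda> where "\<Lambda> = (\<Sum>k<DIM('b). B k)"
  have \<Lambda>0: "0 \<le> \<Lambda>" unfolding \<Lambda>_def using B(1) by (intro sum_nonneg) auto
  have Lip: "(\<Sum>k\<in>{1..<DIM('b)}. norm (X k y - X k z)) \<le> \<Lambda> * norm (y - z)" if "y \<in> cball p R0" "z \<in> cball p R0" for y z
  proof -
    have "(\<Sum>k\<in>{1..<DIM('b)}. norm (X k y - X k z)) \<le> (\<Sum>k\<in>{1..<DIM('b)}. B k * norm (y - z))"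
      using B(2) that by (intro sum_mono) auto
    also have "\<dots> \<le> (\<Sum>k<DIM('b). B k * norm (y - z))" using B(1) by (intro sum_mono2) auto
    finally show ?thesis by (simp add: \<Lambda>_def sum_distrib_right)
  qed
  \<comment> \<open>The admissible movement of the frame over the ball of radius \<open>R\<close>:
    with \<open>C0 * \<eta> \<le> 1 / 2\<close> its effect is absorbed in
    \<open>perturb\<close>.\<close>
  define \<eta> where "\<eta> = 1 / (2 * (C0 + 1))"
  have \<eta>: "0 < \<eta>" "C0 * \<eta> \<le> 1 / 2" using C0_nonneg by (auto simp: \<eta>_def field_simps)
  define R where "R = min R0 (\<eta> / (\<Lambda> + 1))"
  have R: "0 < R" "R \<le> R0" using R0 \<eta> \<Lambda>0 by (auto simp: R_def)
  have "\<Lambda> * R \<le> \<Lambda> * (\<eta> / (\<Lambda> + 1))" unfolding R_def using \<Lambda>0 by (intro mult_left_mono) auto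
  also have "\<dots> \<le> \<eta>" using \<eta> \<Lambda>0 by (simp add: field_simps)
  finally have \<Lambda>R: "\<Lambda> * R \<le> \<eta>" .
  have pR: "p \<in> cball p R0" using R0 by simp
  have sub: "cball p R \<subseteq> cball p R0" using R by auto
  have near: "(\<Sum>k\<in>{1..<DIM('b)}. \<bar>w \<bullet> (e k - X k y)\<bar>) \<le> \<eta> * norm w" if y: "y \<in> cball p R" for y w
  proof -
    have "(\<Sum>k\<in>{1..<DIM('b)}. \<bar>w \<bullet> (e k - X k y)\<bar>) \<le> (\<Sum>k\<in>{1..<DIM('b)}. norm w * norm (e k - X k y))"
      by (intro sum_mono Cauchy_Schwarz_ineq2)
    also have "\<dots> = norm w * (\<Sum>k\<in>{1..<DIM('b)}. norm (e k - X k y))" by (simp add: sum_distrib_left)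
    also have "\<dots> \<le> norm w * (\<Lambda> * norm (p - y))" using Lip[OF pR, of y] y sub by (intro mult_left_mono) auto
    also have "\<dots> \<le> norm w * (\<Lambda> * R)" using y \<Lambda>0 by (intro mult_left_mono) (auto simp: dist_norm)
    also have "\<dots> \<le> norm w * \<eta>" using \<Lambda>R by (intro mult_left_mono) auto
    finally show ?thesis by (simp add: mult.commute)
  qed
  \<comment> \<open>The fields at \<open>y\<close> may replace those at \<open>p\<close> in
    \<open>norm_le_e\<close>, at the price of an error of at most half the norm. For a normal vector
    of the plane at \<open>y\<close> this shows that its pairing with \<open>e 0\<close> is nonzero,
    so that it can be normalized.\<close>
  have perturb: "norm w \<le> 2 * C0 * (\<bar>w \<bullet> e 0\<bar> + (\<Sum>k\<in>{1..<DIM('b)}. \<bar>w \<bullet> X k y\<bar>))" if y: "y \<in> cball p R" for y w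
  proof -
    have "norm w \<le> C0 * (\<bar>w \<bullet> e 0\<bar> + (\<Sum>k\<in>{1..<DIM('b)}. \<bar>w \<bullet> e k\<bar>))"
      using norm_le_e[of w] unfolding DIM_split[of "\<lambda>k. \<bar>w \<bullet> e k\<bar>"] .
    moreover have "(\<Sum>k\<in>{1..<DIM('b)}. \<bar>w \<bullet> e k\<bar>) \<le> (\<Sum>k\<in>{1..<DIM('b)}. \<bar>w \<bullet> X k y\<bar> + \<bar>w \<bullet> (e k - X k y)\<bar>)"
      by (intro sum_mono) (auto simp: inner_diff_right)
    moreover have "(\<Sum>k\<in>{1..<DIM('b)}. \<bar>w \<bullet> X k y\<bar> + \<bar>w \<bullet> (e k - X k y)\<bar>) \<le> (\<Sum>k\<in>{1..<DIM('b)}. \<bar>w \<bullet> X k y\<bar>) + \<eta> * norm w"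
      using near[OF y, of w] by (simp add: sum.distrib)
    ultimately have "norm w \<le> C0 * (\<bar>w \<bullet> e 0\<bar> + ((\<Sum>k\<in>{1..<DIM('b)}. \<bar>w \<bullet> X k y\<bar>) + \<eta> * norm w))"
      using C0_nonneg by (meson add_left_mono mult_left_mono order_trans)
    also have "\<dots> = C0 * (\<bar>w \<bullet> e 0\<bar> + (\<Sum>k\<in>{1..<DIM('b)}. \<bar>w \<bullet> X k y\<bar>)) + C0 * \<eta> * norm w" by (simp add: algebra_simps)
    also have "C0 * \<eta> * norm w \<le> 1 / 2 * norm w" using \<eta>(2) by (intro mult_right_mono) auto
    finally show ?thesis by simp
  qed
  have con: "conormal y \<bullet> e 0 = 1 \<and> (\<forall>j\<in>{1..<DIM('b)}. conormal y \<bullet> X j y = 0)" if y: "y \<in> cball p R" for y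
  proof -
    obtain w :: 'b where w: "w \<noteq> 0" "\<And>j. j \<in> {1..<DIM('b)} \<Longrightarrow> w \<bullet> X j y = 0" using conormal_exists[of y] by blast
    have "norm w \<le> 2 * C0 * \<bar>w \<bullet> e 0\<bar>" using perturb[OF y, of w] w(2) by simp
    then have "w \<bullet> e 0 \<noteq> 0" using w(1) by auto
    then have "(1 / (w \<bullet> e 0)) *\<^sub>R w \<bullet> e 0 = 1 \<and> (\<forall>j\<in>{1..<DIM('b)}. (1 / (w \<bullet> e 0)) *\<^sub>R w \<bullet> X j y = 0)"
      using w(2) by simp
    then show ?thesis unfolding conormal_def by (rule someI)
  qed
  define C3 where "C3 = 2 * C0"
  have C3: "0 \<le> C3" using C0_nonneg by (simp add: C3_def)
  have con_norm: "norm (conormal y) \<le> C3" if y: "y \<in> cball p R" for y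
    using perturb[OF y, of "conormal y"] con[OF y] by (simp add: C3_def)
  define L' where "L' = C3 * C3 * \<Lambda>"
  have L'0: "0 \<le> L'" using C3 \<Lambda>0 by (simp add: L'_def)
  \<comment> \<open>By the normalization the difference of two conormals annihilates
    \<open>e 0\<close>, and on \<open>X k y\<close> it sees only the difference of the fields at
    \<open>y\<close> and \<open>z\<close>; then \<open>perturb\<close> applies.\<close>
  have con_lip: "norm (conormal y - conormal z) \<le> L' * norm (y - z)" if y: "y \<in> cball p R" and z: "z \<in> cball p R" for y z
  proof -
    have "(\<Sum>k\<in>{1..<DIM('b)}. \<bar>(conormal y - conormal z) \<bullet> X k y\<bar>) \<le> (\<Sum>k\<in>{1..<DIM('b)}. C3 * norm (X k y - X k z))"
    proof (rule sum_mono)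
      fix k assume k: "k \<in> {1..<DIM('b)}"
      have "(conormal y - conormal z) \<bullet> X k y = - (conormal z \<bullet> (X k y - X k z))"
        using con[OF y] con[OF z] k by (simp add: inner_diff_left inner_diff_right)
      then have "\<bar>(conormal y - conormal z) \<bullet> X k y\<bar> \<le> norm (conormal z) * norm (X k y - X k z)"
        using Cauchy_Schwarz_ineq2[of "conormal z" "X k y - X k z"] by simp
      also have "\<dots> \<le> C3 * norm (X k y - X k z)" using con_norm[OF z] by (intro mult_right_mono) auto
      finally show "\<bar>(conormal y - conormal z) \<bullet> X k y\<bar> \<le> C3 * norm (X k y - X k z)" .
    qed
    also have "\<dots> = C3 * (\<Sum>k\<in>{1..<DIM('b)}. norm (X k y - X k z))" by (simp add: sum_distrib_left)
    also have "\<dots> \<le> C3 * (\<Lambda> * norm (y - z))" using subsetD[OF sub y] subsetD[OF sub z] by (intro mult_left_mono[OF Lip C3])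
    finally have *: "(\<Sum>k\<in>{1..<DIM('b)}. \<bar>(conormal y - conormal z) \<bullet> X k y\<bar>) \<le> C3 * (\<Lambda> * norm (y - z))" .
    have "(conormal y - conormal z) \<bullet> e 0 = 0" using con[OF y] con[OF z] by (simp add: inner_diff_left)
    then have "norm (conormal y - conormal z) \<le> C3 * (\<Sum>k\<in>{1..<DIM('b)}. \<bar>(conormal y - conormal z) \<bullet> X k y\<bar>)"
      using perturb[OF y, of "conormal y - conormal z"] by (simp add: C3_def)
    also have "\<dots> \<le> C3 * (C3 * (\<Lambda> * norm (y - z)))" using * C3 by (intro mult_left_mono) auto
    finally show ?thesis by (simp add: L'_def mult.assoc)
  qed
  define C2 where "C2 = (2 + C3 * E) * E"
  have C2: "0 \<le> C2" using C3 E_nonneg by (simp add: C2_def)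
  \<comment> \<open>The box bounds the conormal of \<open>x - y\<close>, while
    \<open>norm_le_l\<close> asks for \<open>l 0\<close>. The two differ by pairings of the conormal
    with the remaining \<open>e k\<close>, which the box bounds as well.\<close>
  have box_norm: "norm (x - y) \<le> C2 * \<epsilon>" if y: "y \<in> cball p R" and \<epsilon>: "0 \<le> \<epsilon>" "\<epsilon> \<le> 1" and x: "x \<in> box y \<epsilon>" for x y \<epsilon>
  proof -
    let ?v = "x - y"
    have lk: "\<bar>l k \<bullet> ?v\<bar> \<le> \<epsilon>" if "k \<in> {1..<DIM('b)}" for k using x that by (simp add: box_def)
    have "conormal y \<bullet> ?v = l 0 \<bullet> ?v + (\<Sum>k\<in>{1..<DIM('b)}. (l k \<bullet> ?v) * (conormal y \<bullet> e k))"
      using inner_expansion[of "conormal y" ?v] con[OF y] unfolding DIM_split[of "\<lambda>k. (l k \<bullet> ?v) * (conormal y \<bullet> e k)"] by simp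
    moreover have "\<bar>\<Sum>k\<in>{1..<DIM('b)}. (l k \<bullet> ?v) * (conormal y \<bullet> e k)\<bar> \<le> (\<Sum>k\<in>{1..<DIM('b)}. \<epsilon> * (C3 * norm (e k)))"
    proof (rule order_trans[OF sum_abs sum_mono])
      fix k assume k: "k \<in> {1..<DIM('b)}"
      have "\<bar>conormal y \<bullet> e k\<bar> \<le> C3 * norm (e k)"
        using Cauchy_Schwarz_ineq2[of "conormal y" "e k"] mult_right_mono[OF con_norm[OF y], of "norm (e k)"] by simp
      then show "\<bar>(l k \<bullet> ?v) * (conormal y \<bullet> e k)\<bar> \<le> \<epsilon> * (C3 * norm (e k))"
        unfolding abs_mult using lk[OF k] \<epsilon> by (intro mult_mono) auto
    qed
    moreover have "(\<Sum>k\<in>{1..<DIM('b)}. \<epsilon> * (C3 * norm (e k))) = \<epsilon> * C3 * (\<Sum>k\<in>{1..<DIM('b)}. norm (e k))"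
      by (simp add: sum_distrib_left mult.assoc)
    moreover have E1: "(\<Sum>k\<in>{1..<DIM('b)}. norm (e k)) \<le> E" unfolding E_def by (intro sum_mono2) auto
    then have "\<epsilon> * C3 * (\<Sum>k\<in>{1..<DIM('b)}. norm (e k)) \<le> \<epsilon> * C3 * E" using \<epsilon> C3 by (intro mult_left_mono) auto
    moreover have "\<bar>conormal y \<bullet> ?v\<bar> \<le> \<epsilon>" using x \<epsilon> power_le_one[of \<epsilon> 1] mult_right_mono[OF \<epsilon>(2) \<epsilon>(1)] by (auto simp: box_def power2_eq_square)
    ultimately have l0: "\<bar>l 0 \<bullet> ?v\<bar> \<le> \<epsilon> + \<epsilon> * C3 * E" by linarith
    have "norm ?v \<le> \<bar>l 0 \<bullet> ?v\<bar> * norm (e 0) + (\<Sum>k\<in>{1..<DIM('b)}. \<bar>l k \<bullet> ?v\<bar> * norm (e k))"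
      using norm_le_l[of ?v] unfolding DIM_split[of "\<lambda>k. \<bar>l k \<bullet> ?v\<bar> * norm (e k)"] .
    also have "\<bar>l 0 \<bullet> ?v\<bar> * norm (e 0) \<le> (\<epsilon> + \<epsilon> * C3 * E) * E"
      using l0 norm_e_le[of 0] \<epsilon> C3 E_nonneg by (intro mult_mono) auto
    also have "(\<Sum>k\<in>{1..<DIM('b)}. \<bar>l k \<bullet> ?v\<bar> * norm (e k)) \<le> (\<Sum>k\<in>{1..<DIM('b)}. \<epsilon> * norm (e k))"
      using lk by (intro sum_mono mult_right_mono) auto
    also have "\<dots> \<le> \<epsilon> * E" using E1 \<epsilon> by (simp add: sum_distrib_left[symmetric] mult_left_mono)
    finally show ?thesis by (simp add: C2_def algebra_simps)
  qed
  define D where "D = 3 * E + C2 + 1"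
  have D: "0 < D" using E_nonneg C2 by (simp add: D_def add_nonneg_pos)
  \<comment> \<open>The term with \<open>D\<close> keeps centers and boxes inside the ball. The last
    term gives \<open>r6\<close>, where \<open>1 / 6\<close> is chosen to reduce the factor 3 of the
    spacing to \<open>1 / 2\<close>.\<close>
  define r where "r = min 1 (min (R / (2 * D)) (1 / (6 * (L' * E * C2 + 1))))"
  have r: "0 < r" "r \<le> 1" using R D L'0 E_nonneg C2 by (auto simp: r_def add_nonneg_pos)
  have rD: "r * D \<le> R / 2"
  proof -
    have "r * D \<le> R / (2 * D) * D" using D by (intro mult_right_mono) (auto simp: r_def)
    then show ?thesis using D by simp
  qed
  have r6: "L' * E * C2 * r \<le> 1 / 6"
  proof -
    define q where "q = L' * E * C2"
    have q: "0 \<le> q" using L'0 E_nonneg C2 by (simp add: q_def)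
    have "q * r \<le> q * (1 / (6 * (q + 1)))" using q by (intro mult_left_mono) (auto simp: r_def q_def)
    also have "\<dots> \<le> 1 / 6" using q by (simp add: field_simps)
    finally show ?thesis by (simp add: q_def)
  qed
  have D1: "3 * E \<le> D" "C2 \<le> D" using E_nonneg C2 by (auto simp: D_def)
  have cen: "center (r / real N) i \<in> cball p (R / 2)" if N: "0 < N" and i: "i \<in> grid DIM('b) N" for N i
  proof -
    let ?\<epsilon> = "r / real N"
    have i0: "real (i 0) \<le> (real N)\<^sup>2"
    proof -
      have "i 0 < N\<^sup>2" using PiE_mem[OF i[unfolded grid_def], of 0] by simp
      then show ?thesis by (metis less_imp_le of_nat_le_iff of_nat_power)
    qed
    have ik: "real (i k) \<le> real N" if "k \<in> {1..<DIM('b)}" for k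
      using PiE_mem[OF i[unfolded grid_def], of k] that by simp
    have "norm (center ?\<epsilon> i - p) \<le> norm ((3 * ?\<epsilon>\<^sup>2 * real (i 0)) *\<^sub>R e 0) + norm (\<Sum>k\<in>{1..<DIM('b)}. (3 * ?\<epsilon> * real (i k)) *\<^sub>R e k)"
      unfolding center_def by (metis (no_types, lifting) add.assoc add_diff_cancel_left' norm_triangle_ineq)
    also have "norm ((3 * ?\<epsilon>\<^sup>2 * real (i 0)) *\<^sub>R e 0) \<le> 3 * r * norm (e 0)"
    proof -
      have "3 * ?\<epsilon>\<^sup>2 * real (i 0) \<le> 3 * ?\<epsilon>\<^sup>2 * (real N)\<^sup>2" using i0 by (intro mult_left_mono) auto
      also have "\<dots> = 3 * (r * r)" using N by (simp add: power_divide power2_eq_square)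
      also have "\<dots> \<le> 3 * (r * 1)" using r by (intro mult_left_mono) auto
      finally show ?thesis using r by (simp add: mult_right_mono)
    qed
    also have "norm (\<Sum>k\<in>{1..<DIM('b)}. (3 * ?\<epsilon> * real (i k)) *\<^sub>R e k) \<le> (\<Sum>k\<in>{1..<DIM('b)}. 3 * r * norm (e k))"
    proof (rule sum_norm_le)
      fix k assume k: "k \<in> {1..<DIM('b)}"
      have "3 * ?\<epsilon> * real (i k) \<le> 3 * ?\<epsilon> * real N" using ik[OF k] r by (intro mult_left_mono) auto
      also have "\<dots> = 3 * r" using N by simp
      finally have "3 * ?\<epsilon> * real (i k) * norm (e k) \<le> 3 * r * norm (e k)" by (rule mult_right_mono) simp
      moreover have "\<bar>3 * ?\<epsilon> * real (i k)\<bar> = 3 * ?\<epsilon> * real (i k)" using r by (intro abs_of_nonneg) simp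
      ultimately show "norm ((3 * ?\<epsilon> * real (i k)) *\<^sub>R e k) \<le> 3 * r * norm (e k)" by (simp only: norm_scaleR)
    qed
    finally have "norm (center ?\<epsilon> i - p) \<le> 3 * r * norm (e 0) + (\<Sum>k\<in>{1..<DIM('b)}. 3 * r * norm (e k))" by simp
    also have "\<dots> = r * (3 * E)"
      unfolding E_def DIM_split[of "\<lambda>k. norm (e k)"] by (simp add: sum_distrib_left algebra_simps)
    also have "\<dots> \<le> r * D" using r D1 by (intro mult_left_mono) auto
    finally show ?thesis using rD by (simp add: dist_norm norm_minus_commute)
  qed
  have \<epsilon>: "0 < r / real N" "r / real N \<le> r" if "0 < N" for N
  proof -
    have "1 \<le> real N" using that by simp
    then show "0 < r / real N" "r / real N \<le> r" using r by (auto simp: divide_le_eq)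
  qed
  have cenR: "center (r / real N) i \<in> cball p R" if "0 < N" "i \<in> grid DIM('b) N" for N i
    using cen[OF that] R by auto
  have bx: "x \<in> cball p R \<and> norm (x - center (r / real N) i) \<le> C2 * (r / real N)"
    if N: "0 < N" and i: "i \<in> grid DIM('b) N" and x: "x \<in> box (center (r / real N) i) (r / real N)" for N i x
  proof -
    have *: "norm (x - center (r / real N) i) \<le> C2 * (r / real N)"
      using box_norm[OF cenR[OF N i] _ _ x] \<epsilon>[OF N] r by auto
    also have "\<dots> \<le> D * r" using D1 \<epsilon>[OF N] C2 r by (intro mult_mono) auto
    finally have "norm (x - center (r / real N) i) \<le> R / 2" using rD by (simp add: mult.commute)
    then have "dist p x \<le> R"
      using cen[OF N i] dist_triangle[of p x "center (r / real N) i"] by (simp add: dist_norm norm_minus_commute)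
    then show ?thesis using * by simp
  qed
  have disj: "i = j"
    if N: "0 < N" and i: "i \<in> grid DIM('b) N" and j: "j \<in> grid DIM('b) N"
      and x: "x \<in> box (center (r / real N) i) (r / real N)" "x \<in> box (center (r / real N) j) (r / real N)" for N i j x
  proof -
    define \<epsilon>' where "\<epsilon>' = r / real N"
    have \<epsilon>': "0 < \<epsilon>'" "\<epsilon>' \<le> r" using \<epsilon>[OF N] by (auto simp: \<epsilon>'_def)
    define y z where "y = center \<epsilon>' i" and "z = center \<epsilon>' j"
    have yz: "y \<in> cball p R" "z \<in> cball p R" using cenR[OF N i] cenR[OF N j] by (auto simp: y_def z_def \<epsilon>'_def)
    have xy: "x \<in> box y \<epsilon>'" "x \<in> box z \<epsilon>'" using x by (auto simp: y_def z_def \<epsilon>'_def)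
    have eqk: "i k = j k" if k: "k \<in> {1..<DIM('b)}" for k
    proof -
      have "\<bar>l k \<bullet> (x - y)\<bar> \<le> \<epsilon>'" "\<bar>l k \<bullet> (x - z)\<bar> \<le> \<epsilon>'" using xy k by (auto simp: box_def)
      then have "\<bar>l k \<bullet> (y - z)\<bar> \<le> 2 * \<epsilon>'" by (auto simp: inner_diff_right)
      then have "3 * \<epsilon>' * \<bar>real (i k) - real (j k)\<bar> \<le> 2 * \<epsilon>'"
        using \<epsilon>' unfolding y_def z_def l_center[OF k] by (simp add: abs_mult)
      then have "\<bar>real (i k) - real (j k)\<bar> < 1" using \<epsilon>' by simp
      then show ?thesis by (rule nat_eq_if_close)
    qed
    define \<Delta> where "\<Delta> = real (i 0) - real (j 0)"
    \<comment> \<open>From here only the index of weight 2 is left. The estimates below amount to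
      \<open>3 * \<bar>\<Delta>\<bar> \<le> 2 + \<bar>\<Delta>\<bar> / 2\<close>, which excludes a
      difference of 1 or more.\<close>
    have yz0: "y - z = (3 * \<epsilon>'\<^sup>2 * \<Delta>) *\<^sub>R e 0"
    proof -
      have "(\<Sum>k\<in>{1..<DIM('b)}. (3 * \<epsilon>' * real (i k)) *\<^sub>R e k) = (\<Sum>k\<in>{1..<DIM('b)}. (3 * \<epsilon>' * real (j k)) *\<^sub>R e k)"
        using eqk by (intro sum.cong) auto
      then show ?thesis by (simp add: y_def z_def center_def \<Delta>_def scaleR_diff_left[symmetric] right_diff_distrib)
    qed
    have "\<bar>conormal y \<bullet> (y - z)\<bar> = 3 * \<epsilon>'\<^sup>2 * \<bar>\<Delta>\<bar>" using con[OF yz(1)] by (simp add: yz0 abs_mult)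
    moreover have "conormal y \<bullet> (y - z) = conormal z \<bullet> (x - z) - conormal y \<bullet> (x - y) + (conormal y - conormal z) \<bullet> (x - z)"
      by (simp add: inner_diff_left inner_diff_right)
    moreover have "\<bar>conormal z \<bullet> (x - z)\<bar> \<le> \<epsilon>'\<^sup>2" "\<bar>conormal y \<bullet> (x - y)\<bar> \<le> \<epsilon>'\<^sup>2" using xy by (auto simp: box_def)
    moreover have "\<bar>(conormal y - conormal z) \<bullet> (x - z)\<bar> \<le> \<epsilon>'\<^sup>2 * \<bar>\<Delta>\<bar> * (1 / 2)"
    proof -
      have "\<bar>(conormal y - conormal z) \<bullet> (x - z)\<bar> \<le> norm (conormal y - conormal z) * norm (x - z)" by (rule Cauchy_Schwarz_ineq2)
      also have "\<dots> \<le> (L' * norm (y - z)) * (C2 * \<epsilon>')"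
        using con_lip[OF yz] box_norm[OF yz(2) _ _ xy(2)] \<epsilon>' r L'0 by (intro mult_mono) auto
      also have "norm (y - z) = 3 * \<epsilon>'\<^sup>2 * \<bar>\<Delta>\<bar> * norm (e 0)" by (simp add: yz0 abs_mult)
      also have "L' * (3 * \<epsilon>'\<^sup>2 * \<bar>\<Delta>\<bar> * norm (e 0)) * (C2 * \<epsilon>') = (3 * \<epsilon>'\<^sup>2 * \<bar>\<Delta>\<bar>) * (L' * norm (e 0) * C2 * \<epsilon>')" by simp
      also have "\<dots> \<le> (3 * \<epsilon>'\<^sup>2 * \<bar>\<Delta>\<bar>) * (L' * E * C2 * r)"
        using norm_e_le[of 0] \<epsilon>' L'0 C2 E_nonneg by (intro mult_left_mono mult_mono) auto
      also have "\<dots> \<le> (3 * \<epsilon>'\<^sup>2 * \<bar>\<Delta>\<bar>) * (1 / 6)" using r6 by (intro mult_left_mono) auto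
      finally show ?thesis by (simp add: mult.commute)
    qed
    ultimately have "3 * \<epsilon>'\<^sup>2 * \<bar>\<Delta>\<bar> \<le> 2 * \<epsilon>'\<^sup>2 + \<epsilon>'\<^sup>2 * \<bar>\<Delta>\<bar> * (1 / 2)"
      by linarith
    then have "\<epsilon>'\<^sup>2 * (3 * \<bar>\<Delta>\<bar>) \<le> \<epsilon>'\<^sup>2 * (2 + \<bar>\<Delta>\<bar> * (1 / 2))" by (simp add: algebra_simps)
    then have "3 * \<bar>\<Delta>\<bar> \<le> 2 + \<bar>\<Delta>\<bar> * (1 / 2)" using \<epsilon>' by (simp add: mult_le_cancel_left)
    then have "\<bar>\<Delta>\<bar> < 1" by linarith
    then have "i 0 = j 0" unfolding \<Delta>_def by (rule nat_eq_if_close)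
    then have "i k = j k" if "k \<in> {..<DIM('b)}" for k using eqk that by (cases "k = 0") auto
    then show ?thesis using i j unfolding grid_def by (rule PiE_ext[rotated 2])
  qed
  show thesis
  proof (rule that[of r R C2 C3])
    show "cball p R \<subseteq> U" using sub R0 by blast
    show "\<forall>y\<in>cball p R. norm (conormal y) \<le> C3 \<and> (\<forall>j\<in>{1..<DIM('b)}. conormal y \<bullet> X j y = 0)"
      using con con_norm by blast
    show "\<forall>N>0. \<forall>i\<in>grid DIM('b) N. center (r / real N) i \<in> cball p R \<and>
      (\<forall>x\<in>box (center (r / real N) i) (r / real N). x \<in> cball p R \<and> norm (x - center (r / real N) i) \<le> C2 * (r / real N))"
      using cenR bx by blast
    show "\<forall>N>0. \<forall>i\<in>grid DIM('b) N. \<forall>j\<in>grid DIM('b) N. i \<noteq> j \<longrightarrow>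
      box (center (r / real N) i) (r / real N) \<inter> box (center (r / real N) j) (r / real N) = {}"
      using disj by blast
  qed (use r R C2 C3 in auto)
qed

end


section \<open>Derivatives along the frame\<close>

definition wt :: "nat \<Rightarrow> nat" where
  "wt j = (if j = 0 then 2 else 1)"

text \<open>A single index set holds the boxes of all scales, so that constants which do not depend
  on the index are uniform in the scale.\<close>

locale box_family = moving_frame U X p
  for U :: "'b::euclidean_space set" and X p +
  fixes I :: "'i set" and eps :: "'i \<Rightarrow> real" and Bx :: "'i \<Rightarrow> 'b set" and K :: "'b set"
  assumes eps: "\<And>i. i \<in> I \<Longrightarrow> 0 < eps i" "\<And>i. i \<in> I \<Longrightarrow> eps i \<le> 1"
    and Bx: "\<And>i. i \<in> I \<Longrightarrow> Bx i \<subseteq> K"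
    and K: "compact K" "K \<subseteq> U"
begin

text \<open>Families of functions whose derivatives along up to \<open>n\<close> frame fields are, on the boxes, of the order of
  \<open>\<epsilon>\<close> to the power \<open>-w\<close> minus the weight of the fields.\<close>

definition bnd :: "nat \<Rightarrow> ('i \<Rightarrow> 'b \<Rightarrow> real) \<Rightarrow> bool" where
  "bnd w g \<longleftrightarrow> (\<exists>C\<ge>0. \<forall>i\<in>I. \<forall>x\<in>Bx i. \<bar>g i x\<bar> \<le> C / eps i ^ w)"

primrec order :: "nat \<Rightarrow> nat \<Rightarrow> ('i \<Rightarrow> 'b \<Rightarrow> real) \<Rightarrow> bool" where
  "order 0 w g \<longleftrightarrow> bnd w g"
| "order (Suc n) w g \<longleftrightarrow> bnd w g \<and> (\<forall>i\<in>I. \<forall>x\<in>U. g i differentiable at x) \<and>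
     (\<forall>j<DIM('b). order n (w + wt j) (\<lambda>i x. frechet_derivative (g i) (at x) (X j x)))"

lemma order_0: "order n w g \<Longrightarrow> bnd w g"
  by (cases n) auto

lemma order_Suc_D: "order (Suc n) w g \<Longrightarrow> order n w g"
proof (induction n arbitrary: w g)
  case 0
  then show ?case by simp
next
  case (Suc n)
  then show ?case unfolding order.simps(2)[of "Suc n"] by (subst order.simps(2)) blast
qed

lemma bndI: "0 \<le> C \<Longrightarrow> (\<And>i x. i \<in> I \<Longrightarrow> x \<in> Bx i \<Longrightarrow> \<bar>g i x\<bar> \<le> C / eps i ^ w) \<Longrightarrow> bnd w g"
  by (auto simp: bnd_def)

lemma bndE:
  assumes "bnd w g"
  obtains C where "0 \<le> C" "\<And>i x. i \<in> I \<Longrightarrow> x \<in> Bx i \<Longrightarrow> \<bar>g i x\<bar> \<le> C / eps i ^ w"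
  using assms by (auto simp: bnd_def)

lemma bnd_mono:
  assumes "bnd w g" "w \<le> w'"
  shows "bnd w' g"
proof -
  obtain C where C: "0 \<le> C" "\<And>i x. i \<in> I \<Longrightarrow> x \<in> Bx i \<Longrightarrow> \<bar>g i x\<bar> \<le> C / eps i ^ w"
    by (rule bndE[OF assms(1)], rule that)
  show ?thesis
  proof (rule bndI[OF C(1)])
    fix i x assume i: "i \<in> I" "x \<in> Bx i"
    have "eps i ^ w' \<le> eps i ^ w" using eps[OF i(1)] assms(2) by (intro power_decreasing) auto
    then have "C / eps i ^ w \<le> C / eps i ^ w'" using C(1) eps[OF i(1)] by (intro divide_left_mono) auto
    then show "\<bar>g i x\<bar> \<le> C / eps i ^ w'" using C(2)[OF i] by simp
  qed
qed

lemma box_U: "i \<in> I \<Longrightarrow> x \<in> Bx i \<Longrightarrow> x \<in> U"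
  using Bx K(2) by blast

lemma bnd_cong: "(\<And>i x. i \<in> I \<Longrightarrow> x \<in> U \<Longrightarrow> f i x = g i x) \<Longrightarrow> bnd w f \<Longrightarrow> bnd w g"
  using box_U by (auto simp: bnd_def)

lemma bnd_add:
  assumes "bnd w f" "bnd w g"
  shows "bnd w (\<lambda>i x. f i x + g i x)"
proof -
  obtain C where C: "0 \<le> C" "\<And>i x. i \<in> I \<Longrightarrow> x \<in> Bx i \<Longrightarrow> \<bar>f i x\<bar> \<le> C / eps i ^ w"
    by (rule bndE[OF assms(1)], rule that)
  obtain D where D: "0 \<le> D" "\<And>i x. i \<in> I \<Longrightarrow> x \<in> Bx i \<Longrightarrow> \<bar>g i x\<bar> \<le> D / eps i ^ w"
    by (rule bndE[OF assms(2)], rule that)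
  show ?thesis
  proof (rule bndI[of "C + D"])
    fix i x assume i: "i \<in> I" "x \<in> Bx i"
    show "\<bar>f i x + g i x\<bar> \<le> (C + D) / eps i ^ w"
      using C(2)[OF i] D(2)[OF i] unfolding add_divide_distrib by linarith
  qed (use C D in simp)
qed

lemma bnd_mult:
  assumes "bnd w f" "bnd w' g"
  shows "bnd (w + w') (\<lambda>i x. f i x * g i x)"
proof -
  obtain C where C: "0 \<le> C" "\<And>i x. i \<in> I \<Longrightarrow> x \<in> Bx i \<Longrightarrow> \<bar>f i x\<bar> \<le> C / eps i ^ w"
    by (rule bndE[OF assms(1)], rule that)
  obtain D where D: "0 \<le> D" "\<And>i x. i \<in> I \<Longrightarrow> x \<in> Bx i \<Longrightarrow> \<bar>g i x\<bar> \<le> D / eps i ^ w'"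
    by (rule bndE[OF assms(2)], rule that)
  show ?thesis
  proof (rule bndI[of "C * D"])
    fix i x assume i: "i \<in> I" "x \<in> Bx i"
    have "\<bar>f i x\<bar> * \<bar>g i x\<bar> \<le> (C / eps i ^ w) * (D / eps i ^ w')"
      using C D i eps(1)[OF i(1)] by (intro mult_mono) auto
    then show "\<bar>f i x * g i x\<bar> \<le> (C * D) / eps i ^ (w + w')" by (simp add: abs_mult power_add)
  qed (use C D in simp)
qed

lemma bnd_smooth:
  assumes f: "smooth_on U (f :: 'b \<Rightarrow> real)"
  shows "bnd 0 (\<lambda>i. f)"
proof -
  have "continuous_on K f" using smooth_on_continuous_on[OF f] K(2) by (rule continuous_on_subset)
  then have "bounded (f ` K)" using K(1) by (intro compact_imp_bounded compact_continuous_image)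
  then obtain C where C: "\<And>x. x \<in> K \<Longrightarrow> \<bar>f x\<bar> \<le> C" by (auto simp: bounded_iff)
  show ?thesis
  proof (rule bndI[of "\<bar>C\<bar>"])
    fix i x assume "i \<in> I" "x \<in> Bx i"
    then have "x \<in> K" using Bx by blast
    then show "\<bar>f x\<bar> \<le> \<bar>C\<bar> / eps i ^ 0" using C[of x] by simp
  qed simp
qed

section \<open>Calculus for families of given order\<close>

lemma order_mono: "order n w g \<Longrightarrow> w \<le> w' \<Longrightarrow> order n w' g"
proof (induction n arbitrary: w w' g)
  case 0
  then show ?case by (simp add: bnd_mono)
next
  case (Suc n)
  have "order n (w' + wt j) (\<lambda>i x. frechet_derivative (g i) (at x) (X j x))" if "j < DIM('b)" for j
    by (rule Suc.IH[of "w + wt j"]) (use Suc.prems that in auto)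
  then show ?case using Suc.prems bnd_mono[of w g w'] by simp
qed

lemma order_cong:
  assumes "\<And>i x. i \<in> I \<Longrightarrow> x \<in> U \<Longrightarrow> f i x = g i x" "order n w f"
  shows "order n w g"
  using assms
proof (induction n arbitrary: w f g)
  case 0
  then show ?case using bnd_cong[of f g w] by simp
next
  case (Suc n)
  have "order n (w + wt j) (\<lambda>i x. frechet_derivative (g i) (at x) (X j x))" if "j < DIM('b)" for j
  proof (rule Suc.IH[of "\<lambda>i x. frechet_derivative (f i) (at x) (X j x)"])
    fix i x assume "i \<in> I" "x \<in> U"
    then show "frechet_derivative (f i) (at x) (X j x) = frechet_derivative (g i) (at x) (X j x)"
      using frechet_derivative_cong_open[OF U, of x "f i" "g i"] Suc.prems(1) by simp
  qed (use Suc.prems that in simp)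
  moreover have "g i differentiable at x" if "i \<in> I" "x \<in> U" for i x
    using differentiable_cong_open[OF U that(2), of "f i" "g i"] Suc.prems that by simp
  ultimately show ?case using bnd_cong[of f g w] Suc.prems by simp
qed

lemma order_Suc_I:
  assumes "bnd w g" and d: "\<And>i x. i \<in> I \<Longrightarrow> x \<in> U \<Longrightarrow> (g i has_derivative g' i x) (at x)"
    and g': "\<And>j. j < DIM('b) \<Longrightarrow> order n (w + wt j) (\<lambda>i x. g' i x (X j x))"
  shows "order (Suc n) w g"
proof -
  have "order n (w + wt j) (\<lambda>i x. frechet_derivative (g i) (at x) (X j x))" if "j < DIM('b)" for j
    by (rule order_cong[OF _ g'[OF that]]) (use frechet_derivative_at[OF d] in auto)
  then show ?thesis using assms(1) d by (auto simp: differentiable_def)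
qed

lemma order_derivative:
  "order (Suc n) w g \<Longrightarrow> i \<in> I \<Longrightarrow> x \<in> U \<Longrightarrow> (g i has_derivative frechet_derivative (g i) (at x)) (at x)"
  by (simp add: frechet_derivative_works[symmetric])

lemma order_add: "order n w f \<Longrightarrow> order n w g \<Longrightarrow> order n w (\<lambda>i x. f i x + g i x)"
proof (induction n arbitrary: w f g)
  case 0
  then show ?case by (simp add: bnd_add)
next
  case (Suc n)
  show ?case
  proof (rule order_Suc_I)
    show "bnd w (\<lambda>i x. f i x + g i x)" using Suc.prems by (simp add: bnd_add)
    fix i x assume ix: "i \<in> I" "x \<in> U"
    show "((\<lambda>x. f i x + g i x) has_derivative (\<lambda>v. frechet_derivative (f i) (at x) v + frechet_derivative (g i) (at x) v)) (at x)"
      by (rule has_derivative_add[OF order_derivative[OF Suc.prems(1) ix] order_derivative[OF Suc.prems(2) ix]])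
  next
    fix j assume "j < DIM('b)"
    then show "order n (w + wt j) (\<lambda>i x. frechet_derivative (f i) (at x) (X j x) + frechet_derivative (g i) (at x) (X j x))"
      using Suc by simp
  qed
qed

lemma order_mult: "order n w f \<Longrightarrow> order n w' g \<Longrightarrow> order n (w + w') (\<lambda>i x. f i x * g i x)"
proof (induction n arbitrary: w w' f g)
  case 0
  then show ?case by (simp add: bnd_mult)
next
  case (Suc n)
  show ?case
  proof (rule order_Suc_I)
    show "bnd (w + w') (\<lambda>i x. f i x * g i x)" using Suc.prems by (simp add: bnd_mult)
    fix i x assume ix: "i \<in> I" "x \<in> U"
    show "((\<lambda>x. f i x * g i x) has_derivative (\<lambda>v. f i x * frechet_derivative (g i) (at x) v + frechet_derivative (f i) (at x) v * g i x)) (at x)"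
      by (rule has_derivative_mult[OF order_derivative[OF Suc.prems(1) ix] order_derivative[OF Suc.prems(2) ix]])
  next
    fix j assume j: "j < DIM('b)"
    have "order n (w + (w' + wt j)) (\<lambda>i x. f i x * frechet_derivative (g i) (at x) (X j x))"
      by (rule Suc.IH[OF order_Suc_D[OF Suc.prems(1)]]) (use Suc.prems j in simp)
    moreover have "order n (w + wt j + w') (\<lambda>i x. frechet_derivative (f i) (at x) (X j x) * g i x)"
      by (rule Suc.IH[OF _ order_Suc_D[OF Suc.prems(2)]]) (use Suc.prems j in simp)
    ultimately show "order n (w + w' + wt j) (\<lambda>i x. f i x * frechet_derivative (g i) (at x) (X j x) + frechet_derivative (f i) (at x) (X j x) * g i x)"
      by (intro order_add) (simp_all add: add_ac)
  qed
qed

lemma bnd_zero: "bnd w (\<lambda>i x. 0)"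
  by (rule bndI[of 0]) simp_all

lemma order_zero: "order n w (\<lambda>i x. 0)"
proof (induction n arbitrary: w)
  case (Suc n)
  show ?case by (rule order_Suc_I[where g' = "\<lambda>_ _ _. 0"]) (use Suc bnd_zero in auto)
qed (simp add: bnd_zero)

lemma order_const:
  assumes "0 \<le> C" "\<And>i. i \<in> I \<Longrightarrow> \<bar>c i\<bar> \<le> C / eps i ^ w"
  shows "order n w (\<lambda>i x. c i)"
proof -
  have 0: "bnd w (\<lambda>i x. c i)" by (rule bndI[OF assms(1)]) (use assms(2) in simp)
  have "order (Suc n) w (\<lambda>i x. c i)"
    by (rule order_Suc_I[OF 0, where g' = "\<lambda>_ _ _. 0"]) (simp_all add: order_zero)
  then show ?thesis by (rule order_Suc_D)
qed

lemma order_sum: "(\<And>m. m \<in> J \<Longrightarrow> order n w (f m)) \<Longrightarrow> order n w (\<lambda>i x. \<Sum>m\<in>J. f m i x)"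
  by (induction J rule: infinite_finite_induct) (simp_all add: order_zero order_add del: order.simps)

lemma order_prod: "(\<And>m. m \<in> J \<Longrightarrow> order n 0 (f m)) \<Longrightarrow> order n 0 (\<lambda>i x. \<Prod>m\<in>J. f m i x)"
proof (induction J rule: infinite_finite_induct)
  case (insert m J)
  then show ?case using order_mult[of n 0 "f m" 0 "\<lambda>i x. \<Prod>m\<in>J. f m i x"] by (simp del: order.simps)
qed (simp_all add: order_const[of 1] del: order.simps)

lemma smooth_on_frame_derivative:
  assumes f: "smooth_on U (f :: 'b \<Rightarrow> 'c::real_normed_vector)" and j: "j < DIM('b)"
  shows "smooth_on U (\<lambda>x. frechet_derivative f (at x) (X j x))"
proof (rule smooth_on_cong[OF U])
  show "smooth_on U (\<lambda>x. \<Sum>b\<in>Basis. (X j x \<bullet> b) *\<^sub>R frechet_derivative f (at x) b)"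
    by (rule smooth_on_sum[OF U], rule smooth_on_bilinear[OF U bounded_bilinear_scaleR],
        rule smooth_on_linear[OF U bounded_linear_inner_left X_smooth[OF j]], rule smooth_on_frechet[OF f])
  fix x assume "x \<in> U"
  then have lin: "linear (frechet_derivative f (at x))" using smooth_on_has_derivative[OF f] has_derivative_linear by blast
  show "(\<Sum>b\<in>Basis. (X j x \<bullet> b) *\<^sub>R frechet_derivative f (at x) b) = frechet_derivative f (at x) (X j x)"
    by (subst (2) euclidean_representation[of "X j x", symmetric])
      (simp add: linear_sum[OF lin] linear_cmul[OF lin])
qed

text \<open>For a function independent of the box all derivatives are bounded, and a larger weight
  is a weaker claim since \<open>eps i \<le> 1\<close>.\<close>

lemma order_smooth:
  fixes f :: "'b \<Rightarrow> real"
  shows "smooth_on U f \<Longrightarrow> order n 0 (\<lambda>i. f)"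
proof (induction n arbitrary: f)
  case 0
  then show ?case by (simp add: bnd_smooth)
next
  case (Suc n)
  show ?case
  proof (rule order_Suc_I[OF bnd_smooth[OF Suc.prems]])
    fix x assume "x \<in> U" then show "(f has_derivative frechet_derivative f (at x)) (at x)"
      using smooth_on_has_derivative[OF Suc.prems] by blast
  next
    fix j assume j: "j < DIM('b)"
    show "order n (0 + wt j) (\<lambda>i x. frechet_derivative f (at x) (X j x))"
      by (rule order_mono[OF Suc.IH[OF smooth_on_frame_derivative[OF Suc.prems j]]]) simp
  qed
qed

lemma order_inner:
  fixes h :: "'b \<Rightarrow> 'b"
  assumes h: "smooth_on U h" and w: "\<And>i. i \<in> I \<Longrightarrow> norm (w i) \<le> C"
  shows "order n 0 (\<lambda>i x. w i \<bullet> h x)"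
proof -
  have "order n 0 (\<lambda>i x. \<Sum>b\<in>Basis. (w i \<bullet> b) * (h x \<bullet> b))"
  proof (rule order_sum)
    fix b :: 'b assume b: "b \<in> Basis"
    have "order n 0 (\<lambda>i x. w i \<bullet> b)"
    proof (rule order_const[of "\<bar>C\<bar>"])
      fix i assume "i \<in> I"
      then show "\<bar>w i \<bullet> b\<bar> \<le> \<bar>C\<bar> / eps i ^ 0" using w[of i] Basis_le_norm[OF b, of "w i"] by simp
    qed simp
    moreover have "order n 0 (\<lambda>i x. h x \<bullet> b)"
      by (rule order_smooth[OF smooth_on_linear[OF U bounded_linear_inner_left h]])
    ultimately show "order n 0 (\<lambda>i x. (w i \<bullet> b) * (h x \<bullet> b))" using order_mult[of n 0 _ 0] by simp
  qed
  then show ?thesis by (simp add: euclidean_inner[symmetric] del: order.simps)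
qed

lemma order_scaled:
  assumes "order n w g"
  shows "order n (w + k) (\<lambda>i x. s * (g i x / eps i ^ k))"
proof -
  have "order n k (\<lambda>i x. s / eps i ^ k)"
  proof (rule order_const[of "\<bar>s\<bar>"])
    fix i assume "i \<in> I"
    then have "0 < eps i ^ k" using eps(1) by simp
    then show "\<bar>s / eps i ^ k\<bar> \<le> \<bar>s\<bar> / eps i ^ k" by (simp add: abs_divide)
  qed simp
  from order_mult[OF assms this] show ?thesis by (simp add: mult.commute del: order.simps)
qed

text \<open>The one place where it matters that the boxes are adapted to the frame at their centers.\<close>

lemma order_conormal:
  assumes w: "\<And>i. i \<in> I \<Longrightarrow> norm (w i) \<le> C" and j: "j < DIM('b)"
    and b: "0 < j \<Longrightarrow> \<exists>C\<ge>0. \<forall>i\<in>I. \<forall>x\<in>Bx i. \<bar>w i \<bullet> X j x\<bar> \<le> C * eps i"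
  shows "order n (wt j) (\<lambda>i x. s * ((w i \<bullet> X j x) / (eps i)\<^sup>2))"
proof (cases "j = 0")
  case True
  have "order n 0 (\<lambda>i x. w i \<bullet> X j x)" by (rule order_inner[OF X_smooth[OF j] w])
  from order_scaled[OF this, of 2 s] show ?thesis using True by (simp add: wt_def numeral_2_eq_2 del: order.simps)
next
  case False
  then obtain C' where C': "0 \<le> C'" "\<And>i x. i \<in> I \<Longrightarrow> x \<in> Bx i \<Longrightarrow> \<bar>w i \<bullet> X j x\<bar> \<le> C' * eps i" using b by auto
  have 0: "bnd 1 (\<lambda>i x. s * ((w i \<bullet> X j x) / (eps i)\<^sup>2))"
  proof -
    have "\<bar>s * ((w i \<bullet> X j x) / (eps i)\<^sup>2)\<bar> \<le> (\<bar>s\<bar> * C') / eps i ^ 1" if "i \<in> I" "x \<in> Bx i" for i x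
    proof -
      have "\<bar>w i \<bullet> X j x\<bar> / (eps i)\<^sup>2 \<le> C' * eps i / (eps i)\<^sup>2"
        using C'(2)[OF that] by (intro divide_right_mono) auto
      also have "\<dots> = C' / eps i" using eps(1)[OF that(1)] by (simp add: power2_eq_square)
      finally have "\<bar>s\<bar> * (\<bar>w i \<bullet> X j x\<bar> / (eps i)\<^sup>2) \<le> \<bar>s\<bar> * (C' / eps i)" by (rule mult_left_mono) simp
      then show ?thesis by (simp add: abs_mult)
    qed
    then show ?thesis using C'(1) by (intro bndI[of "\<bar>s\<bar> * C'"]) auto
  qed
  show ?thesis
  proof (cases n)
    case 0
    then show ?thesis using \<open>bnd 1 _\<close> False by (simp add: wt_def)
  next
    case (Suc m)
    have "order (Suc m) 1 (\<lambda>i x. s * ((w i \<bullet> X j x) / (eps i)\<^sup>2))"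
    proof (rule order_Suc_I[OF 0])
      fix i x assume ix: "i \<in> I" "x \<in> U"
      have "((\<lambda>x. w i \<bullet> X j x) has_derivative (\<lambda>v. w i \<bullet> frechet_derivative (X j) (at x) v)) (at x)"
        by (intro has_derivative_inner_right smooth_on_has_derivative[OF X_smooth[OF j] ix(2)])
      then show "((\<lambda>x. s * ((w i \<bullet> X j x) / (eps i)\<^sup>2)) has_derivative (\<lambda>v. s * ((w i \<bullet> frechet_derivative (X j) (at x) v) / (eps i)\<^sup>2))) (at x)"
        using has_derivative_mult_right[of _ _ _ "s / (eps i)\<^sup>2"] by fastforce
    next
      fix k assume k: "k < DIM('b)"
      \<comment> \<open>After one differentiation the gain on the boxes is gone. The crude bound of
        order 2 suffices now, because the two weights already add up to at least 2.\<close>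
      have "order m (0 + 2) (\<lambda>i x. s * ((w i \<bullet> frechet_derivative (X j) (at x) (X k x)) / (eps i)\<^sup>2))"
        by (rule order_scaled[OF order_inner[OF smooth_on_frame_derivative[OF X_smooth[OF j] k] w]])
      then show "order m (1 + wt k) (\<lambda>i x. s * ((w i \<bullet> frechet_derivative (X j) (at x) (X k x)) / (eps i)\<^sup>2))"
        by (rule order_mono) (simp add: wt_def)
    qed
    then show ?thesis using Suc False by (simp add: wt_def del: order.simps)
  qed
qed

text \<open>Chain rule and induction, for all polynomials \<open>q\<close> simultaneously:
  differentiation replaces \<open>q\<close> by \<open>flat_deriv q\<close> and produces the factor
  \<open>u'\<close>, which carries the weight. The range of \<open>u\<close> keeps all
  \<open>flat q\<close> bounded.\<close>

lemma order_flat: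
  assumes u: "\<And>i x. i \<in> I \<Longrightarrow> (u i has_derivative u' i) (at x)"
    and range: "\<And>i x. i \<in> I \<Longrightarrow> x \<in> Bx i \<Longrightarrow> u i x \<in> {0..2}"
    and u': "\<And>j n. j < DIM('b) \<Longrightarrow> order n (wt j) (\<lambda>i x. u' i (X j x))"
  shows "order n 0 (\<lambda>i x. flat q (u i x))"
proof (induction n arbitrary: q)
  case 0
  obtain C where C: "\<And>x. x \<in> {0..2} \<Longrightarrow> \<bar>flat q x\<bar> \<le> C" using flat_bounded[of 2 q] by blast
  have "\<bar>flat q (u i x)\<bar> \<le> \<bar>C\<bar>" if "i \<in> I" "x \<in> Bx i" for i x using C[OF range[OF that]] by simp
  then show ?case by (simp, intro bndI[of "\<bar>C\<bar>"]) auto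
next
  case (Suc n)
  show ?case
  proof (rule order_Suc_I[OF order_0[OF Suc.IH]])
    fix i x assume "i \<in> I" "x \<in> U"
    have "(flat q has_derivative (\<lambda>v. flat (flat_deriv q) (u i x) * v)) (at (u i x))"
      using flat_has_real_derivative[of q "u i x"] by (simp add: has_field_derivative_def)
    from has_derivative_compose[OF u[OF \<open>i \<in> I\<close>] this]
    show "((\<lambda>x. flat q (u i x)) has_derivative (\<lambda>v. flat (flat_deriv q) (u i x) * u' i v)) (at x)" .
  next
    fix j assume "j < DIM('b)"
    from order_mult[OF Suc.IH u'[OF this]]
    show "order n (0 + wt j) (\<lambda>i x. flat (flat_deriv q) (u i x) * u' i (X j x))" .
  qed
qed

text \<open>\<open>R f g\<close> will say that \<open>f\<close> is, in a chart and a trivialization, \<open>g\<close> times a fixed vector.\<close>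

lemma order_power_transfer:
  assumes g: "\<And>n. order n w g" and j: "j < DIM('b)"
    and D: "\<And>i f g. i \<in> I \<Longrightarrow> (\<And>x. x \<in> U \<Longrightarrow> g differentiable at x) \<Longrightarrow> R f g \<Longrightarrow> R (D f) (\<lambda>x. frechet_derivative g (at x) (X j x))"
    and R: "\<And>i. i \<in> I \<Longrightarrow> R (f i) (g i)"
  shows "\<exists>g'. (\<forall>n. order n (w + m * wt j) g') \<and> (\<forall>i\<in>I. R ((D ^^ m) (f i)) (g' i))"
proof (induction m)
  case 0
  show ?case using g R by auto
next
  case (Suc m)
  then obtain g' where g': "\<And>n. order n (w + m * wt j) g'" "\<And>i. i \<in> I \<Longrightarrow> R ((D ^^ m) (f i)) (g' i)" by blast
  have "order n (w + m * wt j + wt j) (\<lambda>i x. frechet_derivative (g' i) (at x) (X j x))" for n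
    using g'(1)[of "Suc n"] j by simp
  moreover have "R ((D ^^ Suc m) (f i)) (\<lambda>x. frechet_derivative (g' i) (at x) (X j x))" if "i \<in> I" for i
    using D[OF that _ g'(2)[OF that]] g'(1)[of "Suc 0"] that by simp
  ultimately show ?case by (intro exI[of _ "\<lambda>i x. frechet_derivative (g' i) (at x) (X j x)"]) (simp add: add_ac del: order.simps)
qed

text \<open>The monomial acts on functions on the manifold, the estimates concern functions of the
  coordinates. A relation \<open>R\<close> that survives single frame derivatives connects the two
  through the whole monomial, and the weights of the factors add up to
  \<open>hweight\<close>.\<close>

lemma order_op_transfer:
  assumes g: "\<And>n. order n w g"
    and D: "\<And>i j f g. i \<in> I \<Longrightarrow> j < DIM('b) \<Longrightarrow> (\<And>x. x \<in> U \<Longrightarrow> g differentiable at x) \<Longrightarrow> R f g \<Longrightarrow> R (D j f) (\<lambda>x. frechet_derivative g (at x) (X j x))"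
    and R: "\<And>i. i \<in> I \<Longrightarrow> R (f i) (g i)"
  shows "\<exists>g'. (\<forall>n. order n (w + hweight DIM('b) \<alpha>) g') \<and> (\<forall>i\<in>I. R (op_monomial DIM('b) D \<alpha> (f i)) (g' i))"
proof -
  have "set js \<subseteq> {..<DIM('b)} \<Longrightarrow> \<exists>g'. (\<forall>n. order n (w + (\<Sum>j\<leftarrow>js. \<alpha> j * wt j)) g') \<and>
      (\<forall>i\<in>I. R (foldr (\<lambda>j g. (D j ^^ \<alpha> j) \<circ> g) js id (f i)) (g' i))" for js
  proof (induction js)
    case Nil
    then show ?case using g R by auto
  next
    case (Cons j js)
    have "set js \<subseteq> {..<DIM('b)}" using Cons.prems by simp
    from Cons.IH[OF this] obtain g' where "(\<forall>n. order n (w + (\<Sum>j\<leftarrow>js. \<alpha> j * wt j)) g') \<and>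
      (\<forall>i\<in>I. R (foldr (\<lambda>j g. (D j ^^ \<alpha> j) \<circ> g) js id (f i)) (g' i))" by (elim exE)
    then have g': "\<And>n. order n (w + (\<Sum>j\<leftarrow>js. \<alpha> j * wt j)) g'"
      "\<And>i. i \<in> I \<Longrightarrow> R (foldr (\<lambda>j g. (D j ^^ \<alpha> j) \<circ> g) js id (f i)) (g' i)" by (blast, blast)
    have j: "j < DIM('b)" using Cons.prems by simp
    have "\<exists>g'. (\<forall>n. order n ((w + (\<Sum>j\<leftarrow>js. \<alpha> j * wt j)) + \<alpha> j * wt j) g') \<and>
        (\<forall>i\<in>I. R ((D j ^^ \<alpha> j) (foldr (\<lambda>j g. (D j ^^ \<alpha> j) \<circ> g) js id (f i))) (g' i))"
    proof (rule order_power_transfer[where R = R and g = g' and f = "\<lambda>i. foldr (\<lambda>j g. (D j ^^ \<alpha> j) \<circ> g) js id (f i)"])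
      show "R (D j f) (\<lambda>x. frechet_derivative g (at x) (X j x))"
        if "i \<in> I" "\<And>x. x \<in> U \<Longrightarrow> g differentiable at x" "R f g" for i f g
        using that by (rule D[OF _ j])
    qed (rule g' j; assumption?)+
    then show ?case by (simp only: list.map sum_list.Cons foldr_Cons comp_def add_ac)
  qed
  moreover have "set [0..<DIM('b)] \<subseteq> {..<DIM('b)}" by auto
  ultimately have "\<exists>g'. (\<forall>n. order n (w + (\<Sum>j\<leftarrow>[0..<DIM('b)]. \<alpha> j * wt j)) g') \<and>
      (\<forall>i\<in>I. R (op_monomial DIM('b) D \<alpha> (f i)) (g' i))"
    unfolding op_monomial_def .
  moreover have "(\<Sum>j\<leftarrow>[0..<DIM('b)]. \<alpha> j * wt j) = hweight DIM('b) \<alpha>"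
  proof -
    have "(\<Sum>j\<leftarrow>[0..<DIM('b)]. \<alpha> j * wt j) = (\<Sum>j<DIM('b). \<alpha> j * wt j)"
      by (simp add: interv_sum_list_conv_sum_set_nat atLeast0LessThan)
    also have "\<dots> = (\<Sum>j<DIM('b). \<alpha> j) + \<alpha> 0"
      unfolding DIM_split by (simp add: wt_def)
    finally show ?thesis by (simp add: hweight_def)
  qed
  ultimately show ?thesis by simp
qed

end


section \<open>Bump functions\<close>

lemma smooth_on_mult: "open U \<Longrightarrow> smooth_on U f \<Longrightarrow> smooth_on U g \<Longrightarrow> smooth_on U (\<lambda>x. f x * g x)"
  for f :: "'a::euclidean_space \<Rightarrow> real"
  by (rule smooth_on_bilinear[OF _ bounded_bilinear_mult])

lemma smooth_on_prod: "open U \<Longrightarrow> (\<And>i. i \<in> J \<Longrightarrow> smooth_on U (f i)) \<Longrightarrow> smooth_on U (\<lambda>x. \<Prod>i\<in>J. f i x)"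
  for f :: "'i \<Rightarrow> 'a::euclidean_space \<Rightarrow> real"
  by (induction J rule: infinite_finite_induct) (simp_all add: smooth_on_mult)

lemma flat_one_mono: "0 < s \<Longrightarrow> s \<le> t \<Longrightarrow> flat 1 s \<le> flat 1 t"
  by (simp add: flat_def frac_le)

text \<open>The factors 1 and -1 are written out so that both arguments are instances of one affine
  form \<open>1 + s * t\<close>.\<close>

definition bump1 :: "real \<Rightarrow> real" where
  "bump1 t = flat 1 (1 + 1 * t) * flat 1 (1 + (-1) * t)"

lemma bump1_eq_0: "1 \<le> \<bar>t\<bar> \<Longrightarrow> bump1 t = 0"
  using flat_eq_0[of "1 + t" 1] flat_eq_0[of "1 - t" 1] by (cases "0 \<le> t") (auto simp: bump1_def)

lemma bump1_ge: "\<bar>t\<bar> \<le> 1 / 2 \<Longrightarrow> flat 1 (1 / 2) * flat 1 (1 / 2) \<le> bump1 t"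
  unfolding bump1_def by (intro mult_mono flat_one_mono flat_one_nonneg) (auto simp: abs_le_iff)

lemma smooth_on_bump1_affine: "smooth_on UNIV (\<lambda>x. bump1 ((w \<bullet> (x - y)) / c))"
  for w y :: "'b::euclidean_space"
proof -
  have aff: "smooth_on UNIV (\<lambda>x. 1 + s * ((w \<bullet> (x - y)) / c))" for s
  proof -
    have "bounded_linear (\<lambda>x. s * ((w \<bullet> x) / c))"
      using bounded_linear_compose[OF bounded_linear_mult_right bounded_linear_compose[OF bounded_linear_divide bounded_linear_inner_right]]
      by (simp add: o_def)
    then have "smooth_on UNIV (\<lambda>x. s * ((w \<bullet> x) / c) + (1 - s * ((w \<bullet> y) / c)))"
      by (intro smooth_on_add smooth_on_const smooth_on_linear_UNIV) auto
    then show ?thesis by (simp add: inner_diff_right algebra_simps diff_divide_distrib)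
  qed
  show ?thesis unfolding bump1_def
    by (intro smooth_on_mult smooth_on_compose[OF open_UNIV aff smooth_on_flat]) auto
qed

context moving_frame
begin

definition bump :: "real \<Rightarrow> 'b \<Rightarrow> 'b \<Rightarrow> real" where
  "bump \<epsilon> y x = bump1 ((conormal y \<bullet> (x - y)) / \<epsilon>\<^sup>2) * (\<Prod>k\<in>{1..<DIM('b)}. bump1 ((l k \<bullet> (x - y)) / \<epsilon>))"

lemma smooth_on_bump: "smooth_on UNIV (bump \<epsilon> y)"
  unfolding bump_def[abs_def] by (intro smooth_on_mult smooth_on_prod smooth_on_bump1_affine) auto

lemma bump_eq_0:
  assumes \<epsilon>: "0 < \<epsilon>" and x: "x \<notin> box y \<epsilon>"
  shows "bump \<epsilon> y x = 0"
proof -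
  consider "\<epsilon>\<^sup>2 < \<bar>conormal y \<bullet> (x - y)\<bar>" | k where "k \<in> {1..<DIM('b)}" "\<epsilon> < \<bar>l k \<bullet> (x - y)\<bar>"
    using x unfolding box_def by force
  then show ?thesis
  proof cases
    case 1
    then have "1 \<le> \<bar>(conormal y \<bullet> (x - y)) / \<epsilon>\<^sup>2\<bar>" using \<epsilon> by (simp add: abs_divide le_divide_eq)
    then show ?thesis unfolding bump_def using bump1_eq_0 by simp
  next
    case (2 k)
    then have "1 \<le> \<bar>(l k \<bullet> (x - y)) / \<epsilon>\<bar>" using \<epsilon> by (simp add: abs_divide le_divide_eq)
    then have "bump1 ((l k \<bullet> (x - y)) / \<epsilon>) = 0" by (rule bump1_eq_0)
    then have "(\<Prod>k\<in>{1..<DIM('b)}. bump1 ((l k \<bullet> (x - y)) / \<epsilon>)) = 0" using 2(1) by (intro prod_zero) auto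
    then show ?thesis unfolding bump_def by simp
  qed
qed

text \<open>An affine contraction towards the center scales the measure by a known factor, so the
  volume of a box never has to be computed.\<close>

definition half_box :: "'b \<Rightarrow> real \<Rightarrow> 'b set" where
  "half_box y \<epsilon> = (\<lambda>x. (1 / 2) *\<^sub>R x + (1 / 2) *\<^sub>R y) ` box y \<epsilon>"

text \<open>On the contracted box all arguments of \<open>bump1\<close> are at most 1/2 in absolute
  value, whatever the box; this makes the bound uniform.\<close>

lemma bump_lower: "\<exists>\<kappa>>0. \<forall>\<epsilon> y x. 0 < \<epsilon> \<longrightarrow> x \<in> half_box y \<epsilon> \<longrightarrow> \<kappa> \<le> bump \<epsilon> y x"
proof -
  define q where "q = flat 1 (1 / 2) * flat 1 (1 / 2)"
  have q: "0 < q" unfolding q_def by (intro mult_pos_pos flat_one_pos) auto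
  have "q * q ^ card {1..<DIM('b)} \<le> bump \<epsilon> y x" if \<epsilon>: "0 < \<epsilon>" and x: "x \<in> half_box y \<epsilon>" for \<epsilon> y x
  proof -
    obtain x' where x': "x' \<in> box y \<epsilon>" "x = (1 / 2) *\<^sub>R x' + (1 / 2) *\<^sub>R y" using x by (auto simp: half_box_def)
    have "x - y = (1 / 2) *\<^sub>R x' + ((1 / 2) *\<^sub>R y - y)" using x'(2) by simp
    also have "(1 / 2) *\<^sub>R y - y = - ((1 / 2) *\<^sub>R y)" using scaleR_left_diff_distrib[of "1 / 2" 1 y] by simp
    finally have xy: "x - y = (1 / 2) *\<^sub>R (x' - y)" by (simp add: scaleR_right_diff_distrib)
    have "\<bar>(conormal y \<bullet> (x - y)) / \<epsilon>\<^sup>2\<bar> \<le> 1 / 2"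
      using x'(1) \<epsilon> by (simp add: xy box_def abs_divide abs_mult divide_le_eq)
    then have 1: "q \<le> bump1 ((conormal y \<bullet> (x - y)) / \<epsilon>\<^sup>2)" unfolding q_def by (rule bump1_ge)
    have "(\<Prod>k\<in>{1..<DIM('b)}. q) \<le> (\<Prod>k\<in>{1..<DIM('b)}. bump1 ((l k \<bullet> (x - y)) / \<epsilon>))"
    proof (rule prod_mono)
      fix k assume "k \<in> {1..<DIM('b)}"
      then have "\<bar>(l k \<bullet> (x - y)) / \<epsilon>\<bar> \<le> 1 / 2"
        using x'(1) \<epsilon> by (simp add: xy box_def abs_divide abs_mult divide_le_eq)
      then show "0 \<le> q \<and> q \<le> bump1 ((l k \<bullet> (x - y)) / \<epsilon>)" using q unfolding q_def by (auto intro: bump1_ge)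
    qed
    then show ?thesis unfolding bump_def using 1 q by (intro mult_mono) auto
  qed
  then show ?thesis using q by (intro exI[of _ "q * q ^ card {1..<DIM('b)}"]) auto
qed

lemma closed_box: "closed (box y \<epsilon>)"
proof -
  have "box y \<epsilon> = {x. \<bar>conormal y \<bullet> (x - y)\<bar> \<le> \<epsilon>\<^sup>2} \<inter> (\<Inter>k\<in>{1..<DIM('b)}. {x. \<bar>l k \<bullet> (x - y)\<bar> \<le> \<epsilon>})"
    by (auto simp: box_def)
  then show ?thesis
    by (auto intro!: closed_Int closed_INT closed_Collect_le continuous_intros)
qed

lemma center_in_half_box: "0 < \<epsilon> \<Longrightarrow> y \<in> half_box y \<epsilon>"
  unfolding half_box_def
  by (rule image_eqI[of _ _ y]) (auto simp: box_def scaleR_left_distrib[symmetric])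

lemma half_box_subset: "half_box y \<epsilon> \<subseteq> box y \<epsilon>" if "0 < \<epsilon>"
proof
  fix x assume "x \<in> half_box y \<epsilon>"
  then obtain x' where x': "x' \<in> box y \<epsilon>" "x = (1 / 2) *\<^sub>R x' + (1 / 2) *\<^sub>R y" by (auto simp: half_box_def)
  have "x - y = (1 / 2) *\<^sub>R x' + ((1 / 2) *\<^sub>R y - y)" using x'(2) by simp
  also have "(1 / 2) *\<^sub>R y - y = - ((1 / 2) *\<^sub>R y)" using scaleR_left_diff_distrib[of "1 / 2" 1 y] by simp
  finally have xy: "x - y = (1 / 2) *\<^sub>R (x' - y)" by (simp add: scaleR_right_diff_distrib)
  have "\<bar>1 / 2 * t\<bar> \<le> e" if "\<bar>t\<bar> \<le> e" for t e :: real using that by simp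
  then show "x \<in> box y \<epsilon>" using x'(1) by (simp only: box_def xy inner_scaleR_right mem_Collect_eq) blast
qed

lemma closed_half_box: "closed (half_box y \<epsilon>)"
proof -
  have "half_box y \<epsilon> = (\<lambda>x. x + (1 / 2) *\<^sub>R y) ` ((*\<^sub>R) (1 / 2) ` box y \<epsilon>)"
    by (simp add: half_box_def image_image)
  then show ?thesis using closed_translation[OF closed_scaling[OF closed_box[of y \<epsilon>], of "1 / 2"], of "(1 / 2) *\<^sub>R y"]
    by (simp add: add.commute)
qed

lemma emeasure_half_box: "emeasure lborel (half_box y \<epsilon>) = ennreal ((1 / 2) ^ DIM('b)) * emeasure lborel (box y \<epsilon>)"
proof -
  have "emeasure lebesgue ((\<lambda>x. (1 / 2) *\<^sub>R x + (1 / 2) *\<^sub>R y) ` box y \<epsilon>) = ennreal (\<bar>1 / 2\<bar> ^ DIM('b)) * emeasure lebesgue (box y \<epsilon>)"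
    by (rule emeasure_lebesgue_affine)
  moreover have "box y \<epsilon> \<in> sets lborel" "half_box y \<epsilon> \<in> sets lborel" using closed_box closed_half_box by auto
  ultimately show ?thesis by (simp add: half_box_def)
qed

end

context box_family
begin

text \<open>The case \<open>m = 1\<close> serves the directions along \<open>H\<close> and
  \<open>m = 2\<close> the thin direction. Only for the latter must \<open>w i\<close> be nearly
  annihilated by the fields along \<open>H\<close>.\<close>

lemma order_bump1:
  assumes m: "m \<in> {1, 2}" and w: "\<And>i. i \<in> I \<Longrightarrow> norm (w i) \<le> C"
    and range: "\<And>i x. i \<in> I \<Longrightarrow> x \<in> Bx i \<Longrightarrow> \<bar>w i \<bullet> (x - y i)\<bar> \<le> eps i ^ m"
    and b: "\<And>j. m = 2 \<Longrightarrow> 0 < j \<Longrightarrow> j < DIM('b) \<Longrightarrow> \<exists>C\<ge>0. \<forall>i\<in>I. \<forall>x\<in>Bx i. \<bar>w i \<bullet> X j x\<bar> \<le> C * eps i"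
  shows "order n 0 (\<lambda>i x. bump1 ((w i \<bullet> (x - y i)) / eps i ^ m))"
proof -
  have "order n 0 (\<lambda>i x. flat 1 (1 + s * ((w i \<bullet> (x - y i)) / eps i ^ m)))" if s: "s \<in> {1, -1}" for s
  proof (rule order_flat[where u' = "\<lambda>i v. s * ((w i \<bullet> v) / eps i ^ m)"])
    fix i x assume i: "i \<in> I"
    have "((\<lambda>x. w i \<bullet> (x - y i)) has_derivative (\<lambda>v. w i \<bullet> (v - 0))) (at x)"
      by (intro has_derivative_inner_right has_derivative_diff has_derivative_ident has_derivative_const)
    from has_derivative_add[OF has_derivative_const[of 1] has_derivative_mult_right[OF this, of "s / eps i ^ m"]]
    show "((\<lambda>x. 1 + s * ((w i \<bullet> (x - y i)) / eps i ^ m)) has_derivative (\<lambda>v. s * ((w i \<bullet> v) / eps i ^ m))) (at x)"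
      by simp
    assume "x \<in> Bx i"
    then have "\<bar>(w i \<bullet> (x - y i)) / eps i ^ m\<bar> \<le> 1"
      using range[OF i] eps(1)[OF i] by (simp add: abs_divide divide_le_eq)
    moreover have "1 + s * t \<in> {0..2}" if "\<bar>t\<bar> \<le> 1" for t using that s by auto
    ultimately show "1 + s * ((w i \<bullet> (x - y i)) / eps i ^ m) \<in> {0..2}" by blast
  next
    fix j n assume j: "j < DIM('b)"
    show "order n (wt j) (\<lambda>i x. s * ((w i \<bullet> X j x) / eps i ^ m))"
    proof (cases "m = 2")
      case True
      then show ?thesis using order_conormal[OF w j b[OF True _ j], of n s] by simp
    next
      case False
      then have "m = 1" using m by simp
      moreover have "order n 0 (\<lambda>i x. w i \<bullet> X j x)" by (rule order_inner[OF X_smooth[OF j] w])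
      then have "order n (0 + 1) (\<lambda>i x. s * ((w i \<bullet> X j x) / eps i ^ 1))" by (rule order_scaled)
      then have "order n (wt j) (\<lambda>i x. s * ((w i \<bullet> X j x) / eps i ^ 1))" by (rule order_mono) (simp add: wt_def)
      ultimately show ?thesis by simp
    qed
  qed
  from order_mult[OF this[of 1] this[of "-1"]] show ?thesis unfolding bump1_def by simp
qed

end

text \<open>\<open>conormal_frame\<close> is the quantitative form of the adaptation of each box to
  the plane at its center.\<close>

locale bump_family = box_family U X p I eps Bx K
  for U :: "'b::euclidean_space set" and X p and I :: "'i set" and eps Bx K +
  fixes y :: "'i \<Rightarrow> 'b"
  assumes Bx_box: "\<And>i. i \<in> I \<Longrightarrow> Bx i = box (y i) (eps i)"
    and conormal_bounded: "\<exists>C. \<forall>i\<in>I. norm (conormal (y i)) \<le> C"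
    and conormal_frame: "\<And>j. 0 < j \<Longrightarrow> j < DIM('b) \<Longrightarrow> \<exists>C\<ge>0. \<forall>i\<in>I. \<forall>x\<in>Bx i. \<bar>conormal (y i) \<bullet> X j x\<bar> \<le> C * eps i"
begin

lemma order_bump: "order n 0 (\<lambda>i. bump (eps i) (y i))"
proof -
  obtain C where C: "\<And>i. i \<in> I \<Longrightarrow> norm (conormal (y i)) \<le> C" using conormal_bounded by blast
  have "order n 0 (\<lambda>i x. bump1 ((conormal (y i) \<bullet> (x - y i)) / eps i ^ 2))"
    by (rule order_bump1[OF _ C]) (use Bx_box conormal_frame in \<open>auto simp: box_def\<close>)
  moreover have "order n 0 (\<lambda>i x. \<Prod>k\<in>{1..<DIM('b)}. bump1 ((l k \<bullet> (x - y i)) / eps i ^ 1))"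
  proof (rule order_prod)
    fix k assume "k \<in> {1..<DIM('b)}"
    then show "order n 0 (\<lambda>i x. bump1 ((l k \<bullet> (x - y i)) / eps i ^ 1))"
      by (intro order_bump1[where C = "norm (l k)"]) (use Bx_box in \<open>auto simp: box_def\<close>)
  qed
  ultimately show ?thesis using order_mult[of n 0 _ 0] unfolding bump_def[abs_def] by (simp del: order.simps)
qed

end

context moving_frame
begin

lemma bump_family_exists:
  obtains r R where "0 < r" "r \<le> 1"
    "bump_family U X p {(N, i). 0 < N \<and> i \<in> grid DIM('b) N} (\<lambda>(N, i). r / real N)
       (\<lambda>(N, i). box (center (r / real N) i) (r / real N)) (cball p R) (\<lambda>(N, i). center (r / real N) i)"
    "\<forall>N>0. \<forall>i\<in>grid DIM('b) N. \<forall>j\<in>grid DIM('b) N. i \<noteq> j \<longrightarrow>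
      box (center (r / real N) i) (r / real N) \<inter> box (center (r / real N) j) (r / real N) = {}"
proof -
  obtain r R C2 C3 where P: "0 < r" "r \<le> 1" "0 < R" "cball p R \<subseteq> U" "0 \<le> C2" "0 \<le> C3"
    and con: "\<forall>y\<in>cball p R. norm (conormal y) \<le> C3 \<and> (\<forall>j\<in>{1..<DIM('b)}. conormal y \<bullet> X j y = 0)"
    and cen: "\<forall>N>0. \<forall>i\<in>grid DIM('b) N. center (r / real N) i \<in> cball p R \<and>
      (\<forall>x\<in>box (center (r / real N) i) (r / real N). x \<in> cball p R \<and> norm (x - center (r / real N) i) \<le> C2 * (r / real N))"
    and disj: "\<forall>N>0. \<forall>i\<in>grid DIM('b) N. \<forall>j\<in>grid DIM('b) N. i \<noteq> j \<longrightarrow>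
      box (center (r / real N) i) (r / real N) \<inter> box (center (r / real N) j) (r / real N) = {}"
    by (rule packing)
  have frame: "\<bar>conormal y \<bullet> X j x\<bar> \<le> C3 * B * C2 * \<epsilon>"
    if j: "j \<in> {1..<DIM('b)}" and B: "0 \<le> B" "\<forall>y\<in>cball p R. \<forall>z\<in>cball p R. norm (X j y - X j z) \<le> B * norm (y - z)"
      and y: "y \<in> cball p R" and x: "x \<in> cball p R" "norm (x - y) \<le> C2 * \<epsilon>" for j B x y \<epsilon>
  proof -
    \<comment> \<open>The conormal annihilates the field at the center, so it only sees the change
      of the field inside the box, which is of order \<epsilon>.\<close>
    have "conormal y \<bullet> X j x = conormal y \<bullet> (X j x - X j y)" using con y j by (simp add: inner_diff_right)
    then have "\<bar>conormal y \<bullet> X j x\<bar> \<le> norm (conormal y) * norm (X j x - X j y)" by (simp add: Cauchy_Schwarz_ineq2)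
    also have "\<dots> \<le> C3 * (B * (C2 * \<epsilon>))"
    proof (intro mult_mono)
      have "norm (X j x - X j y) \<le> B * norm (x - y)" using B(2) x(1) y by blast
      also have "\<dots> \<le> B * (C2 * \<epsilon>)" using x(2) B(1) by (rule mult_left_mono)
      finally show "norm (X j x - X j y) \<le> B * (C2 * \<epsilon>)" .
    qed (use con y P in auto)
    finally show ?thesis by (simp add: mult.assoc)
  qed
  have "bump_family U X p {(N, i). 0 < N \<and> i \<in> grid DIM('b) N} (\<lambda>(N, i). r / real N)
       (\<lambda>(N, i). box (center (r / real N) i) (r / real N)) (cball p R) (\<lambda>(N, i). center (r / real N) i)"
  proof unfold_locales
    fix m assume m: "m \<in> {(N, i). 0 < N \<and> i \<in> grid DIM('b) N}"
    obtain N i where Ni: "m = (N, i)" "0 < N" "i \<in> grid DIM('b) N" using m by blast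
    then have "1 \<le> real N" by simp
    then show "0 < (case m of (N, i) \<Rightarrow> r / real N)" "(case m of (N, i) \<Rightarrow> r / real N) \<le> 1"
      using Ni(1) P by (auto simp: divide_le_eq)
    show "(case m of (N, i) \<Rightarrow> box (center (r / real N) i) (r / real N)) \<subseteq> cball p R"
      using cen Ni by auto
    show "(case m of (N, i) \<Rightarrow> box (center (r / real N) i) (r / real N)) =
        box (case m of (N, i) \<Rightarrow> center (r / real N) i) (case m of (N, i) \<Rightarrow> r / real N)"
      by (simp add: Ni(1))
  next
    show "\<exists>C. \<forall>m\<in>{(N, i). 0 < N \<and> i \<in> grid DIM('b) N}. norm (conormal (case m of (N, i) \<Rightarrow> center (r / real N) i)) \<le> C"
      using cen con by (intro exI[of _ C3]) auto
    fix j :: nat assume j: "0 < j" "j < DIM('b)"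
    obtain B where B: "0 \<le> B" "\<forall>y\<in>cball p R. \<forall>z\<in>cball p R. norm (X j y - X j z) \<le> B * norm (y - z)"
      using smooth_on_lipschitz[OF X_smooth[OF j(2)] P(4)] by blast
    show "\<exists>C\<ge>0. \<forall>m\<in>{(N, i). 0 < N \<and> i \<in> grid DIM('b) N}. \<forall>x\<in>case m of (N, i) \<Rightarrow> box (center (r / real N) i) (r / real N).
        \<bar>conormal (case m of (N, i) \<Rightarrow> center (r / real N) i) \<bullet> X j x\<bar> \<le> C * (case m of (N, i) \<Rightarrow> r / real N)"
    proof (intro exI[of _ "C3 * B * C2"] conjI ballI)
      show "0 \<le> C3 * B * C2" using B P by simp
      fix m x assume m: "m \<in> {(N, i). 0 < N \<and> i \<in> grid DIM('b) N}"
        and x: "x \<in> (case m of (N, i) \<Rightarrow> box (center (r / real N) i) (r / real N))"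
      obtain N i where Ni: "m = (N, i)" "0 < N" "i \<in> grid DIM('b) N" using m by blast
      show "\<bar>conormal (case m of (N, i) \<Rightarrow> center (r / real N) i) \<bullet> X j x\<bar> \<le> C3 * B * C2 * (case m of (N, i) \<Rightarrow> r / real N)"
        using frame[OF _ B, of "center (r / real N) i" x "r / real N"] cen Ni x j by simp
    qed
  qed (use P in auto)
  then show thesis by (rule that[OF P(1,2) _ disj])
qed

end


section \<open>Test sections\<close>

lemma op_monomial_invariant:
  assumes "\<And>j f. j < n \<Longrightarrow> Q f \<Longrightarrow> Q (D j f)" "Q f"
  shows "Q (op_monomial n D \<alpha> f)"
proof -
  have "set js \<subseteq> {..<n} \<Longrightarrow> Q (foldr (\<lambda>j g. (D j ^^ \<alpha> j) \<circ> g) js id f)" for js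
  proof (induction js)
    case (Cons j js)
    have "Q ((D j ^^ m) g)" if "Q g" for m g
      by (induction m) (use that assms(1)[of j] Cons.prems in auto)
    then show ?case using Cons by simp
  qed (simp add: assms(2))
  moreover have "set [0..<n] \<subseteq> {..<n}" by auto
  ultimately show ?thesis unfolding op_monomial_def .
qed

lemma sum_norm_matrix_vector:
  fixes A :: "complex ^ 'r ^ 'r" and M B :: real
  assumes "\<And>i j. cmod (A $ i $ j) \<le> M" "\<And>j. cmod (x $ j) \<le> B" "0 \<le> M"
  shows "cmod ((A *v x) $ i) \<le> CARD('r) * (M * B)"
proof -
  have "cmod ((A *v x) $ i) \<le> (\<Sum>j\<in>UNIV. cmod (A $ i $ j * x $ j))"
    unfolding matrix_vector_mult_def by (simp add: norm_sum)
  also have "\<dots> \<le> (\<Sum>j\<in>(UNIV :: 'r set). M * B)"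
    using assms by (intro sum_mono) (auto simp: norm_mult intro!: mult_mono)
  finally show ?thesis by simp
qed

context herm_bundle
begin

text \<open>A local expression only evaluates derivatives in charts, and vanishing on an open set
  passes to derivatives.\<close>

lemma local_zero:
  assumes P: "heis_diff_op S P v" and u: "u \<in> smooth_sections S" and V: "open V" "\<And>a. a \<in> V \<Longrightarrow> u a = 0"
    and a: "a \<in> V"
  shows "P u a = 0"
proof -
  obtain W c \<psi> X coef where aW: "a \<in> W" and loc: "local_expression S P v W c \<psi> X coef"
    using P unfolding heis_diff_op_def by blast
  then obtain W0 where c: "c \<in> atlas S" "W \<subseteq> fst c" and W0: "(W0, \<psi>) \<in> trivs S" "W \<subseteq> W0" and W: "open W"
    and ex: "\<And>u a. u \<in> smooth_sections S \<Longrightarrow> a \<in> W \<Longrightarrow> \<psi> a (P u a) =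
        (\<Sum>\<alpha> | \<alpha> \<in> multi_index DIM('b) \<and> hweight DIM('b) \<alpha> \<le> v.
           coef \<alpha> a *v op_monomial DIM('b) (\<lambda>j. vf_apply c (X j)) \<alpha> (\<lambda>x. \<psi> x (u x)) a)"
    unfolding local_expression_def h_frame_def by blast
  define O' where "O' = V \<inter> W"
  have O': "open O'" "O' \<subseteq> fst c" "a \<in> O'" using V W a aW c by (auto simp: O'_def)
  define Q where "Q f \<longleftrightarrow> (\<forall>b\<in>O'. f b = 0)" for f :: "'m \<Rightarrow> complex ^ 'r"
  have "Q (op_monomial DIM('b) (\<lambda>j. vf_apply c (X j)) \<alpha> (\<lambda>x. \<psi> x (u x)))" for \<alpha>
  proof (rule op_monomial_invariant[where Q = Q])
    have "\<psi> b (u b) = 0" if "b \<in> O'" for b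
      using triv_zero[OF W0(1), of b] W0(2) V(2) that by (auto simp: O'_def)
    then show "Q (\<lambda>x. \<psi> x (u x))" by (simp add: Q_def)
    fix j and f :: "'m \<Rightarrow> complex ^ 'r" assume f: "Q f"
    have "vf_apply c (X j) f b = 0" if b: "b \<in> O'" for b
    proof -
      have "frechet_derivative (f \<circ> cinv c) (at (snd c b)) = frechet_derivative (\<lambda>_. 0) (at (snd c b))"
      proof (rule frechet_derivative_cong_open)
        show "open (snd c ` O')" by (rule open_chart_image[OF c(1) O'(1,2)])
        show "(f \<circ> cinv c) y = 0" if "y \<in> snd c ` O'" for y using that f c O'(2) by (auto simp: Q_def)
      qed (use b in auto)
      then show ?thesis by (simp add: vf_apply_def)
    qed
    then show "Q (vf_apply c (X j) f)" by (simp add: Q_def)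
  qed
  then have "\<psi> a (P u a) = 0" using ex[OF u aW] O'(3) by (simp add: Q_def)
  moreover have "P u a \<in> fib S a" using P u smooth_sections_fib by (auto simp: heis_diff_op_def)
  ultimately show ?thesis
    using triv_inv_triv[OF W0(1), of a "P u a"] triv_inv_zero[OF W0(1), of a] aW W0(2) by auto
qed

lemma continuous_on_cinv:
  assumes c: "c \<in> atlas S" and W: "W \<subseteq> fst c" "W \<subseteq> W0" and f: "continuous_on W0 f"
  shows "continuous_on (snd c ` W) (\<lambda>y. f (cinv c y))"
proof (rule continuous_on_compose2[OF f])
  show "continuous_on (snd c ` W) (cinv c)"
    using cinv_continuous[OF c] W(1) by (rule continuous_on_subset[OF _ image_mono])
  show "cinv c ` snd c ` W \<subseteq> W0"
  proof
    fix a assume "a \<in> cinv c ` snd c ` W"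
    then obtain b where "b \<in> W" "a = cinv c (snd c b)" by blast
    then show "a \<in> W0" using c W by (metis cinv_chart subsetD)
  qed
qed

lemma transition_smooth:
  assumes "(W, \<psi>) \<in> trivs S" "(W', \<psi>') \<in> trivs S" "c \<in> atlas S"
  shows "smooth_on (snd c ` (W \<inter> W' \<inter> fst c)) (\<lambda>y. \<psi>' (cinv c y) (triv_inv \<psi> (cinv c y) z))"
proof -
  have "\<forall>(W, \<psi>)\<in>trivs S. \<forall>(W', \<psi>')\<in>trivs S. \<forall>c\<in>atlas S. \<forall>z.
        smooth_on (snd c ` (W \<inter> W' \<inter> fst c))
          (\<lambda>y. \<psi>' (cinv c y) (inv_into (fib S (cinv c y)) (\<psi> (cinv c y)) z))"
    using vbundle unfolding vector_bundle_def by (elim conjE)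
  from bspec[OF this assms(1)] have "\<forall>(W', \<psi>')\<in>trivs S. \<forall>c\<in>atlas S. \<forall>z.
        smooth_on (snd c ` (W \<inter> W' \<inter> fst c)) (\<lambda>y. \<psi>' (cinv c y) (inv_into (fib S (cinv c y)) (\<psi> (cinv c y)) z))" by simp
  from bspec[OF this assms(2)] show ?thesis using assms(3) by (simp add: triv_inv_def)
qed

definition cut_section :: "('m, 'b) chart \<Rightarrow> 'm set \<Rightarrow> ('m \<Rightarrow> 'v \<Rightarrow> complex ^ 'r) \<Rightarrow> ('b \<Rightarrow> real) \<Rightarrow> complex ^ 'r \<Rightarrow> 'm \<Rightarrow> 'v" where
  "cut_section c W \<psi> \<phi> z a = (if a \<in> W then triv_inv \<psi> a (\<phi> (snd c a) *\<^sub>R z) else 0)"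

text \<open>The image of \<open>K\<close> on the manifold is compact, hence closed in a Hausdorff
  space. So \<open>W\<close> and the complement of this image are two open sets which cover
  everything, and on the second one the section is 0.\<close>

lemma cut_section_smooth:
  assumes c: "c \<in> atlas S" and W: "open W" "W \<subseteq> fst c" and W0: "(W0, \<psi>) \<in> trivs S" "W \<subseteq> W0"
    and \<phi>: "smooth_on UNIV \<phi>" and K: "compact K" "K \<subseteq> snd c ` W" "\<And>y. y \<notin> K \<Longrightarrow> \<phi> y = 0"
  shows "cut_section c W \<psi> \<phi> z \<in> smooth_sections S"
proof (rule smooth_sections_I)
  show "cut_section c W \<psi> \<phi> z a \<in> fib S a" for a
    using triv_inv_fib[OF W0(1)] W0(2) by (auto simp: cut_section_def)
  fix W' \<psi>' c' assume W': "(W', \<psi>') \<in> trivs S" and c': "c' \<in> atlas S"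
  let ?u = "cut_section c W \<psi> \<phi> z"
  have "compact (cinv c ` K)"
  proof (rule compact_continuous_image[OF _ K(1)])
    have "K \<subseteq> snd c ` fst c" using K(2) W(2) by blast
    with cinv_continuous[OF c] show "continuous_on K (cinv c)" by (rule continuous_on_subset)
  qed
  then have clK: "closed (cinv c ` K)" by (rule compact_imp_closed)
  define A where "A = snd c' ` (W' \<inter> fst c' \<inter> W)"
  define B where "B = snd c' ` (W' \<inter> fst c' - cinv c ` K)"
  have oA: "open A" unfolding A_def
    by (rule open_chart_image[OF c' open_Int[OF open_Int[OF triv_open[OF W'] chart_open(1)[OF c']] W(1)]]) auto
  have oB: "open B" unfolding B_def
    by (rule open_chart_image[OF c' open_Diff[OF open_Int[OF triv_open[OF W'] chart_open(1)[OF c']] clK]]) auto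
  have cover: "snd c' ` (W' \<inter> fst c') = A \<union> B"
  proof -
    have "cinv c ` K \<subseteq> W"
    proof
      fix a assume "a \<in> cinv c ` K"
      then obtain y where y: "y \<in> K" "a = cinv c y" by auto
      then obtain b where "b \<in> W" "y = snd c b" using K(2) by blast
      then show "a \<in> W" using y c W(2) by auto
    qed
    then have "W' \<inter> fst c' = (W' \<inter> fst c' \<inter> W) \<union> (W' \<inter> fst c' - cinv c ` K)" by blast
    then show ?thesis unfolding A_def B_def image_Un[symmetric] by (rule arg_cong)
  qed
  have sA: "smooth_on A (\<lambda>y. \<psi>' (cinv c' y) (?u (cinv c' y)))"
  proof (rule smooth_on_cong[OF oA])
    have s1: "smooth_on A (\<lambda>y. snd c (cinv c' y))"
      by (rule smooth_on_subset[of "snd c' ` (fst c' \<inter> fst c)"]) (use chart_transition[OF c' c] W(2) in \<open>auto simp: o_def A_def\<close>)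
    have s2: "smooth_on A (\<lambda>y. \<psi>' (cinv c' y) (triv_inv \<psi> (cinv c' y) z))"
      by (rule smooth_on_subset[OF transition_smooth[OF W0(1) W' c']]) (use W0(2) in \<open>auto simp: A_def\<close>)
    show "smooth_on A (\<lambda>y. \<phi> (snd c (cinv c' y)) *\<^sub>R \<psi>' (cinv c' y) (triv_inv \<psi> (cinv c' y) z))"
      by (rule smooth_on_bilinear[OF oA bounded_bilinear_scaleR smooth_on_compose[OF oA s1 \<phi>] s2]) auto
    fix y assume "y \<in> A"
    then have y: "cinv c' y \<in> W" "cinv c' y \<in> W'" using c' by (auto simp: A_def)
    have yW0: "cinv c' y \<in> W0" using y W0 by blast
    have r: "x *\<^sub>R w = of_real x *s w" for x and w :: "complex ^ 'r"
      by (simp add: vec_eq_iff scaleR_conv_of_real[where 'a = complex])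
    show "\<phi> (snd c (cinv c' y)) *\<^sub>R \<psi>' (cinv c' y) (triv_inv \<psi> (cinv c' y) z) = \<psi>' (cinv c' y) (?u (cinv c' y))"
      using y triv_inv_fib[OF W0(1) yW0] triv_smul[OF W' y(2)]
      by (simp add: cut_section_def triv_inv_smul[OF W0(1) yW0] r)
  qed
  have sB: "smooth_on B (\<lambda>y. \<psi>' (cinv c' y) (?u (cinv c' y)))"
  proof (rule smooth_on_cong[OF oB])
    show "smooth_on B (\<lambda>_. 0 :: complex ^ 'r)" by simp
    fix y assume "y \<in> B"
    then have y: "cinv c' y \<in> W'" "cinv c' y \<notin> cinv c ` K" using c' by (auto simp: B_def)
    have "?u (cinv c' y) = 0"
    proof (cases "cinv c' y \<in> W")
      case True
      then have "snd c (cinv c' y) \<notin> K" using y(2) W(2) c by (metis cinv_chart image_eqI subsetD)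
      then show ?thesis using K(3) True triv_inv_zero[OF W0(1)] W0(2) by (auto simp: cut_section_def)
    qed (simp add: cut_section_def)
    then show "0 = \<psi>' (cinv c' y) (?u (cinv c' y))" using triv_zero[OF W' y(1)] by simp
  qed
  show "smooth_on (snd c' ` (W' \<inter> fst c')) (\<lambda>y. \<psi>' (cinv c' y) (?u (cinv c' y)))"
    unfolding cover by (rule smooth_on_Un[OF sA sB])
qed


lemma vf_apply_scaleR:
  assumes c: "c \<in> atlas S" and W: "open W" "W \<subseteq> fst c" and y: "y \<in> snd c ` W"
    and g: "g differentiable at y" and f: "\<And>x. x \<in> snd c ` W \<Longrightarrow> f (cinv c x) = g x *\<^sub>R z"
  shows "vf_apply c Y f (cinv c y) = frechet_derivative g (at y) (Y (cinv c y) c) *\<^sub>R z"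
proof -
  have "snd c (cinv c y) = y" using y c W(2) by auto
  moreover have "frechet_derivative (f \<circ> cinv c) (at y) = frechet_derivative (\<lambda>x. g x *\<^sub>R z) (at y)"
    by (rule frechet_derivative_cong_open[OF open_chart_image[OF c W] y]) (simp add: f)
  moreover have "((\<lambda>x. g x *\<^sub>R z) has_derivative (\<lambda>h. frechet_derivative g (at y) h *\<^sub>R z)) (at y)"
    by (rule has_derivative_scaleR_left) (use g in \<open>simp add: frechet_derivative_works\<close>)
  then have "frechet_derivative (\<lambda>x. g x *\<^sub>R z) (at y) = (\<lambda>h. frechet_derivative g (at y) h *\<^sub>R z)"
    by (rule frechet_derivative_at[symmetric])
  ultimately show ?thesis by (simp add: vf_apply_def)
qed

lemma moving_frame_chart:
  assumes X: "h_frame S W X" and c: "c \<in> atlas S" "W \<subseteq> fst c" and a: "a \<in> W"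
  shows "moving_frame (snd c ` W) (\<lambda>j y. X j (cinv c y) c) (snd c a)"
proof
  have WW: "W \<inter> fst c = W" using c by blast
  show "open (snd c ` W)" using open_chart_image[OF c(1) _ c(2)] X by (simp add: h_frame_def)
  show "snd c a \<in> snd c ` W" using a by blast
  have sm: "\<forall>c\<in>atlas S. \<forall>j<DIM('b). smooth_on (snd c ` (W \<inter> fst c)) (\<lambda>y. X j (cinv c y) c)"
    using X unfolding h_frame_def by (elim conjE)
  have fr: "\<forall>c\<in>atlas S. \<forall>a\<in>W \<inter> fst c. inj_on (\<lambda>j. X j a c) {..<DIM('b)} \<and>
        independent ((\<lambda>j. X j a c) ` {..<DIM('b)})"
    using X unfolding h_frame_def by (elim conjE)
  show "smooth_on (snd c ` W) (\<lambda>y. X j (cinv c y) c)" if "j < DIM('b)" for j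
    using sm c(1) that WW by metis
  fix y assume "y \<in> snd c ` W"
  then obtain b where "b \<in> W" "y = snd c b" by blast
  then have "cinv c y \<in> W \<inter> fst c" using c by auto
  then show "inj_on (\<lambda>j. X j (cinv c y) c) {..<DIM('b)}"
    and "independent ((\<lambda>j. X j (cinv c y) c) ` {..<DIM('b)})"
    using bspec[OF fr c(1)] by blast+
qed

section \<open>Norms of sections supported in a coordinate ball\<close>

lemma sq_bounds:
  assumes c: "c \<in> atlas S" and W: "W \<subseteq> fst c" "(W0, \<psi>) \<in> trivs S" "W \<subseteq> W0"
    and K: "compact K" "K \<subseteq> snd c ` W" and z: "z \<noteq> 0"
  obtains \<gamma> \<Gamma> :: real where "0 < \<gamma>" "0 < \<Gamma>"
    "\<forall>y\<in>K. \<forall>w b. (\<forall>q. cmod (w $ q) \<le> b) \<longrightarrow> tsq \<psi> (cinv c y) w \<le> \<Gamma> * b\<^sup>2"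
    "\<forall>y\<in>K. \<forall>t. \<gamma> * t\<^sup>2 \<le> tsq \<psi> (cinv c y) (t *\<^sub>R z)"
proof -
  have gram: "continuous_on K (\<lambda>y. gram \<psi> (cinv c y) i j)" for i j
    by (rule continuous_on_subset[OF continuous_on_cinv[OF c W(1,3) gram_continuous[OF W(2)]] K(2)])
  have KW: "cinv c y \<in> W0" if yK: "y \<in> K" for y
  proof -
    obtain b where "b \<in> W" "y = snd c b" using yK K(2) by blast
    then show ?thesis using c W by (metis cinv_chart subsetD)
  qed
  have "bounded ((\<lambda>y. \<Sum>i\<in>UNIV. \<Sum>j\<in>UNIV. cmod (gram \<psi> (cinv c y) i j)) ` K)"
    by (intro compact_imp_bounded compact_continuous_image continuous_intros gram K(1))
  then obtain \<Gamma> where \<Gamma>: "0 < \<Gamma>" "\<And>y. y \<in> K \<Longrightarrow> norm (\<Sum>i\<in>UNIV. \<Sum>j\<in>UNIV. cmod (gram \<psi> (cinv c y) i j)) \<le> \<Gamma>"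
    by (auto simp: bounded_pos)
  have up: "tsq \<psi> (cinv c y) w \<le> \<Gamma> * b\<^sup>2" if y: "y \<in> K" and w: "\<And>q. cmod (w $ q) \<le> b" for y w b
  proof -
    have b: "0 \<le> b" using w norm_ge_zero order_trans by blast
    have "tsq \<psi> (cinv c y) w \<le> cmod (\<Sum>i\<in>UNIV. \<Sum>j\<in>UNIV. w $ i * cnj (w $ j) * gram \<psi> (cinv c y) i j)"
      unfolding tsq_def by (rule complex_Re_le_cmod)
    also have "\<dots> \<le> (\<Sum>i\<in>UNIV. \<Sum>j\<in>UNIV. b * b * cmod (gram \<psi> (cinv c y) i j))"
    proof (intro sum_norm_le)
      fix i j
      have "cmod (w $ i) * cmod (w $ j) \<le> b * b" using w b by (intro mult_mono) auto
      then show "cmod (w $ i * cnj (w $ j) * gram \<psi> (cinv c y) i j) \<le> b * b * cmod (gram \<psi> (cinv c y) i j)"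
        by (simp add: norm_mult mult_right_mono)
    qed
    also have "\<dots> = b\<^sup>2 * (\<Sum>i\<in>UNIV. \<Sum>j\<in>UNIV. cmod (gram \<psi> (cinv c y) i j))"
      by (simp add: sum_distrib_left power2_eq_square)
    also have "\<dots> \<le> b\<^sup>2 * \<Gamma>" using \<Gamma>(2)[OF y] by (intro mult_left_mono) auto
    finally show ?thesis by (simp add: mult.commute)
  qed
  obtain \<gamma> where \<gamma>: "0 < \<gamma>" "\<And>y. y \<in> K \<Longrightarrow> \<gamma> \<le> tsq \<psi> (cinv c y) z"
  proof (cases "K = {}")
    case True
    then show thesis using that[of 1] by auto
  next
    case False
    have "continuous_on K (\<lambda>y. tsq \<psi> (cinv c y) z)"
      unfolding tsq_def by (intro continuous_intros gram)
    from continuous_attains_inf[OF K(1) False this]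
    obtain y0 where y0: "y0 \<in> K" "\<forall>y\<in>K. tsq \<psi> (cinv c y0) z \<le> tsq \<psi> (cinv c y) z" by blast
    have "0 < tsq \<psi> (cinv c y0) z" by (rule tsq_pos[OF W(2) KW[OF y0(1)] z])
    then show thesis using that[of "tsq \<psi> (cinv c y0) z"] y0(2) by blast
  qed
  have "\<gamma> * t\<^sup>2 \<le> tsq \<psi> (cinv c y) (t *\<^sub>R z)" if "y \<in> K" for y t
    using mult_right_mono[OF \<gamma>(2)[OF that], of "t\<^sup>2"] by (simp add: tsq_scaleR mult.commute)
  then show thesis using that[OF \<gamma>(1) \<Gamma>(1)] up by blast
qed

text \<open>Both bounds are proportional to the Lebesgue measure of \<open>B\<close>, so that
  measures of boxes cancel in quotients of norms.\<close>

lemma Re_ip_bounds: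
  assumes c: "c \<in> atlas S" and K: "compact K" "K \<subseteq> snd c ` fst c"
  obtains m M :: real where "0 < m" "0 < M"
    "\<forall>B\<in>sets borel. B \<subseteq> K \<longrightarrow> (\<forall>u\<in>smooth_sections S. \<forall>b. (\<forall>a. a \<notin> cinv c ` B \<longrightarrow> u a = 0) \<longrightarrow>
       (\<forall>y\<in>B. sq (cinv c y) (u (cinv c y)) \<le> b) \<longrightarrow> Re (ip S u u) \<le> M * b * measure lborel B)"
    "\<forall>B\<in>sets borel. B \<subseteq> K \<longrightarrow> (\<forall>u\<in>smooth_sections S. \<forall>b\<ge>0.
       (\<forall>y\<in>B. b \<le> sq (cinv c y) (u (cinv c y))) \<longrightarrow> m * b * measure lborel B \<le> Re (ip S u u))"
proof -
  interpret finite_measure "dens S" by (rule finite_dens)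
  obtain m M :: real where m: "0 < m" "0 < M"
    "\<forall>B\<in>sets borel. B \<subseteq> K \<longrightarrow> ennreal m * emeasure lborel B \<le> emeasure (dens S) (cinv c ` B) \<and>
      emeasure (dens S) (cinv c ` B) \<le> ennreal M * emeasure lborel B"
    by (rule density_bounds[OF c K])
  have mB: "m * measure lborel B \<le> measure (dens S) (cinv c ` B) \<and> measure (dens S) (cinv c ` B) \<le> M * measure lborel B"
    if "B \<in> sets borel" "B \<subseteq> K" for B
  proof -
    have "emeasure lborel B < \<infinity>"
      using emeasure_mono[OF that(2), of lborel] emeasure_compact_finite[OF K(1)] K(1)
      by (auto simp: compact_imp_closed intro: le_less_trans)
    then have "emeasure lborel B = ennreal (measure lborel B)" by (simp add: emeasure_eq_ennreal_measure)
    moreover have "ennreal m * emeasure lborel B \<le> ennreal (measure (dens S) (cinv c ` B)) \<and>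
        ennreal (measure (dens S) (cinv c ` B)) \<le> ennreal M * emeasure lborel B"
      using m(3) that by (simp add: emeasure_eq_measure)
    ultimately have "ennreal (m * measure lborel B) \<le> ennreal (measure (dens S) (cinv c ` B)) \<and>
        ennreal (measure (dens S) (cinv c ` B)) \<le> ennreal (M * measure lborel B)"
      using m by (simp add: ennreal_mult)
    then show ?thesis using m(2) by simp
  qed
  have int: "integrable (dens S) (\<lambda>a. sq a (u a))" "Re (ip S u u) = (LINT a|dens S. sq a (u a))" if "u \<in> smooth_sections S" for u
    using that smooth_sections_l2 Re_ip by (auto simp: l2_iff)
  have ind: "integrable (dens S) (\<lambda>a. b * indicator (cinv c ` B) a)"
    "(LINT a|dens S. b * indicator (cinv c ` B) a) = b * measure (dens S) (cinv c ` B)"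
    if "B \<in> sets borel" "B \<subseteq> K" for B and b :: real
    using borel_cinv_image[OF c that(1) order_trans[OF that(2) K(2)]] by (simp_all add: emeasure_eq_measure)
  have up: "Re (ip S u u) \<le> M * b * measure lborel B"
    if B: "B \<in> sets borel" "B \<subseteq> K" and u: "u \<in> smooth_sections S"
      and out: "\<forall>a. a \<notin> cinv c ` B \<longrightarrow> u a = 0" and le: "\<forall>y\<in>B. sq (cinv c y) (u (cinv c y)) \<le> b" for B u b
  proof (cases "B = {}")
    case True
    then have "u = 0" using out by (auto simp: fun_eq_iff)
    then show ?thesis using True int(2)[OF u] by (simp add: sq_def)
  next
    case False
    then have b: "0 \<le> b" using le sq_nonneg smooth_sections_fib[OF u] order_trans by blast
    have "Re (ip S u u) \<le> b * measure (dens S) (cinv c ` B)" unfolding int(2)[OF u] ind(2)[OF B, symmetric]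
    proof (rule integral_mono[OF int(1)[OF u] ind(1)[OF B]])
      fix a show "sq a (u a) \<le> b * indicator (cinv c ` B) a"
        using le out by (cases "a \<in> cinv c ` B") (auto simp: sq_def)
    qed
    also have "\<dots> \<le> M * b * measure lborel B"
      using mult_left_mono[OF conjunct2[OF mB[OF B]] b] by (simp add: mult.left_commute mult.assoc)
    finally show ?thesis .
  qed
  have low: "m * b * measure lborel B \<le> Re (ip S u u)"
    if B: "B \<in> sets borel" "B \<subseteq> K" and u: "u \<in> smooth_sections S"
      and b: "0 \<le> b" and le: "\<forall>y\<in>B. b \<le> sq (cinv c y) (u (cinv c y))" for B u b
  proof -
    have "m * b * measure lborel B \<le> b * measure (dens S) (cinv c ` B)"
      using mult_left_mono[OF conjunct1[OF mB[OF B]] b] by (simp add: mult.left_commute mult.assoc)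
    also have "\<dots> \<le> Re (ip S u u)" unfolding int(2)[OF u] ind(2)[OF B, symmetric]
    proof (rule integral_mono[OF ind(1)[OF B] int(1)[OF u]])
      fix a show "b * indicator (cinv c ` B) a \<le> sq a (u a)"
        using le sq_nonneg[OF smooth_sections_fib[OF u]] by (cases "a \<in> cinv c ` B") auto
    qed
    finally show ?thesis .
  qed
  show thesis by (rule that[OF m(1,2)]) (blast intro: up, blast intro: low)
qed

text \<open>On its box \<open>P (f m)\<close> is of order \<open>eps m\<close> to the power
  \<open>- v\<close>, and outside it vanishes; \<open>f m\<close> is bounded below on the half box,
  which has a fixed fraction of the measure. The quotient of the squared norms is therefore at most
  a constant times \<open>eps m\<close> to the power \<open>- 2 * v\<close>.\<close>

theorem test_sections:
  assumes P: "heis_diff_op S P v"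
  shows "\<exists>C>0. \<forall>N>0. \<exists>(F :: (nat \<Rightarrow> nat) set) f. finite F \<and> card F = N ^ (DIM('b) + 1) \<and>
    (\<forall>i\<in>F. f i \<in> smooth_sections S \<and> f i \<noteq> 0 \<and>
      Re (ip S (P (f i)) (P (f i))) \<le> C * real N ^ (2 * v) * Re (ip S (f i) (f i))) \<and>
    (\<forall>i\<in>F. \<forall>j\<in>F. i \<noteq> j \<longrightarrow> ip S (f i) (f j) = 0)"
proof -
  fix a0 :: 'm
  obtain W c \<psi> X coef where aW: "a0 \<in> W" and loc: "local_expression S P v W c \<psi> X coef"
    using P unfolding heis_diff_op_def by blast
  then obtain W0 where c: "c \<in> atlas S" "W \<subseteq> fst c" and W0: "(W0, \<psi>) \<in> trivs S" "W \<subseteq> W0" and X: "h_frame S W X"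
    and coef: "\<And>\<alpha>. smooth_on (snd c ` W) (coef \<alpha> \<circ> cinv c)"
    and ex: "\<And>u a. u \<in> smooth_sections S \<Longrightarrow> a \<in> W \<Longrightarrow> \<psi> a (P u a) =
        (\<Sum>\<alpha> | \<alpha> \<in> multi_index DIM('b) \<and> hweight DIM('b) \<alpha> \<le> v.
           coef \<alpha> a *v op_monomial DIM('b) (\<lambda>j. vf_apply c (X j)) \<alpha> (\<lambda>x. \<psi> x (u x)) a)"
    unfolding local_expression_def by blast
  have oW: "open W" using X by (simp add: h_frame_def)
  define U where "U = snd c ` W"
  have UW: "cinv c x \<in> W" "snd c (cinv c x) = x" if "x \<in> U" for x using that c by (auto simp: U_def subset_iff)
  interpret mf: moving_frame U "\<lambda>j y. X j (cinv c y) c" "snd c a0"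
    unfolding U_def by (rule moving_frame_chart[OF X c aW])
  obtain r R where r: "0 < r" "r \<le> 1" and
    fam: "bump_family U (\<lambda>j y. X j (cinv c y) c) (snd c a0) {(N, i). 0 < N \<and> i \<in> grid DIM('b) N} (\<lambda>(N, i). r / real N)
       (\<lambda>(N, i). mf.box (mf.center (r / real N) i) (r / real N)) (cball (snd c a0) R) (\<lambda>(N, i). mf.center (r / real N) i)" and
    disj: "\<forall>N>0. \<forall>i\<in>grid DIM('b) N. \<forall>j\<in>grid DIM('b) N. i \<noteq> j \<longrightarrow>
      mf.box (mf.center (r / real N) i) (r / real N) \<inter> mf.box (mf.center (r / real N) j) (r / real N) = {}"
    by (rule mf.bump_family_exists, rule that)
  define I where "I = {(N, i). 0 < N \<and> i \<in> grid DIM('b) N}"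
  define eps :: "nat \<times> (nat \<Rightarrow> nat) \<Rightarrow> real" where "eps = (\<lambda>(N, i). r / real N)"
  define y where "y = (\<lambda>(N, i). mf.center (r / real N) i)"
  define Bx where "Bx = (\<lambda>(N, i). mf.box (mf.center (r / real N) i) (r / real N))"
  define K where "K = cball (snd c a0) R"
  interpret bf: bump_family U "\<lambda>j y. X j (cinv c y) c" "snd c a0" I eps Bx K y
    using fam by (simp only: I_def eps_def y_def Bx_def K_def)
  have KU: "K \<subseteq> U" "compact K" using bf.K by auto
  have cl: "closed (Bx m)" if "m \<in> I" for m using mf.closed_box bf.Bx_box[OF that] by simp
  have cB: "compact (Bx m)" if "m \<in> I" for m
    using compact_Int_closed[OF KU(2) cl[OF that]] bf.Bx[OF that] by (simp add: Int_absorb1)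
  define z :: "complex ^ 'r" where "z = (\<chi> _. 1)"
  have z: "z \<noteq> 0" "\<And>q. cmod (z $ q) \<le> 1" by (auto simp: z_def vec_eq_iff)
  define f where "f m = cut_section c W \<psi> (mf.bump (eps m) (y m)) z" for m
  have sm: "f m \<in> smooth_sections S" if m: "m \<in> I" for m
    unfolding f_def
  proof (rule cut_section_smooth[OF c(1) oW c(2) W0 mf.smooth_on_bump cB[OF m]])
    show "Bx m \<subseteq> snd c ` W" using bf.Bx[OF m] KU by (auto simp: U_def)
    show "mf.bump (eps m) (y m) x = 0" if "x \<notin> Bx m" for x
      using mf.bump_eq_0[OF bf.eps(1)[OF m]] that bf.Bx_box[OF m] by simp
  qed
  have f_out: "f m a = 0" if m: "m \<in> I" and a: "a \<notin> cinv c ` Bx m" for m a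
  proof (cases "a \<in> W")
    case True
    have "snd c a \<notin> Bx m"
    proof
      assume "snd c a \<in> Bx m"
      then have "cinv c (snd c a) \<in> cinv c ` Bx m" by (rule imageI)
      then show False using a True c by (auto simp: subset_iff)
    qed
    then have "mf.bump (eps m) (y m) (snd c a) = 0"
      using mf.bump_eq_0[OF bf.eps(1)[OF m]] bf.Bx_box[OF m] by simp
    then show ?thesis using triv_inv_zero[OF W0(1), of a] W0(2) True by (auto simp: f_def cut_section_def)
  qed (simp add: f_def cut_section_def)
  have psi_f: "\<psi> (cinv c x) (f m (cinv c x)) = mf.bump (eps m) (y m) x *\<^sub>R z" if "x \<in> U" for m x
  proof -
    have "cinv c x \<in> W0" using UW[OF that] W0(2) by blast
    then show ?thesis using UW[OF that] triv_triv_inv[OF W0(1)] by (simp add: f_def cut_section_def)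
  qed
  have Pf_out: "P (f m) a = 0" if m: "m \<in> I" and a: "a \<notin> cinv c ` Bx m" for m a
  proof (rule local_zero[OF P sm[OF m]])
    have "compact (cinv c ` Bx m)"
    proof (rule compact_continuous_image[OF _ cB[OF m]])
      have "Bx m \<subseteq> snd c ` fst c" using bf.Bx[OF m] KU c(2) unfolding U_def by blast
      with cinv_continuous[OF c(1)] show "continuous_on (Bx m) (cinv c)" by (rule continuous_on_subset)
    qed
    then show "open (- cinv c ` Bx m)" by (simp add: open_Compl compact_imp_closed)
    show "f m b = 0" if "b \<in> - cinv c ` Bx m" for b using f_out[OF m] that by simp
    show "a \<in> - cinv c ` Bx m" using a by simp
  qed
  \<comment> \<open>Frame derivatives preserve this relation because \<open>z\<close> is constant;
    so everything reduces to scalar estimates for the bump functions.\<close>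
  define R' where "R' h g \<longleftrightarrow> (\<forall>x\<in>U. h (cinv c x) = g x *\<^sub>R z)" for h :: "'m \<Rightarrow> complex ^ 'r" and g
  have ex_g: "\<exists>g'. (\<forall>n. bf.order n (0 + hweight DIM('b) \<alpha>) g') \<and>
      (\<forall>m\<in>I. R' (op_monomial DIM('b) (\<lambda>j. vf_apply c (X j)) \<alpha> (\<lambda>x. \<psi> x (f m x))) (g' m))" for \<alpha>
  proof (rule bf.order_op_transfer[where f = "\<lambda>m x. \<psi> x (f m x)" and R = R' and w = 0 and g = "\<lambda>m. mf.bump (eps m) (y m)"])
    show "bf.order n 0 (\<lambda>m. mf.bump (eps m) (y m))" for n by (rule bf.order_bump)
  next
    fix m j h and g :: "'b \<Rightarrow> real"
    assume g: "\<And>x. x \<in> U \<Longrightarrow> g differentiable at x" and h: "R' h g"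
    show "R' (vf_apply c (X j) h) (\<lambda>x. frechet_derivative g (at x) (X j (cinv c x) c))"
      unfolding R'_def
    proof
      fix x assume x: "x \<in> U"
      have h': "\<forall>x\<in>snd c ` W. h (cinv c x) = g x *\<^sub>R z" using h unfolding R'_def U_def .
      show "vf_apply c (X j) h (cinv c x) = frechet_derivative g (at x) (X j (cinv c x) c) *\<^sub>R z"
        by (rule vf_apply_scaleR[OF c(1) oW c(2) x[unfolded U_def] g[OF x] bspec[OF h']])
    qed
  qed (simp add: R'_def psi_f)
  obtain g' where "\<forall>\<alpha>. (\<forall>n. bf.order n (0 + hweight DIM('b) \<alpha>) (g' \<alpha>)) \<and>
      (\<forall>m\<in>I. R' (op_monomial DIM('b) (\<lambda>j. vf_apply c (X j)) \<alpha> (\<lambda>x. \<psi> x (f m x))) (g' \<alpha> m))"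
  proof -
    have "\<forall>\<alpha>. \<exists>g'. (\<forall>n. bf.order n (0 + hweight DIM('b) \<alpha>) g') \<and>
      (\<forall>m\<in>I. R' (op_monomial DIM('b) (\<lambda>j. vf_apply c (X j)) \<alpha> (\<lambda>x. \<psi> x (f m x))) (g' m))"
      by (rule allI[OF ex_g])
    from choice[OF this] show thesis by (elim exE) (rule that)
  qed
  then have g': "\<And>\<alpha> n. bf.order n (hweight DIM('b) \<alpha>) (g' \<alpha>)"
    "\<And>\<alpha> m. m \<in> I \<Longrightarrow> R' (op_monomial DIM('b) (\<lambda>j. vf_apply c (X j)) \<alpha> (\<lambda>x. \<psi> x (f m x))) (g' \<alpha> m)"
    unfolding add_0 by blast+
  have "\<exists>C\<ge>0. \<forall>m\<in>I. \<forall>x\<in>Bx m. \<bar>g' \<alpha> m x\<bar> \<le> C / eps m ^ hweight DIM('b) \<alpha>" for \<alpha>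
    using bf.order_0[OF g'(1)] unfolding bf.bnd_def .
  then obtain Cg where Cg: "\<And>\<alpha>. 0 \<le> Cg \<alpha>"
    "\<And>\<alpha> m x. m \<in> I \<Longrightarrow> x \<in> Bx m \<Longrightarrow> \<bar>g' \<alpha> m x\<bar> \<le> Cg \<alpha> / eps m ^ hweight DIM('b) \<alpha>"
    by metis
  have "\<exists>M\<ge>0. \<forall>x\<in>K. \<forall>i j. cmod (coef \<alpha> (cinv c x) $ i $ j) \<le> M" for \<alpha>
  proof -
    have "continuous_on K (coef \<alpha> \<circ> cinv c)"
      by (rule continuous_on_subset[OF smooth_on_continuous_on[OF coef]]) (use KU U_def in simp)
    then have "bounded ((coef \<alpha> \<circ> cinv c) ` K)" by (intro compact_imp_bounded compact_continuous_image KU)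
    then obtain M where M: "0 < M" "\<And>x. x \<in> K \<Longrightarrow> norm (coef \<alpha> (cinv c x)) \<le> M"
      by (auto simp: bounded_pos)
    have "cmod (coef \<alpha> (cinv c x) $ i $ j) \<le> M" if "x \<in> K" for x i j
      using M(2)[OF that] Finite_Cartesian_Product.norm_nth_le[of "coef \<alpha> (cinv c x)" i] Finite_Cartesian_Product.norm_nth_le[of "coef \<alpha> (cinv c x) $ i" j] by linarith
    then show ?thesis using M(1) by (intro exI[of _ M]) auto
  qed
  then obtain Mc where Mc: "\<And>\<alpha>. 0 \<le> Mc \<alpha>" "\<And>\<alpha> x i j. x \<in> K \<Longrightarrow> cmod (coef \<alpha> (cinv c x) $ i $ j) \<le> Mc \<alpha>"
    by metis
  define A where "A = {\<alpha>. \<alpha> \<in> multi_index DIM('b) \<and> hweight DIM('b) \<alpha> \<le> v}"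
  \<comment> \<open>The summand 1 keeps the constant positive if all other terms vanish.\<close>
  define CC where "CC = 1 + (\<Sum>\<alpha>\<in>A. real CARD('r) * (Mc \<alpha> * Cg \<alpha>))"
  have CC: "0 < CC" unfolding CC_def using Mc(1) Cg(1) by (intro add_pos_nonneg sum_nonneg) auto
  have Pf: "cmod (\<psi> (cinv c x) (P (f m) (cinv c x)) $ q) \<le> CC / eps m ^ v" if m: "m \<in> I" and x: "x \<in> Bx m" for m x q
  proof -
    have xU: "x \<in> U" "x \<in> K" using x bf.Bx[OF m] KU by auto
    have e: "0 < eps m" "eps m \<le> 1" using bf.eps m by auto
    have "\<psi> (cinv c x) (P (f m) (cinv c x)) = (\<Sum>\<alpha>\<in>A. coef \<alpha> (cinv c x) *v (g' \<alpha> m x *\<^sub>R z))"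
      using ex[OF sm[OF m] UW(1)[OF xU(1)]] g'(2)[OF m] xU(1) by (simp add: R'_def A_def)
    then have "cmod (\<psi> (cinv c x) (P (f m) (cinv c x)) $ q) \<le> (\<Sum>\<alpha>\<in>A. cmod ((coef \<alpha> (cinv c x) *v (g' \<alpha> m x *\<^sub>R z)) $ q))"
      by (simp add: norm_sum)
    also have "\<dots> \<le> (\<Sum>\<alpha>\<in>A. real CARD('r) * (Mc \<alpha> * (Cg \<alpha> / eps m ^ v)))"
    proof (rule sum_mono, rule sum_norm_matrix_vector[OF Mc(2)[OF xU(2)] _ Mc(1)])
      fix \<alpha> j assume \<alpha>: "\<alpha> \<in> A"
      have "cmod ((g' \<alpha> m x *\<^sub>R z) $ j) = \<bar>g' \<alpha> m x\<bar>" by (simp add: z_def)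
      also have "\<dots> \<le> Cg \<alpha> / eps m ^ hweight DIM('b) \<alpha>" by (rule Cg(2)[OF m x])
      \<comment> \<open>Monomials of smaller weight are dominated because
        \<open>eps m \<le> 1\<close>.\<close>
      also have "\<dots> \<le> Cg \<alpha> / eps m ^ v"
        using e \<alpha> Cg(1) by (intro divide_left_mono power_decreasing mult_pos_pos) (auto simp: A_def)
      finally show "cmod ((g' \<alpha> m x *\<^sub>R z) $ j) \<le> Cg \<alpha> / eps m ^ v" .
    qed
    also have "\<dots> = (\<Sum>\<alpha>\<in>A. real CARD('r) * (Mc \<alpha> * Cg \<alpha>)) / eps m ^ v" by (simp add: sum_divide_distrib)
    also have "\<dots> \<le> CC / eps m ^ v" using e by (intro divide_right_mono) (auto simp: CC_def)
    finally show ?thesis .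
  qed
  obtain \<kappa> where \<kappa>: "0 < \<kappa>" "\<And>\<epsilon> y x. 0 < \<epsilon> \<Longrightarrow> x \<in> mf.half_box y \<epsilon> \<Longrightarrow> \<kappa> \<le> mf.bump \<epsilon> y x"
    using mf.bump_lower by blast
  obtain \<gamma> \<Gamma> where \<gamma>: "0 < \<gamma>" "0 < \<Gamma>"
    "\<forall>y\<in>K. \<forall>w b. (\<forall>q. cmod (w $ q) \<le> b) \<longrightarrow> tsq \<psi> (cinv c y) w \<le> \<Gamma> * b\<^sup>2"
    "\<forall>y\<in>K. \<forall>t. \<gamma> * t\<^sup>2 \<le> tsq \<psi> (cinv c y) (t *\<^sub>R z)"
    by (rule sq_bounds[OF c W0 KU(2) KU(1)[unfolded U_def] z(1)], erule (3) that)
  have Kc: "K \<subseteq> snd c ` fst c" using KU(1) c(2) unfolding U_def by blast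
  obtain m0 M0 where m0: "0 < m0" "0 < M0"
    "\<forall>B\<in>sets borel. B \<subseteq> K \<longrightarrow> (\<forall>u\<in>smooth_sections S. \<forall>b. (\<forall>a. a \<notin> cinv c ` B \<longrightarrow> u a = 0) \<longrightarrow>
       (\<forall>y\<in>B. sq (cinv c y) (u (cinv c y)) \<le> b) \<longrightarrow> Re (ip S u u) \<le> M0 * b * measure lborel B)"
    "\<forall>B\<in>sets borel. B \<subseteq> K \<longrightarrow> (\<forall>u\<in>smooth_sections S. \<forall>b\<ge>0.
       (\<forall>y\<in>B. b \<le> sq (cinv c y) (u (cinv c y))) \<longrightarrow> m0 * b * measure lborel B \<le> Re (ip S u u))"
    by (rule Re_ip_bounds[OF c(1) KU(2) Kc], erule (3) that)
  define h :: real where "h = (1 / 2) ^ DIM('b)"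
  have h: "0 < h" by (simp add: h_def)
  \<comment> \<open>The quotient of the constants in the upper and the lower bound. Division by
    \<open>r ^ (2 * v)\<close> converts powers of \<open>1 / eps m\<close> into powers of
    \<open>r / eps m\<close>, which is \<open>N\<close>.\<close>
  define C where "C = M0 * \<Gamma> * CC\<^sup>2 / (m0 * \<gamma> * \<kappa>\<^sup>2 * h) / r ^ (2 * v)"
  have C: "0 < C" unfolding C_def using m0 \<gamma> \<kappa> h r CC by simp
  have KW0: "cinv c x \<in> W0" if "x \<in> K" for x using UW(1) that KU W0 by blast
  have est: "Re (ip S (P (f m)) (P (f m))) \<le> C * (r / eps m) ^ (2 * v) * Re (ip S (f m) (f m))" if m: "m \<in> I" for m
  proof -
    have e: "0 < eps m" using bf.eps m by auto
    have PS: "P (f m) \<in> smooth_sections S" using P sm[OF m] by (simp add: heis_diff_op_def)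
    have up: "Re (ip S (P (f m)) (P (f m))) \<le> M0 * (\<Gamma> * (CC / eps m ^ v)\<^sup>2) * measure lborel (Bx m)"
    proof (rule m0(3)[rule_format, OF _ bf.Bx[OF m] PS Pf_out[OF m]])
      show "Bx m \<in> sets borel" using cl[OF m] by simp
      fix x assume x: "x \<in> Bx m"
      then have xK: "x \<in> K" using bf.Bx[OF m] by blast
      show "sq (cinv c x) (P (f m) (cinv c x)) \<le> \<Gamma> * (CC / eps m ^ v)\<^sup>2"
        unfolding sq_triv[OF W0(1) KW0[OF xK] smooth_sections_fib[OF PS]] by (rule \<gamma>(3)[rule_format, OF xK Pf[OF m x]])
    qed
    have hb: "mf.half_box (y m) (eps m) \<subseteq> K"
      using mf.half_box_subset[OF e, of "y m"] bf.Bx[OF m] bf.Bx_box[OF m] by blast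
    have "emeasure lborel (Bx m) < \<infinity>" by (rule emeasure_compact_finite[OF cB[OF m]])
    then have "measure lborel (mf.half_box (y m) (eps m)) = h * measure lborel (Bx m)"
      using mf.emeasure_half_box[of "y m" "eps m"] h by (simp add: measure_def bf.Bx_box[OF m] h_def enn2real_mult)
    moreover have "m0 * (\<gamma> * \<kappa>\<^sup>2) * measure lborel (mf.half_box (y m) (eps m)) \<le> Re (ip S (f m) (f m))"
    proof (rule m0(4)[rule_format, OF _ hb sm[OF m]])
      show "mf.half_box (y m) (eps m) \<in> sets borel" using mf.closed_half_box by simp
      fix x assume x: "x \<in> mf.half_box (y m) (eps m)"
      then have xK: "x \<in> K" "x \<in> U" using hb KU by auto
      have "\<gamma> * \<kappa>\<^sup>2 \<le> \<gamma> * (mf.bump (eps m) (y m) x)\<^sup>2"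
        using \<kappa>(2)[OF e x] \<kappa>(1) \<gamma>(1) by (intro mult_left_mono power_mono) auto
      also have "\<dots> \<le> tsq \<psi> (cinv c x) (mf.bump (eps m) (y m) x *\<^sub>R z)" by (rule \<gamma>(4)[rule_format, OF xK(1)])
      finally show "\<gamma> * \<kappa>\<^sup>2 \<le> sq (cinv c x) (f m (cinv c x))"
        unfolding sq_triv[OF W0(1) KW0[OF xK(1)] smooth_sections_fib[OF sm[OF m]]] psi_f[OF xK(2)] .
    qed (use \<gamma> in simp)
    ultimately have low: "m0 * \<gamma> * \<kappa>\<^sup>2 * h * measure lborel (Bx m) \<le> Re (ip S (f m) (f m))" by (simp add: mult.assoc)
    have "M0 * (\<Gamma> * (CC / eps m ^ v)\<^sup>2) * measure lborel (Bx m) =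
        C * (r / eps m) ^ (2 * v) * (m0 * \<gamma> * \<kappa>\<^sup>2 * h * measure lborel (Bx m))"
      using m0 \<gamma> \<kappa> h r e by (simp add: C_def power_divide power_mult[symmetric] mult.commute[of v 2])
    also have "\<dots> \<le> C * (r / eps m) ^ (2 * v) * Re (ip S (f m) (f m))"
      using low C r e by (intro mult_left_mono) auto
    finally show ?thesis using up by linarith
  qed
  show ?thesis
  proof (intro exI[of _ C] conjI allI impI C)
    fix N :: nat assume N: "0 < N"
    have mI: "(N, i) \<in> I" if "i \<in> grid DIM('b) N" for i using that N by (simp add: I_def)
    have eN: "r / eps (N, i) = real N" for i using r N by (simp add: eps_def)
    obtain d where d: "DIM('b) = Suc d" using DIM_positive[where 'a = 'b] by (cases "DIM('b)") auto
    show "\<exists>(F :: (nat \<Rightarrow> nat) set) f. finite F \<and> card F = N ^ (DIM('b) + 1) \<and>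
      (\<forall>i\<in>F. f i \<in> smooth_sections S \<and> f i \<noteq> 0 \<and>
        Re (ip S (P (f i)) (P (f i))) \<le> C * real N ^ (2 * v) * Re (ip S (f i) (f i))) \<and>
      (\<forall>i\<in>F. \<forall>j\<in>F. i \<noteq> j \<longrightarrow> ip S (f i) (f j) = 0)"
    proof (intro exI[of _ "grid DIM('b) N"] exI[of _ "\<lambda>i. f (N, i)"] conjI ballI impI)
      show "finite (grid DIM('b) N)" by (rule finite_grid)
      show "card (grid DIM('b) N) = N ^ (DIM('b) + 1)" unfolding d using card_grid[of d N] by simp
      fix i assume i: "i \<in> grid DIM('b) N"
      show "f (N, i) \<in> smooth_sections S" by (rule sm[OF mI[OF i]])
      show "Re (ip S (P (f (N, i))) (P (f (N, i)))) \<le> C * real N ^ (2 * v) * Re (ip S (f (N, i)) (f (N, i)))"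
        using est[OF mI[OF i]] by (simp only: eN)
      show "f (N, i) \<noteq> 0"
      proof
        assume 0: "f (N, i) = 0"
        let ?y = "y (N, i)"
        have e: "0 < eps (N, i)" using bf.eps mI[OF i] by auto
        have hb: "?y \<in> mf.half_box ?y (eps (N, i))" by (rule mf.center_in_half_box[OF e])
        then have yK: "?y \<in> K" "?y \<in> U"
          using mf.half_box_subset[OF e, of ?y] bf.Bx[OF mI[OF i]] bf.Bx_box[OF mI[OF i]] KU by blast+
        have "mf.bump (eps (N, i)) ?y ?y *\<^sub>R z = 0"
          using psi_f[OF yK(2), of "(N, i)"] triv_zero[OF W0(1) KW0[OF yK(1)]] by (simp add: 0)
        then show False using \<kappa>(2)[OF e hb] \<kappa>(1) z(1) by simp
      qed
      fix j assume j: "j \<in> grid DIM('b) N" and ij: "i \<noteq> j"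
      have "Bx (N, i) \<inter> Bx (N, j) = {}" using disj N i j ij by (simp add: Bx_def)
      have "herm S a (f (N, i) a) (f (N, j) a) = 0" for a
      proof (cases "a \<in> cinv c ` Bx (N, i) \<and> a \<in> cinv c ` Bx (N, j)")
        case True
        then obtain x x' where x: "x \<in> Bx (N, i)" "a = cinv c x" "x' \<in> Bx (N, j)" "a = cinv c x'" by blast
        then have "x \<in> U" "x' \<in> U" using bf.Bx[OF mI[OF i]] bf.Bx[OF mI[OF j]] KU by auto
        then have "x = x'" using UW(2) x by metis
        then show ?thesis using x \<open>Bx (N, i) \<inter> Bx (N, j) = {}\<close> by blast
      next
        case False
        then have "f (N, i) a = 0 \<or> f (N, j) a = 0" using f_out[OF mI[OF i]] f_out[OF mI[OF j]] by blast
        then show ?thesis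
          using herm_zero_left[OF smooth_sections_fib[OF sm[OF mI[OF j]]]]
            herm_zero_right[OF smooth_sections_fib[OF sm[OF mI[OF i]]]] by metis
      qed
      then show "ip S (f (N, i)) (f (N, j)) = 0" by (simp add: ip_def)
    qed
  qed
qed

end


section \<open>Weyl asymptotics\<close>

context heat_flow
begin

text \<open>After normalization each test vector contributes at least 1/2 by
  \<open>T_lower_bound\<close>, and \<open>trace_lower_bound\<close> adds these contributions up.
  The condition \<open>t \<le> 1\<close> makes \<open>exp K\<close> a bound for the growth of the
  flow.\<close>

lemma trace_ge_card:
  assumes K: "0 \<le> K" and e: "onb e" and t: "0 < t" "t \<le> 1" and tr: "(\<lambda>k. ip (T t (e k)) (e k)) sums of_real \<theta>"
    and F: "finite F" and f: "\<And>i. i \<in> F \<Longrightarrow> f i \<in> D" "\<And>i. i \<in> F \<Longrightarrow> f i \<noteq> 0"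
    and orth: "\<And>i j. i \<in> F \<Longrightarrow> j \<in> F \<Longrightarrow> i \<noteq> j \<Longrightarrow> ip (f i) (f j) = 0"
    and M: "\<And>i. i \<in> F \<Longrightarrow> nrm (P (f i)) \<le> M * nrm (f i)" and small: "t * (exp K * M) \<le> 1 / 2"
  shows "real (card F) / 2 \<le> \<theta>"
proof -
  define g where "g i = sc (of_real (1 / nrm (f i))) (f i)" for i
  have pos: "0 < nrm (f i)" if "i \<in> F" for i
    using definite[OF f(1)[OF that]] f(2)[OF that] nrm_nonneg[OF D_in_H[OF f(1)[OF that]]] by linarith
  have gD: "g i \<in> D" if "i \<in> F" for i using f(1)[OF that] by (simp add: g_def)
  have g1: "nrm (g i) = 1" if "i \<in> F" for i
    using pos[OF that] f(1)[OF that] by (simp add: g_def nrm_scale norm_divide)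
  have on: "orthonormal g F" unfolding orthonormal_def
  proof (intro conjI ballI)
    fix i j assume i: "i \<in> F" and j: "j \<in> F"
    show "ip (g i) (g j) = (if i = j then 1 else 0)"
    proof (cases "i = j")
      case True
      then show ?thesis using ip_self[OF D_in_H[OF gD[OF i]]] g1[OF i] by simp
    next
      case False
      then show ?thesis using orth[OF i j] f i j by (simp add: g_def ip_scale ip_scale_right)
    qed
  qed (use gD in simp)
  have "1 / 2 \<le> Re (ip (T t (g i)) (g i))" if i: "i \<in> F" for i
  proof -
    have "nrm (P (g i)) = nrm (P (f i)) / nrm (f i)"
      using pos[OF i] f(1)[OF i] by (simp add: g_def P_scale nrm_scale norm_divide)
    also have "\<dots> \<le> M" using M[OF i] pos[OF i] by (simp add: divide_le_eq)
    finally have Mg: "nrm (P (g i)) \<le> M" .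
    then have M0: "0 \<le> M" using nrm_nonneg[OF D_in_H[OF P_D[OF gD[OF i]]]] by linarith
    have "exp (K * t) * M \<le> exp K * M" using M0 K t mult_left_mono[OF t(2) K] by (intro mult_right_mono) auto
    then have "t * (exp (K * t) * M) \<le> t * (exp K * M)" using t by (intro mult_left_mono) auto
    then show ?thesis using T_lower_bound[OF gD[OF i] t(1) Mg K] small g1[OF i] by simp
  qed
  then have "(\<Sum>i\<in>F. 1 / 2) \<le> (\<Sum>i\<in>F. Re (ip (T t (g i)) (g i)))" by (rule sum_mono)
  also have "\<dots> \<le> \<theta>" by (rule trace_lower_bound[OF e t(1) tr on F])
  finally show ?thesis by simp
qed

end

text \<open>Times of the form \<open>\<delta> / N ^ v\<close> are tested: there
  \<open>t powr (n / v)\<close> cancels \<open>N ^ n\<close> exactly and leaves a positive lower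
  bound independent of \<open>N\<close>.\<close>

lemma limit_pos_of_counting_bound:
  fixes \<theta> :: "real \<Rightarrow> real" and n v :: nat
  assumes lim: "((\<lambda>t. t powr (real n / real v) * \<theta> t) \<longlongrightarrow> A) (at_right 0)" and v: "0 < v" and c: "0 \<le> c"
    and low: "\<And>N t. 0 < N \<Longrightarrow> 0 < t \<Longrightarrow> t \<le> 1 \<Longrightarrow> t * (c * real N ^ v) \<le> 1 / 2 \<Longrightarrow> real N ^ n / 2 \<le> \<theta> t"
  shows "0 < A"
proof -
  \<comment> \<open>Small enough for \<open>\<delta> * c \<le> 1 / 2\<close>, as \<open>low\<close>
    demands; the summand 1 covers \<open>c = 0\<close> and ensures
    \<open>\<delta> \<le> 1\<close>.\<close>
  define \<delta> where "\<delta> = 1 / (2 * (c + 1))"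
  have \<delta>: "0 < \<delta>" "\<delta> \<le> 1" "\<delta> * c \<le> 1 / 2" using c by (auto simp: \<delta>_def field_simps)
  define t where "t N = \<delta> / real (Suc N) ^ v" for N
  have t: "0 < t N" for N using \<delta> by (simp add: t_def)
  have "filterlim (\<lambda>N. real (Suc N) ^ v) at_top sequentially"
    using filterlim_pow_at_top[OF v filterlim_compose[OF filterlim_real_sequentially filterlim_Suc]] by simp
  then have "t \<longlonglongrightarrow> 0" unfolding t_def by (intro tendsto_divide_0[OF tendsto_const] filterlim_at_top_imp_at_infinity)
  then have "filterlim t (at_right 0) sequentially" by (rule tendsto_imp_filterlim_at_right) (simp add: t)
  then have "(\<lambda>N. t N powr (real n / real v) * \<theta> (t N)) \<longlonglongrightarrow> A" by (rule filterlim_compose[OF lim])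
  moreover have "\<delta> powr (real n / real v) / 2 \<le> t N powr (real n / real v) * \<theta> (t N)" for N
  proof -
    have "(1::real) \<le> real (Suc N) ^ v" by (rule one_le_power) simp
    then have "\<delta> / real (Suc N) ^ v \<le> 1" using \<delta>(2) by (simp only: divide_le_eq_1_pos)
    then have "real (Suc N) ^ n / 2 \<le> \<theta> (t N)"
      using \<delta> t[of N] by (intro low) (auto simp: t_def simp del: of_nat_Suc)
    moreover have "t N powr (real n / real v) * real (Suc N) ^ n = \<delta> powr (real n / real v)"
    proof -
      have "(real (Suc N) ^ v) powr (real n / real v) = real (Suc N) ^ n"
        using v by (simp add: powr_realpow[symmetric] powr_powr del: of_nat_Suc)
      then show ?thesis unfolding t_def using \<delta> by (simp add: powr_divide del: of_nat_Suc)
    qed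
    ultimately show ?thesis using mult_left_mono[of "real (Suc N) ^ n / 2" "\<theta> (t N)" "t N powr (real n / real v)"] by simp
  qed
  ultimately have "\<delta> powr (real n / real v) / 2 \<le> A" by (intro tendsto_lowerbound) auto
  then show ?thesis using \<delta> by (smt (verit) powr_gt_zero half_gt_zero)
qed

context herm_bundle
begin

sublocale l2: semi_hilbert "section_smul S" "l2_sections S" "ip S"
  by (rule semi_hilbert_l2)

lemma AE_zero_iff:
  assumes u: "u \<in> l2_sections S"
  shows "(AE a in dens S. u a = 0) \<longleftrightarrow> l2.nrm u = 0"
proof -
  have "sq a (u a) = 0 \<longleftrightarrow> u a = 0" for a
    using herm_pos[OF l2_fib[OF u], of a] l2_fib[OF u, of a] by (cases "u a = 0") (auto simp: sq_def)
  then show ?thesis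
    using integral_nonneg_eq_0_iff_AE[of "dens S" "\<lambda>b. sq b (u b)"] u sq_nonneg[OF l2_fib[OF u]]
    by (simp add: l2.nrm_def Re_ip l2_iff)
qed

lemma l2_orthonormal_basis_iff: "l2_orthonormal_basis S e \<longleftrightarrow> l2.onb e"
  unfolding l2_orthonormal_basis_def l2.onb_def l2.orthonormal_def using AE_zero_iff by auto

lemma heat_flow_l2:
  assumes P: "heis_diff_op S P v" and sa: "formally_selfadjoint S P" and below: "bounded_from_below S P"
    and T: "heat_semigroup S P T"
  obtains K where "0 \<le> K" "heat_flow (section_smul S) (l2_sections S) (ip S) (smooth_sections S) P T K"
proof -
  obtain C where C: "\<And>u. u \<in> smooth_sections S \<Longrightarrow> C * Re (ip S u u) \<le> Re (ip S (P u) u)"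
    using below unfolding bounded_from_below_def by blast
  have T': "T t u \<in> smooth_sections S" if "u \<in> l2_sections S" "0 < t" for t u
    using T that by (auto simp: heat_semigroup_def)
  \<comment> \<open>The lower bound \<open>C\<close> can have either sign; its absolute value
    provides a nonnegative \<open>K\<close>.\<close>
  have "heat_flow (section_smul S) (l2_sections S) (ip S) (smooth_sections S) P T \<bar>C\<bar>"
  proof unfold_locales
    fix u assume u: "u \<in> smooth_sections S"
    then have u2: "u \<in> l2_sections S" using smooth_sections_l2 by blast
    show "P u \<in> smooth_sections S" using P u by (simp add: heis_diff_op_def)
    show "u = 0" if "l2.nrm u = 0" using smooth_sections_definite[OF u] that by (simp add: l2.nrm_def)
    have "- \<bar>C\<bar> * (l2.nrm u)\<^sup>2 \<le> C * (l2.nrm u)\<^sup>2" by (intro mult_right_mono) auto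
    then show "- \<bar>C\<bar> * (l2.nrm u)\<^sup>2 \<le> Re (ip S (P u) u)" using C[OF u] by (simp add: l2.nrm_sq[OF u2])
    show "ip S (P u) w = ip S u (P w)" if "w \<in> smooth_sections S" for w
      using sa u that by (simp add: formally_selfadjoint_def)
  next
    fix u assume u: "u \<in> l2_sections S"
    have "((\<lambda>t. Re (ip S (T t u - u) (T t u - u))) \<longlongrightarrow> 0) (at_right 0)"
      using T u by (simp add: heat_semigroup_def Let_def)
    from tendsto_real_sqrt[OF this] show "((\<lambda>t. l2.nrm (T t u - u)) \<longlongrightarrow> 0) (at_right 0)"
      by (simp add: l2.nrm_def)
    fix t :: real assume t: "0 < t"
    let ?w = "\<lambda>s. section_smul S (of_real (1 / s)) (T (t + s) u - T t u) + P (T t u)"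
    have "((\<lambda>s. Re (ip S (?w s) (?w s))) \<longlongrightarrow> 0) (at 0)"
      using T u t unfolding heat_semigroup_def Let_def by blast
    from tendsto_real_sqrt[OF this] show "((\<lambda>s. l2.nrm (?w s)) \<longlongrightarrow> 0) (at 0)"
      by (simp only: l2.nrm_def real_sqrt_zero)
  qed (use smooth_sections_l2 smooth_sections_add smooth_sections_scale T' in auto)
  then show thesis by (rule that[OF abs_ge_zero])
qed

text \<open>By \<open>has_trace\<close> the trace is the same in every orthonormal basis, so it may
  be evaluated in the eigenbasis.\<close>

lemma heat_trace_expansion:
  assumes hf: "heat_flow (section_smul S) (l2_sections S) (ip S) (smooth_sections S) P T K"
    and lam: "eigenvalue_sequence S P lam"
    and trace: "\<And>t. 0 < t \<Longrightarrow> has_trace S (T t) (of_real (\<theta> t))" and t: "0 < t"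
  shows "(\<lambda>k. exp (- (t * lam k))) sums \<theta> t"
proof -
  interpret H: heat_flow "section_smul S" "l2_sections S" "ip S" "smooth_sections S" P T K by (rule hf)
  obtain e where e: "l2.onb e" using trace[of 1] l2_orthonormal_basis_iff by (auto simp: has_trace_def)
  then have eH: "e k \<in> l2_sections S" for k by (simp add: l2.onb_def l2.orthonormal_def)
  obtain f where f: "\<And>\<mu>. inj_on f {k. lam k = \<mu>}"
    "\<And>\<mu>. \<not> l2.dependent (f ` {k. lam k = \<mu>})"
    "\<And>\<mu>. l2.span (f ` {k. lam k = \<mu>}) = eigenspace S P \<mu>"
    using lam unfolding eigenvalue_sequence_def by blast
  \<comment> \<open>The trace at time 2 is the sum of the squared norms at time 1, by
    \<open>T_pos\<close>.\<close>
  have HS: "summable (\<lambda>k. (l2.nrm (T 1 (e k)))\<^sup>2)"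
  proof -
    have "(\<lambda>k. ip S (T 2 (e k)) (e k)) sums of_real (\<theta> 2)"
      using trace[of 2] e l2_orthonormal_basis_iff by (auto simp: has_trace_def)
    from sums_Re[OF this] show ?thesis using H.T_pos[OF eH, of 2] by (simp add: sums_iff)
  qed
  have spn: "l2.span (f ` {k. lam k = \<mu>}) = {u \<in> smooth_sections S. P u = section_smul S (of_real \<mu>) u}" for \<mu>
    by (simp add: f(3) eigenspace_def section_smul_def)
  obtain \<psi> where \<psi>: "l2.onb \<psi>" "\<And>k. \<psi> k \<in> smooth_sections S" "\<And>k. P (\<psi> k) = section_smul S (of_real (lam k)) (\<psi> k)"
    by (rule H.eigenbasis_exists[OF e HS f(1,2) spn], rule that)
  have \<psi>1: "ip S (\<psi> k) (\<psi> k) = 1" "\<psi> k \<in> l2_sections S" for k using \<psi>(1) by (auto simp: l2.onb_def l2.orthonormal_def)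
  have "(\<lambda>k. ip S (T t (\<psi> k)) (\<psi> k)) sums of_real (\<theta> t)"
    using trace[OF t] \<psi>(1) l2_orthonormal_basis_iff by (auto simp: has_trace_def)
  moreover have "ip S (T t (\<psi> k)) (\<psi> k) = of_real (exp (- (t * lam k)))" for k
    using H.T_eigen[OF \<psi>(2,3) t, of k] \<psi>1 by (simp add: l2.ip_scale mult.commute)
  ultimately show ?thesis using sums_of_real_iff[where 'a = complex] by simp
qed

lemma leading_coefficient_pos:
  assumes P: "heis_diff_op S P v" and v: "0 < v"
    and hf: "heat_flow (section_smul S) (l2_sections S) (ip S) (smooth_sections S) P T K" and K: "0 \<le> K"
    and trace: "\<And>t. 0 < t \<Longrightarrow> has_trace S (T t) (of_real (\<theta> t))"
    and lim: "((\<lambda>t. t powr (real (DIM('b) + 1) / real v) * \<theta> t) \<longlongrightarrow> A) (at_right 0)"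
  shows "0 < A"
proof -
  interpret H: heat_flow "section_smul S" "l2_sections S" "ip S" "smooth_sections S" P T K by (rule hf)
  obtain e where e: "l2.onb e" using trace[of 1] l2_orthonormal_basis_iff by (auto simp: has_trace_def)
  obtain C where C: "0 < C" and tests: "\<forall>N>0. \<exists>(F :: (nat \<Rightarrow> nat) set) f. finite F \<and> card F = N ^ (DIM('b) + 1) \<and>
    (\<forall>i\<in>F. f i \<in> smooth_sections S \<and> f i \<noteq> 0 \<and>
      Re (ip S (P (f i)) (P (f i))) \<le> C * real N ^ (2 * v) * Re (ip S (f i) (f i))) \<and>
    (\<forall>i\<in>F. \<forall>j\<in>F. i \<noteq> j \<longrightarrow> ip S (f i) (f j) = 0)"
    using test_sections[OF P] by (elim exE conjE)
  show ?thesis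
  proof (rule limit_pos_of_counting_bound[OF lim v])
    show "0 \<le> exp K * sqrt C" using C by simp
    fix N :: nat and t :: real
    assume N: "0 < N" and t: "0 < t" "t \<le> 1" and small: "t * (exp K * sqrt C * real N ^ v) \<le> 1 / 2"
    from mp[OF spec[OF tests] N] obtain F :: "(nat \<Rightarrow> nat) set" and f where F: "finite F" "card F = N ^ (DIM('b) + 1)"
      and f: "\<forall>i\<in>F. f i \<in> smooth_sections S \<and> f i \<noteq> 0 \<and>
        Re (ip S (P (f i)) (P (f i))) \<le> C * real N ^ (2 * v) * Re (ip S (f i) (f i))"
      and orth: "\<forall>i\<in>F. \<forall>j\<in>F. i \<noteq> j \<longrightarrow> ip S (f i) (f j) = 0" by (elim exE conjE)
    have "real (card F) / 2 \<le> \<theta> t"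
    proof (rule H.trace_ge_card[OF K e t _ F(1), of _ f])
      show "(\<lambda>k. ip S (T t (e k)) (e k)) sums of_real (\<theta> t)"
        using trace[OF t(1)] e l2_orthonormal_basis_iff by (auto simp: has_trace_def)
      show "t * (exp K * (sqrt C * real N ^ v)) \<le> 1 / 2" using small by (simp add: mult.assoc)
      fix i assume i: "i \<in> F"
      show "l2.nrm (P (f i)) \<le> sqrt C * real N ^ v * l2.nrm (f i)"
      proof -
        have "l2.nrm (P (f i)) \<le> sqrt (C * real N ^ (2 * v) * Re (ip S (f i) (f i)))"
          unfolding l2.nrm_def using f i by simp
        moreover have "real N ^ (2 * v) = (real N ^ v)\<^sup>2" by (simp add: power_mult[symmetric] mult.commute)
        ultimately show ?thesis by (simp add: real_sqrt_mult l2.nrm_def)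
      qed
    qed (use f orth in auto)
    then show "real N ^ (DIM('b) + 1) / 2 \<le> \<theta> t" by (simp add: F(2))
  qed
qed

end

theorem proposition1p5p1:
  fixes S :: "('m::{t2_space, second_countable_topology}, 'b::euclidean_space,
                'v::ab_group_add, 'r::finite) herm_heis"
    and P :: "('m \<Rightarrow> 'v) \<Rightarrow> ('m \<Rightarrow> 'v)"
    and d v :: nat
    and lam :: "nat \<Rightarrow> real"
    and T :: "real \<Rightarrow> ('m \<Rightarrow> 'v) \<Rightarrow> ('m \<Rightarrow> 'v)"
    and \<theta> :: "real \<Rightarrow> real"
    and A0 :: real
  assumes dim: "DIM('b) = d + 1"
    and compact: "compact (UNIV :: 'm set)"
    and manifold: "heisenberg_manifold S"
    and density: "smooth_positive_density S"
    and bdl: "vector_bundle S" "hermitian_metric S"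
    and order: "heis_diff_op S P v" "even v" "0 < v"
    and selfadjoint: "formally_selfadjoint S P"
    and below: "bounded_from_below S P"
    and invertible: "heat_symbol_invertible S P v"
    and eigenvalues: "eigenvalue_sequence S P lam"
    and semigroup: "heat_semigroup S P T"
    and trace: "\<And>t. 0 < t \<Longrightarrow> has_trace S (T t) (of_real (\<theta> t))"
    and A0: "((\<lambda>t. t powr ((real d + 2) / real v) * \<theta> t) \<longlongrightarrow> A0) (at_right 0)"
  shows "0 < nu0 d v A0 \<and>
    (\<lambda>x. real (eigenvalue_count lam x))
       \<sim>[at_top] (\<lambda>x. nu0 d v A0 * x powr ((real d + 2) / real v)) \<and>
    lam \<sim>[at_top] (\<lambda>k. (real k / nu0 d v A0) powr (real v / (real d + 2)))"
proof -
  interpret herm_bundle S by standard (fact compact manifold density bdl)+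
  obtain K where K: "0 \<le> K" and hf: "heat_flow (section_smul S) (l2_sections S) (ip S) (smooth_sections S) P T K"
    by (rule heat_flow_l2[OF order(1) selfadjoint below semigroup])
  define \<alpha> where "\<alpha> = (real d + 2) / real v"
  have \<alpha>: "0 < \<alpha>" using order(3) by (simp add: \<alpha>_def)
  \<comment> \<open>The homogeneous dimension exceeds the linear one by 1, as a single coordinate
    has weight 2; it is the exponent in the number of test sections.\<close>
  have n: "real (DIM('b) + 1) = real d + 2" by (simp add: dim)
  have "0 < A0" by (rule leading_coefficient_pos[OF order(1,3) hf K trace A0[folded n]])
  moreover have Ga: "0 < Gamma (\<alpha> + 1)" using \<alpha> by simp
  moreover have nu: "nu0 d v A0 = A0 / Gamma (\<alpha> + 1)" by (simp add: nu0_def \<alpha>_def divide_inverse add.commute)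
  ultimately have pos: "0 < nu0 d v A0" by simp
  have mono: "mono lam" using eigenvalues by (simp add: eigenvalue_sequence_def)
  have sums: "(\<lambda>k. exp (- (t * lam k))) sums \<theta> t" if "0 < t" for t
    by (rule heat_trace_expansion[OF hf eigenvalues trace that])
  have N: "((\<lambda>x. real (eigenvalue_count lam x) / x powr \<alpha>) \<longlongrightarrow> nu0 d v A0) at_top"
    unfolding nu by (rule eigenvalue_count_asymptotics[OF mono sums A0[folded \<alpha>_def] \<alpha>])
  have fin: "finite {k. lam k \<le> x}" for x
    using sums[of 1] by (intro finite_sublevel_of_heat_sum) (auto simp: sums_iff)
  have "(\<lambda>x. real (eigenvalue_count lam x)) \<sim>[at_top] (\<lambda>x. nu0 d v A0 * x powr \<alpha>)"
  proof (rule asymp_equivI'_const)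
    show "nu0 d v A0 \<noteq> 0" using pos by simp
    show "((\<lambda>x. real (eigenvalue_count lam x) / x powr \<alpha>) \<longlongrightarrow> nu0 d v A0) at_top" by (rule N)
  qed
  moreover have "1 / \<alpha> = real v / (real d + 2)" by (simp add: \<alpha>_def)
  then have "lam \<sim>[at_top] (\<lambda>k. (real k / nu0 d v A0) powr (real v / (real d + 2)))"
    using eigenvalue_asymptotics[OF mono fin N \<alpha> pos] by simp
  ultimately show ?thesis using pos by (simp add: \<alpha>_def)
qed

end
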